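(* Let $\mathsf{C}$ be a category with covers (satisfying the axioms (A1)–(A4) of the context). (1) If $G_\bullet$ is a strict Lie $n$-group in $\mathsf{C}$ ($n\ge1$), then its nerve $\overline{W}_\bullet G$ is a Lie $n$-group. (2) If $G_\bullet$ is a simplicial Lie group in $\mathsf{C}$ acting on the left on $X_\bullet$ and $Y_\bullet$, and $\varphi\colon X_\bullet\to Y_\bullet$ is a $G_\bullet$-equivariant $n$-stack, then the induced map of homotopy quotients $$1\times_G\varphi\colon (WG\times_GX)_\bullet\to(WG\times_GY)_\bullet$$ is an $n$-stack.
   Context: **Categories with covers.** $\mathsf{C}$ is a category with a subcategory of morphisms called covers such that: (A1) $\mathsf{C}$ has a terminal object $\ast$ and $X\to\ast$ is a cover for every $X$; (A2) pullbacks of covers along arbitrary maps exist and are covers; (A3) if $g,f$ are composable and $f\circ g$ and $g$ are covers, then $f$ is a cover; (A4) every cover is an effective epimorphism (the coequalizer of its kernel pair). **Simplicial notation.** $\mathsf{sC}$ is the category of simplicial objects in $\mathsf{C}$. For $X_\bullet\in\mathsf{sC}$ and a simplicial set $S$, $\hom(S,X):=\lim_{\Delta^k\to S}X_k$, if it exists. $\Lambda^k_i\subset\partial\Delta^k$ is the horn omitting the $i$-th face. For $f\colon X_\bullet\to Y_\bullet$, $\Lambda^k_i(f)=\hom(\Lambda^k_i,X)\times_{\hom(\Lambda^k_i,Y)}Y_k$ (a single limit, which need not exist), with induced map $\lambda^k_i(f)\colon X_k\to\Lambda^k_i(f)$. When $Y=\ast$ write $\Lambda^k_i(X),\lambda^k_i(X)$.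 **Lie $n$-groupoids and stacks.** For $n\in\mathbb N\cup\{\infty\}$: a Lie $n$-groupoid is $X_\bullet\in\mathsf{sC}$ such that for all $k>0$, $0\le i\le k$, $\Lambda^k_i(X)$ exists and $\lambda^k_i(X)$ is a cover, and is an isomorphism for $k>n$. A Lie $n$-group is a Lie $n$-groupoid with $X_0=\ast$. A map $f$ of Lie $\infty$-groupoids is an $n$-stack if for all $k>0$, $0\le i\le k$, $\Lambda^k_i(f)$ exists and $\lambda^k_i(f)$ is a cover, and is an isomorphism for $k>n$. **Simplicial Lie groups.** A simplicial Lie group is a simplicial object in group objects of $\mathsf{C}$. A strict Lie $n$-group is a simplicial Lie group $G_\bullet$ such that the horn-filling maps $\lambda^k_i(G)$ (of the underlying simplicial object) are isomorphisms for $k\ge n$. The nerve $\overline{W}_\bullet G$ has $\overline W_0G=\ast$, $\overline W_nG=G_0\times\cdots\times G_{n-1}$ for $n>0$, with $$d_i(g_0,\dots,g_{n-1})=(g_0,\dots,g_{i-2},g_{i-1}\,d_ig_i,d_ig_{i+1},\dots,d_ig_{n-1}),$$ $$s_i(g_0,\dots,g_{n-1})=(g_0,\dots,g_{i-1},e,s_ig_i,\dots,s_ig_{n-1}),$$ where $d_0(g_0,\dots,g_{n-1})=(d_0g_1,\dots,d_0g_{n-1})$ and $d_n(g_0,\dots,g_{n-1})=(g_0,\dots,g_{n-2})$. A left action of $G_\bullet$ on $X_\bullet\in\mathsf{sC}$ consists of left actions $G_k\times X_k\to X_k$ for all $k$ with $d_i(gx)=(d_ig)(d_ix)$ and $s_i(gx)=(s_ig)(s_ix)$.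 The homotopy quotient $(WG\times_GX)_\bullet$ has $n$-simplices $\overline W_nG\times X_n$, with $$s_i(g_0,\dots,g_{n-1},x)=(g_0,\dots,g_{i-1},e,s_ig_i,\dots,s_ig_{n-1},s_ix),$$ $$d_n(g_0,\dots,g_{n-1},x)=(g_0,\dots,g_{n-2},g_{n-1}\,d_nx),$$ $$d_i(g_0,\dots,g_{n-1},x)=(g_0,\dots,g_{i-2},g_{i-1}\,d_ig_i,d_ig_{i+1},\dots,d_ig_{n-1},d_ix)\quad(i<n),$$ with $d_0(g_0,\dots,g_{n-1},x)=(d_0g_1,\dots,d_0g_{n-1},d_0x)$ for $n>0$. For an equivariant map $\varphi$, $1\times_G\varphi$ is $1_{\overline W_nG}\times\varphi_n$ on $n$-simplices. *)

theory Defs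
  imports Main "HOL-Library.Extended_Nat"
begin

section \<open>Categories\<close>

record ('o, 'm) cat =
  Ob :: "'o set"
  Ar :: "'m set"
  Dom :: "'m \<Rightarrow> 'o"
  Cod :: "'m \<Rightarrow> 'o"
  Ident :: "'o \<Rightarrow> 'm"
  Comp :: "'m \<Rightarrow> 'm \<Rightarrow> 'm"  (infixr "\<cdot>\<index>" 70)

text \<open>\<open>f \<cdot>\<^bsub>C\<^esub> g\<close> is \<open>f\<close> after \<open>g\<close>.\<close>

definition homs :: "('o, 'm) cat \<Rightarrow> 'o \<Rightarrow> 'o \<Rightarrow> 'm set" where
  "homs C A B = {f \<in> Ar C. Dom C f = A \<and> Cod C f = B}"

locale category =
  fixes C :: "('o, 'm) cat"
  assumes Dom_Ob: "f \<in> Ar C \<Longrightarrow> Dom C f \<in> Ob C"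
    and Cod_Ob: "f \<in> Ar C \<Longrightarrow> Cod C f \<in> Ob C"
    and Ident_homs: "A \<in> Ob C \<Longrightarrow> Ident C A \<in> homs C A A"
    and Comp_homs: "f \<in> homs C B D \<Longrightarrow> g \<in> homs C A B \<Longrightarrow> f \<cdot>\<^bsub>C\<^esub> g \<in> homs C A D"
    and Comp_assoc: "f \<in> homs C D E \<Longrightarrow> g \<in> homs C B D \<Longrightarrow> h \<in> homs C A B \<Longrightarrow>
      (f \<cdot>\<^bsub>C\<^esub> g) \<cdot>\<^bsub>C\<^esub> h = f \<cdot>\<^bsub>C\<^esub> (g \<cdot>\<^bsub>C\<^esub> h)"
    and Ident_left: "f \<in> homs C A B \<Longrightarrow> Ident C B \<cdot>\<^bsub>C\<^esub> f = f"
    and Ident_right: "f \<in> homs C A B \<Longrightarrow> f \<cdot>\<^bsub>C\<^esub> Ident C A = f"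

definition isos :: "('o, 'm) cat \<Rightarrow> 'm set" where
  "isos C = {f \<in> Ar C. \<exists>g \<in> homs C (Cod C f) (Dom C f).
     g \<cdot>\<^bsub>C\<^esub> f = Ident C (Dom C f) \<and> f \<cdot>\<^bsub>C\<^esub> g = Ident C (Cod C f)}"

definition terminal :: "('o, 'm) cat \<Rightarrow> 'o \<Rightarrow> bool" where
  "terminal C T \<longleftrightarrow> T \<in> Ob C \<and> (\<forall>X \<in> Ob C. \<exists>!u. u \<in> homs C X T)"

definition is_pullback ::
    "('o, 'm) cat \<Rightarrow> 'm \<Rightarrow> 'm \<Rightarrow> 'o \<Rightarrow> 'm \<Rightarrow> 'm \<Rightarrow> bool" where
  "is_pullback C f g P p q \<longleftrightarrow>
     f \<in> Ar C \<and> g \<in> Ar C \<and> Cod C f = Cod C g \<and> P \<in> Ob C \<and>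
     p \<in> homs C P (Dom C f) \<and> q \<in> homs C P (Dom C g) \<and> f \<cdot>\<^bsub>C\<^esub> p = g \<cdot>\<^bsub>C\<^esub> q \<and>
     (\<forall>T \<in> Ob C. \<forall>a \<in> homs C T (Dom C f). \<forall>b \<in> homs C T (Dom C g).
        f \<cdot>\<^bsub>C\<^esub> a = g \<cdot>\<^bsub>C\<^esub> b \<longrightarrow>
        (\<exists>!u. u \<in> homs C T P \<and> p \<cdot>\<^bsub>C\<^esub> u = a \<and> q \<cdot>\<^bsub>C\<^esub> u = b))"

definition is_coequalizer :: "('o, 'm) cat \<Rightarrow> 'm \<Rightarrow> 'm \<Rightarrow> 'm \<Rightarrow> bool" where
  "is_coequalizer C p q f \<longleftrightarrow>
     f \<in> Ar C \<and> p \<in> homs C (Dom C p) (Dom C f) \<and> q \<in> homs C (Dom C p) (Dom C f) \<and>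
     f \<cdot>\<^bsub>C\<^esub> p = f \<cdot>\<^bsub>C\<^esub> q \<and>
     (\<forall>Z \<in> Ob C. \<forall>h \<in> homs C (Dom C f) Z. h \<cdot>\<^bsub>C\<^esub> p = h \<cdot>\<^bsub>C\<^esub> q \<longrightarrow>
        (\<exists>!u. u \<in> homs C (Cod C f) Z \<and> u \<cdot>\<^bsub>C\<^esub> f = h))"

definition effective_epi :: "('o, 'm) cat \<Rightarrow> 'm \<Rightarrow> bool" where
  "effective_epi C f \<longleftrightarrow> (\<exists>P p q. is_pullback C f f P p q \<and> is_coequalizer C p q f)"

locale category_with_covers = category C
  for C :: "('o, 'm) cat" +
  fixes Cov :: "'m set"
  assumes cover_Ar: "Cov \<subseteq> Ar C"
    and cover_Ident: "f \<in> Cov \<Longrightarrow> Ident C (Dom C f) \<in> Cov \<and> Ident C (Cod C f) \<in> Cov"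
    and cover_Comp: "f \<in> Cov \<Longrightarrow> g \<in> Cov \<Longrightarrow> Dom C f = Cod C g \<Longrightarrow> f \<cdot>\<^bsub>C\<^esub> g \<in> Cov"
    and A1: "\<exists>T. terminal C T \<and> (\<forall>X \<in> Ob C. homs C X T \<subseteq> Cov)"
    and A2_exists: "f \<in> Cov \<Longrightarrow> g \<in> Ar C \<Longrightarrow> Cod C g = Cod C f \<Longrightarrow>
      \<exists>P p q. is_pullback C f g P p q"
    and A2_cover: "f \<in> Cov \<Longrightarrow> is_pullback C f g P p q \<Longrightarrow> q \<in> Cov"
    and A3: "g \<in> Ar C \<Longrightarrow> f \<in> Ar C \<Longrightarrow> Dom C f = Cod C g \<Longrightarrow>
      f \<cdot>\<^bsub>C\<^esub> g \<in> Cov \<Longrightarrow> g \<in> Cov \<Longrightarrow> f \<in> Cov"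
    and A4: "f \<in> Cov \<Longrightarrow> effective_epi C f"


section \<open>Finite products\<close>

definition is_product ::
    "('o, 'm) cat \<Rightarrow> 'o list \<Rightarrow> 'o \<Rightarrow> (nat \<Rightarrow> 'm) \<Rightarrow> bool" where
  "is_product C As P p \<longleftrightarrow>
     P \<in> Ob C \<and> (\<forall>j < length As. p j \<in> homs C P (As ! j)) \<and>
     (\<forall>T \<in> Ob C. \<forall>t. (\<forall>j < length As. t j \<in> homs C T (As ! j)) \<longrightarrow>
        (\<exists>!u. u \<in> homs C T P \<and> (\<forall>j < length As. p j \<cdot>\<^bsub>C\<^esub> u = t j)))"

text \<open>A fixed choice of finite products (they exist in every category with covers);
  the terminal object is the empty product.\<close>

definition product_cone :: "('o, 'm) cat \<Rightarrow> 'o list \<Rightarrow> 'o \<times> (nat \<Rightarrow> 'm)" where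
  "product_cone C As = (SOME (P, p). is_product C As P p)"

definition prd :: "('o, 'm) cat \<Rightarrow> 'o list \<Rightarrow> 'o" where
  "prd C As = fst (product_cone C As)"

definition prj :: "('o, 'm) cat \<Rightarrow> 'o list \<Rightarrow> nat \<Rightarrow> 'm" where
  "prj C As = snd (product_cone C As)"

definition pt :: "('o, 'm) cat \<Rightarrow> 'o" where
  "pt C = prd C []"

text \<open>\<open>tup C T [t\<^sub>0, \<dots>]\<close> is the morphism from \<open>T\<close> to the product of the codomains
  of the \<open>t\<^sub>j\<close> with components \<open>t\<^sub>j\<close>.\<close>

definition tup :: "('o, 'm) cat \<Rightarrow> 'o \<Rightarrow> 'm list \<Rightarrow> 'm" where
  "tup C T ts = (THE u. u \<in> homs C T (prd C (map (Cod C) ts)) \<and>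
     (\<forall>j < length ts. prj C (map (Cod C) ts) j \<cdot>\<^bsub>C\<^esub> u = ts ! j))"

definition bang :: "('o, 'm) cat \<Rightarrow> 'o \<Rightarrow> 'm" where
  "bang C T = tup C T []"

text \<open>Element-wise formulas are read on generalized elements, i.e. morphisms \<open>T \<rightarrow> A\<close>
  out of an arbitrary object \<open>T\<close>.  The value of \<open>m : A \<times> B \<rightarrow> D\<close> at \<open>a : T \<rightarrow> A\<close>,
  \<open>b : T \<rightarrow> B\<close>:\<close>

definition app2 :: "('o, 'm) cat \<Rightarrow> 'm \<Rightarrow> 'm \<Rightarrow> 'm \<Rightarrow> 'm" where
  "app2 C m a b = m \<cdot>\<^bsub>C\<^esub> tup C (Dom C a) [a, b]"

definition group_object :: "('o, 'm) cat \<Rightarrow> 'o \<Rightarrow> 'm \<Rightarrow> 'm \<Rightarrow> 'm \<Rightarrow> bool" where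
  "group_object C G m e v \<longleftrightarrow>
     G \<in> Ob C \<and> m \<in> homs C (prd C [G, G]) G \<and> e \<in> homs C (pt C) G \<and> v \<in> homs C G G \<and>
     (\<forall>T \<in> Ob C. \<forall>a \<in> homs C T G. \<forall>b \<in> homs C T G. \<forall>c \<in> homs C T G.
        app2 C m (app2 C m a b) c = app2 C m a (app2 C m b c)) \<and>
     (\<forall>T \<in> Ob C. \<forall>a \<in> homs C T G.
        app2 C m (e \<cdot>\<^bsub>C\<^esub> bang C T) a = a \<and>
        app2 C m a (e \<cdot>\<^bsub>C\<^esub> bang C T) = a \<and>
        app2 C m (v \<cdot>\<^bsub>C\<^esub> a) a = e \<cdot>\<^bsub>C\<^esub> bang C T \<and>
        app2 C m a (v \<cdot>\<^bsub>C\<^esub> a) = e \<cdot>\<^bsub>C\<^esub> bang C T)"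


section \<open>Simplicial objects\<close>

text \<open>\<open>fc X n i : X\<^sub>n \<rightarrow> X\<^sub>n\<^sub>-\<^sub>1\<close> (relevant for \<open>n > 0\<close>, \<open>i \<le> n\<close>) and
  \<open>dg X n i : X\<^sub>n \<rightarrow> X\<^sub>n\<^sub>+\<^sub>1\<close> (relevant for \<open>i \<le> n\<close>) are \<open>d\<^sub>i\<close> and \<open>s\<^sub>i\<close> on \<open>n\<close>-simplices.\<close>

record ('o, 'm) sobj =
  ob :: "nat \<Rightarrow> 'o"
  fc :: "nat \<Rightarrow> nat \<Rightarrow> 'm"
  dg :: "nat \<Rightarrow> nat \<Rightarrow> 'm"

definition simplicial_object :: "('o, 'm) cat \<Rightarrow> ('o, 'm, 'z) sobj_scheme \<Rightarrow> bool" where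
  "simplicial_object C X \<longleftrightarrow>
     (\<forall>n. ob X n \<in> Ob C) \<and>
     (\<forall>n > 0. \<forall>i \<le> n. fc X n i \<in> homs C (ob X n) (ob X (n - 1))) \<and>
     (\<forall>n. \<forall>i \<le> n. dg X n i \<in> homs C (ob X n) (ob X (n + 1))) \<and>
     (\<forall>n > 1. \<forall>j \<le> n. \<forall>i < j.
        fc X (n - 1) i \<cdot>\<^bsub>C\<^esub> fc X n j = fc X (n - 1) (j - 1) \<cdot>\<^bsub>C\<^esub> fc X n i) \<and>
     (\<forall>n. \<forall>j \<le> n. \<forall>i \<le> j.
        dg X (n + 1) i \<cdot>\<^bsub>C\<^esub> dg X n j = dg X (n + 1) (j + 1) \<cdot>\<^bsub>C\<^esub> dg X n i) \<and>
     (\<forall>n. \<forall>j \<le> n. \<forall>i < j.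
        fc X (n + 1) i \<cdot>\<^bsub>C\<^esub> dg X n j = dg X (n - 1) (j - 1) \<cdot>\<^bsub>C\<^esub> fc X n i) \<and>
     (\<forall>n. \<forall>j \<le> n.
        fc X (n + 1) j \<cdot>\<^bsub>C\<^esub> dg X n j = Ident C (ob X n) \<and>
        fc X (n + 1) (j + 1) \<cdot>\<^bsub>C\<^esub> dg X n j = Ident C (ob X n)) \<and>
     (\<forall>n. \<forall>i \<le> n + 1. \<forall>j. j + 1 < i \<longrightarrow>
        fc X (n + 1) i \<cdot>\<^bsub>C\<^esub> dg X n j = dg X (n - 1) j \<cdot>\<^bsub>C\<^esub> fc X n (i - 1))"

definition simplicial_map :: "('o, 'm) cat \<Rightarrow> ('o, 'm, 'y) sobj_scheme \<Rightarrow>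
    ('o, 'm, 'z) sobj_scheme \<Rightarrow> (nat \<Rightarrow> 'm) \<Rightarrow> bool" where
  "simplicial_map C X Y f \<longleftrightarrow>
     (\<forall>n. f n \<in> homs C (ob X n) (ob Y n)) \<and>
     (\<forall>n > 0. \<forall>i \<le> n. f (n - 1) \<cdot>\<^bsub>C\<^esub> fc X n i = fc Y n i \<cdot>\<^bsub>C\<^esub> f n) \<and>
     (\<forall>n. \<forall>i \<le> n. f (n + 1) \<cdot>\<^bsub>C\<^esub> dg X n i = dg Y n i \<cdot>\<^bsub>C\<^esub> f n)"

definition point :: "('o, 'm) cat \<Rightarrow> ('o, 'm) sobj" where
  "point C = \<lparr>ob = \<lambda>_. pt C, fc = \<lambda>_ _. Ident C (pt C), dg = \<lambda>_ _. Ident C (pt C)\<rparr>"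

text \<open>A monotone map \<open>\<theta> : [m] \<rightarrow> [n]\<close> is represented by the list of its values
  \<open>[\<theta> 0, \<dots>, \<theta> m]\<close>; these are also the \<open>m\<close>-simplices of \<open>\<Delta>\<^sup>n\<close>.\<close>

definition mono_lists :: "nat \<Rightarrow> nat \<Rightarrow> nat list set" where
  "mono_lists m n = {\<theta>. length \<theta> = Suc m \<and> sorted \<theta> \<and> set \<theta> \<subseteq> {..n}}"

text \<open>The operator \<open>X(\<theta>) : X\<^sub>n \<rightarrow> X\<^sub>m\<close> of \<open>\<theta> : [m] \<rightarrow> [n]\<close>, through the normal form
  \<open>\<theta> = \<delta>\<^bsub>j\<^sub>s\<^esub> \<dots> \<delta>\<^bsub>j\<^sub>1\<^esub> \<sigma>\<^bsub>i\<^sub>1\<^esub> \<dots> \<sigma>\<^bsub>i\<^sub>t\<^esub>\<close>, where \<open>j\<^sub>1 < \<dots> < j\<^sub>s\<close> are the elements of \<open>[n]\<close> not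
  in the image of \<open>\<theta>\<close> and \<open>i\<^sub>1 < \<dots> < i\<^sub>t\<close> the positions with \<open>\<theta> i = \<theta> (i + 1)\<close>.  So \<open>X(\<theta>)\<close>
  applies first \<open>d\<^bsub>j\<^sub>s\<^esub>, \<dots>, d\<^bsub>j\<^sub>1\<^esub>\<close> and then \<open>s\<^bsub>i\<^sub>1\<^esub>, \<dots>, s\<^bsub>i\<^sub>t\<^esub>\<close>, in this order.\<close>

fun faces_op :: "('o, 'm) cat \<Rightarrow> ('o, 'm, 'z) sobj_scheme \<Rightarrow> nat \<Rightarrow> nat list \<Rightarrow> 'm" where
  "faces_op C X n [] = Ident C (ob X n)"
| "faces_op C X n (j # js) = faces_op C X (n - 1) js \<cdot>\<^bsub>C\<^esub> fc X n j"

fun degens_op :: "('o, 'm) cat \<Rightarrow> ('o, 'm, 'z) sobj_scheme \<Rightarrow> nat \<Rightarrow> nat list \<Rightarrow> 'm" where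
  "degens_op C X n [] = Ident C (ob X n)"
| "degens_op C X n (i # is) = degens_op C X (n + 1) is \<cdot>\<^bsub>C\<^esub> dg X n i"

definition sop :: "('o, 'm) cat \<Rightarrow> ('o, 'm, 'z) sobj_scheme \<Rightarrow> nat \<Rightarrow> nat list \<Rightarrow> 'm" where
  "sop C X n \<theta> =
     degens_op C X (card (set \<theta>) - 1) (filter (\<lambda>i. \<theta> ! i = \<theta> ! Suc i) [0..<length \<theta> - 1]) \<cdot>\<^bsub>C\<^esub>
     faces_op C X n (rev (filter (\<lambda>j. j \<notin> set \<theta>) [0..<Suc n]))"


section \<open>Horns and matching objects\<close>

text \<open>A simplicial set: \<open>cells S m\<close> are the \<open>m\<close>-simplices and \<open>restr S \<theta>\<close> is the
  contravariant action of \<open>\<theta> : [m'] \<rightarrow> [m]\<close>.\<close>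

record 's sset =
  cells :: "nat \<Rightarrow> 's set"
  restr :: "nat list \<Rightarrow> 's \<Rightarrow> 's"

text \<open>The horn \<open>\<Lambda>\<^sup>k\<^sub>i\<close>: the union of the faces \<open>{\<sigma>. j \<notin> image \<sigma>}\<close> of \<open>\<Delta>\<^sup>k\<close> with \<open>j \<noteq> i\<close>.\<close>

definition horn :: "nat \<Rightarrow> nat \<Rightarrow> nat list sset" where
  "horn k i = \<lparr>cells = \<lambda>m. {\<sigma> \<in> mono_lists m k. \<exists>j \<le> k. j \<noteq> i \<and> j \<notin> set \<sigma>},
     restr = \<lambda>\<theta> \<sigma>. map (\<lambda>a. \<sigma> ! a) \<theta>\<rparr>"

text \<open>Cones with apex \<open>T\<close> over the diagram \<open>(\<Delta>\<^sup>m \<rightarrow> S) \<mapsto> X\<^sub>m\<close> on the category of simplices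
  of \<open>S\<close>, whose limit is \<open>hom(S, X)\<close>.\<close>

definition hom_cone :: "('o, 'm) cat \<Rightarrow> 's sset \<Rightarrow> ('o, 'm, 'z) sobj_scheme \<Rightarrow>
    'o \<Rightarrow> (nat \<Rightarrow> 's \<Rightarrow> 'm) \<Rightarrow> bool" where
  "hom_cone C S X T t \<longleftrightarrow> T \<in> Ob C \<and>
     (\<forall>m. \<forall>\<sigma> \<in> cells S m. t m \<sigma> \<in> homs C T (ob X m)) \<and>
     (\<forall>m m'. \<forall>\<sigma> \<in> cells S m. \<forall>\<theta> \<in> mono_lists m' m.
        sop C X m \<theta> \<cdot>\<^bsub>C\<^esub> t m \<sigma> = t m' (restr S \<theta> \<sigma>))"

text \<open>\<open>\<Lambda>\<^sup>k\<^sub>i(f) = hom(\<Lambda>\<^sup>k\<^sub>i, X) \<times>\<^bsub>hom(\<Lambda>\<^sup>k\<^sub>i, Y)\<^esub> Y\<^sub>k\<close> as a single limit: its cones consist of a cone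
  \<open>t\<close> for \<open>hom(\<Lambda>\<^sup>k\<^sub>i, X)\<close> and a \<open>y : T \<rightarrow> Y\<^sub>k\<close> which agree over every simplex of \<open>\<Lambda>\<^sup>k\<^sub>i\<close>.\<close>

definition horn_cone :: "('o, 'm) cat \<Rightarrow> ('o, 'm, 'y) sobj_scheme \<Rightarrow>
    ('o, 'm, 'z) sobj_scheme \<Rightarrow> (nat \<Rightarrow> 'm) \<Rightarrow> nat \<Rightarrow> nat \<Rightarrow>
    'o \<Rightarrow> (nat \<Rightarrow> nat list \<Rightarrow> 'm) \<Rightarrow> 'm \<Rightarrow> bool" where
  "horn_cone C X Y f k i T t y \<longleftrightarrow>
     hom_cone C (horn k i) X T t \<and> y \<in> homs C T (ob Y k) \<and>
     (\<forall>m. \<forall>\<sigma> \<in> cells (horn k i) m. f m \<cdot>\<^bsub>C\<^esub> t m \<sigma> = sop C Y k \<sigma> \<cdot>\<^bsub>C\<^esub> y)"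

definition horn_limit :: "('o, 'm) cat \<Rightarrow> ('o, 'm, 'y) sobj_scheme \<Rightarrow>
    ('o, 'm, 'z) sobj_scheme \<Rightarrow> (nat \<Rightarrow> 'm) \<Rightarrow> nat \<Rightarrow> nat \<Rightarrow>
    'o \<Rightarrow> (nat \<Rightarrow> nat list \<Rightarrow> 'm) \<Rightarrow> 'm \<Rightarrow> bool" where
  "horn_limit C X Y f k i L p q \<longleftrightarrow>
     horn_cone C X Y f k i L p q \<and>
     (\<forall>T t y. horn_cone C X Y f k i T t y \<longrightarrow>
        (\<exists>!u. u \<in> homs C T L \<and>
           (\<forall>m. \<forall>\<sigma> \<in> cells (horn k i) m. p m \<sigma> \<cdot>\<^bsub>C\<^esub> u = t m \<sigma>) \<and> q \<cdot>\<^bsub>C\<^esub> u = y))"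

text \<open>\<open>\<lambda>\<^sup>k\<^sub>i(f) : X\<^sub>k \<rightarrow> \<Lambda>\<^sup>k\<^sub>i(f)\<close>, relative to a limit cone \<open>(L, p, q)\<close>.\<close>

definition horn_map :: "('o, 'm) cat \<Rightarrow> ('o, 'm, 'y) sobj_scheme \<Rightarrow>
    (nat \<Rightarrow> 'm) \<Rightarrow> nat \<Rightarrow> nat \<Rightarrow>
    'o \<Rightarrow> (nat \<Rightarrow> nat list \<Rightarrow> 'm) \<Rightarrow> 'm \<Rightarrow> 'm" where
  "horn_map C X f k i L p q = (THE u. u \<in> homs C (ob X k) L \<and>
     (\<forall>m. \<forall>\<sigma> \<in> cells (horn k i) m. p m \<sigma> \<cdot>\<^bsub>C\<^esub> u = sop C X k \<sigma>) \<and> q \<cdot>\<^bsub>C\<^esub> u = f k)"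

text \<open>\<open>\<Lambda>\<^sup>k\<^sub>i(f)\<close> exists and \<open>\<lambda>\<^sup>k\<^sub>i(f)\<close> belongs to the class \<open>K\<close> of morphisms.\<close>

definition horn_map_in :: "('o, 'm) cat \<Rightarrow> 'm set \<Rightarrow> ('o, 'm, 'y) sobj_scheme \<Rightarrow>
    ('o, 'm, 'z) sobj_scheme \<Rightarrow> (nat \<Rightarrow> 'm) \<Rightarrow> nat \<Rightarrow> nat \<Rightarrow> bool" where
  "horn_map_in C K X Y f k i \<longleftrightarrow>
     (\<exists>L p q. horn_limit C X Y f k i L p q) \<and>
     (\<forall>L p q. horn_limit C X Y f k i L p q \<longrightarrow> horn_map C X f k i L p q \<in> K)"

definition horn_conditions :: "('o, 'm) cat \<Rightarrow> 'm set \<Rightarrow> enat \<Rightarrow> ('o, 'm, 'y) sobj_scheme \<Rightarrow>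
    ('o, 'm, 'z) sobj_scheme \<Rightarrow> (nat \<Rightarrow> 'm) \<Rightarrow> bool" where
  "horn_conditions C Cov n X Y f \<longleftrightarrow>
     (\<forall>k > 0. \<forall>i \<le> k. horn_map_in C Cov X Y f k i \<and>
        (n < enat k \<longrightarrow> horn_map_in C (isos C) X Y f k i))"


section \<open>Lie groupoids and stacks\<close>

definition lie_groupoid ::
    "('o, 'm) cat \<Rightarrow> 'm set \<Rightarrow> enat \<Rightarrow> ('o, 'm, 'z) sobj_scheme \<Rightarrow> bool" where
  "lie_groupoid C Cov n X \<longleftrightarrow>
     simplicial_object C X \<and> horn_conditions C Cov n X (point C) (\<lambda>k. bang C (ob X k))"

definition lie_group ::
    "('o, 'm) cat \<Rightarrow> 'm set \<Rightarrow> enat \<Rightarrow> ('o, 'm, 'z) sobj_scheme \<Rightarrow> bool" where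
  "lie_group C Cov n X \<longleftrightarrow> lie_groupoid C Cov n X \<and> ob X 0 = pt C"

definition n_stack :: "('o, 'm) cat \<Rightarrow> 'm set \<Rightarrow> enat \<Rightarrow> ('o, 'm, 'y) sobj_scheme \<Rightarrow>
    ('o, 'm, 'z) sobj_scheme \<Rightarrow> (nat \<Rightarrow> 'm) \<Rightarrow> bool" where
  "n_stack C Cov n X Y f \<longleftrightarrow>
     lie_groupoid C Cov \<infinity> X \<and> lie_groupoid C Cov \<infinity> Y \<and> simplicial_map C X Y f \<and>
     horn_conditions C Cov n X Y f"


section \<open>Simplicial Lie groups\<close>

record ('o, 'm) sgrp = "('o, 'm) sobj" +
  mul :: "nat \<Rightarrow> 'm"
  one :: "nat \<Rightarrow> 'm"
  inve :: "nat \<Rightarrow> 'm"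

definition simplicial_lie_group :: "('o, 'm) cat \<Rightarrow> ('o, 'm) sgrp \<Rightarrow> bool" where
  "simplicial_lie_group C G \<longleftrightarrow>
     simplicial_object C G \<and>
     (\<forall>n. group_object C (ob G n) (mul G n) (one G n) (inve G n)) \<and>
     (\<forall>n. \<forall>T \<in> Ob C. \<forall>a \<in> homs C T (ob G n). \<forall>b \<in> homs C T (ob G n).
        (\<forall>i \<le> n. n > 0 \<longrightarrow> fc G n i \<cdot>\<^bsub>C\<^esub> app2 C (mul G n) a b =
           app2 C (mul G (n - 1)) (fc G n i \<cdot>\<^bsub>C\<^esub> a) (fc G n i \<cdot>\<^bsub>C\<^esub> b)) \<and>
        (\<forall>i \<le> n. dg G n i \<cdot>\<^bsub>C\<^esub> app2 C (mul G n) a b =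
           app2 C (mul G (n + 1)) (dg G n i \<cdot>\<^bsub>C\<^esub> a) (dg G n i \<cdot>\<^bsub>C\<^esub> b)))"

definition strict_lie_group :: "('o, 'm) cat \<Rightarrow> enat \<Rightarrow> ('o, 'm) sgrp \<Rightarrow> bool" where
  "strict_lie_group C n G \<longleftrightarrow>
     simplicial_lie_group C G \<and>
     (\<forall>k > 0. \<forall>i \<le> k. n \<le> enat k \<longrightarrow>
        horn_map_in C (isos C) G (point C) (\<lambda>k. bang C (ob G k)) k i)"

text \<open>Below, \<open>g j\<close> (\<open>j < n\<close>) are the coordinates of the universal element of
  \<open>G\<^sub>0 \<times> \<dots> \<times> G\<^sub>n\<^sub>-\<^sub>1\<close>.  The cases \<open>i = 0\<close> (no coordinate is multiplied or kept) and \<open>i = n\<close>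
  (only coordinates \<open>g j\<close> with \<open>j < n - 1\<close> remain) are covered by the same formula.\<close>

definition nerve_ob :: "('o, 'm) cat \<Rightarrow> ('o, 'm) sgrp \<Rightarrow> nat \<Rightarrow> 'o" where
  "nerve_ob C G n = prd C (map (ob G) [0..<n])"

definition nerve_fc :: "('o, 'm) cat \<Rightarrow> ('o, 'm) sgrp \<Rightarrow> nat \<Rightarrow> nat \<Rightarrow> 'm" where
  "nerve_fc C G n i =
     (let g = prj C (map (ob G) [0..<n]) in
      tup C (nerve_ob C G n)
        (map (\<lambda>j. if Suc j < i then g j
                  else if Suc j = i
                    then app2 C (mul G j) (g j) (fc G (Suc j) i \<cdot>\<^bsub>C\<^esub> g (Suc j))
                  else fc G (Suc j) i \<cdot>\<^bsub>C\<^esub> g (Suc j)) [0..<n - 1]))"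

definition nerve_dg :: "('o, 'm) cat \<Rightarrow> ('o, 'm) sgrp \<Rightarrow> nat \<Rightarrow> nat \<Rightarrow> 'm" where
  "nerve_dg C G n i =
     (let g = prj C (map (ob G) [0..<n]) in
      tup C (nerve_ob C G n)
        (map (\<lambda>j. if j < i then g j
                  else if j = i then one G i \<cdot>\<^bsub>C\<^esub> bang C (nerve_ob C G n)
                  else dg G (j - 1) i \<cdot>\<^bsub>C\<^esub> g (j - 1)) [0..<Suc n]))"

definition nerve :: "('o, 'm) cat \<Rightarrow> ('o, 'm) sgrp \<Rightarrow> ('o, 'm) sobj" where
  "nerve C G = \<lparr>ob = nerve_ob C G, fc = nerve_fc C G, dg = nerve_dg C G\<rparr>"


section \<open>Actions and homotopy quotients\<close>

definition simplicial_action :: "('o, 'm) cat \<Rightarrow> ('o, 'm) sgrp \<Rightarrow>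
    ('o, 'm) sobj \<Rightarrow> (nat \<Rightarrow> 'm) \<Rightarrow> bool" where
  "simplicial_action C G X a \<longleftrightarrow>
     simplicial_object C X \<and>
     (\<forall>n. a n \<in> homs C (prd C [ob G n, ob X n]) (ob X n)) \<and>
     (\<forall>n. \<forall>T \<in> Ob C. \<forall>x \<in> homs C T (ob X n).
        app2 C (a n) (one G n \<cdot>\<^bsub>C\<^esub> bang C T) x = x \<and>
        (\<forall>g \<in> homs C T (ob G n). \<forall>h \<in> homs C T (ob G n).
           app2 C (a n) (app2 C (mul G n) g h) x = app2 C (a n) g (app2 C (a n) h x)) \<and>
        (\<forall>g \<in> homs C T (ob G n).
           (\<forall>i \<le> n. n > 0 \<longrightarrow> fc X n i \<cdot>\<^bsub>C\<^esub> app2 C (a n) g x =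
              app2 C (a (n - 1)) (fc G n i \<cdot>\<^bsub>C\<^esub> g) (fc X n i \<cdot>\<^bsub>C\<^esub> x)) \<and>
           (\<forall>i \<le> n. dg X n i \<cdot>\<^bsub>C\<^esub> app2 C (a n) g x =
              app2 C (a (n + 1)) (dg G n i \<cdot>\<^bsub>C\<^esub> g) (dg X n i \<cdot>\<^bsub>C\<^esub> x))))"

definition equivariant :: "('o, 'm) cat \<Rightarrow> ('o, 'm) sgrp \<Rightarrow> ('o, 'm) sobj \<Rightarrow>
    (nat \<Rightarrow> 'm) \<Rightarrow> (nat \<Rightarrow> 'm) \<Rightarrow> (nat \<Rightarrow> 'm) \<Rightarrow> bool" where
  "equivariant C G X a b \<phi> \<longleftrightarrow>
     (\<forall>n. \<forall>T \<in> Ob C. \<forall>g \<in> homs C T (ob G n). \<forall>x \<in> homs C T (ob X n).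
        \<phi> n \<cdot>\<^bsub>C\<^esub> app2 C (a n) g x = app2 C (b n) g (\<phi> n \<cdot>\<^bsub>C\<^esub> x))"

definition hquot_ob :: "('o, 'm) cat \<Rightarrow> ('o, 'm) sgrp \<Rightarrow> ('o, 'm) sobj \<Rightarrow> nat \<Rightarrow> 'o" where
  "hquot_ob C G X n = prd C [nerve_ob C G n, ob X n]"

text \<open>The group coordinates transform as in the nerve.\<close>

definition hquot_fc :: "('o, 'm) cat \<Rightarrow> ('o, 'm) sgrp \<Rightarrow> ('o, 'm) sobj \<Rightarrow>
    (nat \<Rightarrow> 'm) \<Rightarrow> nat \<Rightarrow> nat \<Rightarrow> 'm" where
  "hquot_fc C G X a n i =
     (let w = prj C [nerve_ob C G n, ob X n] 0;
          x = prj C [nerve_ob C G n, ob X n] 1;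
          g = (\<lambda>j. prj C (map (ob G) [0..<n]) j \<cdot>\<^bsub>C\<^esub> w) in
      tup C (hquot_ob C G X n)
        [nerve_fc C G n i \<cdot>\<^bsub>C\<^esub> w,
         if i = n then app2 C (a (n - 1)) (g (n - 1)) (fc X n n \<cdot>\<^bsub>C\<^esub> x)
         else fc X n i \<cdot>\<^bsub>C\<^esub> x])"

definition hquot_dg :: "('o, 'm) cat \<Rightarrow> ('o, 'm) sgrp \<Rightarrow> ('o, 'm) sobj \<Rightarrow>
    nat \<Rightarrow> nat \<Rightarrow> 'm" where
  "hquot_dg C G X n i =
     (let w = prj C [nerve_ob C G n, ob X n] 0;
          x = prj C [nerve_ob C G n, ob X n] 1 in
      tup C (hquot_ob C G X n) [nerve_dg C G n i \<cdot>\<^bsub>C\<^esub> w, dg X n i \<cdot>\<^bsub>C\<^esub> x])"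

definition hquot :: "('o, 'm) cat \<Rightarrow> ('o, 'm) sgrp \<Rightarrow> ('o, 'm) sobj \<Rightarrow>
    (nat \<Rightarrow> 'm) \<Rightarrow> ('o, 'm) sobj" where
  "hquot C G X a = \<lparr>ob = hquot_ob C G X, fc = hquot_fc C G X a, dg = hquot_dg C G X\<rparr>"

definition hquot_map :: "('o, 'm) cat \<Rightarrow> ('o, 'm) sgrp \<Rightarrow> ('o, 'm) sobj \<Rightarrow>
    (nat \<Rightarrow> 'm) \<Rightarrow> nat \<Rightarrow> 'm" where
  "hquot_map C G X \<phi> n =
     tup C (hquot_ob C G X n)
       [prj C [nerve_ob C G n, ob X n] 0,
        \<phi> n \<cdot>\<^bsub>C\<^esub> prj C [nerve_ob C G n, ob X n] 1]"

end

theory Submission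
  imports Defs
begin

text \<open>
  Everything is done with generalized elements.  For an object \<open>T\<close>, the sets \<open>Hom(T, X\<^sub>n)\<close> form
  a simplicial set and the sets \<open>Hom(T, G\<^sub>n)\<close> a simplicial group, and the formulas for the nerve and
  for the homotopy quotient can be read in them.  So each statement splits into one about simplicial sets,
  proved by calculating with elements, and one about the objects that represent the functors
  of \<open>T\<close> which occur.

  A horn is a family of simplices, its faces, that agree where faces of \<open>\<Delta>\<^sup>k\<close> meet.  Hence \<open>\<Lambda>\<^sup>k\<^sub>i(f)\<close>
  represents the functor which sends \<open>T\<close> to the families of faces \<open>x\<^sub>j : T \<rightarrow> X\<^sub>k\<^sub>-\<^sub>1\<close>, \<open>j \<noteq> i\<close>,
  over a \<open>y : T \<rightarrow> Y\<^sub>k\<close> (\<open>horn_map_in_iff\<close>).  This replaces the limit over all simplices of the horn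
  and rests on the functoriality of the operators \<open>X(\<theta>)\<close> (\<open>operate_operate\<close>).
  A bijection between two such functors that is natural in \<open>T\<close> transports representing
  objects and horn-filling maps (\<open>classified_transfer\<close>).  Covers and isomorphisms are treated alike, as classes
  of morphisms stable under composition and pullback.

  \<^emph>\<open>Simplicial groups.\<close>  Every simplicial group has horn-filling maps that are covers
  (\<open>group_horn_cover\<close>).  Moore's argument fills the universal horn and so gives a section of
  \<open>\<lambda>\<^sup>k\<^sub>i(G)\<close>; with the group structure one obtains an arrow that is a product projection
  up to isomorphism and whose composite with \<open>\<lambda>\<^sup>k\<^sub>i(G)\<close> is another product projection, so that
  \<open>\<lambda>\<^sup>k\<^sub>i(G)\<close> is a cover by (A3) (\<open>cover_of_transport\<close>).  The object \<open>\<Lambda>\<^sup>k\<^sub>i(G)\<close>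
  exists because a horn is built by attaching one face after the other, each along a union
  of faces of \<open>\<Delta>\<^sup>k\<^sup>-\<^sup>1\<close>, that is by pullback of a map already known to be a cover
  (\<open>horn_covers_by_induction\<close>).

  \<^emph>\<open>The nerve.\<close>  A \<open>k\<close>-simplex of the nerve is a \<open>(k-1)\<close>-simplex together with a last coordinate in
  \<open>G\<^sub>k\<^sub>-\<^sub>1\<close>.  There are natural bijections between \<open>\<Lambda>\<^sup>k\<^sub>i\<close> of the nerve and the product of its
  \<open>(k-1)\<close>-simplices with \<open>\<Lambda>\<^sup>k\<^sup>-\<^sup>1\<^sub>j(G)\<close>, where \<open>j = min i (k-1)\<close>: the last face of the horn, or the one
  before it if \<open>i = k\<close>, is the \<open>(k-1)\<close>-simplex, and the last coordinates of the other faces are the horn in \<open>G\<close>, up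
  to a factor coming from that simplex (\<open>nerve_horn\<close>).  The degree drops by one, which is why
  isomorphisms for \<open>k \<ge> n\<close> in \<open>G\<close> become isomorphisms for \<open>k > n\<close> in the nerve.

  \<^emph>\<open>The homotopy quotient.\<close>  Over a fixed simplex \<open>(g\<^sub>0, \<dots>, g\<^sub>k\<^sub>-\<^sub>1)\<close> of the nerve, a horn of the
  quotient becomes a horn of \<open>X\<close> when its last face is divided by \<open>g\<^sub>k\<^sub>-\<^sub>1\<close>, since only the last face
  map involves the action.  Therefore the relative horns of \<open>1 \<times>\<^sub>G \<phi>\<close> are products of simplices
  of the nerve with the relative horns of \<open>\<phi>\<close> (\<open>hquot_map_horn\<close>), and in the same
  way the projection of the quotient to the nerve has horn-filling maps that are covers
  (\<open>hq_nerve_horn\<close>).  Composing with the nerve shows that the quotients are Lie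
  \<open>\<infinity>\<close>-groupoids (\<open>horn_cover_comp\<close>).
\<close>

section \<open>Simplicial sets and fillers in simplicial groups\<close>

text \<open>
  The faces of a map to \<open>S\<close> from the union of those faces of \<open>\<Delta>\<^sup>k\<close> whose opposite vertex is
  in \<open>J\<close>.  The condition on pairs refers to \<open>(k-2)\<close>-simplices.  It is used for \<open>J \<subset> {..k}\<close>
  only, and then \<open>J\<close> contains a pair only if \<open>k \<ge> 2\<close>.
\<close>

definition matching :: "(nat \<Rightarrow> 'a set) \<Rightarrow> (nat \<Rightarrow> nat \<Rightarrow> 'a \<Rightarrow> 'a) \<Rightarrow> nat \<Rightarrow> nat set \<Rightarrow> (nat \<Rightarrow> 'a) \<Rightarrow> bool" where
  "matching S d k J x \<longleftrightarrow> (\<forall>j\<in>J. x j \<in> S (k - 1)) \<and>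
     (\<forall>a\<in>J. \<forall>b\<in>J. a < b \<longrightarrow> d (k - 1) a (x b) = d (k - 1) (b - 1) (x a))"

locale simplicial_set =
  fixes S :: "nat \<Rightarrow> 'a set" and d s :: "nat \<Rightarrow> nat \<Rightarrow> 'a \<Rightarrow> 'a"
  assumes d_in: "x \<in> S (Suc n) \<Longrightarrow> i \<le> Suc n \<Longrightarrow> d (Suc n) i x \<in> S n"
    and s_in: "x \<in> S n \<Longrightarrow> i \<le> n \<Longrightarrow> s n i x \<in> S (Suc n)"
    and dd: "x \<in> S (Suc (Suc n)) \<Longrightarrow> j \<le> Suc (Suc n) \<Longrightarrow> i < j \<Longrightarrow>
      d (Suc n) i (d (Suc (Suc n)) j x) = d (Suc n) (j - 1) (d (Suc (Suc n)) i x)"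
    and ss: "x \<in> S n \<Longrightarrow> j \<le> n \<Longrightarrow> i \<le> j \<Longrightarrow>
      s (Suc n) i (s n j x) = s (Suc n) (Suc j) (s n i x)"
    and ds_less: "x \<in> S (Suc n) \<Longrightarrow> j \<le> Suc n \<Longrightarrow> i < j \<Longrightarrow>
      d (Suc (Suc n)) i (s (Suc n) j x) = s n (j - 1) (d (Suc n) i x)"
    and ds_same: "x \<in> S n \<Longrightarrow> j \<le> n \<Longrightarrow> d (Suc n) j (s n j x) = x"
    and ds_Suc: "x \<in> S n \<Longrightarrow> j \<le> n \<Longrightarrow> d (Suc n) (Suc j) (s n j x) = x"
    and ds_greater: "x \<in> S (Suc n) \<Longrightarrow> i \<le> Suc (Suc n) \<Longrightarrow> Suc j < i \<Longrightarrow>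
      d (Suc (Suc n)) i (s (Suc n) j x) = s n j (d (Suc n) (i - 1) x)"

text \<open>
  Renumbers the vertices other than \<open>a\<close>: the faces \<open>a\<close> and \<open>j\<close> of a simplex meet in
  the face \<open>shift a j\<close> of the former and the face \<open>shift j a\<close> of the latter.
\<close>

definition shift :: "nat \<Rightarrow> nat \<Rightarrow> nat" where
  "shift a j = (if j < a then j else j - 1)"

context simplicial_set begin

text \<open>
  A new face \<open>a\<close> is attached to the faces in \<open>J\<close> along the union of its own faces
  \<open>shift a ` J\<close>.  What the given faces prescribe there is again a matching family, so that face \<open>a\<close>
  has to be a filler of a problem one dimension lower.
\<close>

lemma matching_link:
  assumes J: "insert a J \<subset> {..Suc k}" "a \<notin> J" and x: "matching S d (Suc k) J x"
  shows "\<exists>y. matching S d k (shift a ` J) y \<and> (\<forall>j\<in>J. y (shift a j) = d k (shift j a) (x j))"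
proof -
  define y where "y l = (if l < a then d k (a - 1) (x l) else d k a (x (Suc l)))" for l
  have yj: "y (shift a j) = d k (shift j a) (x j)" if "j \<in> J" for j
    using that J(2) by (auto simp: y_def shift_def)
  have inj: "l \<in> shift a ` J \<longleftrightarrow> (l < a \<and> l \<in> J) \<or> (a \<le> l \<and> Suc l \<in> J)" for l
  proof
    assume "l \<in> shift a ` J"
    then obtain j where j: "j \<in> J" "l = shift a j" by blast
    then have "j \<noteq> a" using J(2) by auto
    then show "(l < a \<and> l \<in> J) \<or> (a \<le> l \<and> Suc l \<in> J)"
      using j by (cases j) (auto simp: shift_def split: if_splits)
  next
    assume "(l < a \<and> l \<in> J) \<or> (a \<le> l \<and> Suc l \<in> J)"
    then have "(l \<in> J \<and> shift a l = l) \<or> (Suc l \<in> J \<and> shift a (Suc l) = l)" by (auto simp: shift_def)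
    then show "l \<in> shift a ` J" by (metis imageI)
  qed
  have xin: "x j \<in> S k" if "j \<in> J" for j using x that by (auto simp: matching_def)
  have le: "j \<le> Suc k" if "j \<in> insert a J" for j using J that by auto
  have xc: "d k p (x q) = d k (q - 1) (x p)" if "p \<in> J" "q \<in> J" "p < q" for p q
    using x that by (auto simp: matching_def)
  have "matching S d k (shift a ` J) y"
    unfolding matching_def
  proof (intro conjI ballI impI)
    fix l assume "l \<in> shift a ` J"
    then obtain j where j: "j \<in> J" "l = shift a j" by auto
    obtain c where c: "c \<le> Suc k" "c \<notin> insert a J" using J by auto
    have "c \<noteq> a" "c \<noteq> j" "j \<noteq> a" using c j J by auto
    then obtain k' where k': "k = Suc k'" using c(1) le[of j] le[of a] j(1) by (cases k) auto
    have "shift j a \<le> k" using le[of j] le[of a] j(1) \<open>j \<noteq> a\<close> by (auto simp: shift_def)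
    then show "y l \<in> S (k - 1)" using yj[OF j(1)] j d_in xin[OF j(1)] k' by simp
  next
    fix l l' assume l: "l \<in> shift a ` J" "l' \<in> shift a ` J" "l < l'"
    obtain c where c: "c \<le> Suc k" "c \<notin> insert a J" using J by auto
    from l inj have "(l < a \<and> l \<in> J \<and> l' < a \<and> l' \<in> J) \<or> (l < a \<and> l \<in> J \<and> a \<le> l' \<and> Suc l' \<in> J) \<or>
       (a \<le> l \<and> Suc l \<in> J \<and> a \<le> l' \<and> Suc l' \<in> J)" by auto
    moreover have "\<exists>m. k = Suc (Suc m)"
    proof -
      obtain j j' where jj: "j \<in> J" "j' \<in> J" "j \<noteq> j'" using l by (metis imageE less_irrefl)
      have "card {a, j, j', c} = 4" using jj c J(2) by (auto simp: card_insert_if)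
      moreover have "card {a, j, j', c} \<le> card {..Suc k}" by (rule card_mono) (use jj c le in auto)
      ultimately have "k \<ge> 2" by simp
      then show ?thesis by (metis add_2_eq_Suc le_Suc_ex)
    qed
    then obtain m where m: "k = Suc (Suc m)" by blast
    ultimately consider (1) "l < a" "l \<in> J" "l' < a" "l' \<in> J" | (2) "l < a" "l \<in> J" "a \<le> l'" "Suc l' \<in> J"
      | (3) "a \<le> l" "Suc l \<in> J" "a \<le> l'" "Suc l' \<in> J" by blast
    then show "d (k - 1) l (y l') = d (k - 1) (l' - 1) (y l)"
    proof cases
      case 1
      then show ?thesis using l le[of a] m dd[of "x l'" m "a-1" l] dd[of "x l" m "a-1" "l'-1"] xin xc[of l l']
        by (auto simp: y_def)
    next
      case 2
      then show ?thesis using l le[of a] le[of "Suc l'"] m dd[of "x (Suc l')" m "a" l] dd[of "x l" m "l'" "a-1"] xin xc[of l "Suc l'"]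
        by (cases "a = l'") (auto simp: y_def)
    next
      case 3
      then show ?thesis using l le[of a] le[of "Suc l'"] le[of "Suc l"] m dd[of "x (Suc l')" m "Suc l" a] dd[of "x (Suc l)" m "l'" "a"] xin xc[of "Suc l" "Suc l'"]
        by (auto simp: y_def)
    qed
  qed
  then show ?thesis using yj by blast
qed

end

locale simplicial_group = simplicial_set G d s
  for G :: "nat \<Rightarrow> 'a set" and d s +
  fixes m :: "nat \<Rightarrow> 'a \<Rightarrow> 'a \<Rightarrow> 'a" and e :: "nat \<Rightarrow> 'a" and v :: "nat \<Rightarrow> 'a \<Rightarrow> 'a"
  assumes m_in: "x \<in> G n \<Longrightarrow> y \<in> G n \<Longrightarrow> m n x y \<in> G n"
    and e_in: "e n \<in> G n"
    and v_in: "x \<in> G n \<Longrightarrow> v n x \<in> G n"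
    and m_assoc: "x \<in> G n \<Longrightarrow> y \<in> G n \<Longrightarrow> z \<in> G n \<Longrightarrow> m n (m n x y) z = m n x (m n y z)"
    and m_e_left: "x \<in> G n \<Longrightarrow> m n (e n) x = x"
    and m_e_right: "x \<in> G n \<Longrightarrow> m n x (e n) = x"
    and m_v_left: "x \<in> G n \<Longrightarrow> m n (v n x) x = e n"
    and m_v_right: "x \<in> G n \<Longrightarrow> m n x (v n x) = e n"
    and d_m: "x \<in> G (Suc n) \<Longrightarrow> y \<in> G (Suc n) \<Longrightarrow> i \<le> Suc n \<Longrightarrow>
      d (Suc n) i (m (Suc n) x y) = m n (d (Suc n) i x) (d (Suc n) i y)"
    and s_m: "x \<in> G n \<Longrightarrow> y \<in> G n \<Longrightarrow> i \<le> n \<Longrightarrow>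
      s n i (m n x y) = m (Suc n) (s n i x) (s n i y)"
begin

lemma m_left_cancel: "x \<in> G n \<Longrightarrow> y \<in> G n \<Longrightarrow> z \<in> G n \<Longrightarrow> m n x y = m n x z \<longleftrightarrow> y = z"
  by (metis m_assoc m_e_left m_v_left v_in)

lemma m_right_cancel: "x \<in> G n \<Longrightarrow> y \<in> G n \<Longrightarrow> z \<in> G n \<Longrightarrow> m n y x = m n z x \<longleftrightarrow> y = z"
  by (metis m_assoc m_e_right m_v_right v_in)

lemma m_v_cancel_left: "x \<in> G n \<Longrightarrow> y \<in> G n \<Longrightarrow> m n x (m n (v n x) y) = y"
  by (metis m_assoc m_e_left m_v_right v_in)

lemma m_v_cancel_right: "x \<in> G n \<Longrightarrow> y \<in> G n \<Longrightarrow> m n (m n y (v n x)) x = y"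
  by (metis m_assoc m_e_right m_v_left v_in)

lemma idem_e: "x \<in> G n \<Longrightarrow> m n x x = x \<Longrightarrow> x = e n"
  by (metis m_left_cancel e_in m_e_right)

lemma d_e: "i \<le> Suc n \<Longrightarrow> d (Suc n) i (e (Suc n)) = e n"
  by (metis d_in d_m e_in idem_e m_e_left)

lemma s_e: "i \<le> n \<Longrightarrow> s n i (e n) = e (Suc n)"
  by (metis s_in s_m e_in idem_e m_e_left)

lemma d_v: "x \<in> G (Suc n) \<Longrightarrow> i \<le> Suc n \<Longrightarrow> d (Suc n) i (v (Suc n) x) = v n (d (Suc n) i x)"
  by (metis d_e d_in d_m m_left_cancel m_v_right v_in)

lemmas closed = d_in s_in m_in e_in v_in

text \<open>
  Moore's correction.  Multiplication by a degeneracy of the quotient \<open>z\<close> of the prescribed by the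
  actual face \<open>j\<close> repairs this face.  At a face \<open>l\<close> where \<open>y\<close> is right already, \<open>z\<close> has the
  trivial face by the matching condition, so that nothing changes there, provided that
  \<open>d\<^sub>l s\<^sub>c\<close> is not the identity.
\<close>

lemma correct_face:
  assumes x: "matching G d (Suc n) J x" and J: "J \<subset> {..Suc n}" and j: "j \<in> J" "c = j \<or> Suc c = j" "c \<le> n"
    and y: "y \<in> G (Suc n)" and L: "L \<subseteq> J" "\<And>l. l \<in> L \<Longrightarrow> l < c \<or> Suc c < l"
      "\<And>l. l \<in> L \<Longrightarrow> d (Suc n) l y = x l"
  shows "\<exists>y'\<in>G (Suc n). d (Suc n) j y' = x j \<and> (\<forall>l\<in>L. d (Suc n) l y' = x l)"
proof -
  define z where "z = m n (v n (d (Suc n) j y)) (x j)"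
  define y' where "y' = m (Suc n) y (s n c z)"
  have le: "l \<le> Suc n" if "l \<in> J" for l using J that by auto
  have xin: "x l \<in> G n" if "l \<in> J" for l using x that by (auto simp: matching_def)
  have xc: "d n p (x q) = d n (q - 1) (x p)" if "p \<in> J" "q \<in> J" "p < q" for p q
    using x that by (auto simp: matching_def)
  have dy: "d (Suc n) l y \<in> G n" if "l \<in> J" for l using d_in y le that by auto
  have zin: "z \<in> G n" unfolding z_def using xin dy j by (intro m_in v_in) auto
  have y'in: "y' \<in> G (Suc n)" using zin y j by (auto simp: y'_def intro!: closed)
  have "d (Suc n) j (s n c z) = z" using j ds_same[OF zin, of c] ds_Suc[OF zin, of c] by auto
  then have 1: "d (Suc n) j y' = x j" using y zin j le xin dy
    by (simp add: y'_def z_def d_m s_in m_v_cancel_left)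
  have "d (Suc n) l y' = x l" if l: "l \<in> L" for l
  proof -
    have lJ: "l \<in> J" "l \<noteq> j" using l L(1) L(2)[OF l] j by auto
    obtain i where "i \<notin> J" "i \<le> Suc n" using J by auto
    then have "i \<noteq> l" "i \<noteq> j" using lJ j by auto
    then obtain n' where n': "n = Suc n'" using le lJ j(1) \<open>i \<le> Suc n\<close> by (cases n) (auto simp: le_Suc_eq)
    have zs: "d n (shift j l) z = e n'"
    proof -
      have "d n (shift j l) (d (Suc n) j y) = d n (shift j l) (x j)"
        using L(3)[OF l] lJ j(1) le n' y xc[of l j] xc[of j l] dd[of y n' j l] dd[of y n' l j]
        by (cases "l < j") (auto simp: shift_def)
      moreover have "shift j l \<le> n" using le[OF lJ(1)] le[OF j(1)] lJ by (auto simp: shift_def)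
      ultimately show ?thesis unfolding z_def
        using n' xin[OF j(1)] dy[OF j(1)] by (simp add: d_m d_v v_in d_in m_v_left)
    qed
    have "d (Suc n) l (s n c z) = e n"
    proof (cases "l < c")
      case True
      then have "d (Suc n) l (s n c z) = s n' (c - 1) (d n l z)" using n' zin j by (simp add: ds_less)
      moreover have "shift j l = l" using True j by (auto simp: shift_def)
      ultimately show ?thesis using zs n' s_e[of "c-1" n'] j True by auto
    next
      case False
      then have "Suc c < l" using L(2)[OF l] by auto
      then have "d (Suc n) l (s n c z) = s n' c (d n (l - 1) z)" using n' zin le lJ by (simp add: ds_greater)
      moreover have "shift j l = l - 1" using \<open>Suc c < l\<close> j by (auto simp: shift_def)
      ultimately show ?thesis using zs n' s_e[of c n'] \<open>Suc c < l\<close> le[OF lJ(1)] by auto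
    qed
    then show ?thesis using L(3)[OF l] y zin j le lJ xin by (simp add: y'_def d_m s_in m_e_right)
  qed
  then show ?thesis using 1 y'in by blast
qed

text \<open>
  The faces \<open>0, \<dots>, i-1\<close> are corrected in increasing order with \<open>s\<^sub>j\<close>, and then the faces
  \<open>k, \<dots>, i+1\<close> in decreasing order with \<open>s\<^sub>j\<^sub>-\<^sub>1\<close>.  In this order no correction meets an earlier one.
\<close>

theorem horn_filler:
  assumes i: "i \<le> Suc n" and x: "matching G d (Suc n) ({..Suc n} - {i}) x"
  shows "\<exists>y\<in>G (Suc n). \<forall>j\<in>{..Suc n} - {i}. d (Suc n) j y = x j"
proof -
  have "\<exists>y\<in>G (Suc n). \<forall>j<a. d (Suc n) j y = x j" if "a \<le> i" for a
    using that
  proof (induction a)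
    case 0 then show ?case using e_in by auto
  next
    case (Suc a)
    then obtain y where "y \<in> G (Suc n)" "\<forall>j<a. d (Suc n) j y = x j" by auto
    with correct_face[OF x, of a a y "{..<a}"] Suc(2) i show ?case by (force simp: less_Suc_eq)
  qed
  from this[of i] obtain y0 where y0: "y0 \<in> G (Suc n)" "\<forall>j<i. d (Suc n) j y0 = x j" by auto
  have "\<exists>y\<in>G (Suc n). \<forall>j. j < i \<or> Suc n - b < j \<and> j \<le> Suc n \<longrightarrow> d (Suc n) j y = x j"
    if "b \<le> Suc n - i" for b using that
  proof (induction b)
    case 0 then show ?case using y0 by auto
  next
    case (Suc b)
    then obtain y where y: "y \<in> G (Suc n)"
       "\<forall>j. j < i \<or> Suc n - b < j \<and> j \<le> Suc n \<longrightarrow> d (Suc n) j y = x j" by auto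
    define j where "j = Suc n - b"
    have j: "i < j" "j \<le> Suc n" "Suc n - Suc b = j - 1" using Suc by (auto simp: j_def)
    have "\<exists>y'\<in>G (Suc n). d (Suc n) j y' = x j \<and> (\<forall>l\<in>{..<i} \<union> {j<..Suc n}. d (Suc n) l y' = x l)"
      by (rule correct_face[OF x, of _ "j - 1" y]) (use y j i in \<open>auto simp: j_def\<close>)
    then obtain y' where "y' \<in> G (Suc n)" "d (Suc n) j y' = x j" "\<forall>l\<in>{..<i} \<union> {j<..Suc n}. d (Suc n) l y' = x l" by auto
    moreover have "l = j \<or> l \<in> {..<i} \<union> {j<..Suc n}"
      if "l < i \<or> Suc n - Suc b < l \<and> l \<le> Suc n" for l using that j by auto
    ultimately show ?case by blast
  qed
  from this[of "Suc n - i"] i obtain y where "y \<in> G (Suc n)"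
    "\<forall>j. j < i \<or> i < j \<and> j \<le> Suc n \<longrightarrow> d (Suc n) j y = x j" by auto
  then show ?thesis by (intro bexI[of _ y]) (auto simp: neq_iff)
qed

end

section \<open>Simplicial operators\<close>

definition repeats :: "nat list \<Rightarrow> nat list" where
  "repeats \<theta> = filter (\<lambda>i. \<theta> ! i = \<theta> ! Suc i) [0..<length \<theta> - 1]"

definition missed :: "nat \<Rightarrow> nat list \<Rightarrow> nat list" where
  "missed n \<theta> = filter (\<lambda>j. j \<notin> set \<theta>) [0..<Suc n]"

text \<open>
  On lists of values of monotone maps, deleting position \<open>i\<close> is precomposition with the \<open>i\<close>-th coface.
\<close>

definition delete_at :: "nat \<Rightarrow> 'b list \<Rightarrow> 'b list" where
  "delete_at i xs = take i xs @ drop (Suc i) xs"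

lemma length_delete_at: "i < length xs \<Longrightarrow> length (delete_at i xs) = length xs - 1"
  by (auto simp: delete_at_def)

lemma nth_delete_at: "i < length xs \<Longrightarrow> p < length xs - 1 \<Longrightarrow> delete_at i xs ! p = xs ! (if p < i then p else Suc p)"
  by (auto simp: delete_at_def nth_append min_def)

lemma map_delete_at: "map f (delete_at i xs) = delete_at i (map f xs)"
  by (simp add: delete_at_def take_map drop_map)

lemma set_delete_at: "set (delete_at i xs) \<subseteq> set xs"
  by (auto simp: delete_at_def dest: in_set_takeD in_set_dropD)

lemma sorted_delete_at: "sorted xs \<Longrightarrow> sorted (delete_at i xs)"
proof (cases "i < length xs")
  case True
  assume "sorted xs"
  then show ?thesis using True
    by (auto simp: sorted_iff_nth_mono length_delete_at nth_delete_at)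
qed (simp add: delete_at_def)

lemma set_delete_repeat:
  assumes "Suc i < length xs" "xs ! i = xs ! Suc i"
  shows "set (delete_at (Suc i) xs) = set xs"
proof -
  have "take (Suc i) xs ! i \<in> set (take (Suc i) xs)" using assms by (intro nth_mem) auto
  then have "xs ! Suc i \<in> set (take (Suc i) xs)" using assms by simp
  moreover have "set xs = set (take (Suc i) xs @ xs ! Suc i # drop (Suc (Suc i)) xs)"
    using id_take_nth_drop[OF assms(1)] by simp
  ultimately show ?thesis by (auto simp: delete_at_def)
qed

lemma upt_split: "a \<le> b \<Longrightarrow> b \<le> c \<Longrightarrow> [a..<c] = [a..<b] @ [b..<c]"
  using upt_add_eq_append[of a b "c - b"] by simp

lemma shift_inj: "a \<noteq> j \<Longrightarrow> b \<noteq> j \<Longrightarrow> shift j a = shift j b \<longleftrightarrow> a = b"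
  by (auto simp: shift_def split: if_splits)

lemma shift_mono: "a \<le> b \<Longrightarrow> shift j a \<le> shift j b"
  by (auto simp: shift_def)

lemma shift_shift: "j < k \<Longrightarrow> v \<noteq> j \<Longrightarrow> v \<noteq> k \<Longrightarrow> shift j (shift k v) = shift (k - 1) (shift j v)"
  by (auto simp: shift_def)

lemma mono_shift:
  assumes "\<theta> \<in> mono_lists m (Suc n)" "j \<le> Suc n" "j \<notin> set \<theta>"
  shows "map (shift j) \<theta> \<in> mono_lists m n"
proof -
  have "shift j v \<le> n" if "v \<in> set \<theta>" for v
  proof -
    have "v \<le> Suc n" "v \<noteq> j" using assms that by (auto simp: mono_lists_def)
    then show ?thesis using assms(2) by (auto simp: shift_def)
  qed
  moreover have "sorted (map (shift j) \<theta>)"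
    unfolding sorted_map
    by (rule sorted_wrt_mono_rel[of \<theta> "(\<le>)"]) (use assms(1) shift_mono in \<open>auto simp: mono_lists_def\<close>)
  ultimately show ?thesis using assms(1) by (auto simp: mono_lists_def)
qed

lemma mono_delete: "\<theta> \<in> mono_lists (Suc m) n \<Longrightarrow> i \<le> Suc m \<Longrightarrow> delete_at i \<theta> \<in> mono_lists m n"
  using set_delete_at[of i \<theta>] by (auto simp: mono_lists_def length_delete_at sorted_delete_at)

lemma mono_comp: "\<theta> \<in> mono_lists p m \<Longrightarrow> \<sigma> \<in> mono_lists m n \<Longrightarrow> map (\<lambda>a. \<sigma> ! a) \<theta> \<in> mono_lists p n"
proof -
  assume a: "\<theta> \<in> mono_lists p m" "\<sigma> \<in> mono_lists m n"
  have "sorted (map (\<lambda>a. \<sigma> ! a) \<theta>)" unfolding sorted_map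
  proof (rule sorted_wrt_mono_rel[of \<theta> "(\<le>)"])
    show "sorted \<theta>" using a by (simp add: mono_lists_def)
    fix v w assume "v \<in> set \<theta>" "w \<in> set \<theta>" "v \<le> w"
    moreover from this have "w < length \<sigma>" using a by (auto simp: mono_lists_def)
    ultimately show "\<sigma> ! v \<le> \<sigma> ! w" using a by (intro sorted_nth_mono) (auto simp: mono_lists_def)
  qed
  moreover have "\<sigma> ! v \<le> n" if "v \<in> set \<theta>" for v
  proof -
    have "v < length \<sigma>" using a that by (auto simp: mono_lists_def)
    then have "\<sigma> ! v \<in> set \<sigma>" by simp
    then show ?thesis using a by (auto simp: mono_lists_def)
  qed
  ultimately show ?thesis using a by (auto simp: mono_lists_def)
qed

lemma mono_id: "[0..<Suc n] \<in> mono_lists n n"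
  by (auto simp: mono_lists_def simp del: upt_Suc)

lemma mono_lists_cases:
  assumes \<theta>: "\<theta> \<in> mono_lists m n"
  obtains j where "j \<le> n" "j \<notin> set \<theta>" | i where "i < m" "\<theta> ! i = \<theta> ! Suc i" | "m = n" "\<theta> = [0..<Suc n]"
proof (cases "(\<exists>j\<le>n. j \<notin> set \<theta>) \<or> (\<exists>i<m. \<theta> ! i = \<theta> ! Suc i)")
  case False
  then have s: "set \<theta> = set [0..<Suc n]" using \<theta> by (auto simp: mono_lists_def)
  have "\<theta> ! i < \<theta> ! Suc i" if "Suc i < length \<theta>" for i
    using \<theta> False that sorted_nth_mono[of \<theta> i "Suc i"] by (force simp: mono_lists_def le_less)
  then have "sorted_wrt (<) \<theta>" by (simp add: sorted_wrt_iff_nth_Suc_transp)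
  then have "\<theta> = [0..<Suc n]" using sorted_distinct_set_unique[OF _ _ _ _ s] by (simp add: strict_sorted_iff del: upt_Suc)
  moreover from this have "m = n" using \<theta> by (simp add: mono_lists_def)
  ultimately show ?thesis using that by blast
qed (use that in blast)

lemma missed_shift:
  assumes "j \<le> Suc n" "j \<notin> set \<theta>" "\<And>l. l \<le> Suc n \<Longrightarrow> j < l \<Longrightarrow> l \<in> set \<theta>"
  shows "missed (Suc n) \<theta> = missed n (map (shift j) \<theta>) @ [j]"
proof -
  have 1: "[0..<Suc (Suc n)] = [0..<j] @ j # [Suc j..<Suc (Suc n)]"
    using assms(1) upt_split[of 0 j "Suc (Suc n)"] upt_conv_Cons[of j "Suc (Suc n)"] by simp
  have 2: "[0..<Suc n] = [0..<j] @ [j..<Suc n]" using assms(1) by (intro upt_split) auto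
  have "filter (\<lambda>l. l \<notin> set \<theta>) [Suc j..<Suc (Suc n)] = []" using assms(3) by (auto simp: filter_empty_conv)
  then have L: "missed (Suc n) \<theta> = filter (\<lambda>l. l \<notin> set \<theta>) [0..<j] @ [j]"
    unfolding missed_def 1 using assms(2) by simp
  have "l \<in> shift j ` set \<theta>" if "j \<le> l" "l < Suc n" for l
  proof -
    have "Suc l \<in> set \<theta>" "shift j (Suc l) = l" using assms(3)[of "Suc l"] that by (auto simp: shift_def)
    then show ?thesis by (metis imageI)
  qed
  then have "filter (\<lambda>l. l \<notin> shift j ` set \<theta>) [j..<Suc n] = []" by (auto simp: filter_empty_conv)
  moreover have "l \<in> shift j ` set \<theta> \<longleftrightarrow> l \<in> set \<theta>" if "l < j" for l
  proof
    assume "l \<in> shift j ` set \<theta>"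
    then obtain v where v: "v \<in> set \<theta>" "l = shift j v" by blast
    then have "v \<noteq> j" using assms(2) by auto
    then have "v = l" using v that by (auto simp: shift_def split: if_splits)
    then show "l \<in> set \<theta>" using v by simp
  qed (use that in \<open>auto simp: shift_def image_iff\<close>)
  then have "filter (\<lambda>l. l \<notin> shift j ` set \<theta>) [0..<j] = filter (\<lambda>l. l \<notin> set \<theta>) [0..<j]"
    by (intro filter_cong) auto
  ultimately have "missed n (map (shift j) \<theta>) = filter (\<lambda>l. l \<notin> set \<theta>) [0..<j]"
    unfolding missed_def 2 by simp
  then show ?thesis using L by simp
qed

lemma repeats_map: "inj_on f (set \<theta>) \<Longrightarrow> repeats (map f \<theta>) = repeats \<theta>"
  unfolding repeats_def by (intro filter_cong) (auto simp: inj_on_eq_iff)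

lemma repeats_delete:
  assumes "Suc i < length \<theta>" "\<theta> ! i = \<theta> ! Suc i" "\<And>p. i < p \<Longrightarrow> Suc p < length \<theta> \<Longrightarrow> \<theta> ! p \<noteq> \<theta> ! Suc p"
  shows "repeats \<theta> = repeats (delete_at (Suc i) \<theta>) @ [i]"
proof -
  let ?l = "length \<theta> - 1" and ?e = "delete_at (Suc i) \<theta>"
  have 1: "[0..<?l] = [0..<i] @ i # [Suc i..<?l]"
    using assms(1) upt_split[of 0 i ?l] upt_conv_Cons[of i ?l] by simp
  have 2: "[0..<length ?e - 1] = [0..<i] @ [i..<length ?e - 1]"
    using assms(1) by (intro upt_split) (auto simp: length_delete_at)
  have "filter (\<lambda>i. \<theta> ! i = \<theta> ! Suc i) [Suc i..<?l] = []" using assms(3) by (auto simp: filter_empty_conv)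
  then have L: "repeats \<theta> = filter (\<lambda>i. \<theta> ! i = \<theta> ! Suc i) [0..<i] @ [i]" unfolding repeats_def 1 using assms(2) by simp
  have "?e ! p \<noteq> ?e ! Suc p" if "i \<le> p" "p < length ?e - 1" for p
    using that assms by (cases "p = i") (auto simp: length_delete_at nth_delete_at)
  then have "filter (\<lambda>i. ?e ! i = ?e ! Suc i) [i..<length ?e - 1] = []" by (auto simp: filter_empty_conv)
  moreover have "filter (\<lambda>i. ?e ! i = ?e ! Suc i) [0..<i] = filter (\<lambda>i. \<theta> ! i = \<theta> ! Suc i) [0..<i]"
    using assms(1) by (intro filter_cong) (auto simp: nth_delete_at)
  ultimately have "repeats ?e = filter (\<lambda>i. \<theta> ! i = \<theta> ! Suc i) [0..<i]" unfolding repeats_def 2 by simp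
  then show ?thesis using L by simp
qed

lemma repeats_strict: "(\<And>i. Suc i < length \<theta> \<Longrightarrow> \<theta> ! i \<noteq> \<theta> ! Suc i) \<Longrightarrow> repeats \<theta> = []"
  by (auto simp: repeats_def filter_empty_conv)

text \<open>
  The operator of \<open>\<theta>\<close> ends with the degeneracy of the last repetition and starts with the face
  of the last missed vertex.  These two are peeled off by definition; all others need the
  simplicial identities.
\<close>

lemma last_repeat:
  assumes "i < m" "\<theta> ! i = \<theta> ! Suc i" "length \<theta> = Suc m"
  obtains k where "i \<le> k" "k < m" "\<theta> ! k = \<theta> ! Suc k" "\<And>p. k < p \<Longrightarrow> Suc p < length \<theta> \<Longrightarrow> \<theta> ! p \<noteq> \<theta> ! Suc p"
proof -
  let ?A = "{k. k < m \<and> \<theta> ! k = \<theta> ! Suc k}"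
  have A: "finite ?A" "i \<in> ?A" using assms by auto
  show ?thesis
  proof
    show "i \<le> Max ?A" using A by (rule Max_ge)
    have "Max ?A \<in> ?A" using A Max_in by blast
    then show "Max ?A < m" "\<theta> ! Max ?A = \<theta> ! Suc (Max ?A)" by auto
    show "\<theta> ! p \<noteq> \<theta> ! Suc p" if "Max ?A < p" "Suc p < length \<theta>" for p
    proof
      assume "\<theta> ! p = \<theta> ! Suc p"
      then have "p \<in> ?A" using that assms(3) by simp
      from Max_ge[OF A(1) this] show False using that by simp
    qed
  qed
qed

lemma card_repeats: "\<theta> \<in> mono_lists m n \<Longrightarrow> card (set \<theta>) + length (repeats \<theta>) = Suc m"
proof (induction m arbitrary: \<theta>)
  case 0
  then obtain v where "\<theta> = [v]" by (auto simp: mono_lists_def length_Suc_conv)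
  then show ?case by (simp add: repeats_def)
next
  case (Suc m)
  have l: "length \<theta> = Suc (Suc m)" "sorted \<theta>" using Suc by (auto simp: mono_lists_def)
  show ?case
  proof (cases "\<exists>i<Suc m. \<theta> ! i = \<theta> ! Suc i")
    case True
    then obtain k where k: "k < Suc m" "\<theta> ! k = \<theta> ! Suc k" "\<And>p. k < p \<Longrightarrow> Suc p < length \<theta> \<Longrightarrow> \<theta> ! p \<noteq> \<theta> ! Suc p"
      using last_repeat l by metis
    have "repeats \<theta> = repeats (delete_at (Suc k) \<theta>) @ [k]" using repeats_delete k l by simp
    moreover have "set (delete_at (Suc k) \<theta>) = set \<theta>" using set_delete_repeat[of k \<theta>] k(1,2) l by simp
    moreover have "delete_at (Suc k) \<theta> \<in> mono_lists m n" using mono_delete[OF Suc(2)] k by simp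
    ultimately show ?thesis using Suc(1)[of "delete_at (Suc k) \<theta>"] by simp
  next
    case False
    then have "repeats \<theta> = []" using repeats_strict l by auto
    moreover have "\<theta> ! i < \<theta> ! Suc i" if "Suc i < length \<theta>" for i
      using False that l sorted_nth_mono[of \<theta> i "Suc i"] by (force simp: le_less)
    then have "sorted_wrt (<) \<theta>" by (simp add: sorted_wrt_iff_nth_Suc_transp)
    then have "card (set \<theta>) = length \<theta>" by (simp add: strict_sorted_iff distinct_card)
    ultimately show ?thesis using l by simp
  qed
qed

lemma last_missed:
  assumes "j \<le> (n::nat)" "j \<notin> set \<theta>"
  obtains k where "j \<le> k" "k \<le> n" "k \<notin> set \<theta>" "\<And>l. l \<le> n \<Longrightarrow> k < l \<Longrightarrow> l \<in> set \<theta>"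
proof -
  let ?A = "{k. k \<le> n \<and> k \<notin> set \<theta>}"
  have A: "finite ?A" "j \<in> ?A" using assms by auto
  show ?thesis
  proof
    show "j \<le> Max ?A" using A by (rule Max_ge)
    have "Max ?A \<in> ?A" using A Max_in by blast
    then show "Max ?A \<le> n" "Max ?A \<notin> set \<theta>" by auto
    show "l \<in> set \<theta>" if "l \<le> n" "Max ?A < l" for l
    proof (rule ccontr)
      assume "l \<notin> set \<theta>"
      then have "l \<in> ?A" using that by simp
      from Max_ge[OF A(1) this] show False using that by simp
    qed
  qed
qed

lemma delete_id:
  assumes "j \<le> Suc m"
  shows "delete_at j [0..<Suc (Suc m)] \<in> mono_lists m (Suc m)"
    and "j \<notin> set (delete_at j [0..<Suc (Suc m)])"
    and "map (shift j) (delete_at j [0..<Suc (Suc m)]) = [0..<Suc m]"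
    and "p \<le> m \<Longrightarrow> delete_at j [0..<Suc (Suc m)] ! p = (if p < j then p else Suc p)"
proof -
  let ?e = "delete_at j [0..<Suc (Suc m)]"
  show e: "?e \<in> mono_lists m (Suc m)" by (rule mono_delete[OF mono_id assms])
  have n: "?e ! p = (if p < j then p else Suc p)" if "p \<le> m" for p
    using that assms by (auto simp: nth_delete_at simp del: upt_Suc)
  then show "p \<le> m \<Longrightarrow> ?e ! p = (if p < j then p else Suc p)" .
  have len: "length ?e = Suc m" using e by (auto simp: mono_lists_def)
  show "j \<notin> set ?e" using n len by (auto simp: in_set_conv_nth less_Suc_eq_le simp del: upt_Suc split: if_splits)
  show "map (shift j) ?e = [0..<Suc m]"
    by (rule nth_equalityI) (use n len in \<open>auto simp: shift_def less_Suc_eq_le simp del: upt_Suc\<close>)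
qed

context simplicial_set begin

fun faces :: "nat \<Rightarrow> nat list \<Rightarrow> 'a \<Rightarrow> 'a" where
  "faces n [] x = x"
| "faces n (j # js) x = faces (n - 1) js (d n j x)"

fun degens :: "nat \<Rightarrow> nat list \<Rightarrow> 'a \<Rightarrow> 'a" where
  "degens n [] x = x"
| "degens n (i # is) x = degens (Suc n) is (s n i x)"

text \<open>
  The operator of \<open>\<theta>\<close> through its normal form, faces first and then degeneracies.
\<close>

definition operate :: "nat \<Rightarrow> nat list \<Rightarrow> 'a \<Rightarrow> 'a" where
  "operate n \<theta> x = degens (card (set \<theta>) - 1) (repeats \<theta>) (faces n (rev (missed n \<theta>)) x)"

lemma degens_snoc: "degens n (is @ [i]) x = s (n + length is) i (degens n is x)"
  by (induction "is" arbitrary: n x) auto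

lemma operate_id: "operate n [0..<Suc n] x = x"
proof -
  have "repeats [0..<Suc n] = []" by (rule repeats_strict) (simp del: upt_Suc)
  moreover have "missed n [0..<Suc n] = []" by (auto simp: missed_def filter_empty_conv)
  ultimately show ?thesis by (simp add: operate_def)
qed

lemma operate_last_missed:
  assumes "j \<le> Suc n" "j \<notin> set \<theta>" "\<And>l. l \<le> Suc n \<Longrightarrow> j < l \<Longrightarrow> l \<in> set \<theta>"
  shows "operate (Suc n) \<theta> x = operate n (map (shift j) \<theta>) (d (Suc n) j x)"
proof -
  have inj: "inj_on (shift j) (set \<theta>)" using assms(2) by (intro inj_onI) (metis shift_inj)
  have "card (set (map (shift j) \<theta>)) = card (set \<theta>)" using card_image[OF inj] by simp
  then show ?thesis using missed_shift[OF assms] repeats_map[OF inj] by (simp add: operate_def)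
qed

lemma operate_last_repeat:
  assumes \<theta>: "\<theta> \<in> mono_lists (Suc m) n" and k: "k < Suc m" "\<theta> ! k = \<theta> ! Suc k"
    "\<And>p. k < p \<Longrightarrow> Suc p < length \<theta> \<Longrightarrow> \<theta> ! p \<noteq> \<theta> ! Suc p"
  shows "operate n \<theta> x = s m k (operate n (delete_at (Suc k) \<theta>) x)"
proof -
  let ?e = "delete_at (Suc k) \<theta>"
  have l: "length \<theta> = Suc (Suc m)" using \<theta> by (auto simp: mono_lists_def)
  have r: "repeats \<theta> = repeats ?e @ [k]" using repeats_delete k l by simp
  have s: "set ?e = set \<theta>" using set_delete_repeat[of k \<theta>] k(1,2) l by simp
  have e: "?e \<in> mono_lists m n" using mono_delete[OF \<theta>] k by simp
  have "card (set ?e) > 0" using e by (auto simp: mono_lists_def card_gt_0_iff)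
  then have "card (set ?e) - 1 + length (repeats ?e) = m" using card_repeats[OF e] by simp
  then show ?thesis unfolding operate_def r using s degens_snoc by (simp add: missed_def)
qed

lemma operate_in: "\<theta> \<in> mono_lists m n \<Longrightarrow> x \<in> S n \<Longrightarrow> operate n \<theta> x \<in> S m"
proof (induction "n + m" arbitrary: n m \<theta> x rule: less_induct)
  case less
  have l: "length \<theta> = Suc m" using less by (auto simp: mono_lists_def)
  from less(2) show ?case
  proof (cases rule: mono_lists_cases)
    case (1 j)
    then obtain k where k: "k \<le> n" "k \<notin> set \<theta>" "\<And>l. l \<le> n \<Longrightarrow> k < l \<Longrightarrow> l \<in> set \<theta>" using last_missed by metis
    have "n \<noteq> 0" using k less(2) by (cases \<theta>) (auto simp: mono_lists_def)
    then obtain n' where n': "n = Suc n'" by (cases n) auto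
    have "operate n' (map (shift k) \<theta>) (d n k x) \<in> S m"
      by (rule less(1)) (use n' k mono_shift[of \<theta> m n' k] less(2,3) d_in in auto)
    then show ?thesis using operate_last_missed[of k n' \<theta> x] k n' by simp
  next
    case (2 i)
    then obtain k where k: "k < m" "\<theta> ! k = \<theta> ! Suc k" "\<And>p. k < p \<Longrightarrow> Suc p < length \<theta> \<Longrightarrow> \<theta> ! p \<noteq> \<theta> ! Suc p"
      using last_repeat l by metis
    then obtain m' where m': "m = Suc m'" by (cases m) auto
    have "operate n (delete_at (Suc k) \<theta>) x \<in> S m'"
      by (rule less(1)) (use m' k mono_delete[of \<theta> m' n "Suc k"] less(2,3) in auto)
    then show ?thesis using operate_last_repeat[of \<theta> m' n k x] k m' less(2) s_in by simp
  next
    case 3 then show ?thesis using less(3) by (simp add: operate_id del: upt_Suc)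
  qed
qed

text \<open>
  Any missed vertex \<open>j\<close> can be split off first: by induction, \<open>d\<^sub>j\<close> is moved past the face
  of the last missed vertex.
\<close>

lemma operate_missed:
  "\<theta> \<in> mono_lists m (Suc n) \<Longrightarrow> x \<in> S (Suc n) \<Longrightarrow> j \<le> Suc n \<Longrightarrow> j \<notin> set \<theta> \<Longrightarrow>
    operate (Suc n) \<theta> x = operate n (map (shift j) \<theta>) (d (Suc n) j x)"
proof (induction n arbitrary: \<theta> x j rule: less_induct)
  case (less n)
  then obtain k where k: "j \<le> k" "k \<le> Suc n" "k \<notin> set \<theta>" "\<And>l. l \<le> Suc n \<Longrightarrow> k < l \<Longrightarrow> l \<in> set \<theta>"
    using last_missed by metis
  show ?case
  proof (cases "j = k")
    case True then show ?thesis using operate_last_missed[of k n \<theta> x] k by simp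
  next
    case False
    then have jk: "j < k" using k by simp
    obtain v where v: "v \<in> set \<theta>" "v \<le> Suc n" using less(2) by (cases \<theta>) (auto simp: mono_lists_def)
    then have "v \<noteq> j" "v \<noteq> k" using less k by auto
    then obtain n' where n': "n = Suc n'" using v jk k(2) by (cases n) auto
    have ml: "map (shift k) \<theta> \<in> mono_lists m n" "map (shift j) \<theta> \<in> mono_lists m n"
      using mono_shift less k by auto
    have nk: "v \<noteq> k" "v \<noteq> j" if "v \<in> set \<theta>" for v using that k less by auto
    have "shift k v \<noteq> j" if "v \<in> set \<theta>" for v using nk[OF that] jk by (auto simp: shift_def)
    then have jm: "j \<notin> set (map (shift k) \<theta>)" by (metis (no_types, lifting) image_iff list.set_map)
    have "operate (Suc n) \<theta> x = operate n (map (shift k) \<theta>) (d (Suc n) k x)"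
      using operate_last_missed[of k n \<theta> x] k by simp
    also have "\<dots> = operate n' (map (shift j) (map (shift k) \<theta>)) (d n j (d (Suc n) k x))"
      unfolding n' by (rule less(1)) (use n' ml jm jk k less d_in in auto)
    also have "map (shift j) (map (shift k) \<theta>) = map (shift (k - 1)) (map (shift j) \<theta>)"
      using shift_shift[OF jk] nk by auto
    also have "d n j (d (Suc n) k x) = d n (k - 1) (d (Suc n) j x)" using dd less k jk n' by simp
    also have "operate n' (map (shift (k - 1)) (map (shift j) \<theta>)) (d n (k - 1) (d (Suc n) j x)) = operate n (map (shift j) \<theta>) (d (Suc n) j x)"
      unfolding n'
    proof (rule operate_last_missed[symmetric])
      show "k - 1 \<le> Suc n'" using k n' by simp
      have "shift j v \<noteq> k - 1" if "v \<in> set \<theta>" for v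
        using nk[OF that] jk by (auto simp: shift_def)
      then show "k - 1 \<notin> set (map (shift j) \<theta>)" by (metis (no_types, lifting) image_iff list.set_map)
      fix l assume "l \<le> Suc n'" "k - 1 < l"
      then have "Suc l \<in> set \<theta>" "shift j (Suc l) = l" using k(4)[of "Suc l"] jk n' by (auto simp: shift_def)
      then show "l \<in> set (map (shift j) \<theta>)" by (metis imageI list.set_map)
    qed
    finally show ?thesis .
  qed
qed

text \<open>
  Dually, any repetition can be split off last.
\<close>

lemma operate_repeat:
  "\<theta> \<in> mono_lists (Suc m) n \<Longrightarrow> x \<in> S n \<Longrightarrow> i < Suc m \<Longrightarrow> \<theta> ! i = \<theta> ! Suc i \<Longrightarrow>
    operate n \<theta> x = s m i (operate n (delete_at (Suc i) \<theta>) x)"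
proof (induction m arbitrary: \<theta> i rule: less_induct)
  case (less m)
  have l: "length \<theta> = Suc (Suc m)" using less by (auto simp: mono_lists_def)
  then obtain k where k: "i \<le> k" "k < Suc m" "\<theta> ! k = \<theta> ! Suc k" "\<And>p. k < p \<Longrightarrow> Suc p < length \<theta> \<Longrightarrow> \<theta> ! p \<noteq> \<theta> ! Suc p"
    using last_repeat less by metis
  show ?case
  proof (cases "i = k")
    case True then show ?thesis using operate_last_repeat[of \<theta> m n k x] k less by simp
  next
    case False
    then have ik: "i < k" using k by simp
    then obtain m' where m': "m = Suc m'" using k by (cases m) auto
    have e: "delete_at (Suc k) \<theta> \<in> mono_lists m n" "delete_at (Suc i) \<theta> \<in> mono_lists m n"
      using mono_delete[OF less(2)] k ik by auto
    have eq: "delete_at (Suc i) (delete_at (Suc k) \<theta>) = delete_at k (delete_at (Suc i) \<theta>)"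
      by (rule nth_equalityI) (use ik k l m' in \<open>auto simp: length_delete_at nth_delete_at\<close>)
    have "operate n \<theta> x = s m k (operate n (delete_at (Suc k) \<theta>) x)"
      using operate_last_repeat[of \<theta> m n k x] k less by simp
    also have "operate n (delete_at (Suc k) \<theta>) x = s m' i (operate n (delete_at (Suc i) (delete_at (Suc k) \<theta>)) x)"
      by (rule less(1)) (use m' e l k ik less in \<open>auto simp: nth_delete_at\<close>)
    also have "s m k (s m' i (operate n (delete_at (Suc i) (delete_at (Suc k) \<theta>)) x)) =
       s m i (s m' (k - 1) (operate n (delete_at (Suc i) (delete_at (Suc k) \<theta>)) x))"
      using ss[of "operate n (delete_at (Suc i) (delete_at (Suc k) \<theta>)) x" m' "k - 1" i] ik k m'
        operate_in[OF mono_delete[of "delete_at (Suc k) \<theta>" m' n "Suc i"] less(3)] e by simp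
    also have "s m' (k - 1) (operate n (delete_at (Suc i) (delete_at (Suc k) \<theta>)) x) = operate n (delete_at (Suc i) \<theta>) x"
    proof -
      obtain q where q: "k = Suc q" using ik by (cases k) auto
      have "operate n (delete_at (Suc i) \<theta>) x = s m' q (operate n (delete_at (Suc q) (delete_at (Suc i) \<theta>)) x)"
      proof (rule operate_last_repeat)
        show "delete_at (Suc i) \<theta> \<in> mono_lists (Suc m') n" using e m' by simp
        show "q < Suc m'" using q k m' by simp
        have "\<theta> ! i = \<theta> ! k" if "q = i" using that q less(5) by simp
        then show "delete_at (Suc i) \<theta> ! q = delete_at (Suc i) \<theta> ! Suc q"
          using q k(2,3) ik l m' by (cases "q = i") (simp_all add: nth_delete_at)
        show "delete_at (Suc i) \<theta> ! p \<noteq> delete_at (Suc i) \<theta> ! Suc p"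
          if "q < p" "Suc p < length (delete_at (Suc i) \<theta>)" for p
        proof -
          have "i < p" "Suc p < Suc (Suc m')" using that ik q l m' k(2) by (auto simp: length_delete_at)
          then show ?thesis using that k(4)[of "Suc p"] q l m' by (simp add: nth_delete_at)
        qed
      qed
      then show ?thesis using eq q by simp
    qed
    finally show ?thesis .
  qed
qed

text \<open>
  If \<open>\<sigma>\<close> misses a vertex or repeats a value, this vertex or value is split off and the simplicial identities
  reduce the claim to smaller maps; otherwise \<open>\<sigma>\<close> is an identity.
\<close>

lemma d_operate:
  "\<sigma> \<in> mono_lists (Suc m) n \<Longrightarrow> x \<in> S n \<Longrightarrow> j \<le> Suc m \<Longrightarrow>
    d (Suc m) j (operate n \<sigma> x) = operate n (delete_at j \<sigma>) x"
proof (induction "n + m" arbitrary: n m \<sigma> x j rule: less_induct)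
  case less
  have l: "length \<sigma> = Suc (Suc m)" using less by (auto simp: mono_lists_def)
  from less(2) show ?case
  proof (cases rule: mono_lists_cases)
    case (1 v)
    then have "n \<noteq> 0" using less(2) by (cases \<sigma>) (auto simp: mono_lists_def)
    then obtain n' where n': "n = Suc n'" by (cases n) auto
    have "d (Suc m) j (operate n \<sigma> x) = d (Suc m) j (operate n' (map (shift v) \<sigma>) (d n v x))"
      using operate_missed[of \<sigma> "Suc m" n' x v] n' less 1 by simp
    also have "\<dots> = operate n' (delete_at j (map (shift v) \<sigma>)) (d n v x)"
      by (rule less(1)) (use n' less 1 mono_shift d_in in auto)
    also have "\<dots> = operate n (delete_at j \<sigma>) x"
      unfolding map_delete_at[symmetric] n' using set_delete_at[of j \<sigma>]
      by (intro operate_missed[symmetric] mono_delete) (use n' less 1 in auto)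
    finally show ?thesis .
  next
    case (2 i)
    let ?y = "operate n (delete_at (Suc i) \<sigma>) x"
    have e: "delete_at (Suc i) \<sigma> \<in> mono_lists m n" "delete_at j \<sigma> \<in> mono_lists m n" using mono_delete[OF less(2)] 2 less by auto
    have y: "?y \<in> S m" using operate_in e less by auto
    have a: "operate n \<sigma> x = s m i ?y" using operate_repeat 2 less by simp
    consider "j = i" | "j = Suc i" | "j < i" | "Suc i < j" by linarith
    then show ?thesis
    proof cases
      case 1
      have "delete_at (Suc i) \<sigma> = delete_at i \<sigma>"
        by (rule nth_equalityI) (use 1 2 l in \<open>auto simp: length_delete_at nth_delete_at\<close>, metis less_SucE)
      then show ?thesis using a y ds_same 1 2 by simp
    next
      case j: 2 then show ?thesis using a y ds_Suc 2 by simp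
    next
      case 3
      then obtain m' where m': "m = Suc m'" using 2 by (cases m) auto
      have "d (Suc m) j (operate n \<sigma> x) = s m' (i - 1) (d m j ?y)" using a ds_less y 2 3 m' by simp
      also have "d m j ?y = operate n (delete_at j (delete_at (Suc i) \<sigma>)) x" unfolding m'
        by (rule less(1)) (use m' 2 3 e less in auto)
      also have "delete_at j (delete_at (Suc i) \<sigma>) = delete_at (Suc (i - 1)) (delete_at j \<sigma>)"
        by (rule nth_equalityI) (use 3 2 l m' in \<open>auto simp: length_delete_at nth_delete_at\<close>)
      also have "s m' (i - 1) (operate n (delete_at (Suc (i - 1)) (delete_at j \<sigma>)) x) = operate n (delete_at j \<sigma>) x"
        by (rule operate_repeat[symmetric]) (use 2 3 m' e less l in \<open>auto simp: nth_delete_at\<close>)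
      finally show ?thesis .
    next
      case 4
      then obtain m' where m': "m = Suc m'" using 2 less(4) by (cases m) auto
      have "d (Suc m) j (operate n \<sigma> x) = s m' i (d m (j - 1) ?y)" using a ds_greater y 2 4 m' less(4) by simp
      also have "d m (j - 1) ?y = operate n (delete_at (j - 1) (delete_at (Suc i) \<sigma>)) x" unfolding m'
        by (rule less(1)) (use m' 2 4 e less in auto)
      also have "delete_at (j - 1) (delete_at (Suc i) \<sigma>) = delete_at (Suc i) (delete_at j \<sigma>)"
        by (rule nth_equalityI) (use 4 2 l m' less(4) in \<open>auto simp: length_delete_at nth_delete_at\<close>)
      also have "s m' i (operate n (delete_at (Suc i) (delete_at j \<sigma>)) x) = operate n (delete_at j \<sigma>) x"
        by (rule operate_repeat[symmetric]) (use 2 4 m' e less l in \<open>auto simp: nth_delete_at\<close>)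
      finally show ?thesis .
    qed
  next
    case 3
    then show ?thesis
      using operate_missed[OF delete_id(1)[OF less(4)] _ less(4) delete_id(2)[OF less(4)], of x] less(3)
        operate_id[of m "d n j x"] operate_id[of n x] delete_id(3)[OF less(4)] by (auto simp del: upt_Suc)
  qed
qed

text \<open>
  Functoriality.  Induction on \<open>\<theta>\<close>, splitting off a missed vertex or a repetition, leaves only faces and
  degeneracies to be composed with \<open>\<sigma>\<close>: these are \<open>d_operate\<close> and \<open>operate_repeat\<close>.
\<close>

lemma operate_operate:
  "\<theta> \<in> mono_lists p m \<Longrightarrow> \<sigma> \<in> mono_lists m n \<Longrightarrow> x \<in> S n \<Longrightarrow>
    operate m \<theta> (operate n \<sigma> x) = operate n (map (\<lambda>a. \<sigma> ! a) \<theta>) x"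
proof (induction "m + p" arbitrary: m p \<theta> \<sigma> rule: less_induct)
  case less
  have l: "length \<theta> = Suc p" "length \<sigma> = Suc m" using less by (auto simp: mono_lists_def)
  from less(2) show ?case
  proof (cases rule: mono_lists_cases)
    case (1 j)
    then have "m \<noteq> 0" using less(2) by (cases \<theta>) (auto simp: mono_lists_def)
    then obtain m' where m': "m = Suc m'" by (cases m) auto
    have "operate m \<theta> (operate n \<sigma> x) = operate m' (map (shift j) \<theta>) (d m j (operate n \<sigma> x))"
      using operate_missed[of \<theta> p m' "operate n \<sigma> x" j] operate_in less 1 m' by simp
    also have "d m j (operate n \<sigma> x) = operate n (delete_at j \<sigma>) x" using d_operate less 1 m' by simp
    also have "operate m' (map (shift j) \<theta>) (operate n (delete_at j \<sigma>) x) = operate n (map (\<lambda>a. delete_at j \<sigma> ! a) (map (shift j) \<theta>)) x"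
      by (rule less(1)[of m' p]) (use m' less 1 mono_shift mono_delete in auto)
    also have "map (\<lambda>a. delete_at j \<sigma> ! a) (map (shift j) \<theta>) = map (\<lambda>a. \<sigma> ! a) \<theta>"
    proof (rule nth_equalityI)
      fix i assume "i < length (map (\<lambda>a. delete_at j \<sigma> ! a) (map (shift j) \<theta>))"
      then have i: "i < length \<theta>" by simp
      then have "\<theta> ! i \<in> set \<theta>" by simp
      then have "\<theta> ! i \<le> m" "\<theta> ! i \<noteq> j" using less(2) 1 by (auto simp: mono_lists_def)
      then show "map (\<lambda>a. delete_at j \<sigma> ! a) (map (shift j) \<theta>) ! i = map (\<lambda>a. \<sigma> ! a) \<theta> ! i"
        using i l m' 1 by (auto simp: shift_def nth_delete_at)
    qed simp
    finally show ?thesis .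
  next
    case (2 i)
    then obtain p' where p': "p = Suc p'" by (cases p) auto
    have "operate m \<theta> (operate n \<sigma> x) = s p' i (operate m (delete_at (Suc i) \<theta>) (operate n \<sigma> x))"
      using operate_repeat[of \<theta> p' m "operate n \<sigma> x" i] operate_in less 2 p' by simp
    also have "operate m (delete_at (Suc i) \<theta>) (operate n \<sigma> x) = operate n (map (\<lambda>a. \<sigma> ! a) (delete_at (Suc i) \<theta>)) x"
      by (rule less(1)[of m p']) (use p' less 2 mono_delete in auto)
    also have "s p' i (operate n (map (\<lambda>a. \<sigma> ! a) (delete_at (Suc i) \<theta>)) x) = operate n (map (\<lambda>a. \<sigma> ! a) \<theta>) x"
      unfolding map_delete_at
      by (rule operate_repeat[symmetric]) (use p' less 2 l mono_comp in auto)
    finally show ?thesis .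
  next
    case 3
    then have "map (\<lambda>a. \<sigma> ! a) \<theta> = \<sigma>" using l(2) by (metis map_nth)
    then show ?thesis using 3 by (simp add: operate_id del: upt_Suc)
  qed
qed

end

section \<open>Nerve and homotopy quotient in sets\<close>

text \<open>
  The nerve is described through the coordinates \<open>co n w j\<close> of its simplices, \<open>j < n\<close>.  It is not
  defined as a set of tuples because the simplices in question are arrows into a chosen product.
\<close>

locale nerve_points = simplicial_group G d s m e v
  for G :: "nat \<Rightarrow> 'a set" and d s m e v +
  fixes N :: "nat \<Rightarrow> 'a set" and co :: "nat \<Rightarrow> 'a \<Rightarrow> nat \<Rightarrow> 'a" and dN sN :: "nat \<Rightarrow> nat \<Rightarrow> 'a \<Rightarrow> 'a"
  assumes co_in: "w \<in> N n \<Longrightarrow> j < n \<Longrightarrow> co n w j \<in> G j"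
    and co_eqI: "w \<in> N n \<Longrightarrow> w' \<in> N n \<Longrightarrow> (\<And>j. j < n \<Longrightarrow> co n w j = co n w' j) \<Longrightarrow> w = w'"
    and co_ex: "(\<And>j. j < n \<Longrightarrow> g j \<in> G j) \<Longrightarrow> \<exists>w\<in>N n. \<forall>j<n. co n w j = g j"
    and dN_in: "w \<in> N (Suc n) \<Longrightarrow> i \<le> Suc n \<Longrightarrow> dN (Suc n) i w \<in> N n"
    and sN_in: "w \<in> N n \<Longrightarrow> i \<le> n \<Longrightarrow> sN n i w \<in> N (Suc n)"
    and co_dN: "w \<in> N (Suc n) \<Longrightarrow> i \<le> Suc n \<Longrightarrow> j < n \<Longrightarrow> co n (dN (Suc n) i w) j =
       (if Suc j < i then co (Suc n) w j
        else if Suc j = i then m j (co (Suc n) w j) (d (Suc j) i (co (Suc n) w (Suc j)))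
        else d (Suc j) i (co (Suc n) w (Suc j)))"
    and co_sN: "w \<in> N n \<Longrightarrow> i \<le> n \<Longrightarrow> j < Suc n \<Longrightarrow> co (Suc n) (sN n i w) j =
       (if j < i then co n w j else if j = i then e i else s (j - 1) i (co n w (j - 1)))"
begin

lemma dN_dN:
  assumes w: "w \<in> N (Suc (Suc n))" and ij: "j \<le> Suc (Suc n)" "i < j"
  shows "dN (Suc n) i (dN (Suc (Suc n)) j w) = dN (Suc n) (j - 1) (dN (Suc (Suc n)) i w)"
proof (rule co_eqI)
  fix l assume l: "l < n"
  then have g: "co (Suc (Suc n)) w l \<in> G l" "co (Suc (Suc n)) w (Suc l) \<in> G (Suc l)"
    "co (Suc (Suc n)) w (Suc (Suc l)) \<in> G (Suc (Suc l))" using w co_in by auto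
  have *: "d (Suc l) i (d (Suc (Suc l)) j (co (Suc (Suc n)) w (Suc (Suc l)))) =
     d (Suc l) (j - 1) (d (Suc (Suc l)) i (co (Suc (Suc n)) w (Suc (Suc l))))" if "j \<le> Suc (Suc l)"
    using dd[OF g(3) that] ij by auto
  consider "Suc (Suc l) < j" | "Suc (Suc l) = j" | "j \<le> Suc l" by linarith
  then show "co n (dN (Suc n) i (dN (Suc (Suc n)) j w)) l = co n (dN (Suc n) (j - 1) (dN (Suc (Suc n)) i w)) l"
    using l w ij g *
    by cases (auto simp: co_dN dN_in d_m d_in m_assoc)
qed (use w ij in \<open>auto intro!: dN_in\<close>)

lemma sN_sN:
  assumes w: "w \<in> N n" and ij: "j \<le> n" "i \<le> j"
  shows "sN (Suc n) i (sN n j w) = sN (Suc n) (Suc j) (sN n i w)"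
proof (rule co_eqI)
  fix l assume l: "l < Suc (Suc n)"
  have g: "k < n \<Longrightarrow> co n w k \<in> G k" for k using w co_in by auto
  show "co (Suc (Suc n)) (sN (Suc n) i (sN n j w)) l = co (Suc (Suc n)) (sN (Suc n) (Suc j) (sN n i w)) l"
  proof (cases "l \<le> Suc j")
    case True then show ?thesis
      using l w ij co_sN[of "sN n i w" "Suc n" "Suc j" l] co_sN[of "sN n j w" "Suc n" i l] sN_in[OF w, of i]
        sN_in[OF w, of j] co_sN[OF w, of i l] co_sN[OF w, of j l] co_sN[OF w, of j "l - 1"] s_e[of i j]
      by (cases "l = Suc j") auto
  next
    case False
    then obtain k where k: "l = Suc (Suc k)" "j \<le> k" by (metis Suc_le_D not_less_eq_eq Suc_le_mono)
    then show ?thesis using l w ij order_trans[OF ij(2,1)] ss[OF g[of k], of j i] by (auto simp: co_sN sN_in)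
  qed
qed (use w ij in \<open>auto intro!: sN_in\<close>)

lemma dN_sN_less:
  assumes w: "w \<in> N (Suc n)" and ij: "j \<le> Suc n" "i < j"
  shows "dN (Suc (Suc n)) i (sN (Suc n) j w) = sN n (j - 1) (dN (Suc n) i w)"
proof (rule co_eqI)
  fix l assume l: "l < Suc n"
  then have g: "k < Suc n \<Longrightarrow> co (Suc n) w k \<in> G k" for k using w co_in by auto
  consider "Suc l < j" | "Suc l = j" | k where "l = Suc k" "j \<le> l"
    by (metis Suc_lessI not_less_eq Suc_pred gr0I less_nat_zero_code ij(2) linorder_not_less le_zero_eq)
  then show "co (Suc n) (dN (Suc (Suc n)) i (sN (Suc n) j w)) l = co (Suc n) (sN n (j - 1) (dN (Suc n) i w)) l"
  proof cases
    case 1 then show ?thesis using l w ij g by (auto simp: co_sN sN_in co_dN dN_in)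
  next
    case 2 then show ?thesis using l w ij g by (auto simp: co_sN sN_in co_dN dN_in d_e m_e_right)
  next
    case 3 then show ?thesis using l w ij g g[of "Suc k"] ds_less[of "co (Suc n) w (Suc k)" k j i] by (auto simp: co_sN sN_in co_dN dN_in)
  qed
qed (use w ij in \<open>auto intro!: dN_in sN_in\<close>)

lemma dN_sN_same:
  assumes w: "w \<in> N n" and ij: "j \<le> n"
  shows "dN (Suc n) j (sN n j w) = w"
proof (rule co_eqI)
  fix l assume l: "l < n"
  then have g: "co n w l \<in> G l" using w co_in by auto
  show "co n (dN (Suc n) j (sN n j w)) l = co n w l"
    using l w ij g ds_same[OF g] by (auto simp: co_sN sN_in co_dN dN_in d_e m_e_right)
qed (use w ij in \<open>auto intro!: dN_in sN_in\<close>)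

lemma dN_sN_Suc:
  assumes w: "w \<in> N n" and ij: "j \<le> n"
  shows "dN (Suc n) (Suc j) (sN n j w) = w"
proof (rule co_eqI)
  fix l assume l: "l < n"
  then have g: "co n w l \<in> G l" using w co_in by auto
  show "co n (dN (Suc n) (Suc j) (sN n j w)) l = co n w l"
    using l w ij g ds_Suc[OF g] by (auto simp: co_sN sN_in co_dN dN_in d_e m_e_left)
qed (use w ij in \<open>auto intro!: dN_in sN_in\<close>)

lemma dN_sN_greater:
  assumes w: "w \<in> N (Suc n)" and ij: "i \<le> Suc (Suc n)" "Suc j < i"
  shows "dN (Suc (Suc n)) i (sN (Suc n) j w) = sN n j (dN (Suc n) (i - 1) w)"
proof (rule co_eqI)
  fix l assume l: "l < Suc n"
  then have g: "k < Suc n \<Longrightarrow> co (Suc n) w k \<in> G k" for k using w co_in by auto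
  show "co (Suc n) (dN (Suc (Suc n)) i (sN (Suc n) j w)) l = co (Suc n) (sN n j (dN (Suc n) (i - 1) w)) l"
  proof (cases l)
    case 0 then show ?thesis using l w ij g by (auto simp: co_sN sN_in co_dN dN_in)
  next
    case (Suc k)
    obtain i' where i': "i = Suc i'" using ij by (cases i) auto
    from Suc show ?thesis using l w ij i' g[of k] g[of l] g[of "Suc k"] ds_greater[of "co (Suc n) w (Suc k)" k i j]
      by (auto simp: co_sN sN_in co_dN dN_in s_m d_in)
  qed
qed (use w ij in \<open>auto intro!: dN_in sN_in\<close>)

lemma simplicial_set_nerve: "simplicial_set N dN sN"
  by unfold_locales (use dN_in sN_in dN_dN sN_sN dN_sN_less dN_sN_same dN_sN_Suc dN_sN_greater in auto)

sublocale nerve: simplicial_set N dN sN by (rule simplicial_set_nerve)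

end

locale action_points = nerve_points G d s m e v N co dN sN + X: simplicial_set X dX sX
  for G :: "nat \<Rightarrow> 'a set" and d s m e v N co dN sN and X :: "nat \<Rightarrow> 'a set" and dX sX +
  fixes act :: "nat \<Rightarrow> 'a \<Rightarrow> 'a \<Rightarrow> 'a"
  assumes act_in: "g \<in> G n \<Longrightarrow> x \<in> X n \<Longrightarrow> act n g x \<in> X n"
    and act_e: "x \<in> X n \<Longrightarrow> act n (e n) x = x"
    and act_m: "g \<in> G n \<Longrightarrow> h \<in> G n \<Longrightarrow> x \<in> X n \<Longrightarrow> act n (m n g h) x = act n g (act n h x)"
    and d_act: "g \<in> G (Suc n) \<Longrightarrow> x \<in> X (Suc n) \<Longrightarrow> i \<le> Suc n \<Longrightarrow>
       dX (Suc n) i (act (Suc n) g x) = act n (d (Suc n) i g) (dX (Suc n) i x)"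
    and s_act: "g \<in> G n \<Longrightarrow> x \<in> X n \<Longrightarrow> i \<le> n \<Longrightarrow>
       sX n i (act n g x) = act (Suc n) (s n i g) (sX n i x)"
begin

lemma act_cancel: "g \<in> G n \<Longrightarrow> x \<in> X n \<Longrightarrow> y \<in> X n \<Longrightarrow> act n g x = act n g y \<longleftrightarrow> x = y"
  by (metis act_e act_m m_v_left v_in)

lemma act_surj: "g \<in> G n \<Longrightarrow> x \<in> X n \<Longrightarrow> \<exists>y\<in>X n. act n g y = x"
  by (metis act_e act_m m_v_right v_in act_in)

end

locale quotient_points = action_points G d s m e v N co dN sN X dX sX act
  for G :: "nat \<Rightarrow> 'a set" and d s m e v N co dN sN and X :: "nat \<Rightarrow> 'a set" and dX sX act +
  fixes Q :: "nat \<Rightarrow> 'a set" and pw px :: "nat \<Rightarrow> 'a \<Rightarrow> 'a" and dQ sQ :: "nat \<Rightarrow> nat \<Rightarrow> 'a \<Rightarrow> 'a"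
  assumes pw_in: "q \<in> Q n \<Longrightarrow> pw n q \<in> N n"
    and px_in: "q \<in> Q n \<Longrightarrow> px n q \<in> X n"
    and Q_eqI: "q \<in> Q n \<Longrightarrow> q' \<in> Q n \<Longrightarrow> pw n q = pw n q' \<Longrightarrow> px n q = px n q' \<Longrightarrow> q = q'"
    and Q_ex: "w \<in> N n \<Longrightarrow> x \<in> X n \<Longrightarrow> \<exists>q\<in>Q n. pw n q = w \<and> px n q = x"
    and dQ_in: "q \<in> Q (Suc n) \<Longrightarrow> i \<le> Suc n \<Longrightarrow> dQ (Suc n) i q \<in> Q n"
    and sQ_in: "q \<in> Q n \<Longrightarrow> i \<le> n \<Longrightarrow> sQ n i q \<in> Q (Suc n)"
    and pw_dQ: "q \<in> Q (Suc n) \<Longrightarrow> i \<le> Suc n \<Longrightarrow> pw n (dQ (Suc n) i q) = dN (Suc n) i (pw (Suc n) q)"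
    and px_dQ: "q \<in> Q (Suc n) \<Longrightarrow> i \<le> Suc n \<Longrightarrow> px n (dQ (Suc n) i q) =
       (if i = Suc n then act n (co (Suc n) (pw (Suc n) q) n) (dX (Suc n) i (px (Suc n) q))
        else dX (Suc n) i (px (Suc n) q))"
    and pw_sQ: "q \<in> Q n \<Longrightarrow> i \<le> n \<Longrightarrow> pw (Suc n) (sQ n i q) = sN n i (pw n q)"
    and px_sQ: "q \<in> Q n \<Longrightarrow> i \<le> n \<Longrightarrow> px (Suc n) (sQ n i q) = sX n i (px n q)"
begin

text \<open>
  If face \<open>b\<close> is the last one, then the factor by which it is twisted has become, in its face \<open>a\<close>, the
  factor that also occurs in the other composite, by the simplicial identities of the nerve.
  It cancels from the equation.
\<close>

lemma twist_pair:
  assumes w: "w \<in> N (Suc (Suc n))" and ab: "a < b" "b \<le> Suc (Suc n)"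
    and x: "xa \<in> X (Suc n)" "xb \<in> X (Suc n)"
    and za: "za \<in> Q (Suc n)" "pw (Suc n) za = dN (Suc (Suc n)) a w" "px (Suc n) za = xa"
    and zb: "zb \<in> Q (Suc n)" "pw (Suc n) zb = dN (Suc (Suc n)) b w"
      "px (Suc n) zb = (if b = Suc (Suc n) then act (Suc n) (co (Suc (Suc n)) w (Suc n)) xb else xb)"
  shows "dQ (Suc n) a zb = dQ (Suc n) (b - 1) za \<longleftrightarrow> dX (Suc n) a xb = dX (Suc n) (b - 1) xa"
proof -
  have g: "co (Suc (Suc n)) w (Suc n) \<in> G (Suc n)" "co (Suc (Suc n)) w n \<in> G n" using w co_in by auto
  have pw: "pw n (dQ (Suc n) a zb) = pw n (dQ (Suc n) (b - 1) za)"
    using pw_dQ[of zb n a] pw_dQ[of za n "b-1"] ab za zb dN_dN[OF w, of b a] by auto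
  have iff: "dQ (Suc n) a zb = dQ (Suc n) (b - 1) za \<longleftrightarrow> px n (dQ (Suc n) a zb) = px n (dQ (Suc n) (b - 1) za)"
    using pw Q_eqI[of "dQ (Suc n) a zb" n "dQ (Suc n) (b - 1) za"] dQ_in za(1) zb(1) ab by auto
  have "px n (dQ (Suc n) a zb) = px n (dQ (Suc n) (b - 1) za) \<longleftrightarrow> dX (Suc n) a xb = dX (Suc n) (b - 1) xa"
  proof (cases "b = Suc (Suc n)")
    case False
    then show ?thesis using px_dQ[of zb n a] px_dQ[of za n "b-1"] ab za zb by auto
  next
    case b: True
    show ?thesis
    proof (cases "a = Suc n")
      case True
      have "px n (dQ (Suc n) a zb) = act n (co (Suc (Suc n)) w n) (act n (d (Suc n) (Suc n) (co (Suc (Suc n)) w (Suc n))) (dX (Suc n) a xb))"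
        using px_dQ[of zb n a] b True zb w x g by (simp add: co_dN d_act)
      moreover have "px n (dQ (Suc n) (b - 1) za) = act n (co (Suc (Suc n)) w n) (act n (d (Suc n) (Suc n) (co (Suc (Suc n)) w (Suc n))) (dX (Suc n) (b-1) xa))"
        using px_dQ[of za n "b-1"] b True za w x g by (simp add: co_dN act_m d_in X.d_in)
      ultimately show ?thesis using g x b True by (simp add: act_cancel act_in d_in X.d_in)
    next
      case False
      then have "px n (dQ (Suc n) a zb) = act n (d (Suc n) a (co (Suc (Suc n)) w (Suc n))) (dX (Suc n) a xb)"
        using px_dQ[of zb n a] b ab zb w x g by (simp add: co_dN d_act)
      moreover have "px n (dQ (Suc n) (b - 1) za) = act n (d (Suc n) a (co (Suc (Suc n)) w (Suc n))) (dX (Suc n) (b-1) xa)"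
        using px_dQ[of za n "b-1"] b False ab za w x g by (simp add: co_dN)
      ultimately show ?thesis using g x b ab by (simp add: act_cancel d_in X.d_in)
    qed
  qed
  then show ?thesis using iff by simp
qed

lemma matching_twist:
  assumes w: "w \<in> N (Suc n)" and J: "J \<subset> {..Suc n}"
    and x: "\<And>j. j \<in> J \<Longrightarrow> x j \<in> X n"
    and z: "\<And>j. j \<in> J \<Longrightarrow> z j \<in> Q n" "\<And>j. j \<in> J \<Longrightarrow> pw n (z j) = dN (Suc n) j w"
      "\<And>j. j \<in> J \<Longrightarrow> px n (z j) = (if j = Suc n then act n (co (Suc n) w n) (x j) else x j)"
  shows "matching Q dQ (Suc n) J z \<longleftrightarrow> matching X dX (Suc n) J x"
proof -
  have "dQ n a (z b) = dQ n (b - 1) (z a) \<longleftrightarrow> dX n a (x b) = dX n (b - 1) (x a)"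
    if ab: "a \<in> J" "b \<in> J" "a < b" for a b
  proof -
    have "b \<le> Suc n" "a \<le> Suc n" using J ab by auto
    moreover obtain i where "i \<le> Suc n" "i \<noteq> a" "i \<noteq> b" using J ab by (metis psubset_imp_ex_mem DiffD1 DiffD2 atMost_iff)
    ultimately obtain k where k: "n = Suc k" using ab(3) by (cases n) (auto simp: le_Suc_eq)
    show ?thesis unfolding k
      by (rule twist_pair[of w]) (use ab k w x z \<open>b \<le> Suc n\<close> in auto)
  qed
  then show ?thesis using x z by (auto simp: matching_def)
qed

lemma simplicial_set_quotient: "simplicial_set Q dQ sQ"
proof
  fix x n j i assume x: "x \<in> Q (Suc (Suc n))" and ij: "j \<le> Suc (Suc n)" "i < j"
  show "dQ (Suc n) i (dQ (Suc (Suc n)) j x) = dQ (Suc n) (j - 1) (dQ (Suc (Suc n)) i x)"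
    using X.dd[of "px (Suc (Suc n)) x" n j i]
    by (subst twist_pair[of "pw (Suc (Suc n)) x" n i j "dX (Suc (Suc n)) i (px (Suc (Suc n)) x)" "dX (Suc (Suc n)) j (px (Suc (Suc n)) x)"])
      (use x ij pw_in px_in in \<open>auto simp: dQ_in pw_dQ px_dQ X.d_in\<close>)
next
  fix x n j i assume x: "x \<in> Q n" and ij: "j \<le> n" "i \<le> j"
  show "sQ (Suc n) i (sQ n j x) = sQ (Suc n) (Suc j) (sQ n i x)"
    by (rule Q_eqI[where n="Suc (Suc n)"]) (use x ij in \<open>auto simp: sQ_in pw_sQ px_sQ pw_in px_in sN_sN X.ss\<close>)
next
  fix x n j i assume x: "x \<in> Q (Suc n)" and ij: "j \<le> Suc n" "i < j"
  show "dQ (Suc (Suc n)) i (sQ (Suc n) j x) = sQ n (j - 1) (dQ (Suc n) i x)"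
    by (rule Q_eqI[where n="Suc n"]) (use x ij in \<open>auto simp: sQ_in dQ_in pw_sQ px_sQ pw_in px_in pw_dQ px_dQ dN_sN_less X.ds_less\<close>)
next
  fix x n j assume x: "x \<in> Q n" and ij: "j \<le> n"
  show "dQ (Suc n) j (sQ n j x) = x"
    by (rule Q_eqI[where n="n"]) (use x ij in \<open>auto simp: sQ_in dQ_in pw_sQ px_sQ pw_in px_in pw_dQ px_dQ dN_sN_same X.ds_same\<close>)
  show "dQ (Suc n) (Suc j) (sQ n j x) = x"
    by (rule Q_eqI[where n="n"]) (use x ij in \<open>auto simp: sQ_in dQ_in pw_sQ px_sQ pw_in px_in pw_dQ px_dQ dN_sN_Suc X.ds_Suc co_sN act_e\<close>)
next
  fix x n j i assume x: "x \<in> Q (Suc n)" and ij: "i \<le> Suc (Suc n)" "Suc j < i"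
  show "dQ (Suc (Suc n)) i (sQ (Suc n) j x) = sQ n j (dQ (Suc n) (i - 1) x)"
    by (rule Q_eqI[where n="Suc n"]) (use x ij co_in[OF pw_in[OF x]] in \<open>auto simp: sQ_in dQ_in pw_sQ px_sQ pw_in px_in pw_dQ px_dQ dN_sN_greater X.ds_greater co_sN s_act X.d_in\<close>)
qed (auto simp: dQ_in sQ_in)

text \<open>
  The faces \<open>z\<close> of a horn of the quotient over the simplex \<open>w\<close> of the nerve, in terms of simplices
  \<open>x\<close> of \<open>X\<close>.  Only the last face map multiplies by a group element, so only the last face
  is twisted.
\<close>

definition twisted :: "nat \<Rightarrow> nat set \<Rightarrow> 'a \<Rightarrow> (nat \<Rightarrow> 'a) \<Rightarrow> (nat \<Rightarrow> 'a) \<Rightarrow> bool" where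
  "twisted n J w x z \<longleftrightarrow> w \<in> N (Suc n) \<and> (\<forall>j\<in>J. x j \<in> X n \<and> z j \<in> Q n \<and>
     pw n (z j) = dN (Suc n) j w \<and>
     px n (z j) = (if j = Suc n then act n (co (Suc n) w n) (x j) else x j))"

lemma matching_twisted:
  "J \<subset> {..Suc n} \<Longrightarrow> twisted n J w x z \<Longrightarrow> matching Q dQ (Suc n) J z \<longleftrightarrow> matching X dX (Suc n) J x"
  by (rule matching_twist) (auto simp: twisted_def)

lemma twist_ex:
  assumes J: "J \<subseteq> {..Suc n}" and w: "w \<in> N (Suc n)" and x: "\<And>j. j \<in> J \<Longrightarrow> x j \<in> X n"
  shows "\<exists>z. twisted n J w x z"
proof -
  have "\<forall>j\<in>J. \<exists>q. q \<in> Q n \<and> pw n q = dN (Suc n) j w \<and>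
      px n q = (if j = Suc n then act n (co (Suc n) w n) (x j) else x j)"
  proof
    fix j assume "j \<in> J"
    then have "dN (Suc n) j w \<in> N n" "(if j = Suc n then act n (co (Suc n) w n) (x j) else x j) \<in> X n"
      using J w x co_in[OF w, of n] by (auto intro!: dN_in act_in)
    from Q_ex[OF this] show "\<exists>q. q \<in> Q n \<and> pw n q = dN (Suc n) j w \<and>
      px n q = (if j = Suc n then act n (co (Suc n) w n) (x j) else x j)" by blast
  qed
  then obtain z where "\<forall>j\<in>J. z j \<in> Q n \<and> pw n (z j) = dN (Suc n) j w \<and>
      px n (z j) = (if j = Suc n then act n (co (Suc n) w n) (x j) else x j)" by metis
  then show ?thesis using w x by (auto simp: twisted_def)
qed

lemma untwist_ex:
  assumes w: "w \<in> N (Suc n)" and z: "\<And>j. j \<in> J \<Longrightarrow> z j \<in> Q n" "\<And>j. j \<in> J \<Longrightarrow> pw n (z j) = dN (Suc n) j w"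
  shows "\<exists>x. twisted n J w x z"
proof -
  have "\<forall>j\<in>J. \<exists>y\<in>X n. px n (z j) = (if j = Suc n then act n (co (Suc n) w n) y else y)"
  proof
    fix j assume "j \<in> J"
    from px_in[OF z(1)[OF this]] show "\<exists>y\<in>X n. px n (z j) = (if j = Suc n then act n (co (Suc n) w n) y else y)"
      using act_surj[OF co_in[OF w lessI]] by (cases "j = Suc n") (simp_all, metis)
  qed
  then obtain x where "\<forall>j\<in>J. x j \<in> X n \<and> px n (z j) = (if j = Suc n then act n (co (Suc n) w n) (x j) else x j)"
    by metis
  then show ?thesis using w z by (auto simp: twisted_def)
qed

lemma twisted_eq_iff:
  "twisted n J w x z \<Longrightarrow> twisted n J w x' z' \<Longrightarrow> (\<forall>j\<in>J. x j = x' j) \<longleftrightarrow> (\<forall>j\<in>J. z j = z' j)"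
proof -
  assume t: "twisted n J w x z" "twisted n J w x' z'"
  have "x j = x' j \<longleftrightarrow> z j = z' j" if j: "j \<in> J" for j
  proof -
    have "z j = z' j \<longleftrightarrow> px n (z j) = px n (z' j)"
      using t j Q_eqI[of "z j" n "z' j"] by (auto simp: twisted_def)
    then show ?thesis using t j act_cancel[OF co_in[of w "Suc n" n], of "x j" "x' j"]
      by (auto simp: twisted_def split: if_splits)
  qed
  then show ?thesis by blast
qed

lemma twisted_faces:
  "q \<in> Q (Suc n) \<Longrightarrow> J \<subseteq> {..Suc n} \<Longrightarrow>
   twisted n J (pw (Suc n) q) (\<lambda>j. dX (Suc n) j (px (Suc n) q)) (\<lambda>j. dQ (Suc n) j q)"
  by (auto simp: twisted_def pw_in px_in X.d_in dQ_in pw_dQ px_dQ)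

end

context nerve_points begin

text \<open>
  Apart from the last face map, the \<open>(n+1)\<close>-simplices of the nerve are the \<open>n\<close>-simplices of the homotopy
  quotient of \<open>G\<close> acting on itself by translation; the last face map becomes the projection to the nerve.
\<close>

lemma decalage: "quotient_points G d s m e v N co dN sN G d s m (\<lambda>n. N (Suc n))
   (\<lambda>n. dN (Suc n) (Suc n)) (\<lambda>n w. co (Suc n) w n) (\<lambda>n. dN (Suc n)) (\<lambda>n. sN (Suc n))"
proof
  fix q n q' assume q: "q \<in> N (Suc n)" "q' \<in> N (Suc n)" "dN (Suc n) (Suc n) q = dN (Suc n) (Suc n) q'"
    "co (Suc n) q n = co (Suc n) q' n"
  show "q = q'"
  proof (rule co_eqI[OF q(1,2)])
    fix j assume "j < Suc n"
    then show "co (Suc n) q j = co (Suc n) q' j"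
      using q(4) co_dN[OF q(1), of "Suc n" j] co_dN[OF q(2), of "Suc n" j] q(3) by (cases "j = n") auto
  qed
next
  fix w n x assume w: "w \<in> N n" "x \<in> G n"
  have "\<exists>q\<in>N (Suc n). \<forall>j<Suc n. co (Suc n) q j = (if j < n then co n w j else x)"
    by (rule co_ex) (use w co_in in \<open>auto simp: less_Suc_eq\<close>)
  then obtain q where q: "q \<in> N (Suc n)" "\<forall>j<Suc n. co (Suc n) q j = (if j < n then co n w j else x)" by blast
  moreover have "dN (Suc n) (Suc n) q = w" by (rule co_eqI) (use q w in \<open>auto simp: dN_in co_dN\<close>)
  ultimately show "\<exists>q\<in>N (Suc n). dN (Suc n) (Suc n) q = w \<and> co (Suc n) q n = x" by auto
qed (auto simp: dN_in sN_in m_in m_e_left m_assoc d_m s_m co_in co_dN co_sN dN_dN[symmetric] dN_sN_greater dN_dN)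

sublocale dec: quotient_points G d s m e v N co dN sN G d s m "\<lambda>n. N (Suc n)"
   "\<lambda>n. dN (Suc n) (Suc n)" "\<lambda>n w. co (Suc n) w n" "\<lambda>n. dN (Suc n)" "\<lambda>n. sN (Suc n)"
  by (rule decalage)


text \<open>
  A family of faces of the nerve that contains the last face is a family of faces of the quotient of \<open>G\<close>
  by itself which lies over that last face.
\<close>

lemma matching_last_present:
  assumes J: "Suc (Suc p) \<notin> J" "J \<subset> {..Suc p}"
  shows "matching N dN (Suc (Suc p)) (insert (Suc (Suc p)) J) z \<longleftrightarrow>
    z (Suc (Suc p)) \<in> N (Suc p) \<and>
    (\<forall>j\<in>J. dN (Suc p) (Suc p) (z j) = dN (Suc p) j (z (Suc (Suc p)))) \<and>
    matching (\<lambda>n. N (Suc n)) (\<lambda>n. dN (Suc n)) (Suc p) J z"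
proof -
  have "j < Suc (Suc p)" if "j \<in> J" for j using J that by auto
  then show ?thesis by (fastforce simp: matching_def)
qed

text \<open>
  Describes the families of all faces but the last.  The penultimate face, number \<open>p + 1\<close>, takes over the
  part of the last one: it is an arbitrary simplex \<open>w\<close>, and every other face is determined
  by its own face \<open>p\<close>, which is a face of \<open>w\<close>, and by its last coordinate.
\<close>

definition last_missing :: "nat \<Rightarrow> 'a \<Rightarrow> (nat \<Rightarrow> 'a) \<Rightarrow> (nat \<Rightarrow> 'a) \<Rightarrow> bool" where
  "last_missing p w h z \<longleftrightarrow> w \<in> N (Suc p) \<and> z (Suc p) = w \<and> matching G d (Suc p) {..p} h \<and>
     (\<forall>j\<le>p. z j \<in> N (Suc p) \<and> dN (Suc p) p (z j) = dN (Suc p) j w \<and> co (Suc p) (z j) p = h j)"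

text \<open>
  The penultimate face keeps all coordinates but the last two, and multiplies these two after applying
  a face map to the last one; given the last one, the other can be recovered.
\<close>

lemma eq_by_dN_penultimate:
  assumes z: "z \<in> N (Suc p)" "z' \<in> N (Suc p)" and eq: "dN (Suc p) p z = dN (Suc p) p z'"
    "co (Suc p) z p = co (Suc p) z' p"
  shows "z = z'"
proof (rule co_eqI[OF z])
  fix j assume j: "j < Suc p"
  have "co p (dN (Suc p) p z) j = co p (dN (Suc p) p z') j" using eq by simp
  moreover have "d (Suc j) (Suc j) (co (Suc p) z (Suc j)) \<in> G j" if "p = Suc j"
    using that co_in[OF z(1), of p] by (auto intro: d_in)
  ultimately show "co (Suc p) z j = co (Suc p) z' j"
    using j z eq(2) co_in[OF z(1), of j] co_in[OF z(2), of j]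
    by (cases "j = p"; cases "Suc j = p") (auto simp: co_dN m_right_cancel split: if_splits)
qed

lemma ex_dN_penultimate:
  assumes u: "u \<in> N p" and h: "h \<in> G p"
  shows "\<exists>z\<in>N (Suc p). dN (Suc p) p z = u \<and> co (Suc p) z p = h"
proof -
  have dh: "d (Suc j) (Suc j) h \<in> G j" if "p = Suc j" for j using that h by (auto intro: d_in)
  (* The coordinate before the last one undoes the multiplication in the penultimate face. *)
  have "\<exists>z\<in>N (Suc p). \<forall>j<Suc p. co (Suc p) z j =
     (if j = p then h else if Suc j = p then m j (co p u j) (v j (d p p h)) else co p u j)"
    by (rule co_ex) (use u h dh co_in in \<open>auto simp: less_Suc_eq intro!: m_in v_in\<close>)
  then obtain z where z: "z \<in> N (Suc p)" "\<And>j. j < Suc p \<Longrightarrow> co (Suc p) z j =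
     (if j = p then h else if Suc j = p then m j (co p u j) (v j (d p p h)) else co p u j)" by blast
  have "dN (Suc p) p z = u"
  proof (rule co_eqI)
    fix j assume "j < p"
    then show "co p (dN (Suc p) p z) j = co p u j"
      using z u dh[of j] co_in[OF u, of j] by (cases "Suc j = p") (auto simp: co_dN m_v_cancel_right)
  qed (use z u in \<open>auto intro!: dN_in\<close>)
  then show ?thesis using z by auto
qed

lemma last_missing_ex:
  assumes w: "w \<in> N (Suc p)" and h: "matching G d (Suc p) {..p} h"
  shows "\<exists>z. last_missing p w h z"
proof -
  have "\<forall>j\<in>{..p}. \<exists>z\<in>N (Suc p). dN (Suc p) p z = dN (Suc p) j w \<and> co (Suc p) z p = h j"
    by (intro ballI ex_dN_penultimate) (use w h in \<open>auto simp: matching_def intro!: dN_in\<close>)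
  then obtain z where z: "\<And>j. j \<le> p \<Longrightarrow> z j \<in> N (Suc p) \<and> dN (Suc p) p (z j) = dN (Suc p) j w \<and> co (Suc p) (z j) p = h j"
    by (metis atMost_iff)
  then have "last_missing p w h (z(Suc p := w))" using w h by (auto simp: last_missing_def)
  then show ?thesis by blast
qed

text \<open>
  Two faces of \<open>z\<close> are compared by \<open>eq_by_dN_penultimate\<close>: their last coordinates agree by the
  condition on \<open>h\<close>, their penultimate faces because both are faces of \<open>w\<close>.
\<close>

lemma last_missing_matching:
  assumes "last_missing p w h z" shows "matching N dN (Suc (Suc p)) {..Suc p} z"
proof -
  have w: "w \<in> N (Suc p)" "z (Suc p) = w" and h: "matching G d (Suc p) {..p} h"
    and z: "\<And>j. j \<le> p \<Longrightarrow> z j \<in> N (Suc p)" "\<And>j. j \<le> p \<Longrightarrow> dN (Suc p) p (z j) = dN (Suc p) j w"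
      "\<And>j. j \<le> p \<Longrightarrow> co (Suc p) (z j) p = h j"
    using assms by (auto simp: last_missing_def)
  have "dN (Suc p) a (z b) = dN (Suc p) (b - 1) (z a)" if ab: "a < b" "b \<le> p" for a b
  proof -
    obtain q where q: "p = Suc q" using ab by (cases p) auto
    have hc: "d p a (h b) = d p (b - 1) (h a)" using h ab by (auto simp: matching_def)
    show ?thesis
    proof (rule eq_by_dN_penultimate[of _ q, folded q])
      show "dN p q (dN (Suc p) a (z b)) = dN p q (dN (Suc p) (b - 1) (z a))"
        using ab q z(1,2)[of a] z(1,2)[of b] dN_dN[of "z b" q p a] dN_dN[of "z a" q p "b-1"] dN_dN[OF w(1)[unfolded q], of b a]
        by auto
      show "co p (dN (Suc p) a (z b)) q = co p (dN (Suc p) (b - 1) (z a)) q"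
        using ab q z(1,3)[of a] z(1,3)[of b] hc by (auto simp: co_dN)
    qed (use z ab q in \<open>auto intro!: dN_in\<close>)
  qed
  then show ?thesis using w z by (auto simp: matching_def le_Suc_eq)
qed

lemma matching_last_missing:
  assumes z: "matching N dN (Suc (Suc p)) {..Suc p} z"
  shows "last_missing p (z (Suc p)) (\<lambda>j. co (Suc p) (z j) p) z"
proof -
  have zin: "z j \<in> N (Suc p)" if "j \<le> Suc p" for j using z that by (auto simp: matching_def)
  have zc: "dN (Suc p) a (z b) = dN (Suc p) (b - 1) (z a)" if "a < b" "b \<le> Suc p" for a b
    using z that by (auto simp: matching_def)
  have "d p a (co (Suc p) (z b) p) = d p (b - 1) (co (Suc p) (z a) p)" if ab: "a < b" "b \<le> p" for a b
  proof -
    obtain q where q: "p = Suc q" using ab by (cases p) auto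
    have "co p (dN (Suc p) a (z b)) q = co p (dN (Suc p) (b - 1) (z a)) q" using zc ab by auto
    then show ?thesis using ab q zin by (auto simp: co_dN split: if_splits)
  qed
  then show ?thesis using zin zc[of _ "Suc p"] co_in by (auto simp: last_missing_def matching_def)
qed

lemma last_missing_eq_iff:
  "last_missing p w h z \<Longrightarrow> last_missing p w' h' z' \<Longrightarrow>
    (w = w' \<and> (\<forall>j\<le>p. h j = h' j)) \<longleftrightarrow> (\<forall>j\<le>Suc p. z j = z' j)"
proof -
  assume i: "last_missing p w h z" "last_missing p w' h' z'"
  then have "z j = z' j \<longleftrightarrow> h j = h' j" if "j \<le> p" "w = w'" for j
    using that eq_by_dN_penultimate[of "z j" p "z' j"] by (auto simp: last_missing_def)
  then show ?thesis using i by (auto simp: last_missing_def le_Suc_eq)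
qed

lemma last_missing_faces:
  assumes z: "z \<in> N (Suc (Suc p))"
  shows "last_missing p (dN (Suc (Suc p)) (Suc p) z) (\<lambda>j. d (Suc p) j (co (Suc (Suc p)) z (Suc p)))
     (\<lambda>j. dN (Suc (Suc p)) j z)"
proof -
  have "matching N dN (Suc (Suc p)) {..Suc p} (\<lambda>j. dN (Suc (Suc p)) j z)"
    using z dN_dN[OF z] by (auto simp: matching_def dN_in)
  from matching_last_missing[OF this] z show ?thesis
    by (auto simp: last_missing_def matching_def co_dN)
qed

end

section \<open>Functors of families and the morphisms that classify their elements\<close>

context category begin

abbreviation comp_arrow (infixr "\<odot>" 70) where "f \<odot> g \<equiv> f \<cdot>\<^bsub>C\<^esub> g"

lemma assoc: "h \<in> homs C A B \<Longrightarrow> g \<in> homs C B D \<Longrightarrow> f \<in> homs C D E \<Longrightarrow> (f \<odot> g) \<odot> h = f \<odot> g \<odot> h"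
  by (rule Comp_assoc)

lemma homs_ob: "f \<in> homs C A B \<Longrightarrow> A \<in> Ob C" "f \<in> homs C A B \<Longrightarrow> B \<in> Ob C"
  using Dom_Ob Cod_Ob by (auto simp: homs_def)

lemma homs_D: "f \<in> homs C A B \<Longrightarrow> Dom C f = A" "f \<in> homs C A B \<Longrightarrow> Cod C f = B" "f \<in> homs C A B \<Longrightarrow> f \<in> Ar C"
  by (auto simp: homs_def)

lemma isosI:
  "f \<in> homs C A B \<Longrightarrow> g \<in> homs C B A \<Longrightarrow> g \<odot> f = Ident C A \<Longrightarrow> f \<odot> g = Ident C B \<Longrightarrow> f \<in> isos C"
  by (auto simp: isos_def homs_def)

lemma isosE:
  assumes "f \<in> isos C" "f \<in> homs C A B"
  obtains g where "g \<in> homs C B A" "g \<odot> f = Ident C A" "f \<odot> g = Ident C B"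
  using assms by (auto simp: isos_def homs_def)

text \<open>
  \<open>F T x\<close> says that \<open>x\<close>, a family of arrows out of \<open>T\<close> indexed by \<open>J\<close>, is an element at \<open>T\<close> of a functor that
  acts by composition.  The object \<open>L\<close> represents it, with universal element \<open>u\<close>.  Families
  are compared on \<open>J\<close> only.
\<close>

definition universal :: "'j set \<Rightarrow> ('o \<Rightarrow> ('j \<Rightarrow> 'm) \<Rightarrow> bool) \<Rightarrow> 'o \<Rightarrow> ('j \<Rightarrow> 'm) \<Rightarrow> bool" where
  "universal J F L u \<longleftrightarrow> L \<in> Ob C \<and> F L u \<and>
     (\<forall>T\<in>Ob C. \<forall>x. F T x \<longrightarrow> (\<exists>!h. h \<in> homs C T L \<and> (\<forall>j\<in>J. u j \<odot> h = x j)))"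

text \<open>
  The functor is representable, and the arrow \<open>A \<rightarrow> L\<close> that corresponds to its element \<open>e\<close> at \<open>A\<close> belongs to
  \<open>K\<close>.  For \<open>A = X\<^sub>k\<close> and the faces of the universal \<open>k\<close>-simplex this arrow is \<open>\<lambda>\<^sup>k\<^sub>i\<close>.
\<close>

definition classified :: "'m set \<Rightarrow> 'j set \<Rightarrow> ('o \<Rightarrow> ('j \<Rightarrow> 'm) \<Rightarrow> bool) \<Rightarrow> 'o \<Rightarrow> ('j \<Rightarrow> 'm) \<Rightarrow> bool" where
  "classified K J F A e \<longleftrightarrow> (\<exists>L u h. universal J F L u \<and> h \<in> homs C A L \<and> h \<in> K \<and> (\<forall>j\<in>J. u j \<odot> h = e j))"

definition presheaf :: "'j set \<Rightarrow> ('o \<Rightarrow> ('j \<Rightarrow> 'm) \<Rightarrow> bool) \<Rightarrow> bool" where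
  "presheaf J F \<longleftrightarrow> (\<forall>T x. F T x \<longrightarrow> (\<forall>j\<in>J. x j \<in> Ar C \<and> Dom C (x j) = T)) \<and>
     (\<forall>T S x h. F T x \<longrightarrow> h \<in> homs C S T \<longrightarrow> F S (\<lambda>j. x j \<odot> h))"

lemma universal_D:
  assumes "universal J F L u"
  shows "L \<in> Ob C" "F L u"
    "F T x \<Longrightarrow> T \<in> Ob C \<Longrightarrow> \<exists>h. h \<in> homs C T L \<and> (\<forall>j\<in>J. u j \<odot> h = x j)"
    "F T x \<Longrightarrow> h \<in> homs C T L \<Longrightarrow> h' \<in> homs C T L \<Longrightarrow> (\<And>j. j \<in> J \<Longrightarrow> u j \<odot> h = x j) \<Longrightarrow> (\<And>j. j \<in> J \<Longrightarrow> u j \<odot> h' = x j) \<Longrightarrow> h = h'"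
  using assms homs_ob unfolding universal_def by blast+

lemma universalI:
  assumes "L \<in> Ob C" "F L u"
    "\<And>T x. T \<in> Ob C \<Longrightarrow> F T x \<Longrightarrow> \<exists>h. h \<in> homs C T L \<and> (\<forall>j\<in>J. u j \<odot> h = x j)"
    "\<And>T x h h'. F T x \<Longrightarrow> h \<in> homs C T L \<Longrightarrow> h' \<in> homs C T L \<Longrightarrow> (\<And>j. j \<in> J \<Longrightarrow> u j \<odot> h = x j) \<Longrightarrow> (\<And>j. j \<in> J \<Longrightarrow> u j \<odot> h' = x j) \<Longrightarrow> h = h'"
  shows "universal J F L u"
  unfolding universal_def using assms by blast

lemma presheaf_homs: "presheaf J F \<Longrightarrow> F T x \<Longrightarrow> j \<in> J \<Longrightarrow> x j \<in> homs C T (Cod C (x j))"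
  by (auto simp: presheaf_def homs_def)

lemma presheaf_comp: "presheaf J F \<Longrightarrow> F T x \<Longrightarrow> h \<in> homs C S T \<Longrightarrow> F S (\<lambda>j. x j \<odot> h)"
  by (auto simp: presheaf_def)

lemma universal_eqI:
  assumes F: "presheaf J F" and L: "universal J F L u" and h: "h \<in> homs C T L" "h' \<in> homs C T L"
    and eq: "\<And>j. j \<in> J \<Longrightarrow> u j \<odot> h = u j \<odot> h'"
  shows "h = h'"
proof -
  have "F T (\<lambda>j. u j \<odot> h)" using presheaf_comp[OF F universal_D(2)[OF L] h(1)] .
  then show ?thesis by (rule universal_D(4)[OF L _ h]) (use eq in auto)
qed

lemma universal_unique:
  assumes F: "presheaf J F" and L: "universal J F L u" and L': "universal J F L' u'"
  obtains h where "h \<in> isos C" "h \<in> homs C L' L" "\<And>j. j \<in> J \<Longrightarrow> u j \<odot> h = u' j"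
proof -
  obtain h where h: "h \<in> homs C L' L" "\<forall>j\<in>J. u j \<odot> h = u' j"
    using universal_D[OF L] universal_D[OF L'] by blast
  obtain h' where h': "h' \<in> homs C L L'" "\<forall>j\<in>J. u' j \<odot> h' = u j"
    using universal_D[OF L] universal_D[OF L'] by blast
  have u: "u j \<in> homs C L (Cod C (u j))" "u' j \<in> homs C L' (Cod C (u' j))" if "j \<in> J" for j
    using presheaf_homs[OF F _ that] universal_D(2)[OF L] universal_D(2)[OF L'] by auto
  have I: "Ident C L \<in> homs C L L" "Ident C L' \<in> homs C L' L'"
    using universal_D(1)[OF L] universal_D(1)[OF L'] Ident_homs by auto
  have "h \<odot> h' = Ident C L"
  proof (rule universal_eqI[OF F L])
    fix j assume j: "j \<in> J"
    show "u j \<odot> h \<odot> h' = u j \<odot> Ident C L"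
      using assoc[OF h'(1) h(1) u(1)[OF j]] h h' j Ident_right[OF u(1)[OF j]] by simp
  qed (use h h' I Comp_homs in blast)+
  moreover have "h' \<odot> h = Ident C L'"
  proof (rule universal_eqI[OF F L'])
    fix j assume j: "j \<in> J"
    show "u' j \<odot> h' \<odot> h = u' j \<odot> Ident C L'"
      using assoc[OF h(1) h'(1) u(2)[OF j]] h h' j Ident_right[OF u(2)[OF j]] by simp
  qed (use h h' I Comp_homs in blast)+
  ultimately have "h \<in> isos C" using isosI[OF h(1) h'(1)] by auto
  then show ?thesis using that h by auto
qed

text \<open>
  What covers and isomorphisms have in common.  Since isomorphisms can be composed with the members of such a class,
  membership of \<open>\<lambda>\<^sup>k\<^sub>i\<close> does not depend on the choice of the limit \<open>\<Lambda>\<^sup>k\<^sub>i\<close>.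
\<close>

definition stable :: "'m set \<Rightarrow> bool" where
  "stable K \<longleftrightarrow> K \<subseteq> Ar C \<and> isos C \<subseteq> K \<and> (\<forall>f\<in>K. \<forall>g\<in>K. Dom C f = Cod C g \<longrightarrow> f \<odot> g \<in> K) \<and>
     (\<forall>f\<in>K. \<forall>g P p q. is_pullback C f g P p q \<longrightarrow> q \<in> K)"

lemma stable_comp: "stable K \<Longrightarrow> f \<in> K \<Longrightarrow> g \<in> K \<Longrightarrow> f \<in> homs C B D \<Longrightarrow> g \<in> homs C A B \<Longrightarrow> f \<odot> g \<in> K"
  by (auto simp: stable_def homs_def)

lemma classified_universal:
  assumes K: "stable K" and F: "presheaf J F" and c: "classified K J F A e" and L: "universal J F L u"
  obtains h where "h \<in> K" "h \<in> homs C A L" "\<And>j. j \<in> J \<Longrightarrow> u j \<odot> h = e j"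
proof -
  obtain L' u' h' where L': "universal J F L' u'" "h' \<in> homs C A L'" "h' \<in> K" "\<forall>j\<in>J. u' j \<odot> h' = e j"
    using c by (auto simp: classified_def)
  obtain g where g: "g \<in> isos C" "g \<in> homs C L' L" "\<And>j. j \<in> J \<Longrightarrow> u j \<odot> g = u' j"
    using universal_unique[OF F L L'(1)] by metis
  show ?thesis
  proof
    show "g \<odot> h' \<in> K" using stable_comp[OF K _ L'(3) g(2) L'(2)] g(1) K by (auto simp: stable_def)
    show "g \<odot> h' \<in> homs C A L" using g L' Comp_homs by blast
    show "u j \<odot> g \<odot> h' = e j" if "j \<in> J" for j
      using assoc[OF L'(2) g(2) presheaf_homs[OF F universal_D(2)[OF L] that]] g(3) L'(4) that by simp
  qed
qed

text \<open>
  A natural bijection between two functors, given by its graph \<open>R\<close>, moves representing objects from one to the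
  other.  A graph avoids naming the two inverse maps, whose values are determined on the
  index sets only.
\<close>

lemma universal_transfer:
  assumes R1: "\<And>T x. T \<in> Ob C \<Longrightarrow> F T x \<Longrightarrow> \<exists>y. R T x y"
    and R2: "\<And>T y. T \<in> Ob C \<Longrightarrow> F' T y \<Longrightarrow> \<exists>x. F T x \<and> R T x y"
    and R3: "\<And>T x y. T \<in> Ob C \<Longrightarrow> R T x y \<Longrightarrow> F' T y"
    and R4: "\<And>T x y x' y'. T \<in> Ob C \<Longrightarrow> R T x y \<Longrightarrow> R T x' y' \<Longrightarrow> (\<forall>j\<in>J. x j = x' j) \<longleftrightarrow> (\<forall>j\<in>J'. y j = y' j)"
    and R5: "\<And>T S x y h. R T x y \<Longrightarrow> h \<in> homs C S T \<Longrightarrow> R S (\<lambda>j. x j \<odot> h) (\<lambda>j. y j \<odot> h)"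
    and L: "universal J F L u"
  shows "\<exists>v. universal J' F' L v \<and> R L u v"
proof -
  obtain v where v: "R L u v" using R1 universal_D[OF L] by blast
  have iff: "(\<forall>j\<in>J. u j \<odot> h = x j) \<longleftrightarrow> (\<forall>j\<in>J'. v j \<odot> h = y j)" if "R T x y" "h \<in> homs C T L" for T x y h
    using R4[OF homs_ob(1)[OF that(2)] R5[OF v that(2)] that(1)] .
  have "universal J' F' L v"
  proof (rule universalI)
    fix T y assume T: "T \<in> Ob C" "F' T y"
    then obtain x where x: "F T x" "R T x y" using R2 by blast
    then show "\<exists>h. h \<in> homs C T L \<and> (\<forall>j\<in>J'. v j \<odot> h = y j)"
      using universal_D(3)[OF L x(1) T(1)] iff[OF x(2)] by blast
  next
    fix T y h h' assume T: "F' T y" "h \<in> homs C T L" "h' \<in> homs C T L"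
      "\<And>j. j \<in> J' \<Longrightarrow> v j \<odot> h = y j" "\<And>j. j \<in> J' \<Longrightarrow> v j \<odot> h' = y j"
    then obtain x where x: "F T x" "R T x y" using R2 homs_ob by blast
    then show "h = h'" using universal_D(4)[OF L x(1) T(2,3)] iff[OF x(2)] T by blast
  qed (use v R3 universal_D[OF L] in auto)
  then show ?thesis using v by blast
qed

lemma classified_transfer:
  assumes R1: "\<And>T x. T \<in> Ob C \<Longrightarrow> F T x \<Longrightarrow> \<exists>y. R T x y"
    and R2: "\<And>T y. T \<in> Ob C \<Longrightarrow> F' T y \<Longrightarrow> \<exists>x. F T x \<and> R T x y"
    and R3: "\<And>T x y. T \<in> Ob C \<Longrightarrow> R T x y \<Longrightarrow> F' T y"
    and R4: "\<And>T x y x' y'. T \<in> Ob C \<Longrightarrow> R T x y \<Longrightarrow> R T x' y' \<Longrightarrow> (\<forall>j\<in>J. x j = x' j) \<longleftrightarrow> (\<forall>j\<in>J'. y j = y' j)"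
    and R5: "\<And>T S x y h. R T x y \<Longrightarrow> h \<in> homs C S T \<Longrightarrow> R S (\<lambda>j. x j \<odot> h) (\<lambda>j. y j \<odot> h)"
    and c: "classified K J F A e" and e: "R A e e'"
  shows "classified K J' F' A e'"
proof -
  obtain L u h where L: "universal J F L u" and h: "h \<in> homs C A L" "h \<in> K" "\<forall>j\<in>J. u j \<odot> h = e j"
    using c by (auto simp: classified_def)
  have "\<exists>v. universal J' F' L v \<and> R L u v"
    by (rule universal_transfer) (fact R1 R2 R3 R4 R5 L)+
  then obtain v where v: "universal J' F' L v" "R L u v" by blast
  have "\<forall>j\<in>J'. v j \<odot> h = e' j"
    using R4[OF homs_ob(1)[OF h(1)] R5[OF v(2) h(1)] e] h(3) by blast
  then show ?thesis using v h by (auto simp: classified_def)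
qed

definition binprod :: "'o \<Rightarrow> 'o \<Rightarrow> 'o \<Rightarrow> 'm \<Rightarrow> 'm \<Rightarrow> bool" where
  "binprod B A W a b \<longleftrightarrow> W \<in> Ob C \<and> a \<in> homs C W B \<and> b \<in> homs C W A \<and>
     (\<forall>T\<in>Ob C. \<forall>x\<in>homs C T B. \<forall>y\<in>homs C T A. \<exists>!h. h \<in> homs C T W \<and> a \<odot> h = x \<and> b \<odot> h = y)"

lemma binprodI:
  assumes "a \<in> homs C W B" "b \<in> homs C W A"
    and "\<And>T x y. T \<in> Ob C \<Longrightarrow> x \<in> homs C T B \<Longrightarrow> y \<in> homs C T A \<Longrightarrow> \<exists>h. h \<in> homs C T W \<and> a \<odot> h = x \<and> b \<odot> h = y"
    and "\<And>T h h'. T \<in> Ob C \<Longrightarrow> h \<in> homs C T W \<Longrightarrow> h' \<in> homs C T W \<Longrightarrow> a \<odot> h = a \<odot> h' \<Longrightarrow> b \<odot> h = b \<odot> h' \<Longrightarrow> h = h'"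
  shows "binprod B A W a b"
  unfolding binprod_def using assms homs_ob by (metis (no_types, lifting))

lemma binprod_D:
  assumes "binprod B A W a b"
  shows "W \<in> Ob C" "a \<in> homs C W B" "b \<in> homs C W A"
   "x \<in> homs C T B \<Longrightarrow> y \<in> homs C T A \<Longrightarrow> \<exists>h. h \<in> homs C T W \<and> a \<odot> h = x \<and> b \<odot> h = y"
   "h \<in> homs C T W \<Longrightarrow> h' \<in> homs C T W \<Longrightarrow> a \<odot> h = a \<odot> h' \<Longrightarrow> b \<odot> h = b \<odot> h' \<Longrightarrow> h = h'"
proof -
  show "h = h'" if h: "h \<in> homs C T W" "h' \<in> homs C T W" "a \<odot> h = a \<odot> h'" "b \<odot> h = b \<odot> h'"
  proof -
    have "\<exists>!k. k \<in> homs C T W \<and> a \<odot> k = a \<odot> h \<and> b \<odot> k = b \<odot> h"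
      using assms h(1) homs_ob(1)[OF h(1)] Comp_homs[of a W B h T] Comp_homs[of b W A h T] unfolding binprod_def by blast
    then show ?thesis using h by metis
  qed
qed (use assms homs_ob in \<open>unfold binprod_def, blast+\<close>)

text \<open>
  \<open>1 \<times> h\<close> is a pullback of \<open>h\<close>; hence stable classes are closed under products with an object.
\<close>

lemma binprod_map_pullback:
  assumes W: "binprod B A W a b" and P: "binprod B L P p q" and h: "h \<in> homs C A L"
    and k: "k \<in> homs C W P" "p \<odot> k = a" "q \<odot> k = h \<odot> b"
  shows "is_pullback C h q W b k"
  unfolding is_pullback_def
proof (intro conjI ballI impI)
  fix T x y assume T: "T \<in> Ob C" and x: "x \<in> homs C T (Dom C h)" and y: "y \<in> homs C T (Dom C q)"
    and eq: "h \<odot> x = q \<odot> y"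
  note d = binprod_D(1-3)[OF W] binprod_D(1-3)[OF P]
  have x': "x \<in> homs C T A" using x h homs_D by auto
  have y': "y \<in> homs C T P" using y d homs_D by auto
  obtain u where u: "u \<in> homs C T W" "a \<odot> u = p \<odot> y" "b \<odot> u = x"
    using binprod_D(4)[OF W, of "p \<odot> y" T x] Comp_homs d y' x' by blast
  show "\<exists>!u. u \<in> homs C T W \<and> b \<odot> u = x \<and> k \<odot> u = y"
  proof (rule ex1I[of _ u], intro conjI)
    show "k \<odot> u = y"
    proof (rule binprod_D(5)[OF P])
      show "p \<odot> k \<odot> u = p \<odot> y" using assoc[OF u(1) k(1) d(5)] k u by simp
      show "q \<odot> k \<odot> u = q \<odot> y" using assoc[OF u(1) k(1) d(6)] assoc[OF u(1) d(3) h] k u eq by simp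
    qed (use u k y' Comp_homs in blast)+
    fix u' assume u': "u' \<in> homs C T W \<and> b \<odot> u' = x \<and> k \<odot> u' = y"
    show "u' = u"
    proof (rule binprod_D(5)[OF W])
      have "a \<odot> u' = p \<odot> k \<odot> u'" using assoc[of u' T W k P p B] k u' d by simp
      then show "a \<odot> u' = a \<odot> u" using u' u by simp
    qed (use u u' in auto)
  qed (use u in auto)
qed (use assms binprod_D(1-3)[OF W] binprod_D(1-3)[OF P] homs_D in auto)

lemma classified_prod:
  assumes K: "stable K" and F: "presheaf J F" and c: "classified K J F A e"
    and W: "binprod B A W a b" and ex: "\<And>L. L \<in> Ob C \<Longrightarrow> \<exists>P p q. binprod B L P p q"
  shows "classified K (insert None (Some ` J)) (\<lambda>T y. y None \<in> homs C T B \<and> F T (\<lambda>j. y (Some j))) W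
     (\<lambda>i. case i of None \<Rightarrow> a | Some j \<Rightarrow> e j \<odot> b)"
proof -
  obtain L u h where L: "universal J F L u" and h: "h \<in> homs C A L" "h \<in> K" "\<forall>j\<in>J. u j \<odot> h = e j"
    using c by (auto simp: classified_def)
  obtain P p q where P: "binprod B L P p q" using ex[OF universal_D(1)[OF L]] by blast
  note d = binprod_D(1-3)[OF W] binprod_D(1-3)[OF P]
  note u = presheaf_homs[OF F universal_D(2)[OF L]]
  obtain k where k: "k \<in> homs C W P" "p \<odot> k = a" "q \<odot> k = h \<odot> b"
    using binprod_D(4)[OF P, of a W "h \<odot> b"] d h Comp_homs by blast
  have "k \<in> K" using binprod_map_pullback[OF W P h(1) k] K h(2) unfolding stable_def by blast
  moreover have "universal (insert None (Some ` J)) (\<lambda>T y. y None \<in> homs C T B \<and> F T (\<lambda>j. y (Some j))) P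
     (\<lambda>i. case i of None \<Rightarrow> p | Some j \<Rightarrow> u j \<odot> q)" (is "universal ?J ?F P ?u")
  proof (rule universalI)
    fix T y assume T: "T \<in> Ob C" "?F T y"
    then obtain g where g: "g \<in> homs C T L" "\<forall>j\<in>J. u j \<odot> g = y (Some j)" using universal_D(3)[OF L] by blast
    then obtain r where r: "r \<in> homs C T P" "p \<odot> r = y None" "q \<odot> r = g" using binprod_D(4)[OF P] T by blast
    then show "\<exists>h. h \<in> homs C T P \<and> (\<forall>j\<in>?J. ?u j \<odot> h = y j)"
      using g assoc[OF r(1) d(6) u] by auto
  next
    fix T y r r' assume T: "?F T y" "r \<in> homs C T P" "r' \<in> homs C T P"
      "\<And>j. j \<in> ?J \<Longrightarrow> ?u j \<odot> r = y j" "\<And>j. j \<in> ?J \<Longrightarrow> ?u j \<odot> r' = y j"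
    show "r = r'"
    proof (rule binprod_D(5)[OF P T(2,3)])
      show "p \<odot> r = p \<odot> r'" using T(4)[of None] T(5)[of None] by simp
      show "q \<odot> r = q \<odot> r'"
      proof (rule universal_eqI[OF F L])
        fix j assume j: "j \<in> J"
        show "u j \<odot> q \<odot> r = u j \<odot> q \<odot> r'" using T(4,5)[of "Some j"] j assoc[OF T(2) d(6) u[OF j]] assoc[OF T(3) d(6) u[OF j]]
          by simp
      qed (use T(2,3) d(6) Comp_homs in blast)+
    qed
  qed (use d(4,5) presheaf_comp[OF F universal_D(2)[OF L] d(6)] in simp_all)
  moreover have "\<forall>j\<in>?J. ?u j \<odot> k = (case j of None \<Rightarrow> a | Some j \<Rightarrow> e j \<odot> b)"
    using k h(3) assoc[OF k(1) d(6) u] assoc[OF d(3) h(1) u] by auto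
  ultimately show ?thesis using k(1) unfolding classified_def by blast
qed

lemma isos_comp: "f \<in> isos C \<Longrightarrow> g \<in> isos C \<Longrightarrow> f \<in> homs C B D \<Longrightarrow> g \<in> homs C A B \<Longrightarrow> f \<odot> g \<in> isos C"
proof -
  assume f: "f \<in> isos C" "f \<in> homs C B D" and g: "g \<in> isos C" "g \<in> homs C A B"
  obtain f' where f': "f' \<in> homs C D B" "f' \<odot> f = Ident C B" "f \<odot> f' = Ident C D" using isosE[OF f] by metis
  obtain g' where g': "g' \<in> homs C B A" "g' \<odot> g = Ident C A" "g \<odot> g' = Ident C B" using isosE[OF g] by metis
  show "f \<odot> g \<in> isos C"
  proof (rule isosI)
    show "f \<odot> g \<in> homs C A D" "g' \<odot> f' \<in> homs C D A" using f f' g g' Comp_homs by blast+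
    show "(g' \<odot> f') \<odot> f \<odot> g = Ident C A"
      using assoc[OF _ f'(1) g'(1), of "f \<odot> g" A] assoc[OF g(2) f(2) f'(1)] f f' g g' Comp_homs[OF f(2) g(2)] Ident_left[OF g(2)] by simp
    show "(f \<odot> g) \<odot> g' \<odot> f' = Ident C D"
      using assoc[OF _ g(2) f(2), of "g' \<odot> f'" D] assoc[OF f'(1) g'(1) g(2)] f f' g g' Comp_homs[OF g'(1) f'(1)] Ident_left[OF f'(1)] by simp
  qed
qed

lemma isos_pullback:
  assumes f: "f \<in> isos C" and P: "is_pullback C f g P p q"
  shows "q \<in> isos C"
proof -
  have t: "f \<in> homs C (Dom C f) (Cod C f)" "g \<in> homs C (Dom C g) (Cod C f)" "p \<in> homs C P (Dom C f)"
    "q \<in> homs C P (Dom C g)" "f \<odot> p = g \<odot> q"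
    using P by (auto simp: is_pullback_def homs_def)
  have ex: "\<exists>!u. u \<in> homs C T P \<and> p \<odot> u = a \<and> q \<odot> u = b" if "a \<in> homs C T (Dom C f)" "b \<in> homs C T (Dom C g)"
     "f \<odot> a = g \<odot> b" for T a b using P that homs_ob unfolding is_pullback_def by blast
  obtain f' where f': "f' \<in> homs C (Cod C f) (Dom C f)" "f' \<odot> f = Ident C (Dom C f)" "f \<odot> f' = Ident C (Cod C f)"
    using isosE[OF f t(1)] by metis
  have I: "Ident C (Dom C g) \<in> homs C (Dom C g) (Dom C g)" "Ident C P \<in> homs C P P" using t Ident_homs homs_ob by blast+
  have fg: "f' \<odot> g \<in> homs C (Dom C g) (Dom C f)" using f' t Comp_homs by blast
  have "f \<odot> f' \<odot> g = g \<odot> Ident C (Dom C g)"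
    using assoc[OF t(2) f'(1) t(1)] f' Ident_left[OF t(2)] Ident_right[OF t(2)] by simp
  from ex[OF fg I(1) this] obtain u where u: "u \<in> homs C (Dom C g) P" "p \<odot> u = f' \<odot> g" "q \<odot> u = Ident C (Dom C g)" by blast
  have "f' \<odot> f \<odot> p = f' \<odot> g \<odot> q" using t(5) by simp
  then have pq: "p = (f' \<odot> g) \<odot> q" using assoc[OF t(3,1) f'(1)] assoc[OF t(4,2) f'(1)] f' Ident_left[OF t(3)] by simp
  have uq: "u \<odot> q \<in> homs C P P" using u t Comp_homs by blast
  have "u \<odot> q = Ident C P"
  proof -
    have "p \<odot> u \<odot> q = p" "q \<odot> u \<odot> q = q"
      using assoc[OF t(4) u(1) t(3)] assoc[OF t(4) u(1) t(4)] pq u Ident_left[OF t(4)] by simp_all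
    then show ?thesis using ex[OF t(3,4,5)] uq I(2) Ident_right[OF t(3)] Ident_right[OF t(4)] by blast
  qed
  then show ?thesis using isosI[OF t(4) u(1)] u by simp
qed

lemma stable_isos: "stable (isos C)"
  unfolding stable_def
proof (intro conjI ballI impI allI)
  fix f g assume fg: "f \<in> isos C" "g \<in> isos C" "Dom C f = Cod C g"
  then have "f \<in> homs C (Dom C f) (Cod C f)" "g \<in> homs C (Dom C g) (Dom C f)" by (auto simp: isos_def homs_def)
  then show "f \<odot> g \<in> isos C" by (rule isos_comp[OF fg(1,2)])
next
  show "isos C \<subseteq> Ar C" by (auto simp: isos_def)
qed (use isos_pullback in blast)+

text \<open>
  An isomorphism is a pullback of an identity along an identity.  As identities are covers, isomorphisms are
  covers by (A2).
\<close>

lemma iso_pullback_Ident: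
  assumes f: "f \<in> isos C" "f \<in> homs C A B"
  shows "is_pullback C (Ident C B) (Ident C B) A f f"
proof -
  obtain g where g: "g \<in> homs C B A" "g \<odot> f = Ident C A" "f \<odot> g = Ident C B" using isosE[OF f] by metis
  have I: "Ident C B \<in> homs C B B" using f Ident_homs homs_ob by blast
  show ?thesis unfolding is_pullback_def
  proof (intro conjI ballI impI)
    fix T a b assume "T \<in> Ob C" "a \<in> homs C T (Dom C (Ident C B))" "b \<in> homs C T (Dom C (Ident C B))"
      "Ident C B \<odot> a = Ident C B \<odot> b"
    then have ab: "a \<in> homs C T B" "a = b" using I homs_D Ident_left by auto
    show "\<exists>!u. u \<in> homs C T A \<and> f \<odot> u = a \<and> f \<odot> u = b"
    proof (rule ex1I[of _ "g \<odot> a"])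
      show "g \<odot> a \<in> homs C T A \<and> f \<odot> g \<odot> a = a \<and> f \<odot> g \<odot> a = b"
        using assoc[OF ab(1) g(1) f(2)] ab g Ident_left Comp_homs by auto
      fix u assume "u \<in> homs C T A \<and> f \<odot> u = a \<and> f \<odot> u = b"
      then show "u = g \<odot> a" using assoc[of u T A f B g A] f g Ident_left by auto
    qed
  qed (use f I homs_D homs_ob in auto)
qed

end

section \<open>Covers and finite products\<close>

context category_with_covers begin

text \<open>
  Every identity is a cover because every object is the domain of one, namely of its arrow to \<open>\<ast>\<close>.
\<close>

lemma Ident_cover: "A \<in> Ob C \<Longrightarrow> Ident C A \<in> Cov"
  using A1 cover_Ident unfolding terminal_def by (metis (no_types, lifting) homs_D(1) subset_iff)

lemma isos_cover: "f \<in> isos C \<Longrightarrow> f \<in> Cov"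
proof -
  assume f: "f \<in> isos C"
  then have "f \<in> homs C (Dom C f) (Cod C f)" by (auto simp: isos_def homs_def)
  from iso_pullback_Ident[OF f this] show ?thesis using A2_cover Ident_cover homs_ob(2)[OF \<open>f \<in> homs C _ _\<close>] by blast
qed

lemma stable_Cov: "stable Cov"
  unfolding stable_def using cover_Ar isos_cover cover_Comp A2_cover by blast

lemma is_product_ex1:
  assumes "is_product C As P p" "T \<in> Ob C" "\<forall>j<length As. t j \<in> homs C T (As ! j)"
  shows "\<exists>!u. u \<in> homs C T P \<and> (\<forall>j<length As. p j \<odot> u = t j)"
proof -
  have "\<forall>t. (\<forall>j<length As. t j \<in> homs C T (As ! j)) \<longrightarrow> (\<exists>!u. u \<in> homs C T P \<and> (\<forall>j<length As. p j \<odot> u = t j))"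
    using assms(1,2) by (simp add: is_product_def)
  from this[THEN spec, of t] assms(3) show ?thesis by simp
qed

text \<open>
  The product with one more factor is a pullback over a terminal object, along an arrow that is a cover.
\<close>

lemma is_product_ex: "set As \<subseteq> Ob C \<Longrightarrow> \<exists>P p. is_product C As P p"
proof (induction As)
  case Nil
  then show ?case using A1 by (auto simp: is_product_def terminal_def)
next
  case (Cons A As)
  then obtain P p where P: "is_product C As P p" by auto
  have pin: "P \<in> Ob C" "\<And>j. j < length As \<Longrightarrow> p j \<in> homs C P (As ! j)" using P by (auto simp: is_product_def)
  obtain Z where Z: "terminal C Z" "\<forall>X\<in>Ob C. homs C X Z \<subseteq> Cov" using A1 by blast
  obtain f where f: "f \<in> homs C A Z" using Z Cons by (auto simp: terminal_def)
  obtain g where g: "g \<in> homs C P Z" using Z pin by (auto simp: terminal_def)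
  have "f \<in> Cov" using f Z Cons by auto
  then obtain Q p1 q where Q: "is_pullback C f g Q p1 q" using A2_exists f g homs_D by metis
  have t: "Q \<in> Ob C" "p1 \<in> homs C Q A" "q \<in> homs C Q P" using Q f g homs_D by (auto simp: is_pullback_def)
  have ex: "\<exists>!u. u \<in> homs C T Q \<and> p1 \<odot> u = a \<and> q \<odot> u = b" if "a \<in> homs C T A" "b \<in> homs C T P" for T a b
  proof -
    have "f \<odot> a \<in> homs C T Z" "g \<odot> b \<in> homs C T Z" using f g that Comp_homs by blast+
    then have "f \<odot> a = g \<odot> b" using Z(1) homs_ob unfolding terminal_def by blast
    then show ?thesis using Q that homs_ob(1)[OF that(1)] homs_D(1)[OF f] homs_D(1)[OF g] unfolding is_pullback_def by metis
  qed
  have "is_product C (A # As) Q (\<lambda>j. case j of 0 \<Rightarrow> p1 | Suc j \<Rightarrow> p j \<odot> q)" (is "is_product C _ Q ?p")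
    unfolding is_product_def
  proof (intro conjI allI impI ballI)
    fix j assume "j < length (A # As)"
    then show "?p j \<in> homs C Q ((A # As) ! j)" using t Comp_homs[OF pin(2) t(3)] by (cases j) auto
  next
    fix T t' assume T: "T \<in> Ob C" "\<forall>j<length (A # As). t' j \<in> homs C T ((A # As) ! j)"
    then have t': "t' 0 \<in> homs C T A" "\<forall>j<length As. t' (Suc j) \<in> homs C T (As ! j)" by auto
    have ex': "\<exists>!u. u \<in> homs C T P \<and> (\<forall>j<length As. p j \<odot> u = t' (Suc j))"
      using is_product_ex1[OF P T(1), of "\<lambda>j. t' (Suc j)"] t'(2) by simp
    then obtain b where b: "b \<in> homs C T P" "\<forall>j<length As. p j \<odot> b = t' (Suc j)" by blast
    obtain u where u: "u \<in> homs C T Q" "p1 \<odot> u = t' 0" "q \<odot> u = b" using ex[OF t'(1) b(1)] by blast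
    show "\<exists>!u. u \<in> homs C T Q \<and> (\<forall>j<length (A # As). ?p j \<odot> u = t' j)"
    proof (rule ex1I[of _ u])
      show "u \<in> homs C T Q \<and> (\<forall>j<length (A # As). ?p j \<odot> u = t' j)"
        using u b assoc[OF u(1) t(3) pin(2)] by (auto split: nat.split)
      fix u' assume u': "u' \<in> homs C T Q \<and> (\<forall>j<length (A # As). ?p j \<odot> u' = t' j)"
      have "q \<odot> u' \<in> homs C T P" using u' t Comp_homs by blast
      moreover have "p j \<odot> q \<odot> u' = t' (Suc j)" if "j < length As" for j
        using u' assoc[OF _ t(3) pin(2)[OF that], of u' T] that by (auto dest: spec[of _ "Suc j"])
      ultimately have "q \<odot> u' = b" using ex' b by blast
      moreover have "p1 \<odot> u' = t' 0" using u' by (auto dest: spec[of _ 0])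
      ultimately show "u' = u" using u u' ex[OF t'(1) b(1)] by blast
    qed
  qed (use t in auto)
  then show ?case by blast
qed

lemma prd_is_product: "set As \<subseteq> Ob C \<Longrightarrow> is_product C As (prd C As) (prj C As)"
proof -
  assume "set As \<subseteq> Ob C"
  then have "\<exists>z. case z of (P, p) \<Rightarrow> is_product C As P p" using is_product_ex by auto
  from someI_ex[OF this] show ?thesis by (simp add: prd_def prj_def product_cone_def case_prod_unfold)
qed

lemma prd_ob: "set As \<subseteq> Ob C \<Longrightarrow> prd C As \<in> Ob C"
  using prd_is_product by (auto simp: is_product_def)

lemma prj_in: "set As \<subseteq> Ob C \<Longrightarrow> j < length As \<Longrightarrow> prj C As j \<in> homs C (prd C As) (As ! j)"
  using prd_is_product by (auto simp: is_product_def)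

lemma prd_eqI:
  assumes As: "set As \<subseteq> Ob C" and f: "f \<in> homs C T (prd C As)" "g \<in> homs C T (prd C As)"
    and eq: "\<And>j. j < length As \<Longrightarrow> prj C As j \<odot> f = prj C As j \<odot> g"
  shows "f = g"
proof -
  have "\<forall>j<length As. prj C As j \<odot> f \<in> homs C T (As ! j)" using prj_in[OF As] f Comp_homs by blast
  then have "\<exists>!u. u \<in> homs C T (prd C As) \<and> (\<forall>j<length As. prj C As j \<odot> u = prj C As j \<odot> f)"
    by (rule is_product_ex1[OF prd_is_product[OF As] homs_ob(1)[OF f(1)]])
  then show ?thesis using f eq by metis
qed

lemma tup:
  assumes T: "T \<in> Ob C" and ts: "length ts = length As" "\<And>j. j < length As \<Longrightarrow> ts ! j \<in> homs C T (As ! j)"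
  shows tup_in: "tup C T ts \<in> homs C T (prd C As)"
    and prj_tup: "j < length As \<Longrightarrow> prj C As j \<odot> tup C T ts = ts ! j"
proof -
  have As: "map (Cod C) ts = As" using ts(1) homs_D(2)[OF ts(2)] by (intro nth_equalityI) auto
  have "set As \<subseteq> Ob C" using homs_ob(2)[OF ts(2)] by (auto simp: in_set_conv_nth)
  then have "\<exists>!u. u \<in> homs C T (prd C As) \<and> (\<forall>j<length As. prj C As j \<odot> u = ts ! j)"
    using is_product_ex1[OF prd_is_product T, of As "\<lambda>j. ts ! j"] ts(2) by simp
  from theI'[OF this] show "tup C T ts \<in> homs C T (prd C As)" "j < length As \<Longrightarrow> prj C As j \<odot> tup C T ts = ts ! j"
    unfolding tup_def As using ts(1) by auto
qed

lemma tup_comp: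
  assumes h: "h \<in> homs C S T" and ts: "\<And>t. t \<in> set ts \<Longrightarrow> t \<in> homs C T (Cod C t)"
  shows "tup C T ts \<odot> h = tup C S (map (\<lambda>t. t \<odot> h) ts)"
proof (rule prd_eqI)
  let ?As = "map (Cod C) ts"
  show As: "set ?As \<subseteq> Ob C" using homs_ob(2)[OF ts] by auto
  have t1: "tup C T ts \<in> homs C T (prd C ?As)" "\<And>j. j < length ts \<Longrightarrow> prj C ?As j \<odot> tup C T ts = ts ! j"
    using tup[of T ts ?As] homs_ob(2)[OF h] ts by auto
  have t2: "ts ! j \<odot> h \<in> homs C S (?As ! j)" if "j < length ts" for j
    using Comp_homs[OF _ h] ts that by auto
  then have t3: "tup C S (map (\<lambda>t. t \<odot> h) ts) \<in> homs C S (prd C ?As)"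
    "\<And>j. j < length ts \<Longrightarrow> prj C ?As j \<odot> tup C S (map (\<lambda>t. t \<odot> h) ts) = ts ! j \<odot> h"
    using tup[of S "map (\<lambda>t. t \<odot> h) ts" ?As] homs_ob(1)[OF h] by auto
  show "tup C T ts \<odot> h \<in> homs C S (prd C ?As)" using t1 h Comp_homs by blast
  show "tup C S (map (\<lambda>t. t \<odot> h) ts) \<in> homs C S (prd C ?As)" by fact
  fix j assume "j < length ?As"
  then show "prj C ?As j \<odot> tup C T ts \<odot> h = prj C ?As j \<odot> tup C S (map (\<lambda>t. t \<odot> h) ts)"
    using assoc[OF h t1(1) prj_in[OF As]] t1 t3 by simp
qed

lemma pt_terminal: "pt C \<in> Ob C" "X \<in> Ob C \<Longrightarrow> \<exists>!u. u \<in> homs C X (pt C)"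
  using prd_is_product[of "[]"] by (auto simp: is_product_def pt_def)

lemma pt_eqI: "f \<in> homs C X (pt C) \<Longrightarrow> g \<in> homs C X (pt C) \<Longrightarrow> f = g"
  using pt_terminal(2) homs_ob by blast

lemma bang_in: "X \<in> Ob C \<Longrightarrow> bang C X \<in> homs C X (pt C)"
  using tup_in[of X "[]" "[]"] by (simp add: bang_def pt_def)

lemma to_pt_cover: "f \<in> homs C X (pt C) \<Longrightarrow> f \<in> Cov"
proof -
  assume f: "f \<in> homs C X (pt C)"
  obtain Z where Z: "terminal C Z" "\<forall>X\<in>Ob C. homs C X Z \<subseteq> Cov" using A1 by blast
  obtain g where g: "g \<in> homs C X Z" using Z homs_ob(1)[OF f] by (auto simp: terminal_def)
  obtain h where h: "h \<in> homs C (pt C) Z" using Z pt_terminal by (auto simp: terminal_def)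
  have Zb: "bang C Z \<in> homs C Z (pt C)" using Z bang_in by (auto simp: terminal_def)
  have zeq: "k = k'" if "k \<in> homs C Y Z" "k' \<in> homs C Y Z" for k k' Y
    using that Z(1) homs_ob(1)[OF that(1)] unfolding terminal_def by blast
  have "bang C Z \<in> isos C"
  proof (rule isosI[OF Zb h])
    show "h \<odot> bang C Z = Ident C Z"
      by (rule zeq[OF Comp_homs[OF h Zb] Ident_homs[OF homs_ob(1)[OF Zb]]])
    show "bang C Z \<odot> h = Ident C (pt C)"
      by (rule pt_eqI[OF Comp_homs[OF Zb h] Ident_homs[OF pt_terminal(1)]])
  qed
  then have "bang C Z \<odot> g \<in> Cov" using stable_comp[OF stable_Cov isos_cover _ Zb g] g Z(2) homs_ob(1)[OF g] by blast
  then show ?thesis using pt_eqI[OF f Comp_homs[OF Zb g]] by simp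
qed

lemma binprod_prd: "A \<in> Ob C \<Longrightarrow> B \<in> Ob C \<Longrightarrow> binprod B A (prd C [B, A]) (prj C [B, A] 0) (prj C [B, A] 1)"
proof (rule binprodI)
  assume o: "A \<in> Ob C" "B \<in> Ob C"
  have As: "set [B, A] \<subseteq> Ob C" using o by auto
  show "prj C [B, A] 0 \<in> homs C (prd C [B, A]) B" "prj C [B, A] 1 \<in> homs C (prd C [B, A]) A"
    using prj_in[OF As] by force+
  show "\<exists>h. h \<in> homs C T (prd C [B, A]) \<and> prj C [B, A] 0 \<odot> h = x \<and> prj C [B, A] 1 \<odot> h = y"
    if T: "T \<in> Ob C" "x \<in> homs C T B" "y \<in> homs C T A" for T x y
  proof -
    have "\<And>j. j < length [B, A] \<Longrightarrow> [x, y] ! j \<in> homs C T ([B, A] ! j)" using T by (auto simp: less_Suc_eq)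
    from tup[OF T(1) _ this] show ?thesis by (intro exI[of _ "tup C T [x, y]"]) force
  qed
  show "h = h'" if "h \<in> homs C T (prd C [B, A])" "h' \<in> homs C T (prd C [B, A])"
    "prj C [B, A] 0 \<odot> h = prj C [B, A] 0 \<odot> h'" "prj C [B, A] 1 \<odot> h = prj C [B, A] 1 \<odot> h'" for T h h'
    by (rule prd_eqI[OF As that(1,2)]) (use that in \<open>auto simp: less_Suc_eq\<close>)
qed

lemma binprod_ex: "A \<in> Ob C \<Longrightarrow> B \<in> Ob C \<Longrightarrow> \<exists>P p q. binprod B A P p q"
  using binprod_prd by blast

lemma binprod_projection_cover:
  assumes W: "binprod B A W a b"
  shows "a \<in> Cov" "b \<in> Cov"
proof -
  note d = binprod_D(1-3)[OF W]
  have o: "A \<in> Ob C" "B \<in> Ob C" using d homs_ob by blast+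
  have eq: "bang C B \<odot> x = bang C A \<odot> y" if "x \<in> homs C T B" "y \<in> homs C T A" for x y T
    using pt_eqI Comp_homs bang_in o that by blast
  have "is_pullback C (bang C B) (bang C A) W a b" "is_pullback C (bang C A) (bang C B) W b a"
    unfolding is_pullback_def using d o bang_in eq[OF d(2,3)] homs_D[OF bang_in[OF o(1)]] homs_D[OF bang_in[OF o(2)]] W
    by (auto simp: binprod_def conj_commute)
  then show "a \<in> Cov" "b \<in> Cov" using A2_cover to_pt_cover bang_in o by blast+
qed

end

section \<open>Points of simplicial objects\<close>

context simplicial_set begin

text \<open>
  Maps that commute with faces and degeneracies commute with all operators.
\<close>

lemma operate_natural:
  assumes S': "simplicial_set S' d' s'" and f: "\<And>n x. x \<in> S n \<Longrightarrow> f n x \<in> S' n"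
    and fd: "\<And>n i x. x \<in> S (Suc n) \<Longrightarrow> i \<le> Suc n \<Longrightarrow> f n (d (Suc n) i x) = d' (Suc n) i (f (Suc n) x)"
    and fs: "\<And>n i x. x \<in> S n \<Longrightarrow> i \<le> n \<Longrightarrow> f (Suc n) (s n i x) = s' n i (f n x)"
  shows "\<theta> \<in> mono_lists m n \<Longrightarrow> x \<in> S n \<Longrightarrow> f m (operate n \<theta> x) = simplicial_set.operate d' s' n \<theta> (f n x)"
proof (induction "n + m" arbitrary: n m \<theta> x rule: less_induct)
  case less
  interpret S': simplicial_set S' d' s' by (rule S')
  have l: "length \<theta> = Suc m" using less by (auto simp: mono_lists_def)
  from less(2) show ?case
  proof (cases rule: mono_lists_cases)
    case (1 j)
    have "n \<noteq> 0" using 1 less(2) by (cases \<theta>) (auto simp: mono_lists_def)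
    then obtain n' where n': "n = Suc n'" by (cases n) auto
    have "f m (operate n' (map (shift j) \<theta>) (d n j x)) = S'.operate n' (map (shift j) \<theta>) (f n' (d n j x))"
      by (rule less(1)) (use n' 1 mono_shift[of \<theta> m n' j] less(2,3) d_in in auto)
    then show ?thesis using operate_missed[of \<theta> m n' x j] S'.operate_missed[of \<theta> m n' "f n x" j] 1 n' less f fd by simp
  next
    case (2 i)
    then obtain m' where m': "m = Suc m'" by (cases m) auto
    have e: "delete_at (Suc i) \<theta> \<in> mono_lists m' n" using mono_delete[of \<theta> m' n "Suc i"] 2 m' less by auto
    have "f m' (operate n (delete_at (Suc i) \<theta>) x) = S'.operate n (delete_at (Suc i) \<theta>) (f n x)"
      by (rule less(1)) (use m' e less(2,3) in auto)
    then show ?thesis using operate_repeat[of \<theta> m' n x i] S'.operate_repeat[of \<theta> m' n "f n x" i] 2 m' less f fs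
        operate_in[OF e less(3)] by simp
  next
    case 3 then show ?thesis using less(3) by (simp add: operate_id S'.operate_id del: upt_Suc)
  qed
qed

text \<open>
  A simplex of the union of faces that lies in the faces \<open>j\<close> and \<open>l\<close> lies in their intersection, where
  \<open>x\<^sub>j\<close> and \<open>x\<^sub>l\<close> agree.
\<close>

lemma matching_independent:
  assumes x: "matching S d (Suc k) J x" and J: "J \<subseteq> {..Suc k}" and \<sigma>: "\<sigma> \<in> mono_lists m (Suc k)"
    and j: "j \<in> J" "j \<notin> set \<sigma>" "l \<in> J" "l \<notin> set \<sigma>" "j < l"
  shows "operate k (map (shift j) \<sigma>) (x j) = operate k (map (shift l) \<sigma>) (x l)"
proof -
  have le: "l \<le> Suc k" "j \<le> Suc k" using j J by auto
  obtain v where v: "v \<in> set \<sigma>" "v \<le> Suc k" using \<sigma> by (cases \<sigma>) (auto simp: mono_lists_def)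
  then have "v \<noteq> j" "v \<noteq> l" using j by auto
  then obtain k' where k': "k = Suc k'" using v le j(5) by (cases k) auto
  have nk: "v \<noteq> l" "v \<noteq> j" if "v \<in> set \<sigma>" for v using that j by auto
  have xin: "x j \<in> S k" "x l \<in> S k" using x j by (auto simp: matching_def)
  have "shift j v \<noteq> l - 1" "shift l v \<noteq> j" if "v \<in> set \<sigma>" for v using nk[OF that] j(5) by (auto simp: shift_def)
  then have 1: "l - 1 \<notin> set (map (shift j) \<sigma>)" "j \<notin> set (map (shift l) \<sigma>)" by (metis (no_types, lifting) image_iff list.set_map)+
  have ml: "map (shift j) \<sigma> \<in> mono_lists m (Suc k')" "map (shift l) \<sigma> \<in> mono_lists m (Suc k')"
    using mono_shift[OF \<sigma>] le j k' by auto
  have "operate k (map (shift j) \<sigma>) (x j) = operate k' (map (shift (l - 1)) (map (shift j) \<sigma>)) (d k (l - 1) (x j))"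
    unfolding k' by (rule operate_missed[OF ml(1)]) (use k' le xin j(5) 1 in auto)
  moreover have "operate k (map (shift l) \<sigma>) (x l) = operate k' (map (shift j) (map (shift l) \<sigma>)) (d k j (x l))"
    unfolding k' by (rule operate_missed[OF ml(2)]) (use k' le xin j(5) 1 in auto)
  moreover have "d k j (x l) = d k (l - 1) (x j)" using x j by (auto simp: matching_def)
  moreover have "map (shift j) (map (shift l) \<sigma>) = map (shift (l - 1)) (map (shift j) \<sigma>)"
    using shift_shift[OF j(5)] nk by auto
  ultimately show ?thesis by (simp only:)
qed

lemma extend_matching:
  assumes x: "matching S d (Suc k) J x" and J: "J \<subseteq> {..Suc k}"
  shows "\<exists>t. \<forall>m \<sigma> j. \<sigma> \<in> mono_lists m (Suc k) \<longrightarrow> j \<in> J \<longrightarrow> j \<notin> set \<sigma> \<longrightarrow>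
    t m \<sigma> = operate k (map (shift j) \<sigma>) (x j)"
proof -
  define t where "t m \<sigma> = (let j = SOME j. j \<in> J \<and> j \<notin> set \<sigma> in operate k (map (shift j) \<sigma>) (x j))" for m :: nat and \<sigma>
  have "t m \<sigma> = operate k (map (shift j) \<sigma>) (x j)" if \<sigma>: "\<sigma> \<in> mono_lists m (Suc k)" "j \<in> J" "j \<notin> set \<sigma>" for m \<sigma> j
  proof -
    define l where "l = (SOME j. j \<in> J \<and> j \<notin> set \<sigma>)"
    have l: "l \<in> J" "l \<notin> set \<sigma>" using someI[of "\<lambda>j. j \<in> J \<and> j \<notin> set \<sigma>" j] that by (auto simp: l_def)
    consider "l = j" | "l < j" | "j < l" by linarith
    then have "operate k (map (shift l) \<sigma>) (x l) = operate k (map (shift j) \<sigma>) (x j)"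
      using matching_independent[OF x J \<sigma>(1)] l that by cases (blast, blast, metis)
    then show ?thesis by (simp add: t_def l_def Let_def)
  qed
  then show ?thesis by blast
qed

end

context category begin

lemma simplicial_object_ob: "simplicial_object C X \<Longrightarrow> ob X n \<in> Ob C"
  by (simp add: simplicial_object_def)

lemma fc_in:
  assumes X: "simplicial_object C X" and i: "i \<le> Suc n"
  shows "fc X (Suc n) i \<in> homs C (ob X (Suc n)) (ob X n)"
proof -
  have "\<forall>n>0. \<forall>i\<le>n. fc X n i \<in> homs C (ob X n) (ob X (n - 1))"
    using X unfolding simplicial_object_def by (elim conjE) assumption
  from this[rule_format, of "Suc n" i] i show ?thesis by simp
qed

lemma dg_in:
  assumes X: "simplicial_object C X" and i: "i \<le> n"
  shows "dg X n i \<in> homs C (ob X n) (ob X (Suc n))"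
proof -
  have "\<forall>n. \<forall>i\<le>n. dg X n i \<in> homs C (ob X n) (ob X (n + 1))"
    using X unfolding simplicial_object_def by (elim conjE) assumption
  from this[rule_format, of i n] i show ?thesis by simp
qed

lemma simplicial_set_points:
  assumes X: "simplicial_object C X"
  shows "simplicial_set (\<lambda>n. homs C T (ob X n)) (\<lambda>n i x. fc X n i \<odot> x) (\<lambda>n i x. dg X n i \<odot> x)"
proof -
  note f = fc_in[OF X] and g = dg_in[OF X]
  have ff: "fc X (Suc n) i \<odot> fc X (Suc (Suc n)) j = fc X (Suc n) (j - 1) \<odot> fc X (Suc (Suc n)) i"
    if "j \<le> Suc (Suc n)" "i < j" for n i j
  proof -
    have "\<forall>n>1. \<forall>j\<le>n. \<forall>i<j. fc X (n - 1) i \<odot> fc X n j = fc X (n - 1) (j - 1) \<odot> fc X n i"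
      using X unfolding simplicial_object_def by (elim conjE) assumption
    from this[rule_format, of "Suc (Suc n)" j i] that show ?thesis by simp
  qed
  have gg: "dg X (Suc n) i \<odot> dg X n j = dg X (Suc n) (Suc j) \<odot> dg X n i" if "j \<le> n" "i \<le> j" for n i j
  proof -
    have "\<forall>n. \<forall>j\<le>n. \<forall>i\<le>j. dg X (n + 1) i \<odot> dg X n j = dg X (n + 1) (j + 1) \<odot> dg X n i"
      using X unfolding simplicial_object_def by (elim conjE) assumption
    from this[rule_format, of j n i] that show ?thesis by simp
  qed
  have fg1: "fc X (Suc (Suc n)) i \<odot> dg X (Suc n) j = dg X n (j - 1) \<odot> fc X (Suc n) i" if "j \<le> Suc n" "i < j" for n i j
  proof -
    have "\<forall>n. \<forall>j\<le>n. \<forall>i<j. fc X (n + 1) i \<odot> dg X n j = dg X (n - 1) (j - 1) \<odot> fc X n i"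
      using X unfolding simplicial_object_def by (elim conjE) assumption
    from this[rule_format, of j "Suc n" i] that show ?thesis by simp
  qed
  have fg2: "fc X (Suc n) j \<odot> dg X n j = Ident C (ob X n)" "fc X (Suc n) (Suc j) \<odot> dg X n j = Ident C (ob X n)" if "j \<le> n" for n j
  proof -
    have "\<forall>n. \<forall>j\<le>n. fc X (n + 1) j \<odot> dg X n j = Ident C (ob X n) \<and> fc X (n + 1) (j + 1) \<odot> dg X n j = Ident C (ob X n)"
      using X unfolding simplicial_object_def by (elim conjE) assumption
    from this[rule_format, of j n] that show "fc X (Suc n) j \<odot> dg X n j = Ident C (ob X n)" "fc X (Suc n) (Suc j) \<odot> dg X n j = Ident C (ob X n)" by simp_all
  qed
  have fg3: "fc X (Suc (Suc n)) i \<odot> dg X (Suc n) j = dg X n j \<odot> fc X (Suc n) (i - 1)" if "i \<le> Suc (Suc n)" "Suc j < i" for n i j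
  proof -
    have "\<forall>n. \<forall>i\<le>n + 1. \<forall>j. j + 1 < i \<longrightarrow> fc X (n + 1) i \<odot> dg X n j = dg X (n - 1) j \<odot> fc X n (i - 1)"
      using X unfolding simplicial_object_def by (elim conjE) assumption
    from this[rule_format, of i "Suc n" j] that show ?thesis by simp
  qed
  show ?thesis
  proof
    fix x n i j assume "x \<in> homs C T (ob X (Suc (Suc n)))" "j \<le> Suc (Suc n)" "i < j"
    then show "fc X (Suc n) i \<odot> fc X (Suc (Suc n)) j \<odot> x = fc X (Suc n) (j - 1) \<odot> fc X (Suc (Suc n)) i \<odot> x"
      using assoc[of x _ _ "fc X (Suc (Suc n)) j" "ob X (Suc n)" "fc X (Suc n) i" "ob X n"]
        assoc[of x _ _ "fc X (Suc (Suc n)) i" "ob X (Suc n)" "fc X (Suc n) (j-1)" "ob X n"] f ff[of j n i] by simp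
  next
    fix x n i j assume "x \<in> homs C T (ob X n)" "j \<le> n" "i \<le> j"
    then show "dg X (Suc n) i \<odot> dg X n j \<odot> x = dg X (Suc n) (Suc j) \<odot> dg X n i \<odot> x"
      using assoc[of x _ _ "dg X n j" "ob X (Suc n)" "dg X (Suc n) i" "ob X (Suc (Suc n))"]
        assoc[of x _ _ "dg X n i" "ob X (Suc n)" "dg X (Suc n) (Suc j)" "ob X (Suc (Suc n))"] g gg[of j n i] by simp
  next
    fix x n i j assume "x \<in> homs C T (ob X (Suc n))" "j \<le> Suc n" "i < j"
    then show "fc X (Suc (Suc n)) i \<odot> dg X (Suc n) j \<odot> x = dg X n (j - 1) \<odot> fc X (Suc n) i \<odot> x"
      using assoc[of x _ _ "dg X (Suc n) j" "ob X (Suc (Suc n))" "fc X (Suc (Suc n)) i" "ob X (Suc n)"]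
        assoc[of x _ _ "fc X (Suc n) i" "ob X n" "dg X n (j-1)" "ob X (Suc n)"] f g fg1[of j n i] by simp
  next
    fix x n j assume "x \<in> homs C T (ob X n)" "j \<le> n"
    then show "fc X (Suc n) j \<odot> dg X n j \<odot> x = x" "fc X (Suc n) (Suc j) \<odot> dg X n j \<odot> x = x"
      using assoc[of x _ _ "dg X n j" "ob X (Suc n)" "fc X (Suc n) j" "ob X n"]
        assoc[of x _ _ "dg X n j" "ob X (Suc n)" "fc X (Suc n) (Suc j)" "ob X n"] f g fg2[of j n] Ident_left by simp_all
  next
    fix x n i j assume "x \<in> homs C T (ob X (Suc n))" "i \<le> Suc (Suc n)" "Suc j < i"
    then show "fc X (Suc (Suc n)) i \<odot> dg X (Suc n) j \<odot> x = dg X n j \<odot> fc X (Suc n) (i - 1) \<odot> x"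
      using assoc[of x _ _ "dg X (Suc n) j" "ob X (Suc (Suc n))" "fc X (Suc (Suc n)) i" "ob X (Suc n)"]
        assoc[of x _ _ "fc X (Suc n) (i-1)" "ob X n" "dg X n j" "ob X (Suc n)"] f g fg3[of i n j] by simp
  next
    fix x n i assume "x \<in> homs C T (ob X (Suc n))" "i \<le> Suc n"
    then show "fc X (Suc n) i \<odot> x \<in> homs C T (ob X n)" by (intro Comp_homs[OF f])
  next
    fix x n i assume "x \<in> homs C T (ob X n)" "i \<le> n"
    then show "dg X n i \<odot> x \<in> homs C T (ob X (Suc n))" by (intro Comp_homs[OF g])
  qed
qed

text \<open>
  The simplicial identities hold if they hold for points: apply the latter to identity arrows.
\<close>

lemma simplicial_objectI:
  assumes o: "\<And>n. ob X n \<in> Ob C"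
    and f: "\<And>n i. i \<le> Suc n \<Longrightarrow> fc X (Suc n) i \<in> homs C (ob X (Suc n)) (ob X n)"
    and g: "\<And>n i. i \<le> n \<Longrightarrow> dg X n i \<in> homs C (ob X n) (ob X (Suc n))"
    and s: "\<And>T. T \<in> Ob C \<Longrightarrow> simplicial_set (\<lambda>n. homs C T (ob X n)) (\<lambda>n i x. fc X n i \<odot> x) (\<lambda>n i x. dg X n i \<odot> x)"
  shows "simplicial_object C X"
proof -
  have S: "simplicial_set (\<lambda>m. homs C (ob X n) (ob X m)) (\<lambda>n i x. fc X n i \<odot> x) (\<lambda>n i x. dg X n i \<odot> x)" for n
    using s o by blast
  have I: "Ident C (ob X n) \<in> homs C (ob X n) (ob X n)" for n using Ident_homs o by blast
  have r: "fc X (Suc n) i \<odot> Ident C (ob X (Suc n)) = fc X (Suc n) i" if "i \<le> Suc n" for n i using Ident_right f that by blast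
  have r': "dg X n i \<odot> Ident C (ob X n) = dg X n i" if "i \<le> n" for n i using Ident_right g that by blast
  have h1: "fc X (n - 1) i \<odot> fc X n j = fc X (n - 1) (j - 1) \<odot> fc X n i" if ij: "1 < n" "j \<le> n" "i < j" for n i j
  proof -
    obtain m where m: "n = Suc (Suc m)" using less_imp_Suc_add[OF ij(1)] by auto
    show ?thesis using simplicial_set.dd[OF S[of "Suc (Suc m)"], of "Ident C (ob X (Suc (Suc m)))" m j i] I[of "Suc (Suc m)"] ij m r by simp
  qed
  have h2: "dg X (n + 1) i \<odot> dg X n j = dg X (n + 1) (j + 1) \<odot> dg X n i" if "j \<le> n" "i \<le> j" for n i j
    using simplicial_set.ss[OF S[of n], of "Ident C (ob X n)" n j i] I[of n] that r' by simp
  have h3: "fc X (n + 1) i \<odot> dg X n j = dg X (n - 1) (j - 1) \<odot> fc X n i" if ij: "j \<le> n" "i < j" for n i j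
  proof -
    obtain m where m: "n = Suc m" using ij by (cases n) auto
    show ?thesis using simplicial_set.ds_less[OF S[of n], of "Ident C (ob X n)" m j i] I[of n] ij m r r' by simp
  qed
  have h4: "fc X (n + 1) j \<odot> dg X n j = Ident C (ob X n)" "fc X (n + 1) (j + 1) \<odot> dg X n j = Ident C (ob X n)"
    if "j \<le> n" for n j
    using simplicial_set.ds_same[OF S[of n], of "Ident C (ob X n)" n j] simplicial_set.ds_Suc[OF S[of n], of "Ident C (ob X n)" n j] I[of n] that r' by simp_all
  have h5: "fc X (n + 1) i \<odot> dg X n j = dg X (n - 1) j \<odot> fc X n (i - 1)" if ij: "i \<le> n + 1" "j + 1 < i" for n i j
  proof -
    obtain m where m: "n = Suc m" using ij by (cases n) auto
    show ?thesis using simplicial_set.ds_greater[OF S[of n], of "Ident C (ob X n)" m i j] I[of n] ij m r r' by simp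
  qed
  have h6: "fc X n i \<in> homs C (ob X n) (ob X (n - 1))" if "0 < n" "i \<le> n" for n i
    using f[of i "n - 1"] that by simp
  have h7: "dg X n i \<in> homs C (ob X n) (ob X (n + 1))" if "i \<le> n" for n i using g that by simp
  show ?thesis unfolding simplicial_object_def
  proof (intro conjI allI impI)
    show "ob X n \<in> Ob C" for n by (rule o)
  qed (fact h1 h2 h3 h4 h5 h6 h7)+
qed

lemma faces_op:
  assumes X: "simplicial_object C X"
  shows "sorted_wrt (>) js \<Longrightarrow> \<forall>j\<in>set js. j \<le> n \<Longrightarrow> length js \<le> n \<Longrightarrow>
    faces_op C X n js \<in> homs C (ob X n) (ob X (n - length js)) \<and>
    (\<forall>T x. x \<in> homs C T (ob X n) \<longrightarrow> faces_op C X n js \<odot> x = simplicial_set.faces (\<lambda>n i x. fc X n i \<odot> x) n js x)"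
proof (induction js arbitrary: n)
  case Nil
  interpret simplicial_set "\<lambda>n. homs C undefined (ob X n)" "\<lambda>n i x. fc X n i \<odot> x" "\<lambda>n i x. dg X n i \<odot> x"
    by (rule simplicial_set_points[OF X])
  show ?case using Ident_homs simplicial_object_ob[OF X] Ident_left by auto
next
  case (Cons j js)
  interpret simplicial_set "\<lambda>n. homs C undefined (ob X n)" "\<lambda>n i x. fc X n i \<odot> x" "\<lambda>n i x. dg X n i \<odot> x"
    by (rule simplicial_set_points[OF X])
  obtain n' where n': "n = Suc n'" using Cons(4) by (cases n) auto
  have v: "sorted_wrt (>) js" "\<forall>j\<in>set js. j \<le> n'" "length js \<le> n'" using Cons n' by auto
  have IH: "faces_op C X n' js \<in> homs C (ob X n') (ob X (n' - length js))"
    "\<And>T x. x \<in> homs C T (ob X n') \<Longrightarrow> faces_op C X n' js \<odot> x = faces n' js x" using Cons(1)[OF v] by auto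
  have j: "fc X n j \<in> homs C (ob X n) (ob X n')" using fc_in[OF X] Cons n' by auto
  have "(faces_op C X n' js \<odot> fc X n j) \<odot> x = faces n' js (fc X n j \<odot> x)" if "x \<in> homs C T (ob X n)" for T x
    using assoc[OF that j IH(1)] IH(2)[OF Comp_homs[OF j that]] by simp
  then show ?case using n' Comp_homs[OF IH(1) j] by simp
qed

text \<open>
  Since the \<open>r\<close>-th of the repeated positions is less than the final dimension minus the number of those after
  it, each degeneracy in the normal form is applied in a dimension where it exists.
\<close>

lemma strict_bound: "sorted_wrt (<) (i # is) \<Longrightarrow> \<forall>j\<in>set (i # is). j < N \<Longrightarrow> i + length is < (N::nat)"
proof (induction "is" arbitrary: i)
  case (Cons j "is")
  then have "j + length is < N" "i < j" by auto
  then show ?case by simp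
qed simp

lemma degens_op:
  assumes X: "simplicial_object C X"
  shows "sorted_wrt (<) is \<Longrightarrow> \<forall>i\<in>set is. i < n + length is \<Longrightarrow>
    degens_op C X n is \<in> homs C (ob X n) (ob X (n + length is)) \<and>
    (\<forall>T x. x \<in> homs C T (ob X n) \<longrightarrow> degens_op C X n is \<odot> x = simplicial_set.degens (\<lambda>n i x. dg X n i \<odot> x) n is x)"
proof (induction "is" arbitrary: n)
  case Nil
  interpret simplicial_set "\<lambda>n. homs C undefined (ob X n)" "\<lambda>n i x. fc X n i \<odot> x" "\<lambda>n i x. dg X n i \<odot> x"
    by (rule simplicial_set_points[OF X])
  show ?case using Ident_homs simplicial_object_ob[OF X] Ident_left by auto
next
  case (Cons i "is")
  interpret simplicial_set "\<lambda>n. homs C undefined (ob X n)" "\<lambda>n i x. fc X n i \<odot> x" "\<lambda>n i x. dg X n i \<odot> x"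
    by (rule simplicial_set_points[OF X])
  have "i \<le> n" using strict_bound[OF Cons(2,3)] by simp
  then have j: "dg X n i \<in> homs C (ob X n) (ob X (Suc n))" using dg_in[OF X] by auto
  have v: "sorted_wrt (<) is" "\<forall>j\<in>set is. j < Suc n + length is" using Cons by auto
  have IH: "degens_op C X (Suc n) is \<in> homs C (ob X (Suc n)) (ob X (Suc n + length is))"
    "\<And>T x. x \<in> homs C T (ob X (Suc n)) \<Longrightarrow> degens_op C X (Suc n) is \<odot> x = degens (Suc n) is x" using Cons(1)[OF v] by auto
  have "(degens_op C X (Suc n) is \<odot> dg X n i) \<odot> x = degens (Suc n) is (dg X n i \<odot> x)" if "x \<in> homs C T (ob X n)" for T x
    using assoc[OF that j IH(1)] IH(2)[OF Comp_homs[OF j that]] by simp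
  then show ?case using Comp_homs[OF IH(1) j] by simp
qed

lemma sop_operate:
  assumes X: "simplicial_object C X" and \<theta>: "\<theta> \<in> mono_lists m n"
  shows sop_in: "sop C X n \<theta> \<in> homs C (ob X n) (ob X m)"
    and sop_comp: "x \<in> homs C T (ob X n) \<Longrightarrow>
      sop C X n \<theta> \<odot> x = simplicial_set.operate (\<lambda>n i x. fc X n i \<odot> x) (\<lambda>n i x. dg X n i \<odot> x) n \<theta> x"
proof -
  let ?js = "rev (missed n \<theta>)" and ?n = "card (set \<theta>) - 1"
  have s: "sop C X n \<theta> = degens_op C X ?n (repeats \<theta>) \<odot> faces_op C X n ?js"
    by (simp add: sop_def repeats_def missed_def)
  have l: "set \<theta> \<subseteq> {..n}" "set \<theta> \<noteq> {}" "length \<theta> = Suc m" using \<theta> by (auto simp: mono_lists_def)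
  have c0: "card (set \<theta>) > 0" using l by (simp add: card_gt_0_iff)
  have ms: "set (missed n \<theta>) = {..n} - set \<theta>" by (auto simp: missed_def less_Suc_eq_le simp del: upt_Suc)
  have dm: "distinct (missed n \<theta>)" by (simp add: missed_def del: upt_Suc)
  have "length (missed n \<theta>) = card ({..n} - set \<theta>)" using distinct_card[OF dm] ms by simp
  then have len: "length ?js = Suc n - card (set \<theta>)" using l card_Diff_subset[of "set \<theta>" "{..n}"] by simp
  have cn: "card (set \<theta>) \<le> Suc n" using card_mono[OF _ l(1)] by simp
  have "sorted_wrt (>) ?js" unfolding sorted_wrt_rev missed_def by (intro sorted_wrt_filter) (simp add: sorted_wrt_upt del: upt_Suc)
  then have F: "faces_op C X n ?js \<in> homs C (ob X n) (ob X ?n)"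
    "\<And>T x. x \<in> homs C T (ob X n) \<Longrightarrow> faces_op C X n ?js \<odot> x = simplicial_set.faces (\<lambda>n i x. fc X n i \<odot> x) n ?js x"
    using faces_op[OF X, of ?js n] ms len c0 cn by auto
  have r: "?n + length (repeats \<theta>) = m" using card_repeats[OF \<theta>] c0 by simp
  have "sorted_wrt (<) (repeats \<theta>)" unfolding repeats_def by (intro sorted_wrt_filter) (simp add: sorted_wrt_upt)
  moreover have "\<forall>i\<in>set (repeats \<theta>). i < m" using l by (auto simp: repeats_def)
  ultimately have D: "degens_op C X ?n (repeats \<theta>) \<in> homs C (ob X ?n) (ob X m)"
    "\<And>T x. x \<in> homs C T (ob X ?n) \<Longrightarrow> degens_op C X ?n (repeats \<theta>) \<odot> x = simplicial_set.degens (\<lambda>n i x. dg X n i \<odot> x) ?n (repeats \<theta>) x"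
    using degens_op[OF X, of "repeats \<theta>" ?n] r by auto
  show "sop C X n \<theta> \<in> homs C (ob X n) (ob X m)" unfolding s using D F Comp_homs by blast
  interpret simplicial_set "\<lambda>n. homs C T (ob X n)" "\<lambda>n i x. fc X n i \<odot> x" "\<lambda>n i x. dg X n i \<odot> x"
    by (rule simplicial_set_points[OF X])
  show "x \<in> homs C T (ob X n) \<Longrightarrow>
      sop C X n \<theta> \<odot> x = operate n \<theta> x"
    unfolding s operate_def using assoc[OF _ F(1) D(1)] F(2) D(2)[OF Comp_homs[OF F(1)]] by simp
qed

end

section \<open>Horns as compatible families of faces\<close>

context category begin

lemma sop_id:
  assumes X: "simplicial_object C X" and x: "x \<in> homs C T (ob X n)"
  shows "sop C X n [0..<Suc n] \<odot> x = x"
proof -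
  interpret simplicial_set "\<lambda>n. homs C T (ob X n)" "\<lambda>n i x. fc X n i \<odot> x" "\<lambda>n i x. dg X n i \<odot> x"
    by (rule simplicial_set_points[OF X])
  show ?thesis using sop_comp[OF X mono_id x] operate_id by simp
qed

lemma sop_face:
  assumes X: "simplicial_object C X" and x: "x \<in> homs C T (ob X (Suc n))" and j: "j \<le> Suc n"
  shows "sop C X (Suc n) (delete_at j [0..<Suc (Suc n)]) \<odot> x = fc X (Suc n) j \<odot> x"
proof -
  interpret simplicial_set "\<lambda>n. homs C T (ob X n)" "\<lambda>n i x. fc X n i \<odot> x" "\<lambda>n i x. dg X n i \<odot> x"
    by (rule simplicial_set_points[OF X])
  show ?thesis using sop_comp[OF X delete_id(1)[OF j] x] d_operate[OF mono_id x j] operate_id[of "Suc n" x]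
    by (simp del: upt_Suc)
qed

lemma sop_sop:
  assumes X: "simplicial_object C X" and x: "x \<in> homs C T (ob X n)" and m: "\<theta> \<in> mono_lists p m" "\<sigma> \<in> mono_lists m n"
  shows "sop C X m \<theta> \<odot> sop C X n \<sigma> \<odot> x = sop C X n (map (\<lambda>a. \<sigma> ! a) \<theta>) \<odot> x"
proof -
  interpret simplicial_set "\<lambda>n. homs C T (ob X n)" "\<lambda>n i x. fc X n i \<odot> x" "\<lambda>n i x. dg X n i \<odot> x"
    by (rule simplicial_set_points[OF X])
  show ?thesis using operate_operate[OF m x] sop_comp[OF X m(2) x] sop_comp[OF X mono_comp[OF m] x]
    sop_comp[OF X m(1), of "operate n \<sigma> x" T] operate_in[OF m(2) x] by simp
qed

lemma sop_missed:
  assumes X: "simplicial_object C X" and x: "x \<in> homs C T (ob X (Suc n))" and s: "\<sigma> \<in> mono_lists m (Suc n)"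
    and j: "j \<le> Suc n" "j \<notin> set \<sigma>"
  shows "sop C X (Suc n) \<sigma> \<odot> x = sop C X n (map (shift j) \<sigma>) \<odot> fc X (Suc n) j \<odot> x"
proof -
  interpret simplicial_set "\<lambda>n. homs C T (ob X n)" "\<lambda>n i x. fc X n i \<odot> x" "\<lambda>n i x. dg X n i \<odot> x"
    by (rule simplicial_set_points[OF X])
  show ?thesis using operate_missed[OF s x j] sop_comp[OF X s x] sop_comp[OF X mono_shift[OF s j] d_in[OF x j(1)]] by simp
qed

lemma simplicial_mapD:
  assumes f: "simplicial_map C X Y f"
  shows "f n \<in> homs C (ob X n) (ob Y n)"
    "i \<le> Suc n \<Longrightarrow> f n \<odot> fc X (Suc n) i = fc Y (Suc n) i \<odot> f (Suc n)"
    "i \<le> n \<Longrightarrow> f (Suc n) \<odot> dg X n i = dg Y n i \<odot> f n"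
proof -
  have a: "\<forall>n. f n \<in> homs C (ob X n) (ob Y n)" "\<forall>n>0. \<forall>i\<le>n. f (n - 1) \<odot> fc X n i = fc Y n i \<odot> f n"
    "\<forall>n. \<forall>i\<le>n. f (n + 1) \<odot> dg X n i = dg Y n i \<odot> f n"
    using f[unfolded simplicial_map_def, THEN conjunct1] f[unfolded simplicial_map_def, THEN conjunct2, THEN conjunct1]
      f[unfolded simplicial_map_def, THEN conjunct2, THEN conjunct2] .
  show "f n \<in> homs C (ob X n) (ob Y n)" using a(1) by blast
  show "i \<le> Suc n \<Longrightarrow> f n \<odot> fc X (Suc n) i = fc Y (Suc n) i \<odot> f (Suc n)" using a(2)[rule_format, of "Suc n" i] by simp
  show "i \<le> n \<Longrightarrow> f (Suc n) \<odot> dg X n i = dg Y n i \<odot> f n" using a(3)[rule_format, of i n] by simp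
qed

lemma map_fc:
  assumes X: "simplicial_object C X" and Y: "simplicial_object C Y" and f: "simplicial_map C X Y f"
    and x: "x \<in> homs C T (ob X (Suc n))" "i \<le> Suc n"
  shows "f n \<odot> fc X (Suc n) i \<odot> x = fc Y (Suc n) i \<odot> f (Suc n) \<odot> x"
  using assoc[OF x(1) fc_in[OF X x(2)] simplicial_mapD(1)[OF f]] simplicial_mapD(2)[OF f x(2)]
    assoc[OF x(1) simplicial_mapD(1)[OF f] fc_in[OF Y x(2)]] by simp

lemma map_dg:
  assumes X: "simplicial_object C X" and Y: "simplicial_object C Y" and f: "simplicial_map C X Y f"
    and x: "x \<in> homs C T (ob X n)" "i \<le> n"
  shows "f (Suc n) \<odot> dg X n i \<odot> x = dg Y n i \<odot> f n \<odot> x"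
  using assoc[OF x(1) dg_in[OF X x(2)] simplicial_mapD(1)[OF f]] simplicial_mapD(3)[OF f x(2)]
    assoc[OF x(1) simplicial_mapD(1)[OF f] dg_in[OF Y x(2)]] by simp

lemma sop_natural:
  assumes X: "simplicial_object C X" and Y: "simplicial_object C Y" and f: "simplicial_map C X Y f"
    and x: "x \<in> homs C T (ob X n)" and s: "\<theta> \<in> mono_lists m n"
  shows "f m \<odot> sop C X n \<theta> \<odot> x = sop C Y n \<theta> \<odot> f n \<odot> x"
proof -
  interpret simplicial_set "\<lambda>n. homs C T (ob X n)" "\<lambda>n i x. fc X n i \<odot> x" "\<lambda>n i x. dg X n i \<odot> x"
    by (rule simplicial_set_points[OF X])
  have "f m \<odot> operate n \<theta> x = simplicial_set.operate (\<lambda>n i x. fc Y n i \<odot> x) (\<lambda>n i x. dg Y n i \<odot> x) n \<theta> (f n \<odot> x)"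
    by (rule operate_natural[OF simplicial_set_points[OF Y], of "\<lambda>n x. f n \<odot> x"])
      (use Comp_homs[OF simplicial_mapD(1)[OF f]] map_fc[OF X Y f] map_dg[OF X Y f] s x in auto)
  then show ?thesis using sop_comp[OF X s x] sop_comp[OF Y s Comp_homs[OF simplicial_mapD(1)[OF f] x]] by simp
qed

definition abs_horn :: "('o, 'm, 'z) sobj_scheme \<Rightarrow> nat \<Rightarrow> nat set \<Rightarrow> 'o \<Rightarrow> (nat \<Rightarrow> 'm) \<Rightarrow> bool" where
  "abs_horn X k J T = matching (\<lambda>n. homs C T (ob X n)) (\<lambda>n i x. fc X n i \<odot> x) k J"

text \<open>
  The points of \<open>\<Lambda>\<^sup>k\<^sub>J(f)\<close>: the index \<open>None\<close> carries the simplex of \<open>Y\<close>, the index \<open>Some j\<close> the face \<open>j\<close>.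
\<close>

definition rel_horn :: "('o, 'm, 'y) sobj_scheme \<Rightarrow> ('o, 'm, 'z) sobj_scheme \<Rightarrow> (nat \<Rightarrow> 'm) \<Rightarrow> nat \<Rightarrow> nat set \<Rightarrow>
    'o \<Rightarrow> (nat option \<Rightarrow> 'm) \<Rightarrow> bool" where
  "rel_horn X Y f k J T z \<longleftrightarrow> abs_horn X k J T (\<lambda>j. z (Some j)) \<and> z None \<in> homs C T (ob Y k) \<and>
     (\<forall>j\<in>J. f (k - 1) \<odot> z (Some j) = fc Y k j \<odot> z None)"

text \<open>
  These two say that \<open>\<Lambda>\<^sup>k\<^sub>i\<close> exists and that \<open>\<lambda>\<^sup>k\<^sub>i\<close> is in \<open>K\<close>, for \<open>X\<close> and for \<open>f\<close>.
\<close>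

abbreviation horn_fills :: "'m set \<Rightarrow> ('o, 'm, 'z) sobj_scheme \<Rightarrow> nat \<Rightarrow> nat \<Rightarrow> bool" where
  "horn_fills K X k i \<equiv> classified K ({..k} - {i}) (abs_horn X k ({..k} - {i})) (ob X k) (fc X k)"

abbreviation rel_horn_fills :: "'m set \<Rightarrow> ('o, 'm, 'y) sobj_scheme \<Rightarrow> ('o, 'm, 'z) sobj_scheme \<Rightarrow>
    (nat \<Rightarrow> 'm) \<Rightarrow> nat \<Rightarrow> nat \<Rightarrow> bool" where
  "rel_horn_fills K X Y f k i \<equiv> classified K (insert None (Some ` ({..k} - {i}))) (rel_horn X Y f k ({..k} - {i}))
     (ob X k) (\<lambda>l. case l of None \<Rightarrow> f k | Some j \<Rightarrow> fc X k j)"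

lemma matching_pair:
  assumes "J \<subset> {..Suc k}" "a \<in> J" "b \<in> J" "a < b"
  obtains k' where "k = Suc k'" "a \<le> k" "b - 1 \<le> k"
proof -
  obtain i where "i \<le> Suc k" "i \<notin> J" using assms(1) by auto
  then have "i \<noteq> a" "i \<noteq> b" using assms by auto
  moreover have "b \<le> Suc k" using assms by auto
  ultimately have "k \<noteq> 0" using \<open>i \<le> Suc k\<close> assms(4) by (auto simp: le_Suc_eq)
  then show ?thesis using that[of "k - 1"] \<open>b \<le> Suc k\<close> assms(4) by simp
qed

lemma presheaf_abs_horn:
  assumes X: "simplicial_object C X" and J: "J \<subset> {..Suc k}"
  shows "presheaf J (abs_horn X (Suc k) J)"
  unfolding presheaf_def
proof (intro conjI allI impI ballI)
  fix T x j assume "abs_horn X (Suc k) J T x" "j \<in> J"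
  then have "x j \<in> homs C T (ob X k)" by (auto simp: abs_horn_def matching_def)
  then show "x j \<in> Ar C" "Dom C (x j) = T" using homs_D by blast+
next
  fix T S x h assume x: "abs_horn X (Suc k) J T x" and h: "h \<in> homs C S T"
  have xin: "x j \<in> homs C T (ob X k)" if "j \<in> J" for j using x that by (auto simp: abs_horn_def matching_def)
  have "fc X k a \<odot> x b \<odot> h = fc X k (b - 1) \<odot> x a \<odot> h" if ab: "a \<in> J" "b \<in> J" "a < b" for a b
  proof -
    obtain k' where k': "k = Suc k'" "a \<le> k" "b - 1 \<le> k" using matching_pair[OF J ab] .
    have "fc X k a \<odot> x b = fc X k (b - 1) \<odot> x a" using x ab by (auto simp: abs_horn_def matching_def)
    then show ?thesis using assoc[OF h xin[OF ab(2)], of "fc X k a"] assoc[OF h xin[OF ab(1)], of "fc X k (b - 1)"]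
        fc_in[OF X, of _ k'] k' by metis
  qed
  then show "abs_horn X (Suc k) J S (\<lambda>j. x j \<odot> h)"
    using Comp_homs[OF xin h] by (simp add: abs_horn_def matching_def)
qed

lemma presheaf_rel_horn:
  assumes X: "simplicial_object C X" and Y: "simplicial_object C Y" and f: "simplicial_map C X Y f" and J: "J \<subset> {..Suc k}"
  shows "presheaf (insert None (Some ` J)) (rel_horn X Y f (Suc k) J)"
  unfolding presheaf_def
proof (intro conjI allI impI ballI)
  fix T x j assume x: "rel_horn X Y f (Suc k) J T x" and j: "j \<in> insert None (Some ` J)"
  have "\<exists>A. x j \<in> homs C T A" using x j by (auto simp: rel_horn_def abs_horn_def matching_def)
  then show "x j \<in> Ar C" "Dom C (x j) = T" using homs_D by blast+
next
  fix T S x h assume x: "rel_horn X Y f (Suc k) J T x" and h: "h \<in> homs C S T"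
  have xin: "x (Some j) \<in> homs C T (ob X k)" if "j \<in> J" for j using x that by (auto simp: rel_horn_def abs_horn_def matching_def)
  have y: "x None \<in> homs C T (ob Y (Suc k))" using x by (simp add: rel_horn_def)
  have "f k \<odot> x (Some j) \<odot> h = fc Y (Suc k) j \<odot> x None \<odot> h" if "j \<in> J" for j
  proof -
    have "j \<le> Suc k" using that J by auto
    moreover have "f k \<odot> x (Some j) = fc Y (Suc k) j \<odot> x None" using x that by (simp add: rel_horn_def)
    ultimately show ?thesis using assoc[OF h xin[OF that] simplicial_mapD(1)[OF f]] assoc[OF h y fc_in[OF Y]] by metis
  qed
  then show "rel_horn X Y f (Suc k) J S (\<lambda>j. x j \<odot> h)"
    using x presheaf_comp[OF presheaf_abs_horn[OF X J], of T "\<lambda>j. x (Some j)" h S] h Comp_homs[OF y h]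
    by (simp add: rel_horn_def)
qed

lemma horn_cells: "\<sigma> \<in> cells (horn k i) m \<longleftrightarrow> \<sigma> \<in> mono_lists m k \<and> (\<exists>j\<in>{..k} - {i}. j \<notin> set \<sigma>)"
  by (auto simp: horn_def)

lemma horn_restr: "restr (horn k i) \<theta> \<sigma> = map (\<lambda>a. \<sigma> ! a) \<theta>"
  by (simp add: horn_def)

text \<open>
  A simplex of the horn lies in some face \<open>j\<close>, and \<open>x\<^sub>j\<close> determines the cone there.
\<close>

lemma horn_coneI:
  assumes X: "simplicial_object C X" and Y: "simplicial_object C Y" and f: "simplicial_map C X Y f"
    and T: "T \<in> Ob C" and z: "rel_horn X Y f (Suc k) ({..Suc k} - {i}) T z"
    and t: "\<And>m \<sigma> j. \<sigma> \<in> mono_lists m (Suc k) \<Longrightarrow> j \<in> {..Suc k} - {i} \<Longrightarrow> j \<notin> set \<sigma> \<Longrightarrow>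
      t m \<sigma> = sop C X k (map (shift j) \<sigma>) \<odot> z (Some j)"
  shows "horn_cone C X Y f (Suc k) i T t (z None)"
proof -
  have zin: "z (Some j) \<in> homs C T (ob X k)" if "j \<in> {..Suc k} - {i}" for j
    using z that by (auto simp: rel_horn_def abs_horn_def matching_def)
  have y: "z None \<in> homs C T (ob Y (Suc k))" using z by (simp add: rel_horn_def)
  have "t m \<sigma> \<in> homs C T (ob X m)" if \<sigma>: "\<sigma> \<in> cells (horn (Suc k) i) m" for m \<sigma>
  proof -
    obtain j where j: "\<sigma> \<in> mono_lists m (Suc k)" "j \<in> {..Suc k} - {i}" "j \<notin> set \<sigma>" using \<sigma> horn_cells by blast
    then have "map (shift j) \<sigma> \<in> mono_lists m k" using mono_shift by auto
    from Comp_homs[OF sop_in[OF X this] zin[OF j(2)]] show ?thesis using t[OF j] by simp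
  qed
  moreover have "sop C X m \<theta> \<odot> t m \<sigma> = t m' (restr (horn (Suc k) i) \<theta> \<sigma>)"
    if \<sigma>: "\<sigma> \<in> cells (horn (Suc k) i) m" and \<theta>: "\<theta> \<in> mono_lists m' m" for m m' \<sigma> \<theta>
  proof -
    obtain j where j: "\<sigma> \<in> mono_lists m (Suc k)" "j \<in> {..Suc k} - {i}" "j \<notin> set \<sigma>" using \<sigma> horn_cells by blast
    then have s: "map (shift j) \<sigma> \<in> mono_lists m k" using mono_shift by auto
    have lt: "a < length \<sigma>" if "a \<in> set \<theta>" for a using \<theta> j(1) that by (auto simp: mono_lists_def)
    have "sop C X m \<theta> \<odot> t m \<sigma> = sop C X k (map (\<lambda>a. map (shift j) \<sigma> ! a) \<theta>) \<odot> z (Some j)"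
      using sop_sop[OF X zin[OF j(2)] \<theta> s] t[OF j] by simp
    also have "map (\<lambda>a. map (shift j) \<sigma> ! a) \<theta> = map (shift j) (map (\<lambda>a. \<sigma> ! a) \<theta>)"
      using lt by simp
    also have "j \<notin> set (map (\<lambda>a. \<sigma> ! a) \<theta>)" using lt j(3) nth_mem[of _ \<sigma>] by auto
    then have "sop C X k (map (shift j) (map (\<lambda>a. \<sigma> ! a) \<theta>)) \<odot> z (Some j) = t m' (map (\<lambda>a. \<sigma> ! a) \<theta>)"
      using t[OF mono_comp[OF \<theta> j(1)] j(2)] by simp
    finally show ?thesis by (simp add: horn_restr)
  qed
  moreover have "f m \<odot> t m \<sigma> = sop C Y (Suc k) \<sigma> \<odot> z None" if \<sigma>: "\<sigma> \<in> cells (horn (Suc k) i) m" for m \<sigma>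
  proof -
    obtain j where j: "\<sigma> \<in> mono_lists m (Suc k)" "j \<in> {..Suc k} - {i}" "j \<notin> set \<sigma>" using \<sigma> horn_cells by blast
    then have s: "map (shift j) \<sigma> \<in> mono_lists m k" using mono_shift by auto
    have "f m \<odot> t m \<sigma> = sop C Y k (map (shift j) \<sigma>) \<odot> f k \<odot> z (Some j)"
      using sop_natural[OF X Y f zin[OF j(2)] s] t[OF j] by simp
    also have "f k \<odot> z (Some j) = fc Y (Suc k) j \<odot> z None" using z j(2) by (simp add: rel_horn_def)
    also have "sop C Y k (map (shift j) \<sigma>) \<odot> fc Y (Suc k) j \<odot> z None = sop C Y (Suc k) \<sigma> \<odot> z None"
      using sop_missed[OF Y y j(1) _ j(3)] j(2) by simp
    finally show ?thesis .
  qed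
  ultimately show ?thesis using T y by (simp add: horn_cone_def hom_cone_def)
qed

text \<open>
  Conversely, a cone is determined by its values at the faces \<open>[0, \<dots>, j-1, j+1, \<dots>, k]\<close>.
\<close>

lemma horn_coneD:
  assumes X: "simplicial_object C X" and Y: "simplicial_object C Y" and f: "simplicial_map C X Y f"
    and i: "i \<le> Suc k" and c: "horn_cone C X Y f (Suc k) i T t y"
  defines "z \<equiv> \<lambda>l. case l of None \<Rightarrow> y | Some j \<Rightarrow> t k (delete_at j [0..<Suc (Suc k)])"
  shows "rel_horn X Y f (Suc k) ({..Suc k} - {i}) T z"
    and "\<And>m \<sigma> j. \<sigma> \<in> mono_lists m (Suc k) \<Longrightarrow> j \<in> {..Suc k} - {i} \<Longrightarrow> j \<notin> set \<sigma> \<Longrightarrow>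
      t m \<sigma> = sop C X k (map (shift j) \<sigma>) \<odot> z (Some j)"
proof -
  let ?J = "{..Suc k} - {i}" and ?\<delta> = "\<lambda>j. delete_at j [0..<Suc (Suc k)]"
  have J: "?J \<subset> {..Suc k}" using i by auto
  have y: "y \<in> homs C T (ob Y (Suc k))" using c by (simp add: horn_cone_def)
  have \<delta>: "?\<delta> j \<in> cells (horn (Suc k) i) k" if "j \<in> ?J" for j
    using that delete_id[of j k] by (auto simp: horn_cells simp del: upt_Suc)
  have tin: "t m \<sigma> \<in> homs C T (ob X m)" if "\<sigma> \<in> cells (horn (Suc k) i) m" for m \<sigma>
    using c that by (simp add: horn_cone_def hom_cone_def)
  have law: "sop C X m \<theta> \<odot> t m \<sigma> = t m' (map (\<lambda>a. \<sigma> ! a) \<theta>)"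
    if "\<sigma> \<in> cells (horn (Suc k) i) m" "\<theta> \<in> mono_lists m' m" for m m' \<sigma> \<theta>
    using c that by (simp add: horn_cone_def hom_cone_def horn_restr)
  have ft: "f m \<odot> t m \<sigma> = sop C Y (Suc k) \<sigma> \<odot> y" if "\<sigma> \<in> cells (horn (Suc k) i) m" for m \<sigma>
    using c that by (simp add: horn_cone_def)
  have "fc X k a \<odot> t k (?\<delta> b) = fc X k (b - 1) \<odot> t k (?\<delta> a)" if ab: "a \<in> ?J" "b \<in> ?J" "a < b" for a b
  proof -
    obtain k' where k': "k = Suc k'" "a \<le> k" "b - 1 \<le> k" using matching_pair[OF J ab] .
    have *: "fc X k p \<odot> t k (?\<delta> q) = t k' (delete_at p (?\<delta> q))" if pq: "p \<le> k" "q \<in> ?J" for p q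
    proof -
      have l: "length (?\<delta> q) = Suc k" using delete_id(1)[of q k] pq by (simp add: mono_lists_def)
      have "fc X k p \<odot> t k (?\<delta> q) = sop C X k (delete_at p [0..<Suc k]) \<odot> t k (?\<delta> q)"
        using sop_face[OF X, of "t k (?\<delta> q)" T k' p] tin[OF \<delta>[OF pq(2)]] k' pq by (simp del: upt_Suc)
      also have "\<dots> = t k' (map (\<lambda>a. ?\<delta> q ! a) (delete_at p [0..<Suc k]))"
        using law[OF \<delta>[OF pq(2)], of "delete_at p [0..<Suc k]" k'] delete_id(1)[of p k'] pq k' by (simp del: upt_Suc)
      also have "map (\<lambda>a. ?\<delta> q ! a) (delete_at p [0..<Suc k]) = delete_at p (?\<delta> q)"
        unfolding map_delete_at using map_nth[of "?\<delta> q"] l by (simp del: upt_Suc)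
      finally show ?thesis .
    qed
    have "delete_at a (?\<delta> b) = delete_at (b - 1) (?\<delta> a)"
      by (rule nth_equalityI) (use ab k' in \<open>auto simp: length_delete_at nth_delete_at simp del: upt_Suc\<close>)
    then show ?thesis using *[OF k'(2) ab(2)] *[OF k'(3) ab(1)] by simp
  qed
  then have "abs_horn X (Suc k) ?J T (\<lambda>j. z (Some j))"
    using tin[OF \<delta>] by (simp add: abs_horn_def matching_def z_def del: upt_Suc)
  moreover have "f k \<odot> t k (?\<delta> j) = fc Y (Suc k) j \<odot> y" if "j \<in> ?J" for j
    using ft[OF \<delta>[OF that]] sop_face[OF Y y, of j] that by (simp del: upt_Suc)
  ultimately show "rel_horn X Y f (Suc k) ?J T z" using y by (simp add: rel_horn_def z_def del: upt_Suc)
  fix m \<sigma> j assume j: "\<sigma> \<in> mono_lists m (Suc k)" "j \<in> ?J" "j \<notin> set \<sigma>"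
  then have s: "map (shift j) \<sigma> \<in> mono_lists m k" using mono_shift by auto
  have "?\<delta> j ! shift j v = v" if "v \<in> set \<sigma>" for v
  proof -
    have "v \<noteq> j" "v \<le> Suc k" using that j by (auto simp: mono_lists_def)
    then show ?thesis using delete_id(4)[of j k "shift j v"] j(2) by (auto simp: shift_def simp del: upt_Suc)
  qed
  then have "map (\<lambda>a. ?\<delta> j ! a) (map (shift j) \<sigma>) = \<sigma>" by (simp add: map_idI del: upt_Suc)
  then show "t m \<sigma> = sop C X k (map (shift j) \<sigma>) \<odot> z (Some j)"
    using law[OF \<delta>[OF j(2)] s] by (simp add: z_def del: upt_Suc)
qed

definition horn_family where
  "horn_family p q = (\<lambda>l. case l of None \<Rightarrow> q | Some (m, \<sigma>) \<Rightarrow> p m \<sigma>)"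

definition horn_index :: "nat \<Rightarrow> nat \<Rightarrow> (nat \<times> nat list) option set" where
  "horn_index k i = insert None (Some ` {(m, \<sigma>). \<sigma> \<in> cells (horn k i) m})"

definition horn_cones where
  "horn_cones X Y f k i T v \<longleftrightarrow> horn_cone C X Y f k i T (\<lambda>m \<sigma>. v (Some (m, \<sigma>))) (v None)"

lemma horn_limit_iff_universal:
  "horn_limit C X Y f k i L p q \<longleftrightarrow> universal (horn_index k i) (horn_cones X Y f k i) L (horn_family p q)"
proof -
  have 1: "(\<forall>j\<in>horn_index k i. horn_family p q j \<odot> u = v j) \<longleftrightarrow>
      (\<forall>m. \<forall>\<sigma>\<in>cells (horn k i) m. p m \<sigma> \<odot> u = v (Some (m, \<sigma>))) \<and> q \<odot> u = v None" for u v
    by (auto simp: horn_index_def horn_family_def)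
  have 2: "horn_cones X Y f k i T (horn_family t y) \<longleftrightarrow> horn_cone C X Y f k i T t y" for T t y
    by (simp add: horn_cones_def horn_family_def)
  have T: "T \<in> Ob C" if "horn_cone C X Y f k i T t y" for T t y
    using that by (simp add: horn_cone_def hom_cone_def)
  show ?thesis
  proof
    assume L: "horn_limit C X Y f k i L p q"
    show "universal (horn_index k i) (horn_cones X Y f k i) L (horn_family p q)"
      unfolding universal_def 1 2
    proof (intro conjI ballI allI impI)
      show "L \<in> Ob C" "horn_cone C X Y f k i L p q" using L T unfolding horn_limit_def by blast+
      fix S v assume "S \<in> Ob C" "horn_cones X Y f k i S v"
      then show "\<exists>!u. u \<in> homs C S L \<and> (\<forall>m. \<forall>\<sigma>\<in>cells (horn k i) m. p m \<sigma> \<odot> u = v (Some (m, \<sigma>))) \<and> q \<odot> u = v None"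
        using L unfolding horn_limit_def horn_cones_def by simp
    qed
  next
    assume U: "universal (horn_index k i) (horn_cones X Y f k i) L (horn_family p q)"
    show "horn_limit C X Y f k i L p q"
      unfolding horn_limit_def
    proof (intro conjI allI impI)
      show "horn_cone C X Y f k i L p q" using U 2 unfolding universal_def by blast
      fix S t y assume c: "horn_cone C X Y f k i S t y"
      then have "\<exists>!u. u \<in> homs C S L \<and> (\<forall>j\<in>horn_index k i. horn_family p q j \<odot> u = horn_family t y j)"
        using U 2 T unfolding universal_def by blast
      then show "\<exists>!u. u \<in> homs C S L \<and> (\<forall>m. \<forall>\<sigma>\<in>cells (horn k i) m. p m \<sigma> \<odot> u = t m \<sigma>) \<and> q \<odot> u = y"
        unfolding 1 by (simp add: horn_family_def)
    qed
  qed
qed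

context
  fixes X :: "('o, 'm, 'y) sobj_scheme" and Y :: "('o, 'm, 'z) sobj_scheme" and f k i
  assumes X: "simplicial_object C X" and Y: "simplicial_object C Y" and f: "simplicial_map C X Y f"
    and i: "i \<le> Suc k"
begin

abbreviation "faces_index \<equiv> {..Suc k} - {i}"

text \<open>
  The bijection between families of faces and cones over all simplices of the horn.
\<close>

definition horn_rel :: "'o \<Rightarrow> (nat option \<Rightarrow> 'm) \<Rightarrow> ((nat \<times> nat list) option \<Rightarrow> 'm) \<Rightarrow> bool" where
  "horn_rel T z v \<longleftrightarrow> T \<in> Ob C \<and> rel_horn X Y f (Suc k) faces_index T z \<and> v None = z None \<and>
     (\<forall>m \<sigma> j. \<sigma> \<in> mono_lists m (Suc k) \<longrightarrow> j \<in> faces_index \<longrightarrow> j \<notin> set \<sigma> \<longrightarrow>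
       v (Some (m, \<sigma>)) = sop C X k (map (shift j) \<sigma>) \<odot> z (Some j))"

lemmas horn_rel_D = horn_rel_def[THEN iffD1, THEN conjunct1]
  horn_rel_def[THEN iffD1, THEN conjunct2, THEN conjunct1]
  horn_rel_def[THEN iffD1, THEN conjunct2, THEN conjunct2, THEN conjunct1]

lemmas horn_rel_value = horn_rel_def[THEN iffD1, THEN conjunct2, THEN conjunct2, THEN conjunct2, rule_format]

lemma faces_index: "faces_index \<subset> {..Suc k}" using i by auto

lemma horn_rel_in: "rel_horn X Y f (Suc k) faces_index T z \<Longrightarrow> j \<in> faces_index \<Longrightarrow> z (Some j) \<in> homs C T (ob X k)"
  by (auto simp: rel_horn_def abs_horn_def matching_def)

lemma horn_rel_ex1:
  assumes T: "T \<in> Ob C" and z: "rel_horn X Y f (Suc k) faces_index T z"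
  shows "\<exists>v. horn_rel T z v"
proof -
  interpret simplicial_set "\<lambda>n. homs C T (ob X n)" "\<lambda>n i x. fc X n i \<odot> x" "\<lambda>n i x. dg X n i \<odot> x"
    by (rule simplicial_set_points[OF X])
  have "matching (\<lambda>n. homs C T (ob X n)) (\<lambda>n i x. fc X n i \<odot> x) (Suc k) faces_index (\<lambda>j. z (Some j))"
    using z by (simp add: rel_horn_def abs_horn_def)
  from extend_matching[OF this] obtain t where t: "\<And>m \<sigma> j. \<sigma> \<in> mono_lists m (Suc k) \<Longrightarrow> j \<in> faces_index \<Longrightarrow> j \<notin> set \<sigma> \<Longrightarrow>
    t m \<sigma> = operate k (map (shift j) \<sigma>) (z (Some j))" by blast
  have "t m \<sigma> = sop C X k (map (shift j) \<sigma>) \<odot> z (Some j)" if "\<sigma> \<in> mono_lists m (Suc k)" "j \<in> faces_index" "j \<notin> set \<sigma>" for m \<sigma> j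
    using t[OF that] sop_comp[OF X _ horn_rel_in[OF z that(2)], of "map (shift j) \<sigma>" m] mono_shift[OF that(1) _ that(3)] that(2)
    by simp
  then have "horn_rel T z (horn_family t (z None))" using T z by (simp add: horn_rel_def horn_family_def)
  then show ?thesis by blast
qed

lemma horn_rel_ex2:
  assumes v: "horn_cones X Y f (Suc k) i T v" shows "\<exists>z. rel_horn X Y f (Suc k) faces_index T z \<and> horn_rel T z v"
proof -
  have c: "horn_cone C X Y f (Suc k) i T (\<lambda>m \<sigma>. v (Some (m, \<sigma>))) (v None)" using v by (simp add: horn_cones_def)
  have "T \<in> Ob C" using c by (simp add: horn_cone_def hom_cone_def)
  moreover have z: "rel_horn X Y f (Suc k) faces_index T (\<lambda>l. case l of None \<Rightarrow> v None | Some j \<Rightarrow> v (Some (k, delete_at j [0..<Suc (Suc k)])))"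
    (is "rel_horn _ _ _ _ _ _ ?z") by (rule horn_coneD(1)[OF X Y f i c])
  moreover have "v (Some (m, \<sigma>)) = sop C X k (map (shift j) \<sigma>) \<odot> ?z (Some j)"
    if "\<sigma> \<in> mono_lists m (Suc k)" "j \<in> faces_index" "j \<notin> set \<sigma>" for m \<sigma> j
    by (rule horn_coneD(2)[OF X Y f i c that])
  ultimately have "horn_rel T ?z v" by (simp add: horn_rel_def del: upt_Suc)
  then show ?thesis using z by blast
qed

lemma horn_rel_cones: "horn_rel T z v \<Longrightarrow> horn_cones X Y f (Suc k) i T v"
proof -
  assume r: "horn_rel T z v"
  have "horn_cone C X Y f (Suc k) i T (\<lambda>m \<sigma>. v (Some (m, \<sigma>))) (z None)"
  proof (rule horn_coneI[OF X Y f, where z = z])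
    show "T \<in> Ob C" "rel_horn X Y f (Suc k) faces_index T z" by (rule horn_rel_D[OF r])+
    show "v (Some (m, \<sigma>)) = sop C X k (map (shift j) \<sigma>) \<odot> z (Some j)"
      if "\<sigma> \<in> mono_lists m (Suc k)" "j \<in> faces_index" "j \<notin> set \<sigma>" for m \<sigma> j
      by (rule horn_rel_value[OF r that])
  qed
  then show ?thesis using horn_rel_D(3)[OF r] by (simp add: horn_cones_def)
qed

lemma horn_rel_eq:
  assumes r: "horn_rel T z v" "horn_rel T z' v'"
  shows "(\<forall>j\<in>insert None (Some ` faces_index). z j = z' j) \<longleftrightarrow> (\<forall>j\<in>horn_index (Suc k) i. v j = v' j)"
proof
  assume eq: "\<forall>j\<in>insert None (Some ` faces_index). z j = z' j"
  have "v (Some (m, \<sigma>)) = v' (Some (m, \<sigma>))" if \<sigma>: "\<sigma> \<in> cells (horn (Suc k) i) m" for m \<sigma>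
  proof -
    obtain j where j: "\<sigma> \<in> mono_lists m (Suc k)" "j \<in> faces_index" "j \<notin> set \<sigma>" using \<sigma>[unfolded horn_cells] by blast
    have "Some j \<in> insert None (Some ` faces_index)" using j(2) by (intro insertI2 imageI)
    from bspec[OF eq this] have "z (Some j) = z' (Some j)" .
    then show ?thesis using horn_rel_value[OF r(1) j] horn_rel_value[OF r(2) j] by simp
  qed
  moreover have "v None = v' None" using horn_rel_D(3)[OF r(1)] horn_rel_D(3)[OF r(2)] bspec[OF eq insertI1] by simp
  ultimately show "\<forall>j\<in>horn_index (Suc k) i. v j = v' j" by (auto simp: horn_index_def)
next
  assume eq: "\<forall>j\<in>horn_index (Suc k) i. v j = v' j"
  have "z (Some j) = z' (Some j)" if j: "j \<in> faces_index" for j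
  proof -
    let ?d = "delete_at j [0..<Suc (Suc k)]"
    have d: "?d \<in> mono_lists k (Suc k)" "j \<notin> set ?d" "map (shift j) ?d = [0..<Suc k]" using delete_id(1-3)[of j k] j by (simp_all del: upt_Suc)
    have "?d \<in> cells (horn (Suc k) i) k" unfolding horn_cells using d(1,2) j by (intro conjI bexI[of _ j])
    then have "Some (k, ?d) \<in> horn_index (Suc k) i" unfolding horn_index_def by (intro insertI2 imageI CollectI case_prodI)
    from bspec[OF eq this] have "v (Some (k, ?d)) = v' (Some (k, ?d))" .
    moreover have "v (Some (k, ?d)) = z (Some j)"
      using horn_rel_value[OF r(1) d(1) j d(2)] d(3) sop_id[OF X horn_rel_in[OF horn_rel_D(2)[OF r(1)] j]] by simp
    moreover have "v' (Some (k, ?d)) = z' (Some j)"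
      using horn_rel_value[OF r(2) d(1) j d(2)] d(3) sop_id[OF X horn_rel_in[OF horn_rel_D(2)[OF r(2)] j]] by simp
    ultimately show ?thesis by simp
  qed
  moreover have "z None = z' None" using horn_rel_D(3)[OF r(1)] horn_rel_D(3)[OF r(2)] bspec[OF eq, of None] by (simp add: horn_index_def)
  ultimately show "\<forall>j\<in>insert None (Some ` faces_index). z j = z' j" by auto
qed

lemma horn_rel_comp:
  assumes r: "horn_rel T z v" and h: "h \<in> homs C S T"
  shows "horn_rel S (\<lambda>j. z j \<odot> h) (\<lambda>j. v j \<odot> h)"
proof -
  have z: "rel_horn X Y f (Suc k) faces_index T z" using horn_rel_D(2)[OF r] .
  have "v (Some (m, \<sigma>)) \<odot> h = sop C X k (map (shift j) \<sigma>) \<odot> z (Some j) \<odot> h"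
    if j: "\<sigma> \<in> mono_lists m (Suc k)" "j \<in> faces_index" "j \<notin> set \<sigma>" for m \<sigma> j
  proof -
    have "map (shift j) \<sigma> \<in> mono_lists m k" using mono_shift j by auto
    from assoc[OF h horn_rel_in[OF z j(2)] sop_in[OF X this]] horn_rel_value[OF r j] show ?thesis by simp
  qed
  then show ?thesis using horn_rel_D(3)[OF r] homs_ob(1)[OF h] presheaf_comp[OF presheaf_rel_horn[OF X Y f faces_index], OF z h]
    by (simp add: horn_rel_def)
qed

lemma presheaf_horn_cones: "presheaf (horn_index (Suc k) i) (horn_cones X Y f (Suc k) i)"
  unfolding presheaf_def
proof (intro conjI allI impI ballI)
  fix T v j assume v: "horn_cones X Y f (Suc k) i T v" "j \<in> horn_index (Suc k) i"
  then have "\<exists>A. v j \<in> homs C T A" by (auto simp: horn_cones_def horn_cone_def hom_cone_def horn_index_def)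
  then show "v j \<in> Ar C" "Dom C (v j) = T" using homs_D by blast+
next
  fix T S v h assume v: "horn_cones X Y f (Suc k) i T v" "h \<in> homs C S T"
  then obtain z where "horn_rel T z v" using horn_rel_ex2 by blast
  from horn_rel_cones[OF horn_rel_comp[OF this v(2)]] show "horn_cones X Y f (Suc k) i S (\<lambda>j. v j \<odot> h)" .
qed

lemma horn_rel_self:
  "horn_rel (ob X (Suc k)) (\<lambda>l. case l of None \<Rightarrow> f (Suc k) | Some j \<Rightarrow> fc X (Suc k) j) (horn_family (\<lambda>m. sop C X (Suc k)) (f (Suc k)))"
proof -
  let ?T = "ob X (Suc k)" and ?I = "Ident C (ob X (Suc k))"
  interpret simplicial_set "\<lambda>n. homs C ?T (ob X n)" "\<lambda>n i x. fc X n i \<odot> x" "\<lambda>n i x. dg X n i \<odot> x"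
    by (rule simplicial_set_points[OF X])
  have I: "?I \<in> homs C ?T (ob X (Suc k))" using Ident_homs simplicial_object_ob[OF X] by blast
  have r: "fc X (Suc k) j \<odot> ?I = fc X (Suc k) j" if "j \<le> Suc k" for j using Ident_right fc_in[OF X that] by blast
  have "fc X k a \<odot> fc X (Suc k) b = fc X k (b - 1) \<odot> fc X (Suc k) a" if ab: "a \<in> faces_index" "b \<in> faces_index" "a < b" for a b
  proof -
    obtain k' where k': "k = Suc k'" using matching_pair[OF faces_index ab] .
    show ?thesis using dd[of ?I k' b a] I ab k' r by simp
  qed
  then have "abs_horn X (Suc k) faces_index ?T (fc X (Suc k))"
    using fc_in[OF X, of _ k] by (simp add: abs_horn_def matching_def)
  then have "rel_horn X Y f (Suc k) faces_index ?T (\<lambda>l. case l of None \<Rightarrow> f (Suc k) | Some j \<Rightarrow> fc X (Suc k) j)"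
    using simplicial_mapD[OF f] by (simp add: rel_horn_def)
  moreover have "sop C X (Suc k) \<sigma> = sop C X k (map (shift j) \<sigma>) \<odot> fc X (Suc k) j"
    if j: "\<sigma> \<in> mono_lists m (Suc k)" "j \<in> faces_index" "j \<notin> set \<sigma>" for m \<sigma> j
    using sop_missed[OF X I j(1) _ j(3)] j(2) Ident_right[OF sop_in[OF X j(1)]] r[of j] by simp
  ultimately show ?thesis using simplicial_object_ob[OF X] by (simp add: horn_rel_def horn_family_def)
qed

theorem horn_map_in_iff:
  assumes K: "stable K"
  shows "horn_map_in C K X Y f (Suc k) i \<longleftrightarrow>
    classified K (insert None (Some ` faces_index)) (rel_horn X Y f (Suc k) faces_index) (ob X (Suc k))
      (\<lambda>l. case l of None \<Rightarrow> f (Suc k) | Some j \<Rightarrow> fc X (Suc k) j)" (is "_ \<longleftrightarrow> classified K ?J ?F ?A ?e")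
proof -
  let ?I = "horn_index (Suc k) i" and ?H = "horn_cones X Y f (Suc k) i"
    and ?s = "horn_family (\<lambda>m. sop C X (Suc k)) (f (Suc k))"
  have self: "?H ?A ?s" by (rule horn_rel_cones[OF horn_rel_self])
  have 1: "horn_map C X f (Suc k) i L p q = h"
    if L: "horn_limit C X Y f (Suc k) i L p q" and h: "h \<in> homs C ?A L" "\<And>j. j \<in> ?I \<Longrightarrow> horn_family p q j \<odot> h = ?s j" for L p q h
  proof -
    note U = L[unfolded horn_limit_iff_universal]
    have iff: "((\<forall>m. \<forall>\<sigma>\<in>cells (horn (Suc k) i) m. p m \<sigma> \<odot> u = sop C X (Suc k) \<sigma>) \<and> q \<odot> u = f (Suc k)) \<longleftrightarrow>
       (\<forall>j\<in>?I. horn_family p q j \<odot> u = ?s j)" for u by (auto simp: horn_index_def horn_family_def)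
    show ?thesis unfolding horn_map_def iff
    proof (rule the_equality)
      show "h \<in> homs C ?A L \<and> (\<forall>j\<in>?I. horn_family p q j \<odot> h = ?s j)" using h by blast
      fix u assume u: "u \<in> homs C ?A L \<and> (\<forall>j\<in>?I. horn_family p q j \<odot> u = ?s j)"
      show "u = h" by (rule universal_D(4)[OF U, OF self conjunct1[OF u] h(1) bspec[OF conjunct2[OF u]] h(2)])
    qed
  qed
  have "horn_map_in C K X Y f (Suc k) i \<longleftrightarrow> classified K ?I ?H ?A ?s"
  proof
    assume m: "horn_map_in C K X Y f (Suc k) i"
    then obtain L p q where L: "horn_limit C X Y f (Suc k) i L p q" unfolding horn_map_in_def by blast
    note U = L[unfolded horn_limit_iff_universal]
    from universal_D(3)[OF U, OF self simplicial_object_ob[OF X]]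
    obtain h where h: "h \<in> homs C ?A L \<and> (\<forall>j\<in>?I. horn_family p q j \<odot> h = ?s j)" by (elim exE)
    have "h = horn_map C X f (Suc k) i L p q"
      by (rule 1[OF L conjunct1[OF h] bspec[OF conjunct2[OF h]], symmetric])
    moreover have "horn_map C X f (Suc k) i L p q \<in> K" using m L unfolding horn_map_in_def by blast
    ultimately have "h \<in> K" by simp
    then show "classified K ?I ?H ?A ?s" unfolding classified_def
      by (intro exI conjI) (rule U, rule conjunct1[OF h], assumption, rule conjunct2[OF h])
  next
    assume c: "classified K ?I ?H ?A ?s"
    then obtain L v where "universal ?I ?H L v" unfolding classified_def by (elim exE conjE)
    moreover have "horn_family (\<lambda>m \<sigma>. v (Some (m, \<sigma>))) (v None) = v" by (auto simp: horn_family_def split: option.split)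
    ultimately have "horn_limit C X Y f (Suc k) i L (\<lambda>m \<sigma>. v (Some (m, \<sigma>))) (v None)" by (simp add: horn_limit_iff_universal)
    moreover have "horn_map C X f (Suc k) i L p q \<in> K" if L: "horn_limit C X Y f (Suc k) i L p q" for L p q
    proof -
      obtain h where "h \<in> K" "h \<in> homs C ?A L" "\<And>j. j \<in> ?I \<Longrightarrow> horn_family p q j \<odot> h = ?s j"
        using classified_universal[OF K presheaf_horn_cones, OF c L[unfolded horn_limit_iff_universal]]
        by metis
      then show ?thesis using 1[OF L] by blast
    qed
    ultimately show "horn_map_in C K X Y f (Suc k) i" unfolding horn_map_in_def by blast
  qed
  also have "\<dots> \<longleftrightarrow> classified K ?J ?F ?A ?e"
  proof
    assume c: "classified K ?I ?H ?A ?s"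
    show "classified K ?J ?F ?A ?e"
    proof (rule classified_transfer[where R = "\<lambda>T v z. horn_rel T z v", OF _ _ _ _ _ c horn_rel_self])
      show "\<exists>z. horn_rel T z v" if "T \<in> Ob C" "?H T v" for T v using horn_rel_ex2[OF that(2)] by blast
      show "\<exists>v. ?H T v \<and> horn_rel T z v" if "T \<in> Ob C" "?F T z" for T z
        using horn_rel_ex1[OF that] horn_rel_cones by blast
      show "?F T z" if "T \<in> Ob C" "horn_rel T z v" for T z v using horn_rel_D(2)[OF that(2)] .
    qed (rule horn_rel_eq[symmetric] horn_rel_comp; assumption)+
  next
    assume c: "classified K ?J ?F ?A ?e"
    show "classified K ?I ?H ?A ?s"
    proof (rule classified_transfer[where R = horn_rel, OF _ _ _ _ _ c horn_rel_self])
      show "\<exists>z. ?F T z \<and> horn_rel T z v" if "T \<in> Ob C" "?H T v" for T v using horn_rel_ex2[OF that(2)] .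
    qed (rule horn_rel_ex1 horn_rel_cones horn_rel_eq horn_rel_comp; assumption)+
  qed
  finally show ?thesis .
qed

end
end

section \<open>Existence of horns and composition of covers\<close>

lemma matching_cong: "(\<And>j. j \<in> J \<Longrightarrow> x j = y j) \<Longrightarrow> matching S d k J x \<longleftrightarrow> matching S d k J y"
  by (simp add: matching_def)

lemma matching_insert:
  assumes "a \<notin> J"
  shows "matching S d (Suc k) (insert a J) x \<longleftrightarrow>
    matching S d (Suc k) J x \<and> x a \<in> S k \<and> (\<forall>j\<in>J. d k (shift a j) (x a) = d k (shift j a) (x j))"
proof -
  have "(\<forall>b\<in>J. (a < b \<longrightarrow> d k a (x b) = d k (b - 1) (x a)) \<and> (b < a \<longrightarrow> d k b (x a) = d k (a - 1) (x b))) \<longleftrightarrow>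
    (\<forall>j\<in>J. d k (shift a j) (x a) = d k (shift j a) (x j))"
  proof (rule ball_cong[OF refl])
    fix b assume "b \<in> J"
    then have "a < b \<or> b < a" using assms by (metis linorder_neqE_nat)
    then show "((a < b \<longrightarrow> d k a (x b) = d k (b - 1) (x a)) \<and> (b < a \<longrightarrow> d k b (x a) = d k (a - 1) (x b))) \<longleftrightarrow>
      d k (shift a b) (x a) = d k (shift b a) (x b)" by (auto simp: shift_def)
  qed
  then show ?thesis unfolding matching_def by auto
qed

context category begin

text \<open>
  The elements of \<open>F'\<close> are pairs of an element of \<open>F\<close> and a point of \<open>A\<close> with the same image in \<open>M\<close>, the point of
  \<open>A\<close> being stored at the index \<open>c\<close>.  The index map \<open>g\<close> lets one statement serve both for a horn with one
  more face and for a horn relative to a map.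
\<close>

lemma universal_pullback:
  assumes L: "universal J F L u" and F: "presheaf J F" and P: "is_pullback C h r P p q"
    and h: "h \<in> homs C A M" and r: "r \<in> homs C L M"
    and I: "I = insert c (g ` J)" and v: "v c = p" "\<And>j. j \<in> J \<Longrightarrow> v (g j) = u j \<odot> q" and vin: "F' P v"
    and F': "\<And>T z. T \<in> Ob C \<Longrightarrow> F' T z \<Longrightarrow> F T (\<lambda>j. z (g j))"
      "\<And>T z. T \<in> Ob C \<Longrightarrow> F' T z \<Longrightarrow> z c \<in> homs C T A"
      "\<And>T z l. T \<in> Ob C \<Longrightarrow> F' T z \<Longrightarrow> l \<in> homs C T L \<Longrightarrow> (\<And>j. j \<in> J \<Longrightarrow> u j \<odot> l = z (g j)) \<Longrightarrow> h \<odot> z c = r \<odot> l"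
  shows "universal I F' P v"
proof -
  have t: "P \<in> Ob C" "p \<in> homs C P A" "q \<in> homs C P L" using P h r homs_D by (auto simp: is_pullback_def)
  have ex: "\<exists>!t. t \<in> homs C T P \<and> p \<odot> t = x \<and> q \<odot> t = y" if "x \<in> homs C T A" "y \<in> homs C T L" "h \<odot> x = r \<odot> y" for T x y
    using P that homs_ob(1)[OF that(1)] homs_D(1)[OF h] homs_D(1)[OF r] unfolding is_pullback_def by metis
  note u = presheaf_homs[OF F universal_D(2)[OF L]]
  show ?thesis
  proof (rule universalI)
    show "P \<in> Ob C" "F' P v" by fact+
    fix T z assume T: "T \<in> Ob C" "F' T z"
    from universal_D(3)[OF L, OF F'(1)[OF T] T(1)]
    obtain l where l: "l \<in> homs C T L \<and> (\<forall>j\<in>J. u j \<odot> l = z (g j))" by (elim exE)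
    have "h \<odot> z c = r \<odot> l" by (rule F'(3)[OF T conjunct1[OF l] bspec[OF conjunct2[OF l]]])
    from ex[OF F'(2)[OF T] conjunct1[OF l] this] obtain t' where t': "t' \<in> homs C T P" "p \<odot> t' = z c" "q \<odot> t' = l" by blast
    have "v j \<odot> t' = z j" if "j \<in> I" for j
    proof (cases "j = c")
      case True then show ?thesis using v t' by simp
    next
      case False
      then obtain j' where j': "j' \<in> J" "j = g j'" using \<open>j \<in> I\<close> I by blast
      then show ?thesis using v(2)[OF j'(1)] assoc[OF t'(1) t(3) u[OF j'(1)]] t'(3) bspec[OF conjunct2[OF l] j'(1)] by simp
    qed
    then show "\<exists>h. h \<in> homs C T P \<and> (\<forall>j\<in>I. v j \<odot> h = z j)" using t'(1) by blast
  next
    fix T z s s' assume z: "F' T z" and s: "s \<in> homs C T P" "s' \<in> homs C T P"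
      "\<And>j. j \<in> I \<Longrightarrow> v j \<odot> s = z j" "\<And>j. j \<in> I \<Longrightarrow> v j \<odot> s' = z j"
    have qs: "q \<odot> s \<in> homs C T L" "q \<odot> s' \<in> homs C T L" "p \<odot> s \<in> homs C T A" using s t Comp_homs by blast+
    have qq: "q \<odot> s = q \<odot> s'"
    proof (rule universal_eqI[OF F L qs(1,2)])
      fix j assume j: "j \<in> J"
      then have "g j \<in> I" using I by simp
      then show "u j \<odot> q \<odot> s = u j \<odot> q \<odot> s'"
        using s(3,4)[of "g j"] v(2)[OF j] assoc[OF s(1) t(3) u[OF j]] assoc[OF s(2) t(3) u[OF j]] by simp
    qed
    have pp: "p \<odot> s = p \<odot> s'" using s(3,4)[of c] v(1) I by simp
    have "h \<odot> p = r \<odot> q" using P by (simp add: is_pullback_def)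
    then have "h \<odot> p \<odot> s = r \<odot> q \<odot> s" using assoc[OF s(1) t(2) h] assoc[OF s(1) t(3) r] by simp
    from ex[OF qs(3,1) this] show "s = s'" using s(1,2) pp qq by metis
  qed
qed

lemma presheaf_abs_horn':
  assumes X: "simplicial_object C X" and J: "J \<subset> {..k}"
  shows "presheaf J (abs_horn X k J)"
proof (cases k)
  case 0
  then have "J = {}" using J by auto
  then show ?thesis by (auto simp: presheaf_def abs_horn_def matching_def)
next
  case (Suc k')
  then show ?thesis using presheaf_abs_horn[OF X] J by simp
qed

lemma abs_horn_faces:
  assumes X: "simplicial_object C X" and J: "J \<subset> {..Suc k}" and x: "x \<in> homs C T (ob X (Suc k))"
  shows "abs_horn X (Suc k) J T (\<lambda>j. fc X (Suc k) j \<odot> x)"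
proof -
  interpret simplicial_set "\<lambda>n. homs C T (ob X n)" "\<lambda>n i x. fc X n i \<odot> x" "\<lambda>n i x. dg X n i \<odot> x"
    by (rule simplicial_set_points[OF X])
  have "fc X k a \<odot> fc X (Suc k) b \<odot> x = fc X k (b - 1) \<odot> fc X (Suc k) a \<odot> x" if ab: "a \<in> J" "b \<in> J" "a < b" for a b
  proof -
    obtain k' where k': "k = Suc k'" using matching_pair[OF J ab] .
    have "b \<le> Suc k" using J ab by auto
    then show ?thesis using dd[of x k' b a] x ab k' by simp
  qed
  moreover have "fc X (Suc k) j \<odot> x \<in> homs C T (ob X k)" if "j \<in> J" for j using d_in[OF x] J that by auto
  ultimately show ?thesis by (simp add: abs_horn_def matching_def)
qed

lemma abs_horn_in: "abs_horn X (Suc k) J T x \<Longrightarrow> j \<in> J \<Longrightarrow> x j \<in> homs C T (ob X k)"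
  by (simp add: abs_horn_def matching_def)

lemma abs_horn_cong: "(\<And>j. j \<in> J \<Longrightarrow> x j = y j) \<Longrightarrow> abs_horn X k J T x \<longleftrightarrow> abs_horn X k J T y"
  unfolding abs_horn_def by (rule matching_cong)

lemma abs_horn_map:
  assumes X: "simplicial_object C X" and Y: "simplicial_object C Y" and f: "simplicial_map C X Y f"
    and J: "J \<subset> {..Suc k}" and x: "abs_horn X (Suc k) J T x"
  shows "abs_horn Y (Suc k) J T (\<lambda>j. f k \<odot> x j)"
proof -
  have "fc Y k a \<odot> f k \<odot> x b = fc Y k (b - 1) \<odot> f k \<odot> x a" if ab: "a \<in> J" "b \<in> J" "a < b" for a b
  proof -
    obtain k' where k': "k = Suc k'" "a \<le> k" "b - 1 \<le> k" using matching_pair[OF J ab] .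
    have "fc X k a \<odot> x b = fc X k (b - 1) \<odot> x a" using x ab by (auto simp: abs_horn_def matching_def)
    then show ?thesis using map_fc[OF X Y f, of _ T k'] abs_horn_in[OF x] ab k' by metis
  qed
  then show ?thesis using Comp_homs[OF simplicial_mapD(1)[OF f] abs_horn_in[OF x]] by (simp add: abs_horn_def matching_def)
qed

end

context category_with_covers begin

text \<open>
  Attaching the face \<open>a\<close> is a pullback of the map from the \<open>k\<close>-simplices to the object that represents the part of its boundary
  along which \<open>a\<close> is attached (\<open>matching_link\<close>).  This map is a cover, so the pullback exists and forgetting \<open>a\<close> is a cover.
\<close>

lemma horn_extend:
  assumes X: "simplicial_object C X" and J: "insert a J \<subset> {..Suc k}" "a \<notin> J"
    and L: "universal J (abs_horn X (Suc k) J) L u"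
    and c: "classified Cov (shift a ` J) (abs_horn X k (shift a ` J)) (ob X k) (fc X k)"
  shows "\<exists>P v q. universal (insert a J) (abs_horn X (Suc k) (insert a J)) P v \<and>
    q \<in> Cov \<and> q \<in> homs C P L \<and> (\<forall>j\<in>J. u j \<odot> q = v j)"
proof -
  let ?J = "shift a ` J"
  have J': "J \<subset> {..Suc k}" using J by auto
  have b: "\<exists>k'. k = Suc k' \<and> shift a j \<le> k \<and> shift j a \<le> k" if j: "j \<in> J" for j
  proof -
    have "a \<noteq> j" "a \<le> Suc k" "j \<le> Suc k" using j J by auto
    moreover have "\<exists>k'. k = Suc k'"
    proof (cases "a < j")
      case True show ?thesis by (rule matching_pair[OF J(1), of a j]) (use j True in auto)
    next
      case False
      then have "j < a" using \<open>a \<noteq> j\<close> by simp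
      then show ?thesis by (rule matching_pair[OF J(1), of j a, rotated 2]) (use j in auto)
    qed
    ultimately show ?thesis by (auto simp: shift_def)
  qed
  have "?J \<subset> {..k}"
  proof -
    obtain i where i: "i \<le> Suc k" "i \<notin> insert a J" using J(1) by auto
    have "shift a i \<notin> ?J" using i J(2) shift_inj[of i a] by (metis imageE insertCI)
    moreover have "shift a i \<le> k" using i J by (auto simp: shift_def)
    ultimately show ?thesis using b by auto
  qed
  then have F': "presheaf ?J (abs_horn X k ?J)" by (rule presheaf_abs_horn'[OF X])
  have F: "presheaf J (abs_horn X (Suc k) J)" by (rule presheaf_abs_horn'[OF X J'])
  obtain M w h where M: "universal ?J (abs_horn X k ?J) M w" and h: "h \<in> homs C (ob X k) M" "h \<in> Cov" "\<forall>j\<in>?J. w j \<odot> h = fc X k j"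
    using c unfolding classified_def by blast
  have Lo: "L \<in> Ob C" by (rule universal_D(1)[OF L])
  have u: "u j \<in> homs C L (ob X k)" if "j \<in> J" for j by (rule abs_horn_in[OF universal_D(2)[OF L] that])
  have w: "w j \<in> homs C M (Cod C (w j))" if "j \<in> ?J" for j by (rule presheaf_homs[OF F' universal_D(2)[OF M] that])
  interpret simplicial_set "\<lambda>n. homs C L (ob X n)" "\<lambda>n i x. fc X n i \<odot> x" "\<lambda>n i x. dg X n i \<odot> x"
    by (rule simplicial_set_points[OF X])
  obtain y where y: "abs_horn X k ?J L y" "\<And>j. j \<in> J \<Longrightarrow> y (shift a j) = fc X k (shift j a) \<odot> u j"
    using matching_link[OF J, of u] universal_D(2)[OF L] unfolding abs_horn_def by blast
  from universal_D(3)[OF M, OF y(1) Lo] obtain r where r: "r \<in> homs C L M \<and> (\<forall>j\<in>?J. w j \<odot> r = y j)" by (elim exE)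
  have r1: "r \<in> homs C L M" and r2: "w (shift a j) \<odot> r = fc X k (shift j a) \<odot> u j" if "j \<in> J" for j
    using r y(2) that by auto
  have r1: "r \<in> homs C L M" using r by simp
  obtain P p q where P: "is_pullback C h r P p q" using A2_exists[OF h(2)] r1 h(1) homs_D by metis
  have q: "q \<in> Cov" by (rule A2_cover[OF h(2) P])
  have t: "P \<in> Ob C" "p \<in> homs C P (ob X k)" "q \<in> homs C P L" "h \<odot> p = r \<odot> q" using P h(1) r1 homs_D by (auto simp: is_pullback_def)
  have key: "w (shift a j) \<odot> h \<odot> x = fc X k (shift a j) \<odot> x" "w (shift a j) \<odot> r \<odot> l = fc X k (shift j a) \<odot> u j \<odot> l"
    if j: "j \<in> J" and x: "x \<in> homs C T (ob X k)" "l \<in> homs C T L" for j x l T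
  proof -
    have sj: "shift a j \<in> ?J" using j by simp
    show "w (shift a j) \<odot> h \<odot> x = fc X k (shift a j) \<odot> x" using assoc[OF x(1) h(1) w[OF sj]] h(3) sj by auto
    obtain k' where k': "k = Suc k'" "shift j a \<le> k" using b[OF j] by blast
    show "w (shift a j) \<odot> r \<odot> l = fc X k (shift j a) \<odot> u j \<odot> l"
      using assoc[OF x(2) r1 w[OF sj]] r2[OF j] assoc[OF x(2) u[OF j] fc_in[OF X k'(2)[unfolded k'(1)], folded k'(1)]] by simp
  qed
  let ?v = "\<lambda>j. if j = a then p else u j \<odot> q"
  have ins: "abs_horn X (Suc k) (insert a J) T z \<longleftrightarrow> abs_horn X (Suc k) J T z \<and> z a \<in> homs C T (ob X k) \<and>
      (\<forall>j\<in>J. fc X k (shift a j) \<odot> z a = fc X k (shift j a) \<odot> z j)" for T z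
    unfolding abs_horn_def by (rule matching_insert[OF J(2)])
  have "universal (insert a J) (abs_horn X (Suc k) (insert a J)) P ?v"
  proof (rule universal_pullback[OF L F P h(1) r1, where g = "\<lambda>j. j" and c = a])
    have "fc X k (shift a j) \<odot> p = fc X k (shift j a) \<odot> u j \<odot> q" if "j \<in> J" for j
      using key[OF that t(2,3)] t(4) by simp
    moreover have "abs_horn X (Suc k) J P ?v \<longleftrightarrow> abs_horn X (Suc k) J P (\<lambda>j. u j \<odot> q)"
      by (rule abs_horn_cong) (use J in auto)
    moreover have "abs_horn X (Suc k) J P (\<lambda>j. u j \<odot> q)" by (rule presheaf_comp[OF F, OF universal_D(2)[OF L] t(3)])
    ultimately show "abs_horn X (Suc k) (insert a J) P ?v" unfolding ins using t(2) J(2) by auto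
    show "?v j = u j \<odot> q" if "j \<in> J" for j using that J(2) by auto
    fix T z assume T: "T \<in> Ob C" and z: "abs_horn X (Suc k) (insert a J) T z"
    show "abs_horn X (Suc k) J T z" using z ins by blast
    show za: "z a \<in> homs C T (ob X k)" using z ins by blast
    fix l assume l: "l \<in> homs C T L" "\<And>j. j \<in> J \<Longrightarrow> u j \<odot> l = z j"
    show "h \<odot> z a = r \<odot> l"
    proof (rule universal_eqI[OF F' M Comp_homs[OF h(1) za] Comp_homs[OF r1 l(1)]])
      fix i assume "i \<in> ?J"
      then obtain j where j: "j \<in> J" "i = shift a j" by blast
      show "w i \<odot> h \<odot> z a = w i \<odot> r \<odot> l"
        using key[OF j(1) za l(1)] j(2) l(2)[OF j(1)] z[unfolded ins] j(1) by simp
    qed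
  qed auto
  then show ?thesis using q t(3) J(2) by (intro exI[of _ P] exI[of _ ?v] exI[of _ q]) auto
qed

lemma universal_empty: "universal {} (abs_horn X k {}) (pt C) u"
  unfolding universal_def using pt_terminal by (simp add: abs_horn_def matching_def)

text \<open>
  The statement for all unions of faces, and not only for horns, because horns are built up through them.
\<close>

definition horn_projections_cover :: "('o, 'm, 'z) sobj_scheme \<Rightarrow> nat \<Rightarrow> bool" where
  "horn_projections_cover X k \<longleftrightarrow> (\<forall>J. J \<subset> {..k} \<longrightarrow> classified Cov J (abs_horn X k J) (ob X k) (fc X k))"

lemma horn_restriction_cover:
  assumes X: "simplicial_object C X" and good: "horn_projections_cover X k"
    and L: "universal J (abs_horn X (Suc k) J) L u" and D: "finite D"
  shows "J \<union> D \<subset> {..Suc k} \<Longrightarrow> \<exists>P v q. universal (J \<union> D) (abs_horn X (Suc k) (J \<union> D)) P v \<and>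
    q \<in> Cov \<and> q \<in> homs C P L \<and> (\<forall>j\<in>J. u j \<odot> q = v j)"
  using D
proof (induction D)
  case empty
  have J: "J \<subset> {..Suc k}" using empty by simp
  have "u j \<odot> Ident C L = u j" if "j \<in> J" for j
    by (rule Ident_right[OF abs_horn_in[OF universal_D(2)[OF L] that]])
  moreover have "Ident C L \<in> Cov" "Ident C L \<in> homs C L L" using Ident_cover Ident_homs universal_D(1)[OF L] by auto
  ultimately show ?case using L by (intro exI[of _ L] exI[of _ u] exI[of _ "Ident C L"]) auto
next
  case (insert a D)
  have JD: "J \<union> D \<subset> {..Suc k}" using insert(4) by auto
  from insert(3)[OF JD] obtain P v q where P: "universal (J \<union> D) (abs_horn X (Suc k) (J \<union> D)) P v"
    and q: "q \<in> Cov" "q \<in> homs C P L" "\<forall>j\<in>J. u j \<odot> q = v j" by (elim exE conjE)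
  show ?case
  proof (cases "a \<in> J \<union> D")
    case True
    then have "J \<union> insert a D = J \<union> D" by auto
    then show ?thesis using P q by (intro exI[of _ P] exI[of _ v] exI[of _ q]) auto
  next
    case False
    have ins: "insert a (J \<union> D) \<subset> {..Suc k}" using insert(4) by auto
    have "shift a ` (J \<union> D) \<subset> {..k}"
    proof -
      obtain i where i: "i \<le> Suc k" "i \<notin> insert a (J \<union> D)" using ins by auto
      have al: "a \<le> Suc k" using ins by auto
      have "shift a i \<notin> shift a ` (J \<union> D)" using i False shift_inj[of i a] by (metis imageE insertCI)
      moreover have "shift a i \<le> k" using i al by (auto simp: shift_def)
      moreover have "shift a j \<le> k" if "j \<in> J \<union> D" for j
      proof -
        have "j \<noteq> a" "j \<le> Suc k" using that False JD by auto
        then show ?thesis using al by (auto simp: shift_def)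
      qed
      ultimately show ?thesis by auto
    qed
    then have "classified Cov (shift a ` (J \<union> D)) (abs_horn X k (shift a ` (J \<union> D))) (ob X k) (fc X k)"
      using good unfolding horn_projections_cover_def by blast
    from horn_extend[OF X ins False P this] obtain P' v' q' where
      P': "universal (insert a (J \<union> D)) (abs_horn X (Suc k) (insert a (J \<union> D))) P' v'"
      and q': "q' \<in> Cov" "q' \<in> homs C P' P" "\<forall>j\<in>J \<union> D. v j \<odot> q' = v' j" by (elim exE conjE)
    have "q \<odot> q' \<in> Cov" by (rule stable_comp[OF stable_Cov q(1) q'(1) q(2) q'(2)])
    moreover have "u j \<odot> q \<odot> q' = v' j" if "j \<in> J" for j
      using assoc[OF q'(2) q(2) abs_horn_in[OF universal_D(2)[OF L] that]] q(3) q'(3) that by simp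
    ultimately show ?thesis using P' Comp_homs[OF q(2) q'(2)]
      by (intro exI[of _ P'] exI[of _ v'] exI[of _ "q \<odot> q'"]) simp
  qed
qed

lemma horn_projections_cover_0:
  assumes X: "simplicial_object C X" shows "horn_projections_cover X 0"
  unfolding horn_projections_cover_def
proof (intro allI impI)
  fix J :: "nat set" assume "J \<subset> {..0}"
  then have J: "J = {}" by auto
  show "classified Cov J (abs_horn X 0 J) (ob X 0) (fc X 0)" unfolding J classified_def
    by (rule exI, rule exI, rule exI[of _ "bang C (ob X 0)"], intro conjI, rule universal_empty)
      (use bang_in[OF simplicial_object_ob[OF X]] to_pt_cover in auto)
qed

lemma horn_object_ex:
  assumes X: "simplicial_object C X" and good: "horn_projections_cover X k" and J: "J \<subset> {..Suc k}"
  shows "\<exists>L u. universal J (abs_horn X (Suc k) J) L u"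
proof -
  have "finite J" using J finite_subset by blast
  from horn_restriction_cover[OF X good universal_empty this] J show ?thesis by auto
qed

text \<open>
  Such a union is contained in a horn, and both the horn-filling map and the restriction from the horn to the union are covers.
\<close>

lemma horn_projections_cover_Suc:
  assumes X: "simplicial_object C X" and good: "horn_projections_cover X k"
    and c: "\<And>i. i \<le> Suc k \<Longrightarrow> horn_fills Cov X (Suc k) i"
  shows "horn_projections_cover X (Suc k)"
  unfolding horn_projections_cover_def
proof (intro allI impI)
  fix J :: "nat set" assume J: "J \<subset> {..Suc k}"
  then obtain i where i: "i \<le> Suc k" "i \<notin> J" by auto
  let ?K = "{..Suc k} - {i}"
  have K: "?K \<subset> {..Suc k}" and JK: "J \<union> ?K = ?K" using i J by auto
  obtain L u where L: "universal J (abs_horn X (Suc k) J) L u" using horn_object_ex[OF X good J] by (elim exE)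
  from horn_restriction_cover[OF X good L, of ?K] K obtain P v q where P: "universal ?K (abs_horn X (Suc k) ?K) P v"
    and q: "q \<in> Cov" "q \<in> homs C P L" "\<forall>j\<in>J. u j \<odot> q = v j" unfolding JK by auto
  have "\<exists>h. h \<in> Cov \<and> h \<in> homs C (ob X (Suc k)) P \<and> (\<forall>j\<in>?K. v j \<odot> h = fc X (Suc k) j)"
    by (rule classified_universal[OF stable_Cov presheaf_abs_horn[OF X K], OF c[OF i(1)] P]) auto
  then obtain h where h: "h \<in> Cov" "h \<in> homs C (ob X (Suc k)) P" "\<forall>j\<in>?K. v j \<odot> h = fc X (Suc k) j" by blast
  have "q \<odot> h \<in> Cov" by (rule stable_comp[OF stable_Cov q(1) h(1) q(2) h(2)])
  moreover have "u j \<odot> q \<odot> h = fc X (Suc k) j" if "j \<in> J" for j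
  proof -
    have "j \<in> ?K" using that JK by auto
    then show ?thesis using assoc[OF h(2) q(2) abs_horn_in[OF universal_D(2)[OF L] that]] q(3) h(3) that by simp
  qed
  ultimately show "classified Cov J (abs_horn X (Suc k) J) (ob X (Suc k)) (fc X (Suc k))"
    unfolding classified_def using L Comp_homs[OF q(2) h(2)] by (intro exI[of _ L] exI[of _ u] exI[of _ "q \<odot> h"]) simp
qed

text \<open>
  To prove that horns exist and have horn-filling maps that are covers, the existence may be assumed: the
  lower dimensions imply it.
\<close>

theorem horn_covers_by_induction:
  assumes X: "simplicial_object C X"
    and step: "\<And>k i L u. i \<le> Suc k \<Longrightarrow> universal ({..Suc k} - {i}) (abs_horn X (Suc k) ({..Suc k} - {i})) L u \<Longrightarrow>
      horn_fills Cov X (Suc k) i"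
    and i: "i \<le> Suc k"
  shows "horn_fills Cov X (Suc k) i"
proof -
  have s: "horn_fills Cov X (Suc k) i"
    if g: "horn_projections_cover X k" and i: "i \<le> Suc k" for k i
  proof -
    have "{..Suc k} - {i} \<subset> {..Suc k}" using i by auto
    from horn_object_ex[OF X g this] obtain L u where "universal ({..Suc k} - {i}) (abs_horn X (Suc k) ({..Suc k} - {i})) L u" by (elim exE)
    from step[OF i this] show ?thesis .
  qed
  have "horn_projections_cover X k" for k
    by (induction k) (use horn_projections_cover_0[OF X] horn_projections_cover_Suc[OF X] s in blast)+
  from s[OF this i] show ?thesis .
qed

text \<open>
  The horn-filling map of \<open>X\<close> is the composite of that of \<open>f\<close> with the projection of \<open>\<Lambda>(f)\<close> to \<open>\<Lambda>(X)\<close>, and this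
  projection is a pullback of the horn-filling map of \<open>Y\<close>.
\<close>

lemma horn_cover_comp:
  assumes X: "simplicial_object C X" and Y: "simplicial_object C Y" and f: "simplicial_map C X Y f"
    and J: "J \<subset> {..Suc k}" and L: "universal J (abs_horn X (Suc k) J) L u"
    and cY: "classified Cov J (abs_horn Y (Suc k) J) (ob Y (Suc k)) (fc Y (Suc k))"
    and cf: "classified Cov (insert None (Some ` J)) (rel_horn X Y f (Suc k) J) (ob X (Suc k))
      (\<lambda>l. case l of None \<Rightarrow> f (Suc k) | Some j \<Rightarrow> fc X (Suc k) j)"
  shows "classified Cov J (abs_horn X (Suc k) J) (ob X (Suc k)) (fc X (Suc k))"
proof -
  have F: "presheaf J (abs_horn X (Suc k) J)" "presheaf J (abs_horn Y (Suc k) J)"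
    using presheaf_abs_horn[OF X J] presheaf_abs_horn[OF Y J] .
  obtain M w h where M: "universal J (abs_horn Y (Suc k) J) M w"
    and h: "h \<in> homs C (ob Y (Suc k)) M" "h \<in> Cov" "\<forall>j\<in>J. w j \<odot> h = fc Y (Suc k) j"
    using cY unfolding classified_def by blast
  have Lo: "L \<in> Ob C" by (rule universal_D(1)[OF L])
  have u: "u j \<in> homs C L (ob X k)" if "j \<in> J" for j by (rule abs_horn_in[OF universal_D(2)[OF L] that])
  have w: "w j \<in> homs C M (ob Y k)" if "j \<in> J" for j by (rule abs_horn_in[OF universal_D(2)[OF M] that])
  from universal_D(3)[OF M, OF abs_horn_map[OF X Y f J universal_D(2)[OF L]] Lo]
  obtain r where r: "r \<in> homs C L M \<and> (\<forall>j\<in>J. w j \<odot> r = f k \<odot> u j)" by (elim exE)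
  then have r1: "r \<in> homs C L M" and r2: "\<And>j. j \<in> J \<Longrightarrow> w j \<odot> r = f k \<odot> u j" by auto
  obtain P p q where P: "is_pullback C h r P p q" using A2_exists[OF h(2)] r1 h(1) homs_D by metis
  have q: "q \<in> Cov" by (rule A2_cover[OF h(2) P])
  have t: "P \<in> Ob C" "p \<in> homs C P (ob Y (Suc k))" "q \<in> homs C P L" "h \<odot> p = r \<odot> q" using P h(1) r1 homs_D by (auto simp: is_pullback_def)
  have key: "w j \<odot> h \<odot> y = fc Y (Suc k) j \<odot> y" "w j \<odot> r \<odot> l = f k \<odot> u j \<odot> l"
    if j: "j \<in> J" and x: "y \<in> homs C T (ob Y (Suc k))" "l \<in> homs C T L" for j y l T
    using assoc[OF x(1) h(1) w[OF j]] h(3) j assoc[OF x(2) r1 w[OF j]] r2[OF j] assoc[OF x(2) u[OF j] simplicial_mapD(1)[OF f]]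
    by auto
  let ?v = "\<lambda>l. case l of None \<Rightarrow> p | Some j \<Rightarrow> u j \<odot> q"
  have U: "universal (insert None (Some ` J)) (rel_horn X Y f (Suc k) J) P ?v"
  proof (rule universal_pullback[OF L F(1) P h(1) r1, where g = Some and c = None])
    have "f k \<odot> u j \<odot> q = fc Y (Suc k) j \<odot> p" if "j \<in> J" for j
      using key[OF that t(2,3)] t(4) by simp
    moreover have "abs_horn X (Suc k) J P (\<lambda>j. u j \<odot> q)" by (rule presheaf_comp[OF F(1), OF universal_D(2)[OF L] t(3)])
    ultimately show "rel_horn X Y f (Suc k) J P ?v" using t(2) by (simp add: rel_horn_def)
    fix T z assume T: "T \<in> Ob C" and z: "rel_horn X Y f (Suc k) J T z"
    show "abs_horn X (Suc k) J T (\<lambda>j. z (Some j))" using z by (simp add: rel_horn_def)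
    show zN: "z None \<in> homs C T (ob Y (Suc k))" using z by (simp add: rel_horn_def)
    fix l assume l: "l \<in> homs C T L" "\<And>j. j \<in> J \<Longrightarrow> u j \<odot> l = z (Some j)"
    show "h \<odot> z None = r \<odot> l"
    proof (rule universal_eqI[OF F(2) M Comp_homs[OF h(1) zN] Comp_homs[OF r1 l(1)]])
      fix j assume j: "j \<in> J"
      have "f k \<odot> z (Some j) = fc Y (Suc k) j \<odot> z None" using z j by (simp add: rel_horn_def)
      then show "w j \<odot> h \<odot> z None = w j \<odot> r \<odot> l" using key[OF j zN l(1)] l(2)[OF j] by simp
    qed
  qed auto
  have "\<exists>g. g \<in> Cov \<and> g \<in> homs C (ob X (Suc k)) P \<and> (\<forall>j\<in>insert None (Some ` J). ?v j \<odot> g = (case j of None \<Rightarrow> f (Suc k) | Some j \<Rightarrow> fc X (Suc k) j))"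
    by (rule classified_universal[OF stable_Cov presheaf_rel_horn[OF X Y f J], OF cf U]) (intro exI conjI ballI, assumption+)
  then obtain g where g: "g \<in> Cov" "g \<in> homs C (ob X (Suc k)) P" "\<forall>j\<in>J. (u j \<odot> q) \<odot> g = fc X (Suc k) j" by auto
  have "q \<odot> g \<in> Cov" by (rule stable_comp[OF stable_Cov q(1) g(1) t(3) g(2)])
  moreover have "u j \<odot> q \<odot> g = fc X (Suc k) j" if "j \<in> J" for j
    using assoc[OF g(2) t(3) u[OF that]] g(3) that by simp
  ultimately show ?thesis
    unfolding classified_def using L Comp_homs[OF t(3) g(2)] by (intro exI[of _ L] exI[of _ u] exI[of _ "q \<odot> g"]) simp
qed

text \<open>
  By itself, a section of \<open>f\<close> does not make \<open>f\<close> a cover, since (A3) requires the first arrow of a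
  composite to be a cover.  Here \<open>t(x, h)\<close> moves \<open>x\<close> into the fibre of \<open>f\<close> over \<open>h\<close> in
  such a way that \<open>(x, h) \<mapsto> (t(x, h), f x)\<close> is an involution of \<open>A \<times> L\<close>.  So \<open>t\<close> is
  a product projection up to isomorphism, hence a cover, and \<open>f \<circ> t\<close> is the other
  projection, also a cover; now (A3) applies.
\<close>

lemma cover_of_transport:
  assumes f: "f \<in> homs C A L" and W: "binprod A L W a b" and t: "t \<in> homs C W A" "f \<odot> t = b"
    and inv: "\<And>s. s \<in> homs C W W \<Longrightarrow> a \<odot> s = t \<Longrightarrow> b \<odot> s = f \<odot> a \<Longrightarrow> t \<odot> s = a"
  shows "f \<in> Cov"
proof -
  note d = binprod_D(1-3)[OF W]
  obtain s where s: "s \<in> homs C W W" "a \<odot> s = t" "b \<odot> s = f \<odot> a"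
    using binprod_D(4)[OF W t(1) Comp_homs[OF f d(2)]] by blast
  have I: "Ident C W \<in> homs C W W" using d Ident_homs by blast
  have "s \<odot> s = Ident C W"
  proof (rule binprod_D(5)[OF W Comp_homs[OF s(1,1)] I])
    show "a \<odot> s \<odot> s = a \<odot> Ident C W" using assoc[OF s(1) s(1) d(2)] s inv[OF s] Ident_right[OF d(2)] by simp
    show "b \<odot> s \<odot> s = b \<odot> Ident C W" using assoc[OF s(1) s(1) d(3)] assoc[OF s(1) d(2) f] s t Ident_right[OF d(3)] by simp
  qed
  then have "s \<in> Cov" using isos_cover isosI[OF s(1,1)] by blast
  then have "t \<in> Cov" using stable_comp[OF stable_Cov binprod_projection_cover(1)[OF W] _ d(2) s(1)] s(2) by simp
  moreover have "f \<odot> t \<in> Cov" using binprod_projection_cover(2)[OF W] t(2) by simp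
  ultimately show ?thesis using A3[of t f] f t(1) homs_D by metis
qed

end

section \<open>Points of simplicial groups and of the nerve\<close>

context category_with_covers begin

lemma tup_upt:
  assumes T: "T \<in> Ob C" and F: "\<And>j. j < n \<Longrightarrow> F j \<in> homs C T (A j)"
  shows "tup C T (map F [0..<n]) \<in> homs C T (prd C (map A [0..<n]))"
    and "j < n \<Longrightarrow> prj C (map A [0..<n]) j \<odot> tup C T (map F [0..<n]) = F j"
  using tup[OF T, of "map F [0..<n]" "map A [0..<n]"] F by auto

lemma tup_pair:
  assumes a: "a \<in> homs C T A" and b: "b \<in> homs C T B"
  shows "tup C T [a, b] \<in> homs C T (prd C [A, B])"
    and "prj C [A, B] 0 \<odot> tup C T [a, b] = a" and "prj C [A, B] 1 \<odot> tup C T [a, b] = b"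
proof -
  have *: "[a, b] ! j \<in> homs C T ([A, B] ! j)" if "j < length [A, B]" for j using that a b by (auto simp: less_Suc_eq)
  show "tup C T [a, b] \<in> homs C T (prd C [A, B])" "prj C [A, B] 0 \<odot> tup C T [a, b] = a" "prj C [A, B] 1 \<odot> tup C T [a, b] = b"
    using tup[OF homs_ob(1)[OF a] _ *] by force+
qed

lemma prj_pair:
  assumes "A \<in> Ob C" "B \<in> Ob C"
  shows "prj C [A, B] 0 \<in> homs C (prd C [A, B]) A" "prj C [A, B] 1 \<in> homs C (prd C [A, B]) B"
  using prj_in[of "[A, B]" 0] prj_in[of "[A, B]" 1] assms by auto

lemma app2:
  assumes m: "m \<in> homs C (prd C [A, B]) D" and a: "a \<in> homs C T A" and b: "b \<in> homs C T B"
  shows app2_in: "app2 C m a b \<in> homs C T D"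
    and app2_comp: "h \<in> homs C S T \<Longrightarrow> app2 C m a b \<odot> h = app2 C m (a \<odot> h) (b \<odot> h)"
proof -
  have e: "app2 C m a b = m \<odot> tup C T [a, b]" using homs_D(1)[OF a] by (simp add: app2_def)
  show "app2 C m a b \<in> homs C T D" unfolding e by (rule Comp_homs[OF m tup_pair(1)[OF a b]])
  assume h: "h \<in> homs C S T"
  have "tup C T [a, b] \<odot> h = tup C S [a \<odot> h, b \<odot> h]"
    using tup_comp[OF h, of "[a, b]"] a b homs_D(2)[OF a] homs_D(2)[OF b] by auto
  moreover have "Dom C (a \<odot> h) = S" using homs_D(1)[OF Comp_homs[OF a h]] .
  ultimately show "app2 C m a b \<odot> h = app2 C m (a \<odot> h) (b \<odot> h)"
    unfolding e using assoc[OF h tup_pair(1)[OF a b] m] by (simp add: app2_def)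
qed

lemma bang_comp: "h \<in> homs C S T \<Longrightarrow> bang C T \<odot> h = bang C S"
  using pt_eqI[OF Comp_homs[OF bang_in[OF homs_ob(2)]] bang_in[OF homs_ob(1)]] by blast

lemma group_objectD:
  assumes g: "group_object C G m e v"
  shows "m \<in> homs C (prd C [G, G]) G" "e \<in> homs C (pt C) G" "v \<in> homs C G G"
    and "a \<in> homs C T G \<Longrightarrow> b \<in> homs C T G \<Longrightarrow> c \<in> homs C T G \<Longrightarrow>
      app2 C m (app2 C m a b) c = app2 C m a (app2 C m b c)"
    and "a \<in> homs C T G \<Longrightarrow> app2 C m (e \<odot> bang C T) a = a"
    and "a \<in> homs C T G \<Longrightarrow> app2 C m a (e \<odot> bang C T) = a"
    and "a \<in> homs C T G \<Longrightarrow> app2 C m (v \<odot> a) a = e \<odot> bang C T"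
    and "a \<in> homs C T G \<Longrightarrow> app2 C m a (v \<odot> a) = e \<odot> bang C T"
proof -
  note g' = g[unfolded group_object_def]
  from g' show "m \<in> homs C (prd C [G, G]) G" by (elim conjE)
  from g' show "e \<in> homs C (pt C) G" by (elim conjE)
  from g' show "v \<in> homs C G G" by (elim conjE)
  from g' have as: "\<forall>T\<in>Ob C. \<forall>a\<in>homs C T G. \<forall>b\<in>homs C T G. \<forall>c\<in>homs C T G.
        app2 C m (app2 C m a b) c = app2 C m a (app2 C m b c)" by (elim conjE)
  show "a \<in> homs C T G \<Longrightarrow> b \<in> homs C T G \<Longrightarrow> c \<in> homs C T G \<Longrightarrow>
      app2 C m (app2 C m a b) c = app2 C m a (app2 C m b c)"
    by (rule as[rule_format, OF homs_ob(1)])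
  from g' have u: "\<forall>T\<in>Ob C. \<forall>a\<in>homs C T G.
        app2 C m (e \<odot> bang C T) a = a \<and> app2 C m a (e \<odot> bang C T) = a \<and>
        app2 C m (v \<odot> a) a = e \<odot> bang C T \<and> app2 C m a (v \<odot> a) = e \<odot> bang C T" by (elim conjE)
  show "a \<in> homs C T G \<Longrightarrow> app2 C m (e \<odot> bang C T) a = a"
    "a \<in> homs C T G \<Longrightarrow> app2 C m a (e \<odot> bang C T) = a"
    "a \<in> homs C T G \<Longrightarrow> app2 C m (v \<odot> a) a = e \<odot> bang C T"
    "a \<in> homs C T G \<Longrightarrow> app2 C m a (v \<odot> a) = e \<odot> bang C T"
    using u[THEN bspec, OF homs_ob(1), THEN bspec, of a] by simp_all
qed

lemma simplicial_lie_groupD: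
  assumes G: "simplicial_lie_group C G"
  shows "simplicial_object C G" "group_object C (ob G n) (mul G n) (one G n) (inve G n)"
    and "a \<in> homs C T (ob G (Suc n)) \<Longrightarrow> b \<in> homs C T (ob G (Suc n)) \<Longrightarrow> i \<le> Suc n \<Longrightarrow>
      fc G (Suc n) i \<odot> app2 C (mul G (Suc n)) a b = app2 C (mul G n) (fc G (Suc n) i \<odot> a) (fc G (Suc n) i \<odot> b)"
    and "a \<in> homs C T (ob G n) \<Longrightarrow> b \<in> homs C T (ob G n) \<Longrightarrow> i \<le> n \<Longrightarrow>
      dg G n i \<odot> app2 C (mul G n) a b = app2 C (mul G (Suc n)) (dg G n i \<odot> a) (dg G n i \<odot> b)"
proof -
  note g = G[unfolded simplicial_lie_group_def]
  show "simplicial_object C G" using g by (elim conjE)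
  from g have "\<forall>n. group_object C (ob G n) (mul G n) (one G n) (inve G n)" by (elim conjE)
  then show "group_object C (ob G n) (mul G n) (one G n) (inve G n)" by blast
  from g have h: "\<forall>n. \<forall>T \<in> Ob C. \<forall>a \<in> homs C T (ob G n). \<forall>b \<in> homs C T (ob G n).
        (\<forall>i \<le> n. n > 0 \<longrightarrow> fc G n i \<odot> app2 C (mul G n) a b =
           app2 C (mul G (n - 1)) (fc G n i \<odot> a) (fc G n i \<odot> b)) \<and>
        (\<forall>i \<le> n. dg G n i \<odot> app2 C (mul G n) a b =
           app2 C (mul G (n + 1)) (dg G n i \<odot> a) (dg G n i \<odot> b))" by (elim conjE)
  show "fc G (Suc n) i \<odot> app2 C (mul G (Suc n)) a b = app2 C (mul G n) (fc G (Suc n) i \<odot> a) (fc G (Suc n) i \<odot> b)"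
    if "a \<in> homs C T (ob G (Suc n))" "b \<in> homs C T (ob G (Suc n))" "i \<le> Suc n"
    using bspec[OF bspec[OF bspec[OF spec[OF h] homs_ob(1)[OF that(1)]] that(1)] that(2), THEN conjunct1] that(3) by simp
  show "dg G n i \<odot> app2 C (mul G n) a b = app2 C (mul G (Suc n)) (dg G n i \<odot> a) (dg G n i \<odot> b)"
    if "a \<in> homs C T (ob G n)" "b \<in> homs C T (ob G n)" "i \<le> n"
    using bspec[OF bspec[OF bspec[OF spec[OF h] homs_ob(1)[OF that(1)]] that(1)] that(2), THEN conjunct2] that(3) by simp
qed

lemma simplicial_group_points:
  assumes G: "simplicial_lie_group C G" and T: "T \<in> Ob C"
  shows "simplicial_group (\<lambda>n. homs C T (ob G n)) (\<lambda>n i x. fc G n i \<odot> x) (\<lambda>n i x. dg G n i \<odot> x)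
    (\<lambda>n. app2 C (mul G n)) (\<lambda>n. one G n \<odot> bang C T) (\<lambda>n x. inve G n \<odot> x)"
proof -
  note D = simplicial_lie_groupD[OF G]
  note gr = group_objectD[OF D(2)]
  interpret simplicial_set "\<lambda>n. homs C T (ob G n)" "\<lambda>n i x. fc G n i \<odot> x" "\<lambda>n i x. dg G n i \<odot> x"
    by (rule simplicial_set_points[OF D(1)])
  show ?thesis
  proof
    show "one G n \<odot> bang C T \<in> homs C T (ob G n)" for n by (rule Comp_homs[OF gr(2) bang_in[OF T]])
    show "app2 C (mul G n) x y \<in> homs C T (ob G n)" if "x \<in> homs C T (ob G n)" "y \<in> homs C T (ob G n)" for x y n
      by (rule app2_in[OF gr(1) that])
    show "inve G n \<odot> x \<in> homs C T (ob G n)" if "x \<in> homs C T (ob G n)" for x n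
      by (rule Comp_homs[OF gr(3) that])
  qed (rule gr(4-8) D(3,4); assumption)+
qed

text \<open>
  A filler \<open>r\<close> of the universal horn is a section of the horn-filling map \<open>f\<close>.  The transport
  \<open>t(x, h) = x (r (f x))\<^sup>-\<^sup>1 r(h)\<close> has faces \<open>h\<close>, because \<open>x\<close> and \<open>r (f x)\<close> have the same faces.
\<close>

theorem group_horn_cover:
  assumes G: "simplicial_lie_group C G" and i: "i \<le> Suc k"
  shows "horn_fills Cov G (Suc k) i"
proof (rule horn_covers_by_induction[OF _ _ i])
  show X: "simplicial_object C G" by (rule simplicial_lie_groupD[OF G])
  fix k i L u assume i: "i \<le> Suc k" and L: "universal ({..Suc k} - {i}) (abs_horn G (Suc k) ({..Suc k} - {i})) L u"
  let ?J = "{..Suc k} - {i}" and ?A = "ob G (Suc k)"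
  have J: "?J \<subset> {..Suc k}" using i by auto
  have F: "presheaf ?J (abs_horn G (Suc k) ?J)" by (rule presheaf_abs_horn[OF X J])
  have Ao: "?A \<in> Ob C" by (rule simplicial_object_ob[OF X])
  have Lo: "L \<in> Ob C" by (rule universal_D(1)[OF L])
  have u: "u j \<in> homs C L (ob G k)" if "j \<in> ?J" for j by (rule abs_horn_in[OF universal_D(2)[OF L] that])
  have fc: "fc G (Suc k) j \<in> homs C ?A (ob G k)" if "j \<in> ?J" for j using fc_in[OF X] that by auto
  have "abs_horn G (Suc k) ?J ?A (\<lambda>j. fc G (Suc k) j \<odot> Ident C ?A)"
    by (rule abs_horn_faces[OF X J Ident_homs[OF Ao]])
  from universal_D(3)[OF L, OF this Ao] obtain f where f: "f \<in> homs C ?A L \<and> (\<forall>j\<in>?J. u j \<odot> f = fc G (Suc k) j \<odot> Ident C ?A)"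
    by (elim exE)
  then have f1: "f \<in> homs C ?A L" and f2: "\<And>j. j \<in> ?J \<Longrightarrow> u j \<odot> f = fc G (Suc k) j" using Ident_right[OF fc] by auto
  have ff: "u j \<odot> f \<odot> x = fc G (Suc k) j \<odot> x" if "x \<in> homs C T ?A" "j \<in> ?J" for x T j
    using assoc[OF that(1) f1 u[OF that(2)]] f2[OF that(2)] by simp
  interpret GL: simplicial_group "\<lambda>n. homs C L (ob G n)" "\<lambda>n i x. fc G n i \<odot> x" "\<lambda>n i x. dg G n i \<odot> x"
    "\<lambda>n. app2 C (mul G n)" "\<lambda>n. one G n \<odot> bang C L" "\<lambda>n x. inve G n \<odot> x" by (rule simplicial_group_points[OF G Lo])
  from GL.horn_filler[OF i universal_D(2)[OF L, unfolded abs_horn_def]]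
  obtain r where r: "r \<in> homs C L ?A" "\<forall>j\<in>?J. fc G (Suc k) j \<odot> r = u j" by blast
  have fr: "f \<odot> r = Ident C L"
    by (rule universal_eqI[OF F L Comp_homs[OF f1 r(1)] Ident_homs[OF Lo]]) (use ff[OF r(1)] r(2) Ident_right[OF u] in auto)
  obtain W a b where W: "binprod ?A L W a b" using binprod_ex[OF Lo Ao] by blast
  note d = binprod_D(1-3)[OF W]
  interpret GW: simplicial_group "\<lambda>n. homs C W (ob G n)" "\<lambda>n i x. fc G n i \<odot> x" "\<lambda>n i x. dg G n i \<odot> x"
    "\<lambda>n. app2 C (mul G n)" "\<lambda>n. one G n \<odot> bang C W" "\<lambda>n x. inve G n \<odot> x" by (rule simplicial_group_points[OF G d(1)])
  define p where "p = r \<odot> f \<odot> a"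
  define q where "q = r \<odot> b"
  define t where "t = app2 C (mul G (Suc k)) (app2 C (mul G (Suc k)) a (inve G (Suc k) \<odot> p)) q"
  have p: "p \<in> homs C W ?A" and q: "q \<in> homs C W ?A" unfolding p_def q_def using r(1) f1 d Comp_homs by blast+
  have v: "inve G (Suc k) \<odot> p \<in> homs C W ?A" using GW.v_in p by blast
  have t: "t \<in> homs C W ?A" unfolding t_def using GW.m_in v d(2) q by blast
  have ft: "f \<odot> t = b"
  proof (rule universal_eqI[OF F L Comp_homs[OF f1 t] d(3)])
    fix j assume j: "j \<in> ?J"
    then have jk: "j \<le> Suc k" by simp
    have in1: "app2 C (mul G (Suc k)) a (inve G (Suc k) \<odot> p) \<in> homs C W ?A" using GW.m_in v d(2) by blast
    have fa: "f \<odot> a \<in> homs C W L" using f1 d Comp_homs by blast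
    have da: "fc G (Suc k) j \<odot> a \<in> homs C W (ob G k)" using GW.d_in[OF d(2) jk] .
    have dp: "fc G (Suc k) j \<odot> p = fc G (Suc k) j \<odot> a"
      using assoc[OF fa r(1) fc[OF j]] r(2) j ff[OF d(2) j] by (simp add: p_def)
    have dq: "fc G (Suc k) j \<odot> q = u j \<odot> b" using assoc[OF d(3) r(1) fc[OF j]] r(2) j by (simp add: q_def)
    have "u j \<odot> f \<odot> t = fc G (Suc k) j \<odot> t" by (rule ff[OF t j])
    also have "\<dots> = app2 C (mul G k) (app2 C (mul G k) (fc G (Suc k) j \<odot> a) (inve G k \<odot> fc G (Suc k) j \<odot> a)) (u j \<odot> b)"
      unfolding t_def using GW.d_m[OF in1 q jk] GW.d_m[OF d(2) v jk] GW.d_v[OF p jk] dp dq by simp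
    also have "\<dots> = u j \<odot> b" using GW.m_v_right[OF da] GW.m_e_left[OF Comp_homs[OF u[OF j] d(3)]] by simp
    finally show "u j \<odot> f \<odot> t = u j \<odot> b" .
  qed
  have "f \<in> Cov"
  proof (rule cover_of_transport[OF f1 W t ft])
    fix s assume s: "s \<in> homs C W W" "a \<odot> s = t" "b \<odot> s = f \<odot> a"
    note gr = group_objectD[OF simplicial_lie_groupD(2)[OF G]]
    have ps: "p \<odot> s = q"
      using assoc[OF s(1) Comp_homs[OF f1 d(2)] r(1)] assoc[OF s(1) d(2) f1] s(2) ft by (simp add: p_def q_def)
    have qs: "q \<odot> s = p" using assoc[OF s(1) d(3) r(1)] s(3) by (simp add: p_def q_def)
    have "t \<odot> s = app2 C (mul G (Suc k)) (app2 C (mul G (Suc k)) t (inve G (Suc k) \<odot> q)) p"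
      unfolding t_def
      using app2_comp[OF gr(1) GW.m_in[OF d(2) v] q s(1)] app2_comp[OF gr(1) d(2) v s(1)]
        assoc[OF s(1) p gr(3)] ps qs s(2) by (simp add: t_def)
    also have "app2 C (mul G (Suc k)) t (inve G (Suc k) \<odot> q) = app2 C (mul G (Suc k)) a (inve G (Suc k) \<odot> p)"
      unfolding t_def using GW.m_assoc[OF GW.m_in[OF d(2) v] q GW.v_in[OF q]] GW.m_v_right[OF q] GW.m_e_right[OF GW.m_in[OF d(2) v]]
      by simp
    also have "app2 C (mul G (Suc k)) (app2 C (mul G (Suc k)) a (inve G (Suc k) \<odot> p)) p = a"
      by (rule GW.m_v_cancel_right[OF p d(2)])
    finally show "t \<odot> s = a" .
  qed
  then show "classified Cov ?J (abs_horn G (Suc k) ?J) ?A (fc G (Suc k))"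
    unfolding classified_def using L f1 f2 by (intro exI[of _ L] exI[of _ u] exI[of _ f]) simp
qed

lemma nerve_ob_in: "simplicial_object C G \<Longrightarrow> nerve_ob C G n \<in> Ob C"
  unfolding nerve_ob_def by (rule prd_ob) (auto simp: simplicial_object_ob)

lemma nerve_prj: "simplicial_object C G \<Longrightarrow> j < n \<Longrightarrow> prj C (map (ob G) [0..<n]) j \<in> homs C (nerve_ob C G n) (ob G j)"
proof -
  assume "simplicial_object C G" "j < n"
  moreover from this have "set (map (ob G) [0..<n]) \<subseteq> Ob C" using simplicial_object_ob by auto
  ultimately show ?thesis unfolding nerve_ob_def using prj_in[of "map (ob G) [0..<n]" j] by simp
qed

lemma nerve_fc:
  assumes G: "simplicial_lie_group C G" and i: "i \<le> Suc n"
  shows nerve_fc_in: "nerve_fc C G (Suc n) i \<in> homs C (nerve_ob C G (Suc n)) (nerve_ob C G n)"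
    and prj_nerve_fc: "w \<in> homs C T (nerve_ob C G (Suc n)) \<Longrightarrow> j < n \<Longrightarrow>
      prj C (map (ob G) [0..<n]) j \<odot> nerve_fc C G (Suc n) i \<odot> w =
       (if Suc j < i then prj C (map (ob G) [0..<Suc n]) j \<odot> w
        else if Suc j = i then app2 C (mul G j) (prj C (map (ob G) [0..<Suc n]) j \<odot> w) (fc G (Suc j) i \<odot> prj C (map (ob G) [0..<Suc n]) (Suc j) \<odot> w)
        else fc G (Suc j) i \<odot> prj C (map (ob G) [0..<Suc n]) (Suc j) \<odot> w)"
proof -
  let ?W = "nerve_ob C G (Suc n)" and ?g = "prj C (map (ob G) [0..<Suc n])"
  note X = simplicial_lie_groupD(1)[OF G] and gr = group_objectD[OF simplicial_lie_groupD(2)[OF G]]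
  define F where "F j = (if Suc j < i then ?g j
                  else if Suc j = i then app2 C (mul G j) (?g j) (fc G (Suc j) i \<odot> ?g (Suc j))
                  else fc G (Suc j) i \<odot> ?g (Suc j))" for j
  have W: "?W \<in> Ob C" by (rule nerve_ob_in[OF X])
  have g: "?g j \<in> homs C ?W (ob G j)" if "j < Suc n" for j using nerve_prj[OF X that] .
  have dg: "fc G (Suc j) i \<odot> ?g (Suc j) \<in> homs C ?W (ob G j)" if "j < n" "i \<le> Suc j" for j
    by (rule Comp_homs[OF fc_in[OF X that(2)] g]) (use that in simp)
  have F: "F j \<in> homs C ?W (ob G j)" if j: "j < n" for j
    unfolding F_def using g[of j] dg[OF j] app2_in[OF gr(1) g[of j] dg[OF j]] j by auto
  have e: "nerve_fc C G (Suc n) i = tup C ?W (map F [0..<n])"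
    unfolding nerve_fc_def Let_def F_def diff_Suc_1 ..
  show f: "nerve_fc C G (Suc n) i \<in> homs C ?W (nerve_ob C G n)"
    unfolding e nerve_ob_def[of C G n] by (rule tup_upt(1)[OF W F])
  assume w: "w \<in> homs C T ?W" and j: "j < n"
  have "prj C (map (ob G) [0..<n]) j \<odot> nerve_fc C G (Suc n) i \<odot> w = F j \<odot> w"
    using assoc[OF w f nerve_prj[OF X j]] tup_upt(2)[OF W F j] by (simp add: e)
  also have "\<dots> = (if Suc j < i then ?g j \<odot> w
        else if Suc j = i then app2 C (mul G j) (?g j \<odot> w) (fc G (Suc j) i \<odot> ?g (Suc j) \<odot> w)
        else fc G (Suc j) i \<odot> ?g (Suc j) \<odot> w)"
  proof -
    have j': "j < Suc n" "Suc j < Suc n" using j by auto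
    show ?thesis unfolding F_def
      using assoc[OF w g[OF j'(2)] fc_in[OF X, of i j]] app2_comp[OF gr(1) g[OF j'(1)] dg[OF j] w] by auto
  qed
  finally show "prj C (map (ob G) [0..<n]) j \<odot> nerve_fc C G (Suc n) i \<odot> w = \<dots>" .
qed

lemma nerve_dg:
  assumes G: "simplicial_lie_group C G" and i: "i \<le> n"
  shows nerve_dg_in: "nerve_dg C G n i \<in> homs C (nerve_ob C G n) (nerve_ob C G (Suc n))"
    and prj_nerve_dg: "w \<in> homs C T (nerve_ob C G n) \<Longrightarrow> j < Suc n \<Longrightarrow>
      prj C (map (ob G) [0..<Suc n]) j \<odot> nerve_dg C G n i \<odot> w =
       (if j < i then prj C (map (ob G) [0..<n]) j \<odot> w
        else if j = i then one G i \<odot> bang C T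
        else dg G (j - 1) i \<odot> prj C (map (ob G) [0..<n]) (j - 1) \<odot> w)"
proof -
  let ?W = "nerve_ob C G n" and ?g = "prj C (map (ob G) [0..<n])"
  note X = simplicial_lie_groupD(1)[OF G] and gr = group_objectD[OF simplicial_lie_groupD(2)[OF G]]
  define F where "F j = (if j < i then ?g j else if j = i then one G i \<odot> bang C ?W
                  else dg G (j - 1) i \<odot> ?g (j - 1))" for j
  have W: "?W \<in> Ob C" by (rule nerve_ob_in[OF X])
  have g: "?g j \<in> homs C ?W (ob G j)" if "j < n" for j using nerve_prj[OF X that] .
  have sg: "dg G (j - 1) i \<odot> ?g (j - 1) \<in> homs C ?W (ob G j)" if "j < Suc n" "i < j" for j
    using Comp_homs[OF dg_in[OF X, of i "j - 1"] g[of "j - 1"]] that by simp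
  have F: "F j \<in> homs C ?W (ob G j)" if j: "j < Suc n" for j
    unfolding F_def using g[of j] sg[OF j] Comp_homs[OF gr(2) bang_in[OF W]] j i by auto
  have e: "nerve_dg C G n i = tup C ?W (map F [0..<Suc n])"
    unfolding nerve_dg_def Let_def F_def ..
  show f: "nerve_dg C G n i \<in> homs C ?W (nerve_ob C G (Suc n))"
    unfolding e nerve_ob_def[of C G "Suc n"] by (rule tup_upt(1)[OF W F])
  assume w: "w \<in> homs C T ?W" and j: "j < Suc n"
  have "prj C (map (ob G) [0..<Suc n]) j \<odot> nerve_dg C G n i \<odot> w = F j \<odot> w"
    using assoc[OF w f nerve_prj[OF X j]] tup_upt(2)[OF W F j] by (simp add: e del: upt_Suc)
  also have "\<dots> = (if j < i then ?g j \<odot> w else if j = i then one G i \<odot> bang C T else dg G (j - 1) i \<odot> ?g (j - 1) \<odot> w)"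
  proof -
    have "(dg G (j - 1) i \<odot> ?g (j - 1)) \<odot> w = dg G (j - 1) i \<odot> ?g (j - 1) \<odot> w" if "i < j"
      by (rule assoc[OF w g dg_in[OF X]]) (use that j in auto)
    then show ?thesis unfolding F_def
      using assoc[OF w bang_in[OF W] gr(2)] bang_comp[OF w] by auto
  qed
  finally show "prj C (map (ob G) [0..<Suc n]) j \<odot> nerve_dg C G n i \<odot> w = \<dots>" .
qed

lemma nerve_points:
  assumes G: "simplicial_lie_group C G" and T: "T \<in> Ob C"
  shows "nerve_points (\<lambda>n. homs C T (ob G n)) (\<lambda>n i x. fc G n i \<odot> x) (\<lambda>n i x. dg G n i \<odot> x)
    (\<lambda>n. app2 C (mul G n)) (\<lambda>n. one G n \<odot> bang C T) (\<lambda>n x. inve G n \<odot> x)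
    (\<lambda>n. homs C T (nerve_ob C G n)) (\<lambda>n w j. prj C (map (ob G) [0..<n]) j \<odot> w)
    (\<lambda>n i w. nerve_fc C G n i \<odot> w) (\<lambda>n i w. nerve_dg C G n i \<odot> w)"
proof -
  note X = simplicial_lie_groupD(1)[OF G]
  interpret simplicial_group "\<lambda>n. homs C T (ob G n)" "\<lambda>n i x. fc G n i \<odot> x" "\<lambda>n i x. dg G n i \<odot> x"
    "\<lambda>n. app2 C (mul G n)" "\<lambda>n. one G n \<odot> bang C T" "\<lambda>n x. inve G n \<odot> x" by (rule simplicial_group_points[OF G T])
  have As: "set (map (ob G) [0..<n]) \<subseteq> Ob C" for n using simplicial_object_ob[OF X] by auto
  show ?thesis
  proof
    fix n j w assume "w \<in> homs C T (nerve_ob C G n)" "j < n"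
    then show "prj C (map (ob G) [0..<n]) j \<odot> w \<in> homs C T (ob G j)" using Comp_homs[OF nerve_prj[OF X]] by blast
  next
    fix n w w' assume "w \<in> homs C T (nerve_ob C G n)" "w' \<in> homs C T (nerve_ob C G n)"
      "\<And>j. j < n \<Longrightarrow> prj C (map (ob G) [0..<n]) j \<odot> w = prj C (map (ob G) [0..<n]) j \<odot> w'"
    then show "w = w'" by (intro prd_eqI[OF As[of n], of w T w']) (simp_all add: nerve_ob_def)
  next
    fix n g assume g: "\<And>j. j < n \<Longrightarrow> g j \<in> homs C T (ob G j)"
    from tup_upt[of T n g "ob G", OF T g] show "\<exists>w\<in>homs C T (nerve_ob C G n). \<forall>j<n. prj C (map (ob G) [0..<n]) j \<odot> w = g j"
      unfolding nerve_ob_def by blast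
  next
    fix n i w assume "w \<in> homs C T (nerve_ob C G (Suc n))" "i \<le> Suc n"
    then show "nerve_fc C G (Suc n) i \<odot> w \<in> homs C T (nerve_ob C G n)" using Comp_homs[OF nerve_fc_in[OF G]] by blast
  next
    fix n i w assume "w \<in> homs C T (nerve_ob C G n)" "i \<le> n"
    then show "nerve_dg C G n i \<odot> w \<in> homs C T (nerve_ob C G (Suc n))" using Comp_homs[OF nerve_dg_in[OF G]] by blast
  qed (rule prj_nerve_fc[OF G] prj_nerve_dg[OF G]; assumption)+
qed

lemma simplicial_object_nerve:
  assumes G: "simplicial_lie_group C G" shows "simplicial_object C (nerve C G)"
proof (rule simplicial_objectI)
  fix T assume "T \<in> Ob C"
  then interpret nerve_points "\<lambda>n. homs C T (ob G n)" "\<lambda>n i x. fc G n i \<odot> x" "\<lambda>n i x. dg G n i \<odot> x"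
    "\<lambda>n. app2 C (mul G n)" "\<lambda>n. one G n \<odot> bang C T" "\<lambda>n x. inve G n \<odot> x"
    "\<lambda>n. homs C T (nerve_ob C G n)" "\<lambda>n w j. prj C (map (ob G) [0..<n]) j \<odot> w"
    "\<lambda>n i w. nerve_fc C G n i \<odot> w" "\<lambda>n i w. nerve_dg C G n i \<odot> w" by (rule nerve_points[OF G])
  show "simplicial_set (\<lambda>n. homs C T (ob (nerve C G) n)) (\<lambda>n i x. fc (nerve C G) n i \<odot> x) (\<lambda>n i x. dg (nerve C G) n i \<odot> x)"
    using simplicial_set_nerve by (simp add: nerve_def)
qed (simp_all add: nerve_def nerve_ob_in[OF simplicial_lie_groupD(1)[OF G]] nerve_fc_in[OF G] nerve_dg_in[OF G])

lemma simplicial_actionD: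
  assumes a: "simplicial_action C G X a"
  shows "simplicial_object C X" "a n \<in> homs C (prd C [ob G n, ob X n]) (ob X n)"
    and "x \<in> homs C T (ob X n) \<Longrightarrow> app2 C (a n) (one G n \<odot> bang C T) x = x"
    and "g \<in> homs C T (ob G n) \<Longrightarrow> h \<in> homs C T (ob G n) \<Longrightarrow> x \<in> homs C T (ob X n) \<Longrightarrow>
       app2 C (a n) (app2 C (mul G n) g h) x = app2 C (a n) g (app2 C (a n) h x)"
    and "g \<in> homs C T (ob G (Suc n)) \<Longrightarrow> x \<in> homs C T (ob X (Suc n)) \<Longrightarrow> i \<le> Suc n \<Longrightarrow>
       fc X (Suc n) i \<odot> app2 C (a (Suc n)) g x = app2 C (a n) (fc G (Suc n) i \<odot> g) (fc X (Suc n) i \<odot> x)"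
    and "g \<in> homs C T (ob G n) \<Longrightarrow> x \<in> homs C T (ob X n) \<Longrightarrow> i \<le> n \<Longrightarrow>
       dg X n i \<odot> app2 C (a n) g x = app2 C (a (Suc n)) (dg G n i \<odot> g) (dg X n i \<odot> x)"
proof -
  note g = a[unfolded simplicial_action_def]
  show "simplicial_object C X" using g by (elim conjE)
  from g have "\<forall>n. a n \<in> homs C (prd C [ob G n, ob X n]) (ob X n)" by (elim conjE)
  then show "a n \<in> homs C (prd C [ob G n, ob X n]) (ob X n)" by blast
  from g have h: "\<forall>n. \<forall>T \<in> Ob C. \<forall>x \<in> homs C T (ob X n).
        app2 C (a n) (one G n \<odot> bang C T) x = x \<and>
        (\<forall>g \<in> homs C T (ob G n). \<forall>h \<in> homs C T (ob G n).
           app2 C (a n) (app2 C (mul G n) g h) x = app2 C (a n) g (app2 C (a n) h x)) \<and>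
        (\<forall>g \<in> homs C T (ob G n).
           (\<forall>i \<le> n. n > 0 \<longrightarrow> fc X n i \<odot> app2 C (a n) g x =
              app2 C (a (n - 1)) (fc G n i \<odot> g) (fc X n i \<odot> x)) \<and>
           (\<forall>i \<le> n. dg X n i \<odot> app2 C (a n) g x =
              app2 C (a (n + 1)) (dg G n i \<odot> g) (dg X n i \<odot> x)))" by (elim conjE)
  have h': "app2 C (a n) (one G n \<odot> bang C T) x = x \<and>
        (\<forall>g \<in> homs C T (ob G n). \<forall>h \<in> homs C T (ob G n).
           app2 C (a n) (app2 C (mul G n) g h) x = app2 C (a n) g (app2 C (a n) h x)) \<and>
        (\<forall>g \<in> homs C T (ob G n).
           (\<forall>i \<le> n. n > 0 \<longrightarrow> fc X n i \<odot> app2 C (a n) g x =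
              app2 C (a (n - 1)) (fc G n i \<odot> g) (fc X n i \<odot> x)) \<and>
           (\<forall>i \<le> n. dg X n i \<odot> app2 C (a n) g x =
              app2 C (a (n + 1)) (dg G n i \<odot> g) (dg X n i \<odot> x)))" if "x \<in> homs C T (ob X n)" for x T n
    by (rule bspec[OF bspec[OF spec[OF h] homs_ob(1)[OF that]] that])
  show "x \<in> homs C T (ob X n) \<Longrightarrow> app2 C (a n) (one G n \<odot> bang C T) x = x" using h' by blast
  show "g \<in> homs C T (ob G n) \<Longrightarrow> h \<in> homs C T (ob G n) \<Longrightarrow> x \<in> homs C T (ob X n) \<Longrightarrow>
       app2 C (a n) (app2 C (mul G n) g h) x = app2 C (a n) g (app2 C (a n) h x)" using h' by blast
  show "fc X (Suc n) i \<odot> app2 C (a (Suc n)) g x = app2 C (a n) (fc G (Suc n) i \<odot> g) (fc X (Suc n) i \<odot> x)"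
    if "g \<in> homs C T (ob G (Suc n))" "x \<in> homs C T (ob X (Suc n))" "i \<le> Suc n"
    using h'[OF that(2), THEN conjunct2, THEN conjunct2, THEN bspec, OF that(1), THEN conjunct1] that(3) by simp
  show "dg X n i \<odot> app2 C (a n) g x = app2 C (a (Suc n)) (dg G n i \<odot> g) (dg X n i \<odot> x)"
    if "g \<in> homs C T (ob G n)" "x \<in> homs C T (ob X n)" "i \<le> n"
    using h'[OF that(2), THEN conjunct2, THEN conjunct2, THEN bspec, OF that(1), THEN conjunct2] that(3) by simp
qed

end

section \<open>Points of the homotopy quotient\<close>

context category begin

lemma simplicial_mapI:
  assumes X: "simplicial_object C X" and Y: "simplicial_object C Y"
    and f: "\<And>n. f n \<in> homs C (ob X n) (ob Y n)"
    and fd: "\<And>n i x. x \<in> homs C (ob X (Suc n)) (ob X (Suc n)) \<Longrightarrow> i \<le> Suc n \<Longrightarrow>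
      f n \<odot> fc X (Suc n) i \<odot> x = fc Y (Suc n) i \<odot> f (Suc n) \<odot> x"
    and fs: "\<And>n i x. x \<in> homs C (ob X n) (ob X n) \<Longrightarrow> i \<le> n \<Longrightarrow>
      f (Suc n) \<odot> dg X n i \<odot> x = dg Y n i \<odot> f n \<odot> x"
  shows "simplicial_map C X Y f"
proof -
  have I: "Ident C (ob X n) \<in> homs C (ob X n) (ob X n)" for n using Ident_homs simplicial_object_ob[OF X] by blast
  have "f (n - 1) \<odot> fc X n i = fc Y n i \<odot> f n" if n: "0 < n" "i \<le> n" for n i
  proof -
    obtain m where m: "n = Suc m" using n(1) by (cases n) auto
    then have i: "i \<le> Suc m" using n by simp
    show ?thesis using fd[OF I i] Ident_right[OF fc_in[OF X i]] Ident_right[OF f] m by simp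
  qed
  moreover have "f (n + 1) \<odot> dg X n i = dg Y n i \<odot> f n" if "i \<le> n" for n i
    using fs[OF I that] Ident_right[OF dg_in[OF X that]] Ident_right[OF f] by simp
  ultimately show ?thesis unfolding simplicial_map_def using f by simp
qed

end

context category_with_covers begin

lemma simplicial_object_point: "simplicial_object C (point C)"
proof (rule simplicial_objectI)
  fix T :: 'o
  have id: "Ident C (pt C) \<odot> x = x" if "x \<in> homs C T (pt C)" for x using Ident_left[OF that] .
  show "simplicial_set (\<lambda>n. homs C T (ob (point C) n)) (\<lambda>n i x. fc (point C) n i \<odot> x) (\<lambda>n i x. dg (point C) n i \<odot> x)"
    by unfold_locales (simp_all add: point_def id)
qed (simp_all add: point_def pt_terminal Ident_homs)

lemma simplicial_map_bang: "simplicial_object C X \<Longrightarrow> simplicial_map C X (point C) (\<lambda>k. bang C (ob X k))"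
proof (rule simplicial_mapI[OF _ simplicial_object_point])
  assume X: "simplicial_object C X"
  note o = simplicial_object_ob[OF X]
  have I: "Ident C (pt C) \<in> homs C (pt C) (pt C)" using Ident_homs pt_terminal by blast
  show "bang C (ob X n) \<in> homs C (ob X n) (ob (point C) n)" for n using bang_in[OF o] by (simp add: point_def)
  fix n i x assume x: "x \<in> homs C (ob X (Suc n)) (ob X (Suc n))" "i \<le> Suc n"
  show "bang C (ob X n) \<odot> fc X (Suc n) i \<odot> x = fc (point C) (Suc n) i \<odot> bang C (ob X (Suc n)) \<odot> x"
    using pt_eqI[OF Comp_homs[OF bang_in[OF o] Comp_homs[OF fc_in[OF X x(2)] x(1)]] Comp_homs[OF I Comp_homs[OF bang_in[OF o] x(1)]]]
    by (simp add: point_def)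
next
  assume X: "simplicial_object C X"
  note o = simplicial_object_ob[OF X]
  have I: "Ident C (pt C) \<in> homs C (pt C) (pt C)" using Ident_homs pt_terminal by blast
  fix n i x assume x: "x \<in> homs C (ob X n) (ob X n)" "i \<le> n"
  show "bang C (ob X (Suc n)) \<odot> dg X n i \<odot> x = dg (point C) n i \<odot> bang C (ob X n) \<odot> x"
    using pt_eqI[OF Comp_homs[OF bang_in[OF o] Comp_homs[OF dg_in[OF X x(2)] x(1)]] Comp_homs[OF I Comp_homs[OF bang_in[OF o] x(1)]]]
    by (simp add: point_def)
qed

text \<open>
  Over the point, the condition of lying over a simplex of the base is empty.
\<close>

lemma rel_horn_point:
  assumes X: "simplicial_object C X" and J: "J \<subset> {..Suc k}"
  shows "rel_horn X (point C) (\<lambda>k. bang C (ob X k)) (Suc k) J T z \<longleftrightarrow>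
    abs_horn X (Suc k) J T (\<lambda>j. z (Some j)) \<and> z None \<in> homs C T (pt C)"
proof -
  have I: "Ident C (pt C) \<in> homs C (pt C) (pt C)" using Ident_homs pt_terminal by blast
  have "bang C (ob X k) \<odot> z (Some j) = Ident C (pt C) \<odot> z None"
    if "abs_horn X (Suc k) J T (\<lambda>j. z (Some j))" "z None \<in> homs C T (pt C)" "j \<in> J" for j
    by (rule pt_eqI[OF Comp_homs[OF bang_in[OF simplicial_object_ob[OF X]] abs_horn_in[OF that(1,3)]] Comp_homs[OF I that(2)]])
  then show ?thesis by (auto simp: rel_horn_def point_def)
qed

theorem horn_map_in_point_iff:
  assumes X: "simplicial_object C X" and i: "i \<le> Suc k" and K: "stable K"
  shows "horn_map_in C K X (point C) (\<lambda>k. bang C (ob X k)) (Suc k) i \<longleftrightarrow>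
    horn_fills K X (Suc k) i"
    (is "_ \<longleftrightarrow> classified K ?J ?F ?A ?e")
proof -
  let ?b = "\<lambda>k. bang C (ob X k)"
  let ?J' = "insert None (Some ` ?J)" and ?F' = "rel_horn X (point C) ?b (Suc k) ?J"
    and ?e' = "\<lambda>l. case l of None \<Rightarrow> ?b (Suc k) | Some j \<Rightarrow> fc X (Suc k) j"
  have J: "?J \<subset> {..Suc k}" using i by auto
  note f = simplicial_map_bang[OF X]
  note rp = rel_horn_point[OF X J]
  define R where "R T z x \<longleftrightarrow> ?F' T z \<and> ?F T x \<and> (\<forall>j\<in>?J. x j = z (Some j))" for T z x
  have Ao: "?A \<in> Ob C" by (rule simplicial_object_ob[OF X])
  have R1: "\<exists>x. R T z x" if "?F' T z" for T z
    using that rp[of T z] by (intro exI[of _ "\<lambda>j. z (Some j)"]) (simp add: R_def)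
  have R2: "\<exists>z. R T z x" if "T \<in> Ob C" "?F T x" for T x
    by (intro exI[of _ "\<lambda>l. case l of None \<Rightarrow> bang C T | Some j \<Rightarrow> x j"]) (simp add: R_def rp that bang_in)
  have R4: "(\<forall>j\<in>?J'. z j = z' j) \<longleftrightarrow> (\<forall>j\<in>?J. x j = x' j)" if "R T z x" "R T z' x'" for T z x z' x'
  proof -
    have "z None = z' None" by (rule pt_eqI) (use that rp in \<open>auto simp: R_def\<close>)
    then show ?thesis using that by (auto simp: R_def)
  qed
  have R5: "R S (\<lambda>j. z j \<odot> h) (\<lambda>j. x j \<odot> h)" if "R T z x" "h \<in> homs C S T" for T S z x h
    using that presheaf_comp[OF presheaf_rel_horn[OF X simplicial_object_point f J] _ that(2)]
      presheaf_comp[OF presheaf_abs_horn[OF X J] _ that(2)] by (simp add: R_def)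
  have "abs_horn X (Suc k) ?J ?A (\<lambda>j. fc X (Suc k) j \<odot> Ident C ?A)"
    by (rule abs_horn_faces[OF X J Ident_homs[OF Ao]])
  moreover have "abs_horn X (Suc k) ?J ?A (\<lambda>j. fc X (Suc k) j \<odot> Ident C ?A) \<longleftrightarrow> ?F ?A ?e"
    by (rule abs_horn_cong) (use Ident_right[OF fc_in[OF X]] in auto)
  ultimately have e: "R ?A ?e' ?e" using bang_in[OF Ao] by (simp add: R_def rp)
  have "horn_map_in C K X (point C) ?b (Suc k) i \<longleftrightarrow> classified K ?J' ?F' ?A ?e'"
    by (rule horn_map_in_iff[OF X simplicial_object_point f i K])
  also have "\<dots> \<longleftrightarrow> classified K ?J ?F ?A ?e"
  proof
    assume c: "classified K ?J' ?F' ?A ?e'"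
    show "classified K ?J ?F ?A ?e"
    proof (rule classified_transfer[where R = R, OF _ _ _ _ _ c e])
      show "\<exists>x. R T z x" if "T \<in> Ob C" "?F' T z" for T z by (rule R1[OF that(2)])
      show "\<exists>z. ?F' T z \<and> R T z x" if "T \<in> Ob C" "?F T x" for T x using R2[OF that] by (auto simp: R_def)
      show "?F T x" if "T \<in> Ob C" "R T z x" for T z x using that by (simp add: R_def)
    qed (rule R4 R5; assumption)+
  next
    assume c: "classified K ?J ?F ?A ?e"
    show "classified K ?J' ?F' ?A ?e'"
    proof (rule classified_transfer[where R = "\<lambda>T x z. R T z x", OF _ _ _ _ _ c e])
      show "\<exists>z. R T z x" if "T \<in> Ob C" "?F T x" for T x by (rule R2[OF that])
      show "\<exists>x. ?F T x \<and> R T z x" if "T \<in> Ob C" "?F' T z" for T z using R1[OF that(2)] by (auto simp: R_def)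
      show "?F' T z" if "T \<in> Ob C" "R T z x" for T z x using that by (simp add: R_def)
    qed (rule R4[symmetric] R5; assumption)+
  qed
  finally show ?thesis .
qed

lemma nerve_simps: "ob (nerve C G) = nerve_ob C G" "fc (nerve C G) = nerve_fc C G" "dg (nerve C G) = nerve_dg C G"
  by (simp_all add: nerve_def)

lemma hquot_simps: "ob (hquot C G X a) = hquot_ob C G X" "fc (hquot C G X a) = hquot_fc C G X a" "dg (hquot C G X a) = hquot_dg C G X"
  by (simp_all add: hquot_def)

abbreviation hq_nerve :: "('o, 'm) sgrp \<Rightarrow> ('o, 'm) sobj \<Rightarrow> nat \<Rightarrow> 'm" where
  "hq_nerve G X n \<equiv> prj C [nerve_ob C G n, ob X n] 0"

abbreviation hq_fibre :: "('o, 'm) sgrp \<Rightarrow> ('o, 'm) sobj \<Rightarrow> nat \<Rightarrow> 'm" where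
  "hq_fibre G X n \<equiv> prj C [nerve_ob C G n, ob X n] 1"

abbreviation coord :: "('o, 'm) sgrp \<Rightarrow> nat \<Rightarrow> nat \<Rightarrow> 'm" where
  "coord G n j \<equiv> prj C (map (ob G) [0..<n]) j"

context
  fixes G X a
  assumes G: "simplicial_lie_group C G" and a: "simplicial_action C G X a"
begin

lemma group_simplicial: "simplicial_object C G" by (rule simplicial_lie_groupD(1)[OF G])
lemma acted_simplicial: "simplicial_object C X" by (rule simplicial_actionD(1)[OF a])

lemma hquot_prj:
  "hq_nerve G X n \<in> homs C (hquot_ob C G X n) (nerve_ob C G n)"
  "hq_fibre G X n \<in> homs C (hquot_ob C G X n) (ob X n)"
  unfolding hquot_ob_def using prj_pair[OF nerve_ob_in[OF group_simplicial] simplicial_object_ob[OF acted_simplicial]] .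

lemma hquot_ob_in: "hquot_ob C G X n \<in> Ob C"
  using homs_ob(1)[OF hquot_prj(1)] .

lemma hquot_pair:
  assumes w: "w \<in> homs C T (nerve_ob C G n)" and x: "x \<in> homs C T (ob X n)"
  shows "tup C T [w, x] \<in> homs C T (hquot_ob C G X n)"
    "hq_nerve G X n \<odot> tup C T [w, x] = w" "hq_fibre G X n \<odot> tup C T [w, x] = x"
  unfolding hquot_ob_def using tup_pair[OF w x] .

lemma hquot_eqI:
  assumes "q \<in> homs C T (hquot_ob C G X n)" "q' \<in> homs C T (hquot_ob C G X n)"
    "hq_nerve G X n \<odot> q = hq_nerve G X n \<odot> q'" "hq_fibre G X n \<odot> q = hq_fibre G X n \<odot> q'"
  shows "q = q'"
  using binprod_D(5)[OF binprod_prd[OF simplicial_object_ob[OF acted_simplicial, of n] nerve_ob_in[OF group_simplicial, of n]], of q T q'] assms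
  by (simp add: hquot_ob_def)

lemma hquot_fc:
  assumes i: "i \<le> Suc n"
  shows hquot_fc_in: "hquot_fc C G X a (Suc n) i \<in> homs C (hquot_ob C G X (Suc n)) (hquot_ob C G X n)"
    and hq_nerve_fc: "q \<in> homs C T (hquot_ob C G X (Suc n)) \<Longrightarrow>
      hq_nerve G X n \<odot> hquot_fc C G X a (Suc n) i \<odot> q = nerve_fc C G (Suc n) i \<odot> hq_nerve G X (Suc n) \<odot> q"
    and hq_fibre_fc: "q \<in> homs C T (hquot_ob C G X (Suc n)) \<Longrightarrow>
      hq_fibre G X n \<odot> hquot_fc C G X a (Suc n) i \<odot> q =
        (if i = Suc n then app2 C (a n) (coord G (Suc n) n \<odot> hq_nerve G X (Suc n) \<odot> q) (fc X (Suc n) i \<odot> hq_fibre G X (Suc n) \<odot> q)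
         else fc X (Suc n) i \<odot> hq_fibre G X (Suc n) \<odot> q)"
proof -
  let ?w = "hq_nerve G X (Suc n)" and ?x = "hq_fibre G X (Suc n)"
  define w where "w = nerve_fc C G (Suc n) i \<odot> ?w"
  define g where "g = coord G (Suc n) n \<odot> ?w"
  define x where "x = (if i = Suc n then app2 C (a n) g (fc X (Suc n) (Suc n) \<odot> ?x) else fc X (Suc n) i \<odot> ?x)"
  note p = hquot_prj[of "Suc n"]
  have w: "w \<in> homs C (hquot_ob C G X (Suc n)) (nerve_ob C G n)"
    unfolding w_def by (rule Comp_homs[OF nerve_fc_in[OF G i] p(1)])
  have c: "coord G (Suc n) n \<in> homs C (nerve_ob C G (Suc n)) (ob G n)" by (rule nerve_prj[OF group_simplicial]) simp
  have g: "g \<in> homs C (hquot_ob C G X (Suc n)) (ob G n)" unfolding g_def by (rule Comp_homs[OF c p(1)])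
  have f: "fc X (Suc n) j \<odot> ?x \<in> homs C (hquot_ob C G X (Suc n)) (ob X n)" if "j \<le> Suc n" for j
    by (rule Comp_homs[OF fc_in[OF acted_simplicial that] p(2)])
  have x: "x \<in> homs C (hquot_ob C G X (Suc n)) (ob X n)"
    unfolding x_def using app2_in[OF simplicial_actionD(2)[OF a] g f[of "Suc n"]] f[OF i] by simp
  have e: "hquot_fc C G X a (Suc n) i = tup C (hquot_ob C G X (Suc n)) [w, x]"
    unfolding hquot_fc_def Let_def w_def x_def g_def diff_Suc_1 ..
  show h: "hquot_fc C G X a (Suc n) i \<in> homs C (hquot_ob C G X (Suc n)) (hquot_ob C G X n)"
    unfolding e by (rule hquot_pair(1)[OF w x])
  assume q: "q \<in> homs C T (hquot_ob C G X (Suc n))"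
  show "hq_nerve G X n \<odot> hquot_fc C G X a (Suc n) i \<odot> q = nerve_fc C G (Suc n) i \<odot> ?w \<odot> q"
    using assoc[OF q h hquot_prj(1)] hquot_pair(2)[OF w x] assoc[OF q p(1) nerve_fc_in[OF G i]] by (simp add: e w_def)
  have "hq_fibre G X n \<odot> hquot_fc C G X a (Suc n) i \<odot> q = x \<odot> q"
    using assoc[OF q h hquot_prj(2)] hquot_pair(3)[OF w x] by (simp add: e)
  also have "x \<odot> q = (if i = Suc n then app2 C (a n) (coord G (Suc n) n \<odot> ?w \<odot> q) (fc X (Suc n) i \<odot> ?x \<odot> q)
         else fc X (Suc n) i \<odot> ?x \<odot> q)"
    unfolding x_def using app2_comp[OF simplicial_actionD(2)[OF a] g f[of "Suc n"] q] assoc[OF q p(1) c]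
      assoc[OF q p(2) fc_in[OF acted_simplicial i]] assoc[OF q p(2) fc_in[OF acted_simplicial, of "Suc n" n]] by (simp add: g_def)
  finally show "hq_fibre G X n \<odot> hquot_fc C G X a (Suc n) i \<odot> q = \<dots>" .
qed

lemma hquot_dg:
  assumes i: "i \<le> n"
  shows hquot_dg_in: "hquot_dg C G X n i \<in> homs C (hquot_ob C G X n) (hquot_ob C G X (Suc n))"
    and hq_nerve_dg: "q \<in> homs C T (hquot_ob C G X n) \<Longrightarrow>
      hq_nerve G X (Suc n) \<odot> hquot_dg C G X n i \<odot> q = nerve_dg C G n i \<odot> hq_nerve G X n \<odot> q"
    and hq_fibre_dg: "q \<in> homs C T (hquot_ob C G X n) \<Longrightarrow>
      hq_fibre G X (Suc n) \<odot> hquot_dg C G X n i \<odot> q = dg X n i \<odot> hq_fibre G X n \<odot> q"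
proof -
  let ?w = "hq_nerve G X n" and ?x = "hq_fibre G X n"
  note p = hquot_prj[of n]
  have w: "nerve_dg C G n i \<odot> ?w \<in> homs C (hquot_ob C G X n) (nerve_ob C G (Suc n))"
    by (rule Comp_homs[OF nerve_dg_in[OF G i] p(1)])
  have x: "dg X n i \<odot> ?x \<in> homs C (hquot_ob C G X n) (ob X (Suc n))"
    by (rule Comp_homs[OF dg_in[OF acted_simplicial i] p(2)])
  have e: "hquot_dg C G X n i = tup C (hquot_ob C G X n) [nerve_dg C G n i \<odot> ?w, dg X n i \<odot> ?x]"
    unfolding hquot_dg_def Let_def ..
  show h: "hquot_dg C G X n i \<in> homs C (hquot_ob C G X n) (hquot_ob C G X (Suc n))"
    unfolding e by (rule hquot_pair(1)[OF w x])
  assume q: "q \<in> homs C T (hquot_ob C G X n)"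
  show "hq_nerve G X (Suc n) \<odot> hquot_dg C G X n i \<odot> q = nerve_dg C G n i \<odot> ?w \<odot> q"
    using assoc[OF q h hquot_prj(1)] hquot_pair(2)[OF w x] assoc[OF q p(1) nerve_dg_in[OF G i]] by (simp only: e)
  show "hq_fibre G X (Suc n) \<odot> hquot_dg C G X n i \<odot> q = dg X n i \<odot> ?x \<odot> q"
    using assoc[OF q h hquot_prj(2)] hquot_pair(3)[OF w x] assoc[OF q p(2) dg_in[OF acted_simplicial i]] by (simp only: e)
qed

lemma quotient_points:
  assumes T: "T \<in> Ob C"
  shows "quotient_points (\<lambda>n. homs C T (ob G n)) (\<lambda>n i x. fc G n i \<odot> x) (\<lambda>n i x. dg G n i \<odot> x)
    (\<lambda>n. app2 C (mul G n)) (\<lambda>n. one G n \<odot> bang C T) (\<lambda>n x. inve G n \<odot> x)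
    (\<lambda>n. homs C T (nerve_ob C G n)) (\<lambda>n w j. coord G n j \<odot> w)
    (\<lambda>n i w. nerve_fc C G n i \<odot> w) (\<lambda>n i w. nerve_dg C G n i \<odot> w)
    (\<lambda>n. homs C T (ob X n)) (\<lambda>n i x. fc X n i \<odot> x) (\<lambda>n i x. dg X n i \<odot> x) (\<lambda>n. app2 C (a n))
    (\<lambda>n. homs C T (hquot_ob C G X n)) (\<lambda>n q. hq_nerve G X n \<odot> q) (\<lambda>n q. hq_fibre G X n \<odot> q)
    (\<lambda>n i q. hquot_fc C G X a n i \<odot> q) (\<lambda>n i q. hquot_dg C G X n i \<odot> q)"
proof -
  interpret nerve_points "\<lambda>n. homs C T (ob G n)" "\<lambda>n i x. fc G n i \<odot> x" "\<lambda>n i x. dg G n i \<odot> x"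
    "\<lambda>n. app2 C (mul G n)" "\<lambda>n. one G n \<odot> bang C T" "\<lambda>n x. inve G n \<odot> x"
    "\<lambda>n. homs C T (nerve_ob C G n)" "\<lambda>n w j. coord G n j \<odot> w"
    "\<lambda>n i w. nerve_fc C G n i \<odot> w" "\<lambda>n i w. nerve_dg C G n i \<odot> w" by (rule nerve_points[OF G T])
  interpret X: simplicial_set "\<lambda>n. homs C T (ob X n)" "\<lambda>n i x. fc X n i \<odot> x" "\<lambda>n i x. dg X n i \<odot> x"
    by (rule simplicial_set_points[OF acted_simplicial])
  note A = simplicial_actionD[OF a]
  show ?thesis
  proof
    show "app2 C (a n) g x \<in> homs C T (ob X n)" if "g \<in> homs C T (ob G n)" "x \<in> homs C T (ob X n)" for g x n
      by (rule app2_in[OF A(2) that])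
    show "\<exists>q\<in>homs C T (hquot_ob C G X n). hq_nerve G X n \<odot> q = w \<and> hq_fibre G X n \<odot> q = x"
      if "w \<in> homs C T (nerve_ob C G n)" "x \<in> homs C T (ob X n)" for w x n
      using hquot_pair[OF that] by blast
    show "hq_nerve G X n \<odot> q \<in> homs C T (nerve_ob C G n)" "hq_fibre G X n \<odot> q \<in> homs C T (ob X n)"
      if "q \<in> homs C T (hquot_ob C G X n)" for q n
      by (rule Comp_homs[OF hquot_prj(1) that], rule Comp_homs[OF hquot_prj(2) that])
    show "hquot_fc C G X a (Suc n) i \<odot> q \<in> homs C T (hquot_ob C G X n)"
      if "q \<in> homs C T (hquot_ob C G X (Suc n))" "i \<le> Suc n" for q n i by (rule Comp_homs[OF hquot_fc_in[OF that(2)] that(1)])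
    show "hquot_dg C G X n i \<odot> q \<in> homs C T (hquot_ob C G X (Suc n))"
      if "q \<in> homs C T (hquot_ob C G X n)" "i \<le> n" for q n i by (rule Comp_homs[OF hquot_dg_in[OF that(2)] that(1)])
  qed (rule A(3-6) hquot_eqI hq_nerve_fc hq_fibre_fc hq_nerve_dg hq_fibre_dg; assumption)+
qed

lemma simplicial_object_hquot: "simplicial_object C (hquot C G X a)"
proof (rule simplicial_objectI)
  fix T assume "T \<in> Ob C"
  from quotient_points.simplicial_set_quotient[OF quotient_points[OF this]]
  show "simplicial_set (\<lambda>n. homs C T (ob (hquot C G X a) n)) (\<lambda>n i x. fc (hquot C G X a) n i \<odot> x) (\<lambda>n i x. dg (hquot C G X a) n i \<odot> x)"
    by (simp add: hquot_simps)
qed (simp_all add: hquot_simps hquot_ob_in hquot_fc_in hquot_dg_in)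

lemma simplicial_map_hq_nerve: "simplicial_map C (hquot C G X a) (nerve C G) (hq_nerve G X)"
  by (rule simplicial_mapI[OF simplicial_object_hquot simplicial_object_nerve[OF G]])
    (simp_all add: hquot_simps nerve_simps hquot_prj hq_nerve_fc hq_nerve_dg)

text \<open>
  The relation \<open>twisted\<close> for the points of the quotient over \<open>T\<close>, spelled out to exhibit its dependence on \<open>T\<close>.
\<close>

definition twisted_horn :: "'o \<Rightarrow> nat \<Rightarrow> nat set \<Rightarrow> 'm \<Rightarrow> (nat \<Rightarrow> 'm) \<Rightarrow> (nat \<Rightarrow> 'm) \<Rightarrow> bool" where
  "twisted_horn T n J w x z \<longleftrightarrow> w \<in> homs C T (nerve_ob C G (Suc n)) \<and>
     (\<forall>j\<in>J. x j \<in> homs C T (ob X n) \<and> z j \<in> homs C T (hquot_ob C G X n) \<and>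
       hq_nerve G X n \<odot> z j = nerve_fc C G (Suc n) j \<odot> w \<and>
       hq_fibre G X n \<odot> z j = (if j = Suc n then app2 C (a n) (coord G (Suc n) n \<odot> w) (x j) else x j))"

lemma twisted_horn_comp:
  assumes t: "twisted_horn T n J w x z" and J: "J \<subseteq> {..Suc n}" and h: "h \<in> homs C S T"
  shows "twisted_horn S n J (w \<odot> h) (\<lambda>j. x j \<odot> h) (\<lambda>j. z j \<odot> h)"
proof -
  have w: "w \<in> homs C T (nerve_ob C G (Suc n))" using t by (simp add: twisted_horn_def)
  have c: "coord G (Suc n) n \<in> homs C (nerve_ob C G (Suc n)) (ob G n)" by (rule nerve_prj[OF group_simplicial]) simp
  have "x j \<odot> h \<in> homs C S (ob X n) \<and> z j \<odot> h \<in> homs C S (hquot_ob C G X n) \<and>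
       hq_nerve G X n \<odot> z j \<odot> h = nerve_fc C G (Suc n) j \<odot> w \<odot> h \<and>
       hq_fibre G X n \<odot> z j \<odot> h = (if j = Suc n then app2 C (a n) (coord G (Suc n) n \<odot> w \<odot> h) (x j \<odot> h) else x j \<odot> h)"
    if j: "j \<in> J" for j
  proof -
    have x: "x j \<in> homs C T (ob X n)" and z: "z j \<in> homs C T (hquot_ob C G X n)"
      and e: "hq_nerve G X n \<odot> z j = nerve_fc C G (Suc n) j \<odot> w"
       "hq_fibre G X n \<odot> z j = (if j = Suc n then app2 C (a n) (coord G (Suc n) n \<odot> w) (x j) else x j)"
      using t j by (simp_all add: twisted_horn_def)
    have jn: "j \<le> Suc n" using j J by auto
    have "hq_nerve G X n \<odot> z j \<odot> h = nerve_fc C G (Suc n) j \<odot> w \<odot> h"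
      using assoc[OF h z hquot_prj(1)] assoc[OF h w nerve_fc_in[OF G jn]] e by simp
    moreover have "hq_fibre G X n \<odot> z j \<odot> h = (if j = Suc n then app2 C (a n) (coord G (Suc n) n \<odot> w \<odot> h) (x j \<odot> h) else x j \<odot> h)"
      using assoc[OF h z hquot_prj(2)] assoc[OF h w c] app2_comp[OF simplicial_actionD(2)[OF a] Comp_homs[OF c w] x h] e by auto
    ultimately show ?thesis using Comp_homs[OF x h] Comp_homs[OF z h] by blast
  qed
  then show ?thesis using Comp_homs[OF w h] unfolding twisted_horn_def by blast
qed

lemma twisted_horn_matching:
  assumes T: "T \<in> Ob C" and t: "twisted_horn T n J w x z" and J: "J \<subset> {..Suc n}"
  shows "abs_horn (hquot C G X a) (Suc n) J T z \<longleftrightarrow> abs_horn X (Suc n) J T x"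
proof -
  note q = quotient_points[OF T]
  note tw = quotient_points.twisted_def[OF q, folded twisted_horn_def]
  from quotient_points.matching_twisted[OF q J, unfolded tw, OF t] show ?thesis
    by (simp only: abs_horn_def hquot_simps)
qed

lemma twisted_horn_ex:
  assumes T: "T \<in> Ob C" and J: "J \<subseteq> {..Suc n}" and w: "w \<in> homs C T (nerve_ob C G (Suc n))"
    and x: "\<And>j. j \<in> J \<Longrightarrow> x j \<in> homs C T (ob X n)"
  shows "\<exists>z. twisted_horn T n J w x z"
proof -
  note q = quotient_points[OF T]
  note tw = quotient_points.twisted_def[OF q, folded twisted_horn_def]
  show ?thesis by (rule quotient_points.twist_ex[OF q J w, unfolded tw, OF x])
qed

lemma untwisted_horn_ex:
  assumes T: "T \<in> Ob C" and w: "w \<in> homs C T (nerve_ob C G (Suc n))"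
    and z: "\<And>j. j \<in> J \<Longrightarrow> z j \<in> homs C T (hquot_ob C G X n)"
      "\<And>j. j \<in> J \<Longrightarrow> hq_nerve G X n \<odot> z j = nerve_fc C G (Suc n) j \<odot> w"
  shows "\<exists>x. twisted_horn T n J w x z"
proof -
  note q = quotient_points[OF T]
  note tw = quotient_points.twisted_def[OF q, folded twisted_horn_def]
  show ?thesis by (rule quotient_points.untwist_ex[OF q w, unfolded tw, OF z])
qed

lemma twisted_horn_eq_iff:
  assumes T: "T \<in> Ob C" and t: "twisted_horn T n J w x z" "twisted_horn T n J w x' z'"
  shows "(\<forall>j\<in>J. x j = x' j) \<longleftrightarrow> (\<forall>j\<in>J. z j = z' j)"
proof -
  note q = quotient_points[OF T]
  note tw = quotient_points.twisted_def[OF q, folded twisted_horn_def]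
  show ?thesis by (rule quotient_points.twisted_eq_iff[OF q, unfolded tw, OF t])
qed

lemma twisted_horn_faces:
  assumes J: "J \<subseteq> {..Suc n}"
  shows "twisted_horn (hquot_ob C G X (Suc n)) n J (hq_nerve G X (Suc n))
    (\<lambda>j. fc X (Suc n) j \<odot> hq_fibre G X (Suc n)) (\<lambda>j. hquot_fc C G X a (Suc n) j)"
proof -
  let ?T = "hquot_ob C G X (Suc n)"
  have r: "hq_nerve G X (Suc n) \<odot> Ident C ?T = hq_nerve G X (Suc n)" "hq_fibre G X (Suc n) \<odot> Ident C ?T = hq_fibre G X (Suc n)"
    by (rule Ident_right[OF hquot_prj(1)], rule Ident_right[OF hquot_prj(2)])
  have r': "hquot_fc C G X a (Suc n) j \<odot> Ident C ?T = hquot_fc C G X a (Suc n) j" if "j \<in> J" for j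
    by (rule Ident_right[OF hquot_fc_in]) (use that J in auto)
  note q = quotient_points[OF hquot_ob_in, of "Suc n"]
  note tw = quotient_points.twisted_def[OF q, folded twisted_horn_def]
  from quotient_points.twisted_faces[OF q Ident_homs[OF hquot_ob_in] J, unfolded tw r]
  show ?thesis unfolding twisted_horn_def using r' by simp
qed

end

end

section \<open>Horns of the homotopy quotient\<close>

context category_with_covers begin

context
  fixes G X a
  assumes G: "simplicial_lie_group C G" and a: "simplicial_action C G X a"
begin

text \<open>
  Relative horns of the projection of the quotient to the nerve are pairs of a simplex of the nerve and a
  horn of \<open>X\<close>, by untwisting.
\<close>

theorem hq_nerve_horn:
  assumes K: "stable K" and i: "i \<le> Suc k"
    and c: "horn_fills K X (Suc k) i"
  shows "classified K (insert None (Some ` ({..Suc k} - {i})))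
    (rel_horn (hquot C G X a) (nerve C G) (hq_nerve G X) (Suc k) ({..Suc k} - {i})) (hquot_ob C G X (Suc k))
    (\<lambda>l. case l of None \<Rightarrow> hq_nerve G X (Suc k) | Some j \<Rightarrow> hquot_fc C G X a (Suc k) j)"
proof -
  let ?J = "{..Suc k} - {i}" and ?A = "hquot_ob C G X (Suc k)"
  have J: "?J \<subset> {..Suc k}" "?J \<subseteq> {..Suc k}" using i by auto
  note XO = simplicial_actionD(1)[OF a] and GO = simplicial_lie_groupD(1)[OF G]
  have B: "binprod (nerve_ob C G (Suc k)) (ob X (Suc k)) ?A (hq_nerve G X (Suc k)) (hq_fibre G X (Suc k))"
    unfolding hquot_ob_def by (rule binprod_prd[OF simplicial_object_ob[OF XO] nerve_ob_in[OF GO]])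
  note P = presheaf_abs_horn[OF XO J(1)]
  note cp = classified_prod[OF K P c B binprod_ex[OF _ nerve_ob_in[OF GO]]]
  define R where "R T y z \<longleftrightarrow> T \<in> Ob C \<and> abs_horn X (Suc k) ?J T (\<lambda>j. y (Some j)) \<and> z None = y None \<and>
     twisted_horn G X a T k ?J (y None) (\<lambda>j. y (Some j)) (\<lambda>j. z (Some j))" for T and y z :: "nat option \<Rightarrow> 'm"
  have tw: "w \<in> homs C T (nerve_ob C G (Suc k))" "j \<in> ?J \<Longrightarrow> z j \<in> homs C T (hquot_ob C G X k)"
    "j \<in> ?J \<Longrightarrow> hq_nerve G X k \<odot> z j = nerve_fc C G (Suc k) j \<odot> w" if "twisted_horn G X a T k ?J w x z" for T w x z j
    using that by (simp_all add: twisted_horn_def[OF G a])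
  show ?thesis
  proof (rule classified_transfer[where R = R, OF _ _ _ _ _ cp])
    show "\<exists>z. R T y z" if T: "T \<in> Ob C" and y: "y None \<in> homs C T (nerve_ob C G (Suc k)) \<and> abs_horn X (Suc k) ?J T (\<lambda>j. y (Some j))" for T y
    proof -
      from twisted_horn_ex[OF G a T J(2) conjunct1[OF y], of "\<lambda>j. y (Some j)", OF abs_horn_in[OF conjunct2[OF y]]]
      obtain z where "twisted_horn G X a T k ?J (y None) (\<lambda>j. y (Some j)) z" by blast
      then show ?thesis using T y by (intro exI[of _ "\<lambda>l. case l of None \<Rightarrow> y None | Some j \<Rightarrow> z j"]) (simp add: R_def)
    qed
    show "\<exists>y. (y None \<in> homs C T (nerve_ob C G (Suc k)) \<and> abs_horn X (Suc k) ?J T (\<lambda>j. y (Some j))) \<and> R T y z"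
      if T: "T \<in> Ob C" and z: "rel_horn (hquot C G X a) (nerve C G) (hq_nerve G X) (Suc k) ?J T z" for T z
    proof -
      have h: "abs_horn (hquot C G X a) (Suc k) ?J T (\<lambda>j. z (Some j))" and w: "z None \<in> homs C T (nerve_ob C G (Suc k))"
        and e: "\<And>j. j \<in> ?J \<Longrightarrow> hq_nerve G X k \<odot> z (Some j) = nerve_fc C G (Suc k) j \<odot> z None"
        using z by (simp_all add: rel_horn_def nerve_simps)
      have zj: "\<And>j. j \<in> ?J \<Longrightarrow> z (Some j) \<in> homs C T (hquot_ob C G X k)" using abs_horn_in[OF h] by (simp add: hquot_simps)
      obtain x where x: "twisted_horn G X a T k ?J (z None) x (\<lambda>j. z (Some j))"
        using untwisted_horn_ex[OF G a T w zj e] by blast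
      then have "abs_horn X (Suc k) ?J T x" using twisted_horn_matching[OF G a T x J(1)] h by simp
      then show ?thesis using T x w by (intro exI[of _ "\<lambda>l. case l of None \<Rightarrow> z None | Some j \<Rightarrow> x j"]) (simp add: R_def)
    qed
    show "rel_horn (hquot C G X a) (nerve C G) (hq_nerve G X) (Suc k) ?J T z" if T: "T \<in> Ob C" and r: "R T y z" for T y z
    proof -
      have t: "twisted_horn G X a T k ?J (y None) (\<lambda>j. y (Some j)) (\<lambda>j. z (Some j))" and n: "z None = y None" using r by (simp_all add: R_def)
      have "abs_horn (hquot C G X a) (Suc k) ?J T (\<lambda>j. z (Some j))" using twisted_horn_matching[OF G a T t J(1)] r by (simp add: R_def)
      then show ?thesis using tw(1,3)[OF t] n by (simp add: rel_horn_def nerve_simps)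
    qed
    show "(\<forall>j\<in>insert None (Some ` ?J). y j = y' j) \<longleftrightarrow> (\<forall>j\<in>insert None (Some ` ?J). z j = z' j)"
      if T: "T \<in> Ob C" and r: "R T y z" "R T y' z'" for T y z y' z'
    proof (cases "y None = y' None")
      case True
      have "(\<forall>j\<in>?J. y (Some j) = y' (Some j)) \<longleftrightarrow> (\<forall>j\<in>?J. z (Some j) = z' (Some j))"
        by (rule twisted_horn_eq_iff[OF G a T, of k ?J "y None"]) (use r True in \<open>simp_all add: R_def\<close>)
      then show ?thesis using True r by (simp add: R_def)
    next
      case False then show ?thesis using r by (simp add: R_def)
    qed
    show "R S (\<lambda>j. y j \<odot> h) (\<lambda>j. z j \<odot> h)" if r: "R T y z" and h: "h \<in> homs C S T" for T S y z h
      using r homs_ob(1)[OF h] presheaf_comp[OF P, of T "\<lambda>j. y (Some j)", OF _ h] twisted_horn_comp[OF G a _ J(2) h] by (simp add: R_def)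
    have "abs_horn X (Suc k) ?J ?A (\<lambda>j. fc X (Suc k) j \<odot> hq_fibre G X (Suc k))"
      by (rule abs_horn_faces[OF XO J(1) hquot_prj(2)[OF G a]])
    then show "R ?A (\<lambda>i. case i of None \<Rightarrow> hq_nerve G X (Suc k) | Some j \<Rightarrow> fc X (Suc k) j \<odot> hq_fibre G X (Suc k))
      (\<lambda>l. case l of None \<Rightarrow> hq_nerve G X (Suc k) | Some j \<Rightarrow> hquot_fc C G X a (Suc k) j)"
      using twisted_horn_faces[OF G a J(2)] hquot_ob_in[OF G a] by (simp add: R_def)
  qed
qed

end

context
  fixes G X Y a b \<phi>
  assumes G: "simplicial_lie_group C G" and a: "simplicial_action C G X a" and b: "simplicial_action C G Y b"
    and f: "simplicial_map C X Y \<phi>" and eq: "equivariant C G X a b \<phi>"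
begin

lemma equivariantD: "g \<in> homs C T (ob G n) \<Longrightarrow> x \<in> homs C T (ob X n) \<Longrightarrow>
   \<phi> n \<odot> app2 C (a n) g x = app2 C (b n) g (\<phi> n \<odot> x)"
  using eq homs_ob(1) unfolding equivariant_def by blast

lemma hquot_map:
  shows hquot_map_in: "hquot_map C G X \<phi> n \<in> homs C (hquot_ob C G X n) (hquot_ob C G Y n)"
    and hq_nerve_map: "q \<in> homs C T (hquot_ob C G X n) \<Longrightarrow> hq_nerve G Y n \<odot> hquot_map C G X \<phi> n \<odot> q = hq_nerve G X n \<odot> q"
    and hq_fibre_map: "q \<in> homs C T (hquot_ob C G X n) \<Longrightarrow> hq_fibre G Y n \<odot> hquot_map C G X \<phi> n \<odot> q = \<phi> n \<odot> hq_fibre G X n \<odot> q"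
proof -
  note p = hquot_prj[OF G a, of n] and f' = simplicial_mapD(1)[OF f]
  have x: "\<phi> n \<odot> hq_fibre G X n \<in> homs C (hquot_ob C G X n) (ob Y n)" by (rule Comp_homs[OF f' p(2)])
  note e = hquot_map_def[of C G X \<phi> n]
  show h: "hquot_map C G X \<phi> n \<in> homs C (hquot_ob C G X n) (hquot_ob C G Y n)"
    unfolding e by (rule hquot_pair(1)[OF G b p(1) x])
  assume q: "q \<in> homs C T (hquot_ob C G X n)"
  show "hq_nerve G Y n \<odot> hquot_map C G X \<phi> n \<odot> q = hq_nerve G X n \<odot> q"
    using assoc[OF q h hquot_prj(1)[OF G b]] hquot_pair(2)[OF G b p(1) x] by (simp only: e)
  show "hq_fibre G Y n \<odot> hquot_map C G X \<phi> n \<odot> q = \<phi> n \<odot> hq_fibre G X n \<odot> q"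
    using assoc[OF q h hquot_prj(2)[OF G b]] hquot_pair(3)[OF G b p(1) x] assoc[OF q p(2) f'] by (simp only: e)
qed

lemma simplicial_map_hquot: "simplicial_map C (hquot C G X a) (hquot C G Y b) (hquot_map C G X \<phi>)"
proof (rule simplicial_mapI[OF simplicial_object_hquot[OF G a] simplicial_object_hquot[OF G b]])
  note XO = simplicial_actionD(1)[OF a] and YO = simplicial_actionD(1)[OF b] and GO = simplicial_lie_groupD(1)[OF G]
  show "hquot_map C G X \<phi> n \<in> homs C (ob (hquot C G X a) n) (ob (hquot C G Y b) n)" for n
    by (simp add: hquot_simps hquot_map_in)
  fix n i q
  show "hquot_map C G X \<phi> n \<odot> fc (hquot C G X a) (Suc n) i \<odot> q = fc (hquot C G Y b) (Suc n) i \<odot> hquot_map C G X \<phi> (Suc n) \<odot> q"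
    if "q \<in> homs C (ob (hquot C G X a) (Suc n)) (ob (hquot C G X a) (Suc n))" and i: "i \<le> Suc n"
  proof -
    define T where "T = hquot_ob C G X (Suc n)"
    have q: "q \<in> homs C T (hquot_ob C G X (Suc n))" using that by (simp add: hquot_simps T_def)
    have dq: "hquot_fc C G X a (Suc n) i \<odot> q \<in> homs C T (hquot_ob C G X n)" by (rule Comp_homs[OF hquot_fc_in[OF G a i] q])
    have fq: "hquot_map C G X \<phi> (Suc n) \<odot> q \<in> homs C T (hquot_ob C G Y (Suc n))" by (rule Comp_homs[OF hquot_map_in q])
    have g: "coord G (Suc n) n \<odot> hq_nerve G X (Suc n) \<odot> q \<in> homs C T (ob G n)"
      by (rule Comp_homs[OF nerve_prj[OF GO lessI] Comp_homs[OF hquot_prj(1)[OF G a] q]])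
    have x: "hq_fibre G X (Suc n) \<odot> q \<in> homs C T (ob X (Suc n))" by (rule Comp_homs[OF hquot_prj(2)[OF G a] q])
    have dx: "fc X (Suc n) i \<odot> hq_fibre G X (Suc n) \<odot> q \<in> homs C T (ob X n)" by (rule Comp_homs[OF fc_in[OF XO i] x])
    have "hquot_map C G X \<phi> n \<odot> hquot_fc C G X a (Suc n) i \<odot> q = hquot_fc C G Y b (Suc n) i \<odot> hquot_map C G X \<phi> (Suc n) \<odot> q"
    proof (rule hquot_eqI[OF G b Comp_homs[OF hquot_map_in dq] Comp_homs[OF hquot_fc_in[OF G b i] fq]])
      show "hq_nerve G Y n \<odot> hquot_map C G X \<phi> n \<odot> hquot_fc C G X a (Suc n) i \<odot> q =
        hq_nerve G Y n \<odot> hquot_fc C G Y b (Suc n) i \<odot> hquot_map C G X \<phi> (Suc n) \<odot> q"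
        by (simp only: hq_nerve_map[OF dq] hq_nerve_fc[OF G a i q] hq_nerve_fc[OF G b i fq] hq_nerve_map[OF q])
      show "hq_fibre G Y n \<odot> hquot_map C G X \<phi> n \<odot> hquot_fc C G X a (Suc n) i \<odot> q =
        hq_fibre G Y n \<odot> hquot_fc C G Y b (Suc n) i \<odot> hquot_map C G X \<phi> (Suc n) \<odot> q"
        unfolding hq_fibre_map[OF dq] hq_fibre_fc[OF G a i q] hq_fibre_fc[OF G b i fq] hq_nerve_map[OF q] hq_fibre_map[OF q]
        using equivariantD[OF g dx] map_fc[OF XO YO f x i] by (cases "i = Suc n") simp_all
    qed
    then show ?thesis by (simp only: hquot_simps)
  qed
  show "hquot_map C G X \<phi> (Suc n) \<odot> dg (hquot C G X a) n i \<odot> q = dg (hquot C G Y b) n i \<odot> hquot_map C G X \<phi> n \<odot> q"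
    if "q \<in> homs C (ob (hquot C G X a) n) (ob (hquot C G X a) n)" and i: "i \<le> n"
  proof -
    define T where "T = hquot_ob C G X n"
    have q: "q \<in> homs C T (hquot_ob C G X n)" using that by (simp add: hquot_simps T_def)
    have dq: "hquot_dg C G X n i \<odot> q \<in> homs C T (hquot_ob C G X (Suc n))" by (rule Comp_homs[OF hquot_dg_in[OF G a i] q])
    have fq: "hquot_map C G X \<phi> n \<odot> q \<in> homs C T (hquot_ob C G Y n)" by (rule Comp_homs[OF hquot_map_in q])
    have x: "hq_fibre G X n \<odot> q \<in> homs C T (ob X n)" by (rule Comp_homs[OF hquot_prj(2)[OF G a] q])
    have "hquot_map C G X \<phi> (Suc n) \<odot> hquot_dg C G X n i \<odot> q = hquot_dg C G Y n i \<odot> hquot_map C G X \<phi> n \<odot> q"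
    proof (rule hquot_eqI[OF G b Comp_homs[OF hquot_map_in dq] Comp_homs[OF hquot_dg_in[OF G b i] fq]])
      show "hq_nerve G Y (Suc n) \<odot> hquot_map C G X \<phi> (Suc n) \<odot> hquot_dg C G X n i \<odot> q =
        hq_nerve G Y (Suc n) \<odot> hquot_dg C G Y n i \<odot> hquot_map C G X \<phi> n \<odot> q"
        by (simp only: hq_nerve_map[OF dq] hq_nerve_dg[OF G a i q] hq_nerve_dg[OF G b i fq] hq_nerve_map[OF q])
      show "hq_fibre G Y (Suc n) \<odot> hquot_map C G X \<phi> (Suc n) \<odot> hquot_dg C G X n i \<odot> q =
        hq_fibre G Y (Suc n) \<odot> hquot_dg C G Y n i \<odot> hquot_map C G X \<phi> n \<odot> q"
        by (simp only: hq_fibre_map[OF dq] hq_fibre_dg[OF G a i q] hq_fibre_dg[OF G b i fq] hq_fibre_map[OF q] map_dg[OF XO YO f x i])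
    qed
    then show ?thesis by (simp only: hquot_simps)
  qed
qed

text \<open>
  The same untwisting, over a simplex of the quotient of \<open>Y\<close>, whose two components are a simplex of the nerve and
  a simplex of \<open>Y\<close>.
\<close>

theorem hquot_map_horn:
  assumes K: "stable K" and i: "i \<le> Suc k"
    and c: "rel_horn_fills K X Y \<phi> (Suc k) i"
  shows "classified K (insert None (Some ` ({..Suc k} - {i})))
    (rel_horn (hquot C G X a) (hquot C G Y b) (hquot_map C G X \<phi>) (Suc k) ({..Suc k} - {i})) (hquot_ob C G X (Suc k))
    (\<lambda>l. case l of None \<Rightarrow> hquot_map C G X \<phi> (Suc k) | Some j \<Rightarrow> hquot_fc C G X a (Suc k) j)"
proof -
  let ?J = "{..Suc k} - {i}" and ?A = "hquot_ob C G X (Suc k)"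
  let ?I = "insert None (Some ` ?J)" and ?H = "rel_horn (hquot C G X a) (hquot C G Y b) (hquot_map C G X \<phi>) (Suc k) ?J"
  have J: "?J \<subset> {..Suc k}" "?J \<subseteq> {..Suc k}" using i by auto
  note XO = simplicial_actionD(1)[OF a] and YO = simplicial_actionD(1)[OF b] and GO = simplicial_lie_groupD(1)[OF G]
  have B: "binprod (nerve_ob C G (Suc k)) (ob X (Suc k)) ?A (hq_nerve G X (Suc k)) (hq_fibre G X (Suc k))"
    unfolding hquot_ob_def by (rule binprod_prd[OF simplicial_object_ob[OF XO] nerve_ob_in[OF GO]])
  note P = presheaf_rel_horn[OF XO YO f J(1)]
  note cp = classified_prod[OF K P c B binprod_ex[OF _ nerve_ob_in[OF GO]]]
  have cw: "coord G (Suc k) k \<odot> w \<in> homs C T (ob G k)" if "w \<in> homs C T (nerve_ob C G (Suc k))" for w T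
    by (rule Comp_homs[OF nerve_prj[OF GO lessI] that])
  define R where "R T y z \<longleftrightarrow> T \<in> Ob C \<and> rel_horn X Y \<phi> (Suc k) ?J T (\<lambda>j. y (Some j)) \<and>
     z None \<in> homs C T (hquot_ob C G Y (Suc k)) \<and> hq_nerve G Y (Suc k) \<odot> z None = y None \<and>
     hq_fibre G Y (Suc k) \<odot> z None = y (Some None) \<and>
     twisted_horn G X a T k ?J (y None) (\<lambda>j. y (Some (Some j))) (\<lambda>j. z (Some j))" for T y z
  have tw: "w \<in> homs C T (nerve_ob C G (Suc k))" "j \<in> ?J \<Longrightarrow> x j \<in> homs C T (ob X k)" "j \<in> ?J \<Longrightarrow> z j \<in> homs C T (hquot_ob C G X k)"
    "j \<in> ?J \<Longrightarrow> hq_nerve G X k \<odot> z j = nerve_fc C G (Suc k) j \<odot> w"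
    "j \<in> ?J \<Longrightarrow> hq_fibre G X k \<odot> z j = (if j = Suc k then app2 C (a k) (coord G (Suc k) k \<odot> w) (x j) else x j)"
    if "twisted_horn G X a T k ?J w x z" for T w x z j
    using that unfolding twisted_horn_def[OF G a] by blast+
  \<comment> \<open>If \<open>j\<close> is the last face, both sides carry the same factor because \<open>\<phi>\<close> is equivariant.\<close>
  have over: "hquot_map C G X \<phi> k \<odot> z j = hquot_fc C G Y b (Suc k) j \<odot> r \<longleftrightarrow> \<phi> k \<odot> x j = fc Y (Suc k) j \<odot> y"
    if T: "T \<in> Ob C" and t: "twisted_horn G X a T k ?J w x z" and r: "r \<in> homs C T (hquot_ob C G Y (Suc k))"
      "hq_nerve G Y (Suc k) \<odot> r = w" "hq_fibre G Y (Suc k) \<odot> r = y" and j: "j \<in> ?J" for T w x z r y j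
  proof -
    have jk: "j \<le> Suc k" using j by simp
    note w = tw(1)[OF t] and xj = tw(2)[OF t j] and zj = tw(3)[OF t j]
    have yin: "y \<in> homs C T (ob Y (Suc k))" using Comp_homs[OF hquot_prj(2)[OF G b] r(1)] r(3) by simp
    have dy: "fc Y (Suc k) j \<odot> y \<in> homs C T (ob Y k)" by (rule Comp_homs[OF fc_in[OF YO jk] yin])
    have fx: "\<phi> k \<odot> x j \<in> homs C T (ob Y k)" by (rule Comp_homs[OF simplicial_mapD(1)[OF f] xj])
    have in1: "hquot_map C G X \<phi> k \<odot> z j \<in> homs C T (hquot_ob C G Y k)" by (rule Comp_homs[OF hquot_map_in zj])
    have in2: "hquot_fc C G Y b (Suc k) j \<odot> r \<in> homs C T (hquot_ob C G Y k)" by (rule Comp_homs[OF hquot_fc_in[OF G b jk] r(1)])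
    have n: "hq_nerve G Y k \<odot> hquot_map C G X \<phi> k \<odot> z j = hq_nerve G Y k \<odot> hquot_fc C G Y b (Suc k) j \<odot> r"
      by (simp only: hq_nerve_map[OF zj] tw(4)[OF t j] hq_nerve_fc[OF G b jk r(1)] r(2))
    have "hq_fibre G Y k \<odot> hquot_map C G X \<phi> k \<odot> z j = hq_fibre G Y k \<odot> hquot_fc C G Y b (Suc k) j \<odot> r \<longleftrightarrow>
       \<phi> k \<odot> x j = fc Y (Suc k) j \<odot> y"
    proof (cases "j = Suc k")
      case True
      have "hq_fibre G Y k \<odot> hquot_map C G X \<phi> k \<odot> z j = app2 C (b k) (coord G (Suc k) k \<odot> w) (\<phi> k \<odot> x j)"
        using hq_fibre_map[OF zj] tw(5)[OF t j] True equivariantD[OF cw[OF w] xj] by simp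
      moreover have "hq_fibre G Y k \<odot> hquot_fc C G Y b (Suc k) j \<odot> r = app2 C (b k) (coord G (Suc k) k \<odot> w) (fc Y (Suc k) j \<odot> y)"
        using hq_fibre_fc[OF G b jk r(1)] True r(2,3) by simp
      ultimately show ?thesis
        using action_points.act_cancel[OF quotient_points.axioms(1)[OF quotient_points[OF G b T]] cw[OF w] fx dy] by simp
    next
      case False
      then show ?thesis using hq_fibre_map[OF zj] tw(5)[OF t j] hq_fibre_fc[OF G b jk r(1)] r(3) by simp
    qed
    then show ?thesis using n hquot_eqI[OF G b in1 in2] by metis
  qed
  show ?thesis
  proof (rule classified_transfer[where R = R, OF _ _ _ _ _ cp])
    show "\<exists>z. R T y z" if T: "T \<in> Ob C" and y: "y None \<in> homs C T (nerve_ob C G (Suc k)) \<and> rel_horn X Y \<phi> (Suc k) ?J T (\<lambda>j. y (Some j))" for T y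
    proof -
      have h: "abs_horn X (Suc k) ?J T (\<lambda>j. y (Some (Some j)))" and y': "y (Some None) \<in> homs C T (ob Y (Suc k))"
        using y by (simp_all add: rel_horn_def)
      from twisted_horn_ex[OF G a T J(2) conjunct1[OF y], of "\<lambda>j. y (Some (Some j))", OF abs_horn_in[OF h]]
      obtain z where z: "twisted_horn G X a T k ?J (y None) (\<lambda>j. y (Some (Some j))) z" by blast
      note q = hquot_pair[OF G b conjunct1[OF y] y']
      show ?thesis using T y z q
        by (intro exI[of _ "\<lambda>l. case l of None \<Rightarrow> tup C T [y None, y (Some None)] | Some j \<Rightarrow> z j"]) (simp add: R_def)
    qed
    show "\<exists>y. (y None \<in> homs C T (nerve_ob C G (Suc k)) \<and> rel_horn X Y \<phi> (Suc k) ?J T (\<lambda>j. y (Some j))) \<and> R T y z"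
      if T: "T \<in> Ob C" and z: "?H T z" for T z
    proof -
      have h: "abs_horn (hquot C G X a) (Suc k) ?J T (\<lambda>j. z (Some j))" and r: "z None \<in> homs C T (hquot_ob C G Y (Suc k))"
        and e: "\<And>j. j \<in> ?J \<Longrightarrow> hquot_map C G X \<phi> k \<odot> z (Some j) = hquot_fc C G Y b (Suc k) j \<odot> z None"
        using z by (simp_all add: rel_horn_def hquot_simps)
      have zj: "\<And>j. j \<in> ?J \<Longrightarrow> z (Some j) \<in> homs C T (hquot_ob C G X k)" using abs_horn_in[OF h] by (simp add: hquot_simps)
      define w where "w = hq_nerve G Y (Suc k) \<odot> z None"
      define y where "y = hq_fibre G Y (Suc k) \<odot> z None"
      have w: "w \<in> homs C T (nerve_ob C G (Suc k))" unfolding w_def by (rule Comp_homs[OF hquot_prj(1)[OF G b] r])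
      have y: "y \<in> homs C T (ob Y (Suc k))" unfolding y_def by (rule Comp_homs[OF hquot_prj(2)[OF G b] r])
      have n: "hq_nerve G X k \<odot> z (Some j) = nerve_fc C G (Suc k) j \<odot> w" if j: "j \<in> ?J" for j
      proof -
        have jk: "j \<le> Suc k" using j by simp
        show ?thesis using hq_nerve_map[OF zj[OF j]] e[OF j] hq_nerve_fc[OF G b jk r] by (simp add: w_def)
      qed
      obtain x where x: "twisted_horn G X a T k ?J w x (\<lambda>j. z (Some j))"
        using untwisted_horn_ex[OF G a T w zj n] by blast
      have "abs_horn X (Suc k) ?J T x" using twisted_horn_matching[OF G a T x J(1)] h by simp
      moreover have "\<phi> k \<odot> x j = fc Y (Suc k) j \<odot> y" if j: "j \<in> ?J" for j
        using over[OF T x r w_def[symmetric] y_def[symmetric] j] e[OF j] by simp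
      ultimately have "rel_horn X Y \<phi> (Suc k) ?J T (\<lambda>l. case l of None \<Rightarrow> y | Some j \<Rightarrow> x j)" using y by (simp add: rel_horn_def)
      then show ?thesis using T x w r
        by (intro exI[of _ "\<lambda>l. case l of None \<Rightarrow> w | Some l \<Rightarrow> (case l of None \<Rightarrow> y | Some j \<Rightarrow> x j)"]) (simp add: R_def w_def y_def)
    qed
    show "?H T z" if T: "T \<in> Ob C" and r: "R T y z" for T y z
    proof -
      have t: "twisted_horn G X a T k ?J (y None) (\<lambda>j. y (Some (Some j))) (\<lambda>j. z (Some j))"
        and n: "z None \<in> homs C T (hquot_ob C G Y (Suc k))" "hq_nerve G Y (Suc k) \<odot> z None = y None"
          "hq_fibre G Y (Suc k) \<odot> z None = y (Some None)"
        and h: "abs_horn X (Suc k) ?J T (\<lambda>j. y (Some (Some j)))" "\<And>j. j \<in> ?J \<Longrightarrow> \<phi> k \<odot> y (Some (Some j)) = fc Y (Suc k) j \<odot> y (Some None)"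
        using r by (simp_all add: R_def rel_horn_def)
      have "abs_horn (hquot C G X a) (Suc k) ?J T (\<lambda>j. z (Some j))" using twisted_horn_matching[OF G a T t J(1)] h by simp
      moreover have "hquot_map C G X \<phi> k \<odot> z (Some j) = hquot_fc C G Y b (Suc k) j \<odot> z None" if j: "j \<in> ?J" for j
        using over[OF T t n j] h(2)[OF j] by simp
      ultimately show ?thesis using n(1) by (simp add: rel_horn_def hquot_simps)
    qed
    show "(\<forall>j\<in>insert None (Some ` ?I). y j = y' j) \<longleftrightarrow> (\<forall>j\<in>?I. z j = z' j)"
      if T: "T \<in> Ob C" and r: "R T y z" "R T y' z'" for T y z y' z'
    proof -
      have N: "z None = z' None \<longleftrightarrow> y None = y' None \<and> y (Some None) = y' (Some None)"
        using r hquot_eqI[OF G b, of "z None" T "Suc k" "z' None"] unfolding R_def by metis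
      have t: "(\<forall>j\<in>?J. y (Some (Some j)) = y' (Some (Some j))) \<longleftrightarrow> (\<forall>j\<in>?J. z (Some j) = z' (Some j))" if "y None = y' None"
        by (rule twisted_horn_eq_iff[OF G a T, of k ?J "y None"]) (use r that in \<open>simp_all add: R_def\<close>)
      have "(\<forall>j\<in>insert None (Some ` ?I). y j = y' j) \<longleftrightarrow> y None = y' None \<and> y (Some None) = y' (Some None) \<and> (\<forall>j\<in>?J. y (Some (Some j)) = y' (Some (Some j)))"
        unfolding image_insert ball_simps by (simp only: image_image ball_simps)
      also have "\<dots> \<longleftrightarrow> (\<forall>j\<in>?I. z j = z' j)" using N t by (simp only: ball_simps) blast
      finally show ?thesis .
    qed
    show "R S (\<lambda>j. y j \<odot> h) (\<lambda>j. z j \<odot> h)" if r: "R T y z" and h: "h \<in> homs C S T" for T S y z h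
    proof -
      have n: "z None \<in> homs C T (hquot_ob C G Y (Suc k))" "hq_nerve G Y (Suc k) \<odot> z None = y None"
          "hq_fibre G Y (Suc k) \<odot> z None = y (Some None)" using r by (simp_all add: R_def)
      have "hq_nerve G Y (Suc k) \<odot> z None \<odot> h = y None \<odot> h" "hq_fibre G Y (Suc k) \<odot> z None \<odot> h = y (Some None) \<odot> h"
        using assoc[OF h n(1) hquot_prj(1)[OF G b]] assoc[OF h n(1) hquot_prj(2)[OF G b]] n by simp_all
      then show ?thesis
        using r homs_ob(1)[OF h] presheaf_comp[OF P, of T "\<lambda>j. y (Some j)", OF _ h] twisted_horn_comp[OF G a _ J(2) h] Comp_homs[OF n(1) h]
        by (simp add: R_def)
    qed
    have "rel_horn X Y \<phi> (Suc k) ?J (ob X (Suc k)) (\<lambda>l. case l of None \<Rightarrow> \<phi> (Suc k) | Some j \<Rightarrow> fc X (Suc k) j)"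
      by (rule horn_rel_D(2)[OF XO YO f i horn_rel_self[OF XO YO f i]])
    from presheaf_comp[OF P, OF this hquot_prj(2)[OF G a]]
    have "rel_horn X Y \<phi> (Suc k) ?J ?A (\<lambda>l. (case l of None \<Rightarrow> \<phi> (Suc k) | Some j \<Rightarrow> fc X (Suc k) j) \<odot> hq_fibre G X (Suc k))" .
    moreover have "hq_nerve G Y (Suc k) \<odot> hquot_map C G X \<phi> (Suc k) = hq_nerve G X (Suc k)"
      "hq_fibre G Y (Suc k) \<odot> hquot_map C G X \<phi> (Suc k) = \<phi> (Suc k) \<odot> hq_fibre G X (Suc k)"
      using hq_nerve_map[OF Ident_homs[OF hquot_ob_in[OF G a]], of "Suc k"] hq_fibre_map[OF Ident_homs[OF hquot_ob_in[OF G a]], of "Suc k"]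
        Ident_right[OF hquot_map_in, of "Suc k"] Ident_right[OF hquot_prj(1)[OF G a], of "Suc k"] Ident_right[OF hquot_prj(2)[OF G a], of "Suc k"] by simp_all
    ultimately show "R ?A (\<lambda>i. case i of None \<Rightarrow> hq_nerve G X (Suc k) | Some j \<Rightarrow> (case j of None \<Rightarrow> \<phi> (Suc k) | Some j \<Rightarrow> fc X (Suc k) j) \<odot> hq_fibre G X (Suc k))
      (\<lambda>l. case l of None \<Rightarrow> hquot_map C G X \<phi> (Suc k) | Some j \<Rightarrow> hquot_fc C G X a (Suc k) j)"
      using twisted_horn_faces[OF G a J(2)] hquot_ob_in[OF G a] hquot_map_in by (simp add: R_def)
  qed
qed

end

end

section \<open>Horns of the nerve\<close>

context category_with_covers begin

context
  fixes G
  assumes G: "simplicial_lie_group C G"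
begin

lemma nerve_ob_0: "nerve_ob C G 0 = pt C"
  by (simp add: nerve_ob_def pt_def)

text \<open>
  A horn of dimension 1 is a vertex, and the nerve has a single one.
\<close>

lemma nerve_horn_1:
  assumes i: "i \<le> Suc 0"
  shows "classified Cov ({..Suc 0} - {i}) (abs_horn (nerve C G) (Suc 0) ({..Suc 0} - {i})) (nerve_ob C G (Suc 0)) (nerve_fc C G (Suc 0))"
proof -
  let ?J = "{..Suc 0} - {i}"
  have J: "?J = {1 - i}" using i by (auto simp: le_Suc_eq)
  have h: "abs_horn (nerve C G) (Suc 0) ?J T x \<longleftrightarrow> x (1 - i) \<in> homs C T (pt C)" for T x
    unfolding J by (simp add: abs_horn_def matching_def nerve_simps nerve_ob_0)
  have I: "Ident C (pt C) \<in> homs C (pt C) (pt C)" using Ident_homs pt_terminal by blast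
  have "universal ?J (abs_horn (nerve C G) (Suc 0) ?J) (pt C) (\<lambda>_. Ident C (pt C))"
  proof (rule universalI)
    show "pt C \<in> Ob C" by (rule pt_terminal)
    show "abs_horn (nerve C G) (Suc 0) ?J (pt C) (\<lambda>_. Ident C (pt C))" using I h by simp
    fix T x
    show "\<exists>t. t \<in> homs C T (pt C) \<and> (\<forall>j\<in>?J. Ident C (pt C) \<odot> t = x j)" if "abs_horn (nerve C G) (Suc 0) ?J T x"
      using that[unfolded h] Ident_left[OF that[unfolded h]] unfolding J by (intro exI[of _ "x (1 - i)"]) simp
    show "t = t'" if "t \<in> homs C T (pt C)" "t' \<in> homs C T (pt C)" for t t' by (rule pt_eqI[OF that])
  qed
  moreover have f: "nerve_fc C G (Suc 0) (1 - i) \<in> homs C (nerve_ob C G (Suc 0)) (pt C)"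
    using nerve_fc_in[OF G, of "1 - i" 0] by (simp add: nerve_ob_0)
  ultimately show ?thesis unfolding classified_def
    using to_pt_cover[OF f] Ident_left[OF f] unfolding J
    by (intro exI[of _ "pt C"] exI[of _ "\<lambda>_. Ident C (pt C)"] exI[of _ "nerve_fc C G (Suc 0) (1 - i)"]) simp
qed

text \<open>
  The relations \<open>twisted\<close> (for the action of \<open>G\<close> on itself) and \<open>last_missing\<close> at \<open>T\<close>.
\<close>

definition last_present_horn :: "'o \<Rightarrow> nat \<Rightarrow> nat set \<Rightarrow> 'm \<Rightarrow> (nat \<Rightarrow> 'm) \<Rightarrow> (nat \<Rightarrow> 'm) \<Rightarrow> bool" where
  "last_present_horn T n J w x z \<longleftrightarrow> w \<in> homs C T (nerve_ob C G (Suc n)) \<and>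
     (\<forall>j\<in>J. x j \<in> homs C T (ob G n) \<and> z j \<in> homs C T (nerve_ob C G (Suc n)) \<and>
       nerve_fc C G (Suc n) (Suc n) \<odot> z j = nerve_fc C G (Suc n) j \<odot> w \<and>
       coord G (Suc n) n \<odot> z j = (if j = Suc n then app2 C (mul G n) (coord G (Suc n) n \<odot> w) (x j) else x j))"

definition last_missing_horn :: "'o \<Rightarrow> nat \<Rightarrow> 'm \<Rightarrow> (nat \<Rightarrow> 'm) \<Rightarrow> (nat \<Rightarrow> 'm) \<Rightarrow> bool" where
  "last_missing_horn T p w h z \<longleftrightarrow> w \<in> homs C T (nerve_ob C G (Suc p)) \<and> z (Suc p) = w \<and>
     matching (\<lambda>n. homs C T (ob G n)) (\<lambda>n i x. fc G n i \<odot> x) (Suc p) {..p} h \<and>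
     (\<forall>j\<le>p. z j \<in> homs C T (nerve_ob C G (Suc p)) \<and> nerve_fc C G (Suc p) p \<odot> z j = nerve_fc C G (Suc p) j \<odot> w \<and>
       coord G (Suc p) p \<odot> z j = h j)"

lemma nerve_faces_typed:
  "j \<le> Suc n \<Longrightarrow> nerve_fc C G (Suc n) j \<in> homs C (nerve_ob C G (Suc n)) (nerve_ob C G n)"
  "coord G (Suc n) n \<in> homs C (nerve_ob C G (Suc n)) (ob G n)"
  by (rule nerve_fc_in[OF G], assumption) (rule nerve_prj[OF simplicial_lie_groupD(1)[OF G] lessI])

lemma last_present_horn_comp:
  assumes t: "last_present_horn T n J w x z" and J: "J \<subseteq> {..Suc n}" and h: "h \<in> homs C S T"
  shows "last_present_horn S n J (w \<odot> h) (\<lambda>j. x j \<odot> h) (\<lambda>j. z j \<odot> h)"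
proof -
  have w: "w \<in> homs C T (nerve_ob C G (Suc n))" using t by (simp add: last_present_horn_def)
  note c = nerve_faces_typed
  have "x j \<odot> h \<in> homs C S (ob G n) \<and> z j \<odot> h \<in> homs C S (nerve_ob C G (Suc n)) \<and>
       nerve_fc C G (Suc n) (Suc n) \<odot> z j \<odot> h = nerve_fc C G (Suc n) j \<odot> w \<odot> h \<and>
       coord G (Suc n) n \<odot> z j \<odot> h = (if j = Suc n then app2 C (mul G n) (coord G (Suc n) n \<odot> w \<odot> h) (x j \<odot> h) else x j \<odot> h)"
    if j: "j \<in> J" for j
  proof -
    have x: "x j \<in> homs C T (ob G n)" and z: "z j \<in> homs C T (nerve_ob C G (Suc n))"
      and e: "nerve_fc C G (Suc n) (Suc n) \<odot> z j = nerve_fc C G (Suc n) j \<odot> w"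
       "coord G (Suc n) n \<odot> z j = (if j = Suc n then app2 C (mul G n) (coord G (Suc n) n \<odot> w) (x j) else x j)"
      using t j unfolding last_present_horn_def by blast+
    have jn: "j \<le> Suc n" using j J by auto
    have "nerve_fc C G (Suc n) (Suc n) \<odot> z j \<odot> h = nerve_fc C G (Suc n) j \<odot> w \<odot> h"
      using assoc[OF h z c(1)[OF order_refl]] assoc[OF h w c(1)[OF jn]] e(1) by simp
    moreover have "coord G (Suc n) n \<odot> z j \<odot> h = (if j = Suc n then app2 C (mul G n) (coord G (Suc n) n \<odot> w \<odot> h) (x j \<odot> h) else x j \<odot> h)"
      using assoc[OF h z c(2)] assoc[OF h w c(2)]
        app2_comp[OF group_objectD(1)[OF simplicial_lie_groupD(2)[OF G]] Comp_homs[OF c(2) w] x h] e(2)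
      by (simp del: upt_Suc split: if_splits)
    ultimately show ?thesis using Comp_homs[OF x h] Comp_homs[OF z h] by blast
  qed
  then show ?thesis using Comp_homs[OF w h] unfolding last_present_horn_def by blast
qed

text \<open>
  These two product decompositions of the simplices of the nerve carry the horn-filling map of the nerve to
  the product of an identity with a horn-filling map of \<open>G\<close>: the first if the last face belongs to
  the horn, the second if it does not.
\<close>

lemma nerve_binprod_last:
  "binprod (nerve_ob C G n) (ob G n) (nerve_ob C G (Suc n)) (nerve_fc C G (Suc n) (Suc n)) (coord G (Suc n) n)"
proof (rule binprodI)
  show "nerve_fc C G (Suc n) (Suc n) \<in> homs C (nerve_ob C G (Suc n)) (nerve_ob C G n)"
    "coord G (Suc n) n \<in> homs C (nerve_ob C G (Suc n)) (ob G n)" using nerve_faces_typed by blast+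
  fix T assume T: "T \<in> Ob C"
  note q = nerve_points.decalage[OF nerve_points[OF G T]]
  show "\<exists>h. h \<in> homs C T (nerve_ob C G (Suc n)) \<and> nerve_fc C G (Suc n) (Suc n) \<odot> h = x \<and> coord G (Suc n) n \<odot> h = y"
    if "x \<in> homs C T (nerve_ob C G n)" "y \<in> homs C T (ob G n)" for x y
    using quotient_points.Q_ex[OF q that] by blast
  show "h = h'" if "h \<in> homs C T (nerve_ob C G (Suc n))" "h' \<in> homs C T (nerve_ob C G (Suc n))"
    "nerve_fc C G (Suc n) (Suc n) \<odot> h = nerve_fc C G (Suc n) (Suc n) \<odot> h'" "coord G (Suc n) n \<odot> h = coord G (Suc n) n \<odot> h'" for h h'
    by (rule quotient_points.Q_eqI[OF q that])
qed

lemma nerve_binprod_penultimate: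
  "binprod (nerve_ob C G n) (ob G n) (nerve_ob C G (Suc n)) (nerve_fc C G (Suc n) n) (coord G (Suc n) n)"
proof (rule binprodI)
  show "nerve_fc C G (Suc n) n \<in> homs C (nerve_ob C G (Suc n)) (nerve_ob C G n)"
    "coord G (Suc n) n \<in> homs C (nerve_ob C G (Suc n)) (ob G n)" using nerve_faces_typed le_SucI[OF order_refl] by blast+
  fix T assume T: "T \<in> Ob C"
  note q = nerve_points[OF G T]
  show "\<exists>h. h \<in> homs C T (nerve_ob C G (Suc n)) \<and> nerve_fc C G (Suc n) n \<odot> h = x \<and> coord G (Suc n) n \<odot> h = y"
    if "x \<in> homs C T (nerve_ob C G n)" "y \<in> homs C T (ob G n)" for x y
    using nerve_points.ex_dN_penultimate[OF q that] by blast
  show "h = h'" if "h \<in> homs C T (nerve_ob C G (Suc n))" "h' \<in> homs C T (nerve_ob C G (Suc n))"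
    "nerve_fc C G (Suc n) n \<odot> h = nerve_fc C G (Suc n) n \<odot> h'" "coord G (Suc n) n \<odot> h = coord G (Suc n) n \<odot> h'" for h h'
    by (rule nerve_points.eq_by_dN_penultimate[OF q that])
qed

lemma nerve_horn_last_present:
  assumes K: "stable K" and i: "i \<le> Suc p"
    and c: "horn_fills K G (Suc p) i"
  shows "classified K ({..Suc (Suc p)} - {i}) (abs_horn (nerve C G) (Suc (Suc p)) ({..Suc (Suc p)} - {i}))
    (nerve_ob C G (Suc (Suc p))) (nerve_fc C G (Suc (Suc p)))"
proof -
  let ?k = "Suc (Suc p)" and ?J = "{..Suc p} - {i}"
  let ?A = "nerve_ob C G ?k"
  have I: "{..?k} - {i} = insert ?k ?J" using i by auto
  have J: "?J \<subset> {..Suc p}" "?J \<subseteq> {..Suc p}" "?k \<notin> ?J" using i by auto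
  note GO = simplicial_lie_groupD(1)[OF G]
  note P = presheaf_abs_horn[OF GO J(1)]
  note cp = classified_prod[OF K P c nerve_binprod_last binprod_ex[OF _ nerve_ob_in[OF GO]]]
  define R where "R T y z \<longleftrightarrow> T \<in> Ob C \<and> abs_horn G (Suc p) ?J T (\<lambda>j. y (Some j)) \<and> z ?k = y None \<and>
     last_present_horn T p ?J (y None) (\<lambda>j. y (Some j)) z" for T and y :: "nat option \<Rightarrow> 'm" and z
  have nh: "abs_horn (nerve C G) ?k (insert ?k ?J) T z \<longleftrightarrow> z ?k \<in> homs C T (nerve_ob C G (Suc p)) \<and>
      (\<forall>j\<in>?J. nerve_fc C G (Suc p) (Suc p) \<odot> z j = nerve_fc C G (Suc p) j \<odot> z ?k) \<and>
      matching (\<lambda>n. homs C T (nerve_ob C G (Suc n))) (\<lambda>n i z. nerve_fc C G (Suc n) i \<odot> z) (Suc p) ?J z" if T: "T \<in> Ob C" for T z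
    unfolding abs_horn_def nerve_simps by (rule nerve_points.matching_last_present[OF nerve_points[OF G T] J(3,1)])
  have mt: "matching (\<lambda>n. homs C T (nerve_ob C G (Suc n))) (\<lambda>n i z. nerve_fc C G (Suc n) i \<odot> z) (Suc p) ?J z \<longleftrightarrow> abs_horn G (Suc p) ?J T x"
    if T: "T \<in> Ob C" and t: "last_present_horn T p ?J w x z" for T w x z
  proof -
    note q = nerve_points.decalage[OF nerve_points[OF G T]]
    note tw = quotient_points.twisted_def[OF q, folded last_present_horn_def]
    from quotient_points.matching_twisted[OF q J(1), unfolded tw, OF t] show ?thesis unfolding abs_horn_def .
  qed
  show ?thesis unfolding I
  proof (rule classified_transfer[where R = R, OF _ _ _ _ _ cp])
    show "\<exists>z. R T y z" if T: "T \<in> Ob C" and y: "y None \<in> homs C T (nerve_ob C G (Suc p)) \<and> abs_horn G (Suc p) ?J T (\<lambda>j. y (Some j))" for T y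
    proof -
      note q = nerve_points.decalage[OF nerve_points[OF G T]]
      note tw = quotient_points.twisted_def[OF q, folded last_present_horn_def]
      from quotient_points.twist_ex[OF q J(2) conjunct1[OF y], unfolded tw, of "\<lambda>j. y (Some j)", OF abs_horn_in[OF conjunct2[OF y]]]
      obtain z where "last_present_horn T p ?J (y None) (\<lambda>j. y (Some j)) z" by blast
      then have "last_present_horn T p ?J (y None) (\<lambda>j. y (Some j)) (z(?k := y None))" using J(3) by (auto simp: last_present_horn_def)
      then show ?thesis using T y by (intro exI[of _ "z(?k := y None)"]) (simp add: R_def)
    qed
    show "\<exists>y. (y None \<in> homs C T (nerve_ob C G (Suc p)) \<and> abs_horn G (Suc p) ?J T (\<lambda>j. y (Some j))) \<and> R T y z"
      if T: "T \<in> Ob C" and z: "abs_horn (nerve C G) ?k (insert ?k ?J) T z" for T z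
    proof -
      note q = nerve_points.decalage[OF nerve_points[OF G T]]
      note tw = quotient_points.twisted_def[OF q, folded last_present_horn_def]
      note z' = z[unfolded nh[OF T]]
      have zj: "\<And>j. j \<in> ?J \<Longrightarrow> z j \<in> homs C T (nerve_ob C G (Suc p))" using z' by (simp add: matching_def)
      have e: "\<And>j. j \<in> ?J \<Longrightarrow> nerve_fc C G (Suc p) (Suc p) \<odot> z j = nerve_fc C G (Suc p) j \<odot> z ?k" using z' by blast
      from quotient_points.untwist_ex[OF q conjunct1[OF z'], unfolded tw, OF zj e]
      obtain x where x: "last_present_horn T p ?J (z ?k) x z" by blast
      then have "abs_horn G (Suc p) ?J T x" using mt[OF T x] z' by blast
      then show ?thesis using T x conjunct1[OF z'] by (intro exI[of _ "\<lambda>l. case l of None \<Rightarrow> z ?k | Some j \<Rightarrow> x j"]) (simp add: R_def)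
    qed
    show "abs_horn (nerve C G) ?k (insert ?k ?J) T z" if T: "T \<in> Ob C" and r: "R T y z" for T y z
    proof -
      have t: "last_present_horn T p ?J (y None) (\<lambda>j. y (Some j)) z" and n: "z ?k = y None" and h: "abs_horn G (Suc p) ?J T (\<lambda>j. y (Some j))"
        using r unfolding R_def by blast+
      have "y None \<in> homs C T (nerve_ob C G (Suc p))"
        "\<forall>j\<in>?J. nerve_fc C G (Suc p) (Suc p) \<odot> z j = nerve_fc C G (Suc p) j \<odot> y None" using t unfolding last_present_horn_def by blast+
      then show ?thesis unfolding nh[OF T] n using mt[OF T t] h by blast
    qed
    show "(\<forall>j\<in>insert None (Some ` ?J). y j = y' j) \<longleftrightarrow> (\<forall>j\<in>insert ?k ?J. z j = z' j)"
      if T: "T \<in> Ob C" and r: "R T y z" "R T y' z'" for T y z y' z'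
    proof (cases "y None = y' None")
      case True
      note q = nerve_points.decalage[OF nerve_points[OF G T]]
      note tw = quotient_points.twisted_def[OF q, folded last_present_horn_def]
      have "(\<forall>j\<in>?J. y (Some j) = y' (Some j)) \<longleftrightarrow> (\<forall>j\<in>?J. z j = z' j)"
        by (rule quotient_points.twisted_eq_iff[OF q, unfolded tw, of p ?J "y None"]) (use r True in \<open>simp_all add: R_def\<close>)
      then show ?thesis using True r by (simp add: R_def)
    next
      case False then show ?thesis using r by (simp add: R_def)
    qed
    show "R S (\<lambda>j. y j \<odot> h) (\<lambda>j. z j \<odot> h)" if r: "R T y z" and h: "h \<in> homs C S T" for T S y z h
      using r homs_ob(1)[OF h] presheaf_comp[OF P, of T "\<lambda>j. y (Some j)", OF _ h] last_present_horn_comp[OF _ J(2) h] by (simp add: R_def)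
    have "abs_horn G (Suc p) ?J ?A (\<lambda>j. fc G (Suc p) j \<odot> coord G ?k (Suc p))"
      by (rule abs_horn_faces[OF GO J(1) nerve_faces_typed(2)])
    moreover have "last_present_horn ?A p ?J (nerve_fc C G ?k ?k) (\<lambda>j. fc G (Suc p) j \<odot> coord G ?k (Suc p)) (nerve_fc C G ?k)"
    proof -
      have Ao: "?A \<in> Ob C" by (rule nerve_ob_in[OF GO])
      note q = nerve_points.decalage[OF nerve_points[OF G Ao]]
      note tw = quotient_points.twisted_def[OF q, folded last_present_horn_def]
      have r: "nerve_fc C G ?k j \<odot> Ident C ?A = nerve_fc C G ?k j" if "j \<le> ?k" for j
        by (rule Ident_right[OF nerve_faces_typed(1)[OF that]])
      have r': "coord G ?k (Suc p) \<odot> Ident C ?A = coord G ?k (Suc p)" by (rule Ident_right[OF nerve_faces_typed(2)])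
      from quotient_points.twisted_faces[OF q Ident_homs[OF Ao] J(2), unfolded tw r[OF order_refl] r']
      show ?thesis unfolding last_present_horn_def using r by simp
    qed
    ultimately show "R ?A (\<lambda>i. case i of None \<Rightarrow> nerve_fc C G ?k ?k | Some j \<Rightarrow> fc G (Suc p) j \<odot> coord G ?k (Suc p)) (nerve_fc C G ?k)"
      using nerve_ob_in[OF GO, of ?k] by (simp add: R_def del: upt_Suc)
  qed
qed

lemma nerve_horn_last_missing:
  assumes K: "stable K"
    and c: "horn_fills K G (Suc p) (Suc p)"
  shows "classified K ({..Suc (Suc p)} - {Suc (Suc p)}) (abs_horn (nerve C G) (Suc (Suc p)) ({..Suc (Suc p)} - {Suc (Suc p)}))
    (nerve_ob C G (Suc (Suc p))) (nerve_fc C G (Suc (Suc p)))"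
proof -
  let ?k = "Suc (Suc p)"
  let ?A = "nerve_ob C G ?k"
  have I: "{..?k} - {?k} = {..Suc p}" and I': "{..Suc p} - {Suc p} = {..p}" by auto
  have J: "{..p} \<subset> {..Suc p}" by auto
  note GO = simplicial_lie_groupD(1)[OF G]
  note P = presheaf_abs_horn[OF GO J]
  note cp = classified_prod[OF K P c[unfolded I'] nerve_binprod_penultimate binprod_ex[OF _ nerve_ob_in[OF GO]]]
  define R where "R T y z \<longleftrightarrow> T \<in> Ob C \<and> last_missing_horn T p (y None) (\<lambda>j. y (Some j)) z" for T and y :: "nat option \<Rightarrow> 'm" and z
  note inn = nerve_points.last_missing_def[OF nerve_points[OF G], folded last_missing_horn_def]
  show ?thesis unfolding I
  proof (rule classified_transfer[where R = R, OF _ _ _ _ _ cp])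
    show "\<exists>z. R T y z" if T: "T \<in> Ob C" and y: "y None \<in> homs C T (nerve_ob C G (Suc p)) \<and> abs_horn G (Suc p) {..p} T (\<lambda>j. y (Some j))" for T y
      using nerve_points.last_missing_ex[OF nerve_points[OF G T], unfolded inn[OF T], OF conjunct1[OF y] conjunct2[OF y, unfolded abs_horn_def]] T
      by (simp add: R_def)
    show "\<exists>y. (y None \<in> homs C T (nerve_ob C G (Suc p)) \<and> abs_horn G (Suc p) {..p} T (\<lambda>j. y (Some j))) \<and> R T y z"
      if T: "T \<in> Ob C" and z: "abs_horn (nerve C G) ?k {..Suc p} T z" for T z
    proof -
      from nerve_points.matching_last_missing[OF nerve_points[OF G T], unfolded inn[OF T], OF z[unfolded abs_horn_def nerve_simps]]
      have n: "last_missing_horn T p (z (Suc p)) (\<lambda>j. coord G (Suc p) p \<odot> z j) z" .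
      then have "z (Suc p) \<in> homs C T (nerve_ob C G (Suc p))" "abs_horn G (Suc p) {..p} T (\<lambda>j. coord G (Suc p) p \<odot> z j)"
        unfolding last_missing_horn_def abs_horn_def by blast+
      then show ?thesis using n T
        by (intro exI[of _ "\<lambda>l. case l of None \<Rightarrow> z (Suc p) | Some j \<Rightarrow> coord G (Suc p) p \<odot> z j"]) (simp add: R_def del: upt_Suc)
    qed
    show "abs_horn (nerve C G) ?k {..Suc p} T z" if T: "T \<in> Ob C" and r: "R T y z" for T y z
      using nerve_points.last_missing_matching[OF nerve_points[OF G T], unfolded inn[OF T]] r
      unfolding R_def abs_horn_def nerve_simps by blast
    show "(\<forall>j\<in>insert None (Some ` {..p}). y j = y' j) \<longleftrightarrow> (\<forall>j\<in>{..Suc p}. z j = z' j)"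
      if T: "T \<in> Ob C" and r: "R T y z" "R T y' z'" for T y z y' z'
    proof -
      have "(y None = y' None \<and> (\<forall>j\<le>p. y (Some j) = y' (Some j))) \<longleftrightarrow> (\<forall>j\<le>Suc p. z j = z' j)"
        by (rule nerve_points.last_missing_eq_iff[OF nerve_points[OF G T], unfolded inn[OF T]]) (use r in \<open>simp_all add: R_def\<close>)
      then show ?thesis by (simp only: ball_simps atMost_iff Ball_def[of "{.._}"])
    qed
    show "R S (\<lambda>j. y j \<odot> h) (\<lambda>j. z j \<odot> h)" if r: "R T y z" and h: "h \<in> homs C S T" for T S y z h
    proof -
      note c = nerve_faces_typed
      have n: "last_missing_horn T p (y None) (\<lambda>j. y (Some j)) z" using r by (simp add: R_def)
      have w: "y None \<in> homs C T (nerve_ob C G (Suc p))" and zp: "z (Suc p) = y None" and m: "abs_horn G (Suc p) {..p} T (\<lambda>j. y (Some j))"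
        and zj: "\<And>j. j \<le> p \<Longrightarrow> z j \<in> homs C T (nerve_ob C G (Suc p))"
        "\<And>j. j \<le> p \<Longrightarrow> nerve_fc C G (Suc p) p \<odot> z j = nerve_fc C G (Suc p) j \<odot> y None"
        "\<And>j. j \<le> p \<Longrightarrow> coord G (Suc p) p \<odot> z j = y (Some j)"
        using n unfolding last_missing_horn_def abs_horn_def by blast+
      have "z j \<odot> h \<in> homs C S (nerve_ob C G (Suc p)) \<and>
          nerve_fc C G (Suc p) p \<odot> z j \<odot> h = nerve_fc C G (Suc p) j \<odot> y None \<odot> h \<and>
          coord G (Suc p) p \<odot> z j \<odot> h = y (Some j) \<odot> h" if j: "j \<le> p" for j
        using Comp_homs[OF zj(1)[OF j] h] assoc[OF h zj(1)[OF j] c(1)[of p p]] assoc[OF h w c(1)[of j p]] assoc[OF h zj(1)[OF j] c(2)]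
          zj(2,3)[OF j] j by simp
      then show ?thesis
        using homs_ob(1)[OF h] Comp_homs[OF w h] zp presheaf_comp[OF P, OF m h]
        unfolding R_def last_missing_horn_def abs_horn_def by simp
    qed
    have Ao: "?A \<in> Ob C" by (rule nerve_ob_in[OF GO])
    have r: "nerve_fc C G ?k j \<odot> Ident C ?A = nerve_fc C G ?k j" if "j \<le> ?k" for j
      by (rule Ident_right[OF nerve_faces_typed(1)[OF that]])
    have r': "coord G ?k (Suc p) \<odot> Ident C ?A = coord G ?k (Suc p)" by (rule Ident_right[OF nerve_faces_typed(2)])
    have "last_missing_horn ?A p (nerve_fc C G ?k (Suc p)) (\<lambda>j. fc G (Suc p) j \<odot> coord G ?k (Suc p)) (\<lambda>j. nerve_fc C G ?k j \<odot> Ident C ?A)"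
      using nerve_points.last_missing_faces[OF nerve_points[OF G Ao], unfolded inn[OF Ao], OF Ident_homs[OF Ao]] r[of "Suc p"] r' by simp
    then have "last_missing_horn ?A p (nerve_fc C G ?k (Suc p)) (\<lambda>j. fc G (Suc p) j \<odot> coord G ?k (Suc p)) (nerve_fc C G ?k)"
      unfolding last_missing_horn_def using r by simp
    then show "R ?A (\<lambda>i. case i of None \<Rightarrow> nerve_fc C G ?k (Suc p) | Some j \<Rightarrow> fc G (Suc p) j \<odot> coord G ?k (Suc p)) (nerve_fc C G ?k)"
      using Ao by (simp add: R_def del: upt_Suc)
  qed
qed

text \<open>
  Here the degree drops by one.
\<close>

lemma nerve_horn:
  assumes K: "stable K" and i: "i \<le> Suc (Suc p)"
    and c: "\<And>i. i \<le> Suc p \<Longrightarrow> horn_fills K G (Suc p) i"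
  shows "classified K ({..Suc (Suc p)} - {i}) (abs_horn (nerve C G) (Suc (Suc p)) ({..Suc (Suc p)} - {i}))
    (nerve_ob C G (Suc (Suc p))) (nerve_fc C G (Suc (Suc p)))"
proof (cases "i = Suc (Suc p)")
  case True
  then show ?thesis using nerve_horn_last_missing[OF K c[OF order_refl]] by simp
next
  case False
  then have "i \<le> Suc p" using i by simp
  then show ?thesis using nerve_horn_last_present[OF K _ c] by blast
qed

lemma nerve_horn_cover:
  assumes i: "i \<le> Suc k"
  shows "classified Cov ({..Suc k} - {i}) (abs_horn (nerve C G) (Suc k) ({..Suc k} - {i})) (nerve_ob C G (Suc k)) (nerve_fc C G (Suc k))"
  using i nerve_horn_1 nerve_horn[OF stable_Cov _ group_horn_cover[OF G]] by (cases k) blast+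

end

section \<open>The nerve as a Lie group and the stack of quotients\<close>

lemma horn_conditionsI:
  assumes "\<And>k i. i \<le> Suc k \<Longrightarrow> horn_map_in C Cov X Y f (Suc k) i"
    and "\<And>k i. i \<le> Suc k \<Longrightarrow> n < enat (Suc k) \<Longrightarrow> horn_map_in C (isos C) X Y f (Suc k) i"
  shows "horn_conditions C Cov n X Y f"
  unfolding horn_conditions_def
proof (intro allI impI conjI)
  fix k i :: nat assume "0 < k" "i \<le> k"
  then obtain l where l: "k = Suc l" "i \<le> Suc l" by (cases k) auto
  show "horn_map_in C Cov X Y f k i" using assms(1) l by blast
  show "horn_map_in C (isos C) X Y f k i" if "n < enat k" using assms(2) l that by blast
qed

lemma horn_conditionsD:
  assumes "horn_conditions C Cov n X Y f" "i \<le> Suc k"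
  shows "horn_map_in C Cov X Y f (Suc k) i" "n < enat (Suc k) \<Longrightarrow> horn_map_in C (isos C) X Y f (Suc k) i"
  using assms unfolding horn_conditions_def by blast+

text \<open>
  A horn-filling map of degree \<open>k > n\<close> for the nerve comes from one of degree \<open>k - 1 \<ge> n\<close> for the group.
  As \<open>n \<ge> 1\<close>, the degree \<open>k = 1\<close> does not occur among these.
\<close>

theorem nerve_lie_group:
  assumes n: "1 \<le> n" and G: "strict_lie_group C n G"
  shows "lie_group C Cov n (nerve C G)"
proof -
  have S: "simplicial_lie_group C G" using G by (simp add: strict_lie_group_def)
  note N = simplicial_object_nerve[OF S] and GO = simplicial_lie_groupD(1)[OF S]
  have "horn_conditions C Cov n (nerve C G) (point C) (\<lambda>k. bang C (ob (nerve C G) k))"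
  proof (rule horn_conditionsI)
    fix k i assume i: "i \<le> Suc k"
    show "horn_map_in C Cov (nerve C G) (point C) (\<lambda>k. bang C (ob (nerve C G) k)) (Suc k) i"
      unfolding horn_map_in_point_iff[OF N i stable_Cov] unfolding nerve_simps(1,2) by (rule nerve_horn_cover[OF S i])
    assume nk: "n < enat (Suc k)"
    have "1 < enat (Suc k)" using n nk by (rule order.strict_trans1)
    then obtain p where p: "k = Suc p" by (cases k) (auto simp: one_enat_def)
    have np: "n \<le> enat (Suc p)" using nk p by (cases n) auto
    have "classified (isos C) ({..Suc p} - {i}) (abs_horn G (Suc p) ({..Suc p} - {i})) (ob G (Suc p)) (fc G (Suc p))"
      if "i \<le> Suc p" for i
      using G np that unfolding strict_lie_group_def horn_map_in_point_iff[OF GO that stable_isos, symmetric] by blast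
    then show "horn_map_in C (isos C) (nerve C G) (point C) (\<lambda>k. bang C (ob (nerve C G) k)) (Suc k) i"
      unfolding horn_map_in_point_iff[OF N i stable_isos] unfolding nerve_simps(1,2) p
      using nerve_horn[OF S stable_isos] i p by blast
  qed
  then show ?thesis using N by (simp add: lie_group_def lie_groupoid_def nerve_simps nerve_ob_0[OF S])
qed

text \<open>
  The nerve of any simplicial Lie group is a Lie \<open>\<infinity>\<close>-group, and the projection of the quotient to it has
  horn-filling maps that are covers.
\<close>

lemma hquot_lie_groupoid:
  assumes G: "simplicial_lie_group C G" and a: "simplicial_action C G X a" and X: "lie_groupoid C Cov \<infinity> X"
  shows "lie_groupoid C Cov \<infinity> (hquot C G X a)"
proof -
  note XO = simplicial_actionD(1)[OF a] and N = simplicial_object_nerve[OF G] and Q = simplicial_object_hquot[OF G a]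
  have hX: "horn_conditions C Cov \<infinity> X (point C) (\<lambda>k. bang C (ob X k))" using X by (simp add: lie_groupoid_def)
  have cX: "horn_fills Cov X (Suc k) i"
    if i: "i \<le> Suc k" for k i
    using horn_conditionsD(1)[OF hX i] unfolding horn_map_in_point_iff[OF XO i stable_Cov] .
  have "horn_conditions C Cov \<infinity> (hquot C G X a) (point C) (\<lambda>k. bang C (ob (hquot C G X a) k))"
  proof (rule horn_conditionsI)
    fix k i assume i: "i \<le> Suc k"
    have "horn_fills Cov (hquot C G X a) (Suc k) i"
    proof (rule horn_covers_by_induction[OF Q _ i])
      fix k i L u assume i: "i \<le> Suc k" and L: "universal ({..Suc k} - {i}) (abs_horn (hquot C G X a) (Suc k) ({..Suc k} - {i})) L u"
      have J: "{..Suc k} - {i} \<subset> {..Suc k}" using i by auto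
      show "horn_fills Cov (hquot C G X a) (Suc k) i"
        by (rule horn_cover_comp[OF Q N simplicial_map_hq_nerve[OF G a] J L])
          (use nerve_horn_cover[OF G i] hq_nerve_horn[OF G a stable_Cov i cX[OF i]] in \<open>simp_all only: nerve_simps hquot_simps\<close>)
    qed
    then show "horn_map_in C Cov (hquot C G X a) (point C) (\<lambda>k. bang C (ob (hquot C G X a) k)) (Suc k) i"
      unfolding horn_map_in_point_iff[OF Q i stable_Cov] .
  qed simp
  then show ?thesis using Q by (simp add: lie_groupoid_def)
qed

theorem hquot_n_stack:
  assumes G: "simplicial_lie_group C G" and a: "simplicial_action C G X a" and b: "simplicial_action C G Y b"
    and s: "n_stack C Cov n X Y \<phi>" and eq: "equivariant C G X a b \<phi>"
  shows "n_stack C Cov n (hquot C G X a) (hquot C G Y b) (hquot_map C G X \<phi>)"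
proof -
  have X: "lie_groupoid C Cov \<infinity> X" and Y: "lie_groupoid C Cov \<infinity> Y" and f: "simplicial_map C X Y \<phi>"
    and h: "horn_conditions C Cov n X Y \<phi>" using s by (simp_all add: n_stack_def)
  note XO = simplicial_actionD(1)[OF a] and YO = simplicial_actionD(1)[OF b]
  note QX = simplicial_object_hquot[OF G a] and QY = simplicial_object_hquot[OF G b] and F = simplicial_map_hquot[OF G a b f eq]
  have lift: "horn_map_in C K (hquot C G X a) (hquot C G Y b) (hquot_map C G X \<phi>) (Suc k) i"
    if K: "stable K" and i: "i \<le> Suc k" and m: "horn_map_in C K X Y \<phi> (Suc k) i" for K k i
    using hquot_map_horn[OF G a b f eq K i m[unfolded horn_map_in_iff[OF XO YO f i K]]]
    unfolding horn_map_in_iff[OF QX QY F i K] by (simp only: hquot_simps)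
  have "horn_conditions C Cov n (hquot C G X a) (hquot C G Y b) (hquot_map C G X \<phi>)"
    by (rule horn_conditionsI)
      (rule lift[OF stable_Cov _ horn_conditionsD(1)[OF h]] lift[OF stable_isos _ horn_conditionsD(2)[OF h]]; assumption)+
  then show ?thesis using hquot_lie_groupoid[OF G a X] hquot_lie_groupoid[OF G b Y] F by (simp add: n_stack_def)
qed

end

theorem theorem6p7:
  fixes C :: "('o, 'm) cat" and Cov :: "'m set"
  assumes "category_with_covers C Cov"
  shows "(\<forall>(n :: enat) G. 1 \<le> n \<and> strict_lie_group C n G \<longrightarrow> lie_group C Cov n (nerve C G)) \<and>
    (\<forall>(n :: enat) G X Y a b \<phi>.
       simplicial_lie_group C G \<and> simplicial_action C G X a \<and> simplicial_action C G Y b \<and>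
       n_stack C Cov n X Y \<phi> \<and> equivariant C G X a b \<phi> \<longrightarrow>
       n_stack C Cov n (hquot C G X a) (hquot C G Y b) (hquot_map C G X \<phi>))"
proof -
  interpret category_with_covers C Cov by fact
  show ?thesis using nerve_lie_group hquot_n_stack by blast
qed

end
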